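(* Any totally geodesic Lagrangian submanifold of the pseudo-nearly Kähler manifold $(\mathrm{SL}(2,\mathbb{R})\times\mathrm{SL}(2,\mathbb{R}),g,J)$ is congruent to the image of one of the following maps, possibly restricted to an open subset: (1) $f\colon\mathrm{SL}(2,\mathbb{R})\to\mathrm{SL}(2,\mathbb{R})\times\mathrm{SL}(2,\mathbb{R})\colon u\mapsto(\mathrm{Id}_2,u)$, (2) $f\colon\mathrm{SL}(2,\mathbb{R})\to\mathrm{SL}(2,\mathbb{R})\times\mathrm{SL}(2,\mathbb{R})\colon u\mapsto(u,\mathbf{i}u\mathbf{i})$, (3) $f\colon\mathrm{SL}(2,\mathbb{R})\to\mathrm{SL}(2,\mathbb{R})\times\mathrm{SL}(2,\mathbb{R})\colon u\mapsto(u,\mathbf{k}u\mathbf{k})$, where $$\mathrm{Id}_2=\begin{pmatrix}1&0\\0&1\end{pmatrix},\quad \mathbf{i}=\begin{pmatrix}0&1\\-1&0\end{pmatrix},\quad \mathbf{k}=\begin{pmatrix}1&0\\0&-1\end{pmatrix}.$$ Conversely, the maps (1), (2) and (3) are totally geodesic Lagrangian immersions.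
   Context: On the space $M(2,\mathbb{R})$ of real $2\times2$ matrices consider $\langle a,b\rangle=-\frac12\operatorname{Trace}(\operatorname{adj}(a)b)$, where $\operatorname{adj}$ is the adjugate; then $\mathrm{SL}(2,\mathbb{R})=\{a:\langle a,a\rangle=-1\}$ and $T_a\mathrm{SL}(2,\mathbb{R})=\{a\alpha:\alpha\in\mathfrak{sl}(2,\mathbb{R})\}$, with $\mathfrak{sl}(2,\mathbb{R})$ the trace-free matrices. On $\mathrm{SL}(2,\mathbb{R})\times\mathrm{SL}(2,\mathbb{R})$ define, for $\alpha,\beta,\gamma,\delta\in\mathfrak{sl}(2,\mathbb{R})$, the almost complex structure and pseudo-Riemannian metric at $(a,b)$ $$J(a\alpha,b\beta)=\tfrac{1}{\sqrt3}\big(a(\alpha-2\beta),b(2\alpha-\beta)\big),$$ $$g\big((a\alpha,b\beta),(a\gamma,b\delta)\big)=\tfrac23\big(\langle\alpha,\gamma\rangle+\langle\beta,\delta\rangle\big)-\tfrac13\big(\langle\beta,\gamma\rangle+\langle\alpha,\delta\rangle\big).$$ With these, $\mathrm{SL}(2,\mathbb{R})\times\mathrm{SL}(2,\mathbb{R})$ is pseudo-nearly Kähler, i.e. almost Hermitian with $G(X,Y)=(\tilde\nabla_XJ)Y$ skew-symmetric, $\tilde\nabla$ being the Levi-Civita connection of $g$. A Lagrangian submanifold (immersion) is a 3-dimensional immersed submanifold $M$, non-degenerate (the metric induced by $g$ is non-degenerate), such that $J$ maps the tangent spaces of $M$ into the normal spaces and vice versa. It is totally geodesic if its second fundamental form $h$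 (defined by $\tilde\nabla_XY=\nabla_XY+h(X,Y)$, with $\nabla$ the Levi-Civita connection of the induced metric) vanishes identically. Two submanifolds are congruent if an isometry of $(\mathrm{SL}(2,\mathbb{R})\times\mathrm{SL}(2,\mathbb{R}),g)$ maps one to the other.
   Formalization: The submanifold is assumed connected; without this the claim fails, e.g. for the disjoint union of the images of u ↦ (Id,u) and u ↦ (a,u) with a ≠ Id, which is not congruent to an open piece of a single model. *)

theory Defs
  imports "HOL-Analysis.Analysis"
begin

section \<open>Smooth maps\<close>

fun C_k_on :: "nat \<Rightarrow> ('a::real_normed_vector \<Rightarrow> 'b::real_normed_vector) \<Rightarrow> 'a set \<Rightarrow> bool" where
  "C_k_on 0 f U = continuous_on U f"
| "C_k_on (Suc k) f U =
     ((\<forall>x\<in>U. f differentiable (at x)) \<and>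
      (\<forall>v. C_k_on k (\<lambda>x. frechet_derivative f (at x) v) U))"

text \<open>Smoothness on an arbitrary subset of a Euclidean space means having local smooth extensions.
  For open sets and for embedded submanifolds this is the usual notion.\<close>

definition smooth_on :: "'a::real_normed_vector set \<Rightarrow> ('a \<Rightarrow> 'b::real_normed_vector) \<Rightarrow> bool" where
  "smooth_on S f \<longleftrightarrow>
     (\<forall>p\<in>S. \<exists>U h. open U \<and> p \<in> U \<and> (\<forall>k. C_k_on k h U) \<and> (\<forall>x\<in>S \<inter> U. f x = h x))"

text \<open>The differential, at \<open>p\<close>, of a map that is smooth on \<open>S\<close>. If \<open>S\<close> is an embedded submanifold,
  its value is uniquely determined only on vectors tangent to \<open>S\<close> at \<open>p\<close>; it is only ever
  applied to such vectors. If \<open>S\<close> is open, this is the usual Frechet derivative.\<close>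

abbreviation differential ::
    "'a::real_normed_vector set \<Rightarrow> ('a \<Rightarrow> 'b::real_normed_vector) \<Rightarrow> 'a \<Rightarrow> 'a \<Rightarrow> 'b" where
  "differential S f p \<equiv> frechet_derivative f (at p within S)"


section \<open>Connections\<close>

text \<open>Throughout, \<open>S\<close> is an embedded submanifold of a Euclidean space (possibly an open subset of it)
  with tangent spaces \<open>T p\<close>, and \<open>E\<close> is a vector bundle over \<open>S\<close> whose fibres \<open>E p\<close> are linear
  subspaces of a fixed Euclidean space. Only the values of sections on \<open>S\<close> are relevant.\<close>

definition sections :: "'a::real_normed_vector set \<Rightarrow> ('a \<Rightarrow> 'b::real_normed_vector set) \<Rightarrow> ('a \<Rightarrow> 'b) set" where
  "sections S E = {s. smooth_on S s \<and> (\<forall>p\<in>S. s p \<in> E p)}"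

text \<open>\<open>D p v s\<close> is the covariant derivative at \<open>p\<close> of the section \<open>s\<close> in the direction \<open>v \<in> T p\<close>;
  for a vector field \<open>X\<close>, the section usually written $\nabla_X s$ is \<open>\<lambda>p. D p (X p) s\<close>.\<close>

definition is_connection ::
    "'a::real_normed_vector set \<Rightarrow> ('a \<Rightarrow> 'a set) \<Rightarrow> ('a \<Rightarrow> 'b::real_normed_vector set) \<Rightarrow>
     ('a \<Rightarrow> 'a \<Rightarrow> ('a \<Rightarrow> 'b) \<Rightarrow> 'b) \<Rightarrow> bool" where
  "is_connection S T E D \<longleftrightarrow>
     (\<forall>X\<in>sections S T. \<forall>s\<in>sections S E. (\<lambda>p. D p (X p) s) \<in> sections S E) \<and>
     (\<forall>p\<in>S. \<forall>v\<in>T p. \<forall>s\<in>sections S E.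
        D p v s \<in> E p \<and>
        (\<forall>w\<in>T p. \<forall>c. D p (c *\<^sub>R v + w) s = c *\<^sub>R D p v s + D p w s) \<and>
        (\<forall>t\<in>sections S E. D p v (\<lambda>q. s q + t q) = D p v s + D p v t) \<and>
        (\<forall>f::'a \<Rightarrow> real. smooth_on S f \<longrightarrow>
           D p v (\<lambda>q. f q *\<^sub>R s q) = differential S f p v *\<^sub>R s p + f p *\<^sub>R D p v s) \<and>
        (\<forall>t\<in>sections S E. (\<forall>q\<in>S. s q = t q) \<longrightarrow> D p v s = D p v t))"

definition lie_bracket ::
    "'a::real_normed_vector set \<Rightarrow> ('a \<Rightarrow> 'a) \<Rightarrow> ('a \<Rightarrow> 'a) \<Rightarrow> 'a \<Rightarrow> 'a" where
  "lie_bracket S X Y p = differential S Y p (X p) - differential S X p (Y p)"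

text \<open>The Levi-Civita connection of a metric \<open>g\<close> (\<open>g p\<close> being a bilinear form on \<open>T p\<close>): the torsion-free
  metric connection. For non-degenerate \<open>g\<close> it exists and is unique on sections.\<close>

definition is_levi_civita ::
    "'a::real_normed_vector set \<Rightarrow> ('a \<Rightarrow> 'a set) \<Rightarrow> ('a \<Rightarrow> 'a \<Rightarrow> 'a \<Rightarrow> real) \<Rightarrow>
     ('a \<Rightarrow> 'a \<Rightarrow> ('a \<Rightarrow> 'a) \<Rightarrow> 'a) \<Rightarrow> bool" where
  "is_levi_civita S T g D \<longleftrightarrow>
     is_connection S T T D \<and>
     (\<forall>X\<in>sections S T. \<forall>Y\<in>sections S T. \<forall>p\<in>S.
        D p (X p) Y - D p (Y p) X = lie_bracket S X Y p) \<and>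
     (\<forall>Y\<in>sections S T. \<forall>Z\<in>sections S T. \<forall>p\<in>S. \<forall>v\<in>T p.
        differential S (\<lambda>q. g q (Y q) (Z q)) p v = g p (D p v Y) (Z p) + g p (Y p) (D p v Z))"

text \<open>For a smooth map \<open>f\<close> from an open set \<open>V\<close> into \<open>N\<close>, the connection \<open>D\<close> induced on vector fields
  along \<open>f\<close> (sections of the pulled back tangent bundle) by a connection \<open>DN\<close> on \<open>N\<close>. This is the
  meaning of covariant derivatives, with respect to \<open>DN\<close>, of vector fields that are only
  defined along an immersed submanifold.\<close>

definition is_pullback_connection ::
    "'a::real_normed_vector set \<Rightarrow> ('a \<Rightarrow> 'b::real_normed_vector) \<Rightarrow> 'b set \<Rightarrow> ('b \<Rightarrow> 'b set) \<Rightarrow>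
     ('b \<Rightarrow> 'b \<Rightarrow> ('b \<Rightarrow> 'b) \<Rightarrow> 'b) \<Rightarrow> ('a \<Rightarrow> 'a \<Rightarrow> ('a \<Rightarrow> 'b) \<Rightarrow> 'b) \<Rightarrow> bool" where
  "is_pullback_connection V f N T DN D \<longleftrightarrow>
     is_connection V (\<lambda>_. UNIV) (\<lambda>x. T (f x)) D \<and>
     (\<forall>Y\<in>sections N T. \<forall>x\<in>V. \<forall>v.
        D x v (\<lambda>y. Y (f y)) = DN (f x) (differential V f x v) Y)"


section \<open>Manifolds\<close>

text \<open>A chart is a pair \<open>(U, \<phi>)\<close> of an open set and a homeomorphism from it onto an open subset
  of a Euclidean space.\<close>

definition is_chart :: "'m topology \<Rightarrow> 'm set \<times> ('m \<Rightarrow> 'c::euclidean_space) \<Rightarrow> bool" where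
  "is_chart M = (\<lambda>(U, \<phi>). openin M U \<and> open (\<phi> ` U) \<and>
     homeomorphic_map (subtopology M U) (top_of_set (\<phi> ` U)) \<phi>)"

definition smooth_manifold ::
    "'m topology \<Rightarrow> ('m set \<times> ('m \<Rightarrow> 'c::euclidean_space)) set \<Rightarrow> bool" where
  "smooth_manifold M A \<longleftrightarrow>
     Hausdorff_space M \<and> second_countable M \<and>
     (\<forall>c\<in>A. is_chart M c) \<and> (\<Union>(U, \<phi>)\<in>A. U) = topspace M \<and>
     (\<forall>(U, \<phi>)\<in>A. \<forall>(W, \<psi>)\<in>A. smooth_on (\<phi> ` (U \<inter> W)) (\<lambda>x. \<psi> (inv_into U \<phi> x)))"

text \<open>The smooth charts of an embedded submanifold of a Euclidean space.\<close>

definition submanifold_atlas ::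
    "'a::euclidean_space set \<Rightarrow> ('a set \<times> ('a \<Rightarrow> 'c::euclidean_space)) set" where
  "submanifold_atlas S = {(U, \<phi>). openin (top_of_set S) U \<and> inj_on \<phi> U \<and> open (\<phi> ` U) \<and>
     smooth_on U \<phi> \<and> smooth_on (\<phi> ` U) (inv_into U \<phi>)}"

text \<open>The expression of a map \<open>F\<close> on a manifold in a chart.\<close>

definition in_chart :: "('m \<Rightarrow> 'b) \<Rightarrow> 'm set \<times> ('m \<Rightarrow> 'c) \<Rightarrow> 'c \<Rightarrow> 'b" where
  "in_chart F = (\<lambda>(U, \<phi>) x. F (inv_into U \<phi> x))"

definition chart_range :: "'m set \<times> ('m \<Rightarrow> 'c) \<Rightarrow> 'c set" where
  "chart_range = (\<lambda>(U, \<phi>). \<phi> ` U)"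

definition immersion_into ::
    "'b::euclidean_space set \<Rightarrow> 'm topology \<Rightarrow> ('m set \<times> ('m \<Rightarrow> 'c::euclidean_space)) set \<Rightarrow>
     ('m \<Rightarrow> 'b) \<Rightarrow> bool" where
  "immersion_into N M A F \<longleftrightarrow>
     smooth_manifold M A \<and> F ` topspace M \<subseteq> N \<and>
     (\<forall>c\<in>A. smooth_on (chart_range c) (in_chart F c) \<and>
        (\<forall>x\<in>chart_range c. inj (differential (chart_range c) (in_chart F c) x)))"


section \<open>Submanifolds of a pseudo-Riemannian manifold\<close>

text \<open>Here \<open>f\<close> is an immersion of an open set \<open>V\<close>, that is, an immersion expressed in a chart.\<close>

definition induced_metric ::
    "('b \<Rightarrow> 'b \<Rightarrow> 'b \<Rightarrow> real) \<Rightarrow> 'a::euclidean_space set \<Rightarrow> ('a \<Rightarrow> 'b::euclidean_space) \<Rightarrow>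
     'a \<Rightarrow> 'a \<Rightarrow> 'a \<Rightarrow> real" where
  "induced_metric g V f x v w = g (f x) (differential V f x v) (differential V f x w)"

definition tangent_image ::
    "'a::euclidean_space set \<Rightarrow> ('a \<Rightarrow> 'b::euclidean_space) \<Rightarrow> 'a \<Rightarrow> 'b set" where
  "tangent_image V f x = range (differential V f x)"

definition normal_space ::
    "('b \<Rightarrow> 'b set) \<Rightarrow> ('b \<Rightarrow> 'b \<Rightarrow> 'b \<Rightarrow> real) \<Rightarrow> 'a::euclidean_space set \<Rightarrow>
     ('a \<Rightarrow> 'b::euclidean_space) \<Rightarrow> 'a \<Rightarrow> 'b set" where
  "normal_space T g V f x = {w \<in> T (f x). \<forall>v\<in>tangent_image V f x. g (f x) v w = 0}"

text \<open>The value $h(X,Y) = \tilde\nabla_X Y - \nabla_X Y$ of the second fundamental form at \<open>x\<close>, for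
  \<open>X x = v\<close>, where \<open>Dt\<close> is the ambient connection along \<open>f\<close> and \<open>D\<close> the connection on \<open>V\<close>.\<close>

definition second_fundamental_form ::
    "('a \<Rightarrow> 'a \<Rightarrow> ('a \<Rightarrow> 'b) \<Rightarrow> 'b) \<Rightarrow> ('a \<Rightarrow> 'a \<Rightarrow> ('a \<Rightarrow> 'a) \<Rightarrow> 'a) \<Rightarrow>
     'a::euclidean_space set \<Rightarrow> ('a \<Rightarrow> 'b::euclidean_space) \<Rightarrow> 'a \<Rightarrow> 'a \<Rightarrow> ('a \<Rightarrow> 'a) \<Rightarrow> 'b" where
  "second_fundamental_form Dt D V f x v Y =
     Dt x v (\<lambda>y. differential V f y (Y y)) - differential V f x (D x v Y)"

definition nondegenerate_immersion ::
    "('b \<Rightarrow> 'b \<Rightarrow> 'b \<Rightarrow> real) \<Rightarrow> ('m set \<times> ('m \<Rightarrow> 'c::euclidean_space)) set \<Rightarrow>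
     ('m \<Rightarrow> 'b::euclidean_space) \<Rightarrow> bool" where
  "nondegenerate_immersion g A F \<longleftrightarrow>
     (\<forall>c\<in>A. \<forall>x\<in>chart_range c. \<forall>v.
        (\<forall>w. induced_metric g (chart_range c) (in_chart F c) x v w = 0) \<longrightarrow> v = 0)"

text \<open>The connections in the following definition are unique on the sections they are applied to,
  whence the existential quantifiers only introduce names for them.\<close>

definition totally_geodesic ::
    "'b::euclidean_space set \<Rightarrow> ('b \<Rightarrow> 'b set) \<Rightarrow> ('b \<Rightarrow> 'b \<Rightarrow> 'b \<Rightarrow> real) \<Rightarrow>
     ('m set \<times> ('m \<Rightarrow> 'c::euclidean_space)) set \<Rightarrow> ('m \<Rightarrow> 'b) \<Rightarrow> bool" where
  "totally_geodesic N T g A F \<longleftrightarrow>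
     (\<exists>DN. is_levi_civita N T g DN \<and>
       (\<forall>c\<in>A. let V = chart_range c; f = in_chart F c in
          \<exists>Dt D. is_pullback_connection V f N T DN Dt \<and>
            is_levi_civita V (\<lambda>_. UNIV) (induced_metric g V f) D \<and>
            (\<forall>x\<in>V. \<forall>v. \<forall>Y\<in>sections V (\<lambda>_. UNIV).
               second_fundamental_form Dt D V f x v Y = 0)))"

definition isometry_of ::
    "'b::euclidean_space set \<Rightarrow> ('b \<Rightarrow> 'b set) \<Rightarrow> ('b \<Rightarrow> 'b \<Rightarrow> 'b \<Rightarrow> real) \<Rightarrow> ('b \<Rightarrow> 'b) \<Rightarrow> bool" where
  "isometry_of N T g \<Phi> \<longleftrightarrow>
     bij_betw \<Phi> N N \<and> smooth_on N \<Phi> \<and> smooth_on N (inv_into N \<Phi>) \<and>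
     (\<forall>p\<in>N. \<forall>v\<in>T p. \<forall>w\<in>T p.
        g (\<Phi> p) (differential N \<Phi> p v) (differential N \<Phi> p w) = g p v w)"

definition congruent_in ::
    "'b::euclidean_space set \<Rightarrow> ('b \<Rightarrow> 'b set) \<Rightarrow> ('b \<Rightarrow> 'b \<Rightarrow> 'b \<Rightarrow> real) \<Rightarrow>
     'b set \<Rightarrow> 'b set \<Rightarrow> bool" where
  "congruent_in N T g B C \<longleftrightarrow> (\<exists>\<Phi>. isometry_of N T g \<Phi> \<and> \<Phi> ` B = C)"


section \<open>The pseudo-nearly Kaehler structure on \<open>SL(2,\<real>) \<times> SL(2,\<real>)\<close>\<close>

type_synonym mat2 = "real^2^2"

definition mat2 :: "real \<Rightarrow> real \<Rightarrow> real \<Rightarrow> real \<Rightarrow> mat2" where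
  "mat2 a b c d = vector [vector [a, b], vector [c, d]]"

definition adj2 :: "mat2 \<Rightarrow> mat2" where
  "adj2 a = mat2 (a $ 2 $ 2) (- (a $ 1 $ 2)) (- (a $ 2 $ 1)) (a $ 1 $ 1)"

definition mat2_inner :: "mat2 \<Rightarrow> mat2 \<Rightarrow> real" where
  "mat2_inner a b = - (1 / 2) * trace (adj2 a ** b)"

definition SL2 :: "mat2 set" where
  "SL2 = {a. det a = 1}"

definition sl2 :: "mat2 set" where
  "sl2 = {\<alpha>. trace \<alpha> = 0}"

definition SL2xSL2 :: "(mat2 \<times> mat2) set" where
  "SL2xSL2 = SL2 \<times> SL2"

definition T_SL2xSL2 :: "mat2 \<times> mat2 \<Rightarrow> (mat2 \<times> mat2) set" where
  "T_SL2xSL2 = (\<lambda>(a, b). {(a ** \<alpha>, b ** \<beta>) | \<alpha> \<beta>. \<alpha> \<in> sl2 \<and> \<beta> \<in> sl2})"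

text \<open>A tangent vector \<open>(v, w)\<close> at \<open>(a, b)\<close> is \<open>(a \<alpha>, b \<beta>)\<close> with \<open>\<alpha> = a\<^sup>-\<^sup>1 v\<close> and \<open>\<beta> = b\<^sup>-\<^sup>1 w\<close>.\<close>

definition J_NK :: "mat2 \<times> mat2 \<Rightarrow> mat2 \<times> mat2 \<Rightarrow> mat2 \<times> mat2" where
  "J_NK = (\<lambda>(a, b) (v, w).
     let \<alpha> = matrix_inv a ** v; \<beta> = matrix_inv b ** w
     in (1 / sqrt 3) *\<^sub>R (a ** (\<alpha> - 2 *\<^sub>R \<beta>), b ** (2 *\<^sub>R \<alpha> - \<beta>)))"

definition g_NK :: "mat2 \<times> mat2 \<Rightarrow> mat2 \<times> mat2 \<Rightarrow> mat2 \<times> mat2 \<Rightarrow> real" where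
  "g_NK = (\<lambda>(a, b) (v, w) (v', w').
     let \<alpha> = matrix_inv a ** v; \<beta> = matrix_inv b ** w;
         \<gamma> = matrix_inv a ** v'; \<delta> = matrix_inv b ** w'
     in 2 / 3 * (mat2_inner \<alpha> \<gamma> + mat2_inner \<beta> \<delta>) - 1 / 3 * (mat2_inner \<beta> \<gamma> + mat2_inner \<alpha> \<delta>))"

text \<open>The dimension 3 of \<open>M\<close> is fixed by the type \<open>real^3\<close> of the charts.\<close>

definition lagrangian_immersion ::
    "'m topology \<Rightarrow> ('m set \<times> ('m \<Rightarrow> real^3)) set \<Rightarrow> ('m \<Rightarrow> mat2 \<times> mat2) \<Rightarrow> bool" where
  "lagrangian_immersion M A F \<longleftrightarrow>
     immersion_into SL2xSL2 M A F \<and> nondegenerate_immersion g_NK A F \<and>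
     (\<forall>c\<in>A. let V = chart_range c; f = in_chart F c in
        \<forall>x\<in>V.
          J_NK (f x) ` tangent_image V f x \<subseteq> normal_space T_SL2xSL2 g_NK V f x \<and>
          J_NK (f x) ` normal_space T_SL2xSL2 g_NK V f x \<subseteq> tangent_image V f x)"

definition totally_geodesic_lagrangian ::
    "'m topology \<Rightarrow> ('m set \<times> ('m \<Rightarrow> real^3)) set \<Rightarrow> ('m \<Rightarrow> mat2 \<times> mat2) \<Rightarrow> bool" where
  "totally_geodesic_lagrangian M A F \<longleftrightarrow>
     lagrangian_immersion M A F \<and> totally_geodesic SL2xSL2 T_SL2xSL2 g_NK A F"

definition mat_i :: mat2 where "mat_i = mat2 0 1 (-1) 0"

definition mat_k :: mat2 where "mat_k = mat2 1 0 0 (-1)"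

definition f1 :: "mat2 \<Rightarrow> mat2 \<times> mat2" where "f1 u = (mat 1, u)"

definition f2 :: "mat2 \<Rightarrow> mat2 \<times> mat2" where "f2 u = (u, mat_i ** u ** mat_i)"

definition f3 :: "mat2 \<Rightarrow> mat2 \<times> mat2" where "f3 u = (u, mat_k ** u ** mat_k)"

end

theory Submission imports Defs
begin

text \<open>Left translation identifies the tangent space at \<open>(a, b)\<close> with pairs \<open>(\<alpha>, \<beta>)\<close> of trace-free
  matrices, through \<open>(a \<alpha>, b \<beta>)\<close>. In this trivialization the metric, the almost complex structure and the
  Levi-Civita connection have constant coefficients: they become \<open>gq\<close>, \<open>J0 / sqrt 3\<close> and the bilinear map
  \<open>Bt\<close>. An immersion \<open>f\<close> of an open set becomes a field of subspaces \<open>L x\<close> of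
  \<open>sl2 \<times> sl2\<close>; it is Lagrangian if and only if all \<open>L x\<close> are Lagrangian for the symplectic form
  \<open>om X Y = gq (J0 X) Y\<close> and non-degenerate for \<open>gq\<close>.

  In its second argument \<open>Bt\<close> has a \<open>J0\<close>-linear part, which is
  the diagonal adjoint action of \<open>(\<alpha> + \<beta>) / 3\<close>, and a \<open>J0\<close>-antilinear part. If \<open>f\<close> is totally geodesic and
  Lagrangian, then the antilinear part maps \<open>L x\<close> into itself (\<open>special_volume\<close>). Hence the
  field \<open>L\<close> is parallel for the connection given by the linear part alone, and each \<open>L x\<close> is invariant under its
  curvature, which acts through the diagonal adjoint action of the matrices \<open>curv_sl2 X Y\<close>
  (\<open>curvature_invariant\<close>). The locale \<open>invariant_lagrangian\<close> records these properties. In it, \<open>K\<close> denotes the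
  stabilizer of \<open>L\<close> in \<open>sl2\<close> and \<open>P\<close> the set of all matrices whose adjoint action maps \<open>L\<close> into \<open>J0 L\<close>.
  Because the curvature is dual to the adjoint action (\<open>gq_pair_ad\<close>), the orthogonal complement of \<open>K\<close> lies in
  \<open>P\<close>; because \<open>L\<close> is non-degenerate, \<open>K\<close> and \<open>P\<close> meet only in \<open>0\<close>. It follows that \<open>K\<close> is either all of \<open>sl2\<close>
  or a line spanned by a non-null matrix \<open>e\<close>. Up to the linear map \<open>rot1\<close> of order three, \<open>L\<close> consists in the
  first case of the pairs with \<open>\<alpha> = 0\<close> (\<open>factor_type\<close>) and in the second case of the pairs with
  \<open>\<beta> e = e \<alpha>\<close> (\<open>axis_type\<close>).

  The type of \<open>L x\<close>, including the power of \<open>rot1\<close>, can be read off from a cubic form in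
  \<open>s\<close> and \<open>t\<close>, the determinant of the linear map \<open>s \<alpha> + t \<beta>\<close> from \<open>L x\<close> to \<open>sl2\<close>, and this makes it locally constant. As \<open>rot1\<close> is the differential, up to
  an adjoint action, of the isometry \<open>rho (a, b) = (inverse b, a (inverse b))\<close>, the power of \<open>rot1\<close> may be
  taken to be zero. If \<open>\<alpha> = 0\<close> throughout, then the first component of \<open>f\<close> is locally constant. In the
  other case the direction of \<open>e\<close> is locally constant because \<open>L\<close> is parallel, and then \<open>b e (inverse a)\<close> has zero
  derivative. So locally \<open>f\<close> takes its values in one of the submanifolds \<open>a = c\<close> or \<open>b e = c a\<close>, or in
  their preimages under a power of \<open>rho\<close>. Any open piece determines that submanifold (\<open>model_unique\<close>), so that on a
  connected manifold there is only one. Up to a factor, \<open>e\<close> is conjugate to \<open>mat_i\<close> or \<open>mat_k\<close>, according to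
  the sign of its norm; together with translations this provides an isometry that maps the submanifold into the image of
  \<open>f1\<close>, \<open>f2\<close> or \<open>f3\<close> (\<open>model_congruent\<close>). The image of \<open>f\<close> is open there, for dimensional reasons.

  Conversely, in the left trivialization each of \<open>f1\<close>, \<open>f2\<close>, \<open>f3\<close> has a constant differential, and its image is a
  Lagrangian subspace that is closed under \<open>Bt\<close>; this is all that is required.\<close>

section \<open>Smooth maps\<close>

lemma C_k_on_cong:
  assumes "open U" "\<And>x. x \<in> U \<Longrightarrow> f x = g x"
  shows "C_k_on k f U \<longleftrightarrow> C_k_on k g U"
proof -
  have *: "C_k_on k g U" if "C_k_on k f U" "\<And>x. x \<in> U \<Longrightarrow> f x = g x" for f g :: "'a \<Rightarrow> 'b"
    using that
  proof (induction k arbitrary: f g)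
    case 0
    then show ?case by (auto cong: continuous_on_cong)
  next
    case (Suc k)
    have d: "f differentiable (at x)" if "x \<in> U" for x using Suc.prems(1) that by simp
    have e: "frechet_derivative f (at x) = frechet_derivative g (at x)" if "x \<in> U" for x
      using frechet_derivative_transform_within_open[OF d[OF that] assms(1) that] Suc.prems(2) by blast
    have "g differentiable (at x)" if "x \<in> U" for x
      using d[OF that] that assms(1) Suc.prems(2)
      by (meson differentiable_def has_derivative_transform_within_open)
    moreover have "C_k_on k (\<lambda>x. frechet_derivative g (at x) v) U" for v
      using Suc.IH[of "\<lambda>x. frechet_derivative f (at x) v"] Suc.prems(1) e by simp
    ultimately show ?case by simp
  qed
  show ?thesis using *[of f g] *[of g f] assms(2) by auto
qed

lemma C_k_on_subset: "C_k_on k f U \<Longrightarrow> V \<subseteq> U \<Longrightarrow> C_k_on k f V"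
  by (induction k arbitrary: f) (auto intro: continuous_on_subset)

lemma C_k_on_imp_continuous_on: "C_k_on k f U \<Longrightarrow> continuous_on U f"
  by (cases k) (auto intro!: differentiable_imp_continuous_on
      simp: differentiable_on_def differentiable_at_withinI)

lemma C_k_on_SucD: "C_k_on (Suc k) f U \<Longrightarrow> C_k_on k f U"
proof (induction k arbitrary: f)
  case 0
  then show ?case using C_k_on_imp_continuous_on[of "Suc 0" f U] by simp
next
  case (Suc k)
  then show ?case by simp
qed

lemma C_k_on_const [simp]: "C_k_on k (\<lambda>_. c) U"
  by (induction k arbitrary: c) auto

lemma C_k_on_bounded_linear:
  assumes "bounded_linear f" shows "C_k_on k f U"
proof (cases k)
  case 0
  then show ?thesis using assms by (simp add: linear_continuous_on)
next
  case (Suc j)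
  have "frechet_derivative f (at x) v = f v" for x v
    using bounded_linear_imp_has_derivative[OF assms] frechet_derivative_at by metis
  moreover have "f differentiable (at x)" for x
    using bounded_linear_imp_differentiable[OF assms] .
  ultimately show ?thesis using Suc by simp
qed

lemma C_k_on_add:
  assumes "open U" "C_k_on k f U" "C_k_on k g U"
  shows "C_k_on k (\<lambda>x. f x + g x) U"
  using assms(2,3)
proof (induction k arbitrary: f g)
  case 0
  then show ?case by (auto intro: continuous_on_add)
next
  case (Suc k)
  have "frechet_derivative (\<lambda>x. f x + g x) (at x) v
      = frechet_derivative f (at x) v + frechet_derivative g (at x) v" if "x \<in> U" for x v
  proof -
    have "((\<lambda>x. f x + g x) has_derivative (\<lambda>v. frechet_derivative f (at x) v + frechet_derivative g (at x) v)) (at x)"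
      using Suc.prems that by (auto intro!: has_derivative_add simp: frechet_derivative_works)
    from fun_cong[OF frechet_derivative_at[OF this], of v] show ?thesis by simp
  qed
  then have "C_k_on k (\<lambda>x. frechet_derivative (\<lambda>x. f x + g x) (at x) v) U" for v
    using Suc.IH[of "\<lambda>x. frechet_derivative f (at x) v" "\<lambda>x. frechet_derivative g (at x) v"] Suc.prems
    by (subst C_k_on_cong[OF assms(1)]) auto
  then show ?case using Suc.prems by simp
qed

lemma C_k_on_bilinear:
  assumes B: "bounded_bilinear B" and "open U" and "C_k_on k f U" "C_k_on k g U"
  shows "C_k_on k (\<lambda>x. B (f x) (g x)) U"
  using assms(3,4)
proof (induction k arbitrary: f g)
  case 0
  then show ?case using bounded_bilinear.continuous_on[OF B] by auto
next
  case (Suc k)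
  have d: "((\<lambda>x. B (f x) (g x)) has_derivative
      (\<lambda>v. B (f x) (frechet_derivative g (at x) v) + B (frechet_derivative f (at x) v) (g x))) (at x)"
    if "x \<in> U" for x
    using Suc.prems that by (auto intro!: bounded_bilinear.FDERIV[OF B] simp: frechet_derivative_works)
  have e: "frechet_derivative (\<lambda>x. B (f x) (g x)) (at x) v =
     B (f x) (frechet_derivative g (at x) v) + B (frechet_derivative f (at x) v) (g x)"
    if "x \<in> U" for x v
    using fun_cong[OF frechet_derivative_at[OF d[OF that]], of v] by simp
  have "C_k_on k (\<lambda>x. frechet_derivative (\<lambda>x. B (f x) (g x)) (at x) v) U" for v
    using Suc.prems C_k_on_SucD[OF Suc.prems(1)] C_k_on_SucD[OF Suc.prems(2)]
    by (subst C_k_on_cong[OF assms(2) e]) (auto intro!: C_k_on_add[OF assms(2)] Suc.IH)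
  moreover have "(\<lambda>x. B (f x) (g x)) differentiable (at x)" if "x \<in> U" for x
    using d[OF that] differentiable_def by blast
  ultimately show ?case by simp
qed

lemma C_k_on_sum:
  assumes "open U" "\<And>i. i \<in> I \<Longrightarrow> C_k_on k (f i) U"
  shows "C_k_on k (\<lambda>x. \<Sum>i\<in>I. f i x) U"
  using assms(2) by (induction I rule: infinite_finite_induct) (auto intro: C_k_on_add[OF assms(1)])

lemma linear_sum_Basis:
  fixes v :: "'a::euclidean_space"
  assumes "linear L"
  shows "L v = (\<Sum>i\<in>Basis. (v \<bullet> i) *\<^sub>R L i)"
proof -
  have "L v = L (\<Sum>i\<in>Basis. (v \<bullet> i) *\<^sub>R i)" by (simp add: euclidean_representation)
  then show ?thesis using assms by (simp add: linear_sum linear_scale)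
qed

lemma C_k_on_compose:
  fixes f :: "'a::real_normed_vector \<Rightarrow> 'b::euclidean_space" and g :: "'b \<Rightarrow> 'c::real_normed_vector"
  assumes "open U" "C_k_on k f U" "C_k_on k g W" "f ` U \<subseteq> W"
  shows "C_k_on k (\<lambda>x. g (f x)) U"
  using assms(2-4)
proof (induction k arbitrary: g)
  case 0
  then show ?case by (auto intro: continuous_on_compose2)
next
  case (Suc k)
  have d: "((\<lambda>x. g (f x)) has_derivative
      (\<lambda>v. frechet_derivative g (at (f x)) (frechet_derivative f (at x) v))) (at x)"
    if "x \<in> U" for x
  proof -
    have "(f has_derivative frechet_derivative f (at x)) (at x)"
      using Suc.prems(1) that by (simp add: frechet_derivative_works)
    moreover have "(g has_derivative frechet_derivative g (at (f x))) (at (f x))"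
      using Suc.prems(2,3) that by (auto simp: frechet_derivative_works)
    ultimately show ?thesis using diff_chain_at by (fastforce simp: o_def)
  qed
  have e: "frechet_derivative (\<lambda>x. g (f x)) (at x) v =
     (\<Sum>i\<in>Basis. (frechet_derivative f (at x) v \<bullet> i) *\<^sub>R frechet_derivative g (at (f x)) i)"
    if "x \<in> U" for x v
  proof -
    have "linear (frechet_derivative g (at (f x)))"
      using Suc.prems(2,3) that by (intro linear_frechet_derivative) auto
    then show ?thesis
      using fun_cong[OF frechet_derivative_at[OF d[OF that]], of v]
        linear_sum_Basis[of "frechet_derivative g (at (f x))" "frechet_derivative f (at x) v"] by simp
  qed
  have "C_k_on k (\<lambda>x. frechet_derivative (\<lambda>x. g (f x)) (at x) v) U" for v
  proof (subst C_k_on_cong[OF assms(1) e])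
    have "C_k_on k (\<lambda>x. frechet_derivative g (at (f x)) i) U" for i
      using Suc.IH[of "\<lambda>y. frechet_derivative g (at y) i"] Suc.prems C_k_on_SucD[OF Suc.prems(1)] by simp
    moreover have "C_k_on k (\<lambda>x. frechet_derivative f (at x) v \<bullet> i) U" for i
      using C_k_on_bilinear[OF bounded_bilinear_inner assms(1) _ C_k_on_const, of k "\<lambda>x. frechet_derivative f (at x) v"] Suc.prems(1) by simp
    ultimately show "C_k_on k (\<lambda>x. \<Sum>i\<in>Basis. (frechet_derivative f (at x) v \<bullet> i) *\<^sub>R
        frechet_derivative g (at (f x)) i) U"
      by (intro C_k_on_sum assms(1) C_k_on_bilinear[OF bounded_bilinear_scaleR])
  qed
  moreover have "(\<lambda>x. g (f x)) differentiable (at x)" if "x \<in> U" for x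
    using d[OF that] differentiable_def by blast
  ultimately show ?case by simp
qed

lemma C_k_on_inverse: "open U \<Longrightarrow> 0 \<notin> U \<Longrightarrow> C_k_on k (inverse :: real \<Rightarrow> real) U"
proof (induction k)
  case 0
  then show ?case by (auto intro!: continuous_intros)
next
  case (Suc k)
  have d: "(inverse has_derivative (\<lambda>v::real. - (inverse x * v * inverse x))) (at x)" if "x \<in> U" for x
    using that Suc.prems by (intro has_derivative_inverse') auto
  have e: "frechet_derivative inverse (at x) v = (- v) * (inverse x * inverse x)" if "x \<in> U" for x v
  proof -
    have "frechet_derivative inverse (at x) v = - (inverse x * v * inverse x)"
      using fun_cong[OF frechet_derivative_at[OF d[OF that]], of v] by simp
    then show ?thesis by simp
  qed
  have "C_k_on k (\<lambda>x. frechet_derivative inverse (at x) v) U" for v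
    using Suc C_k_on_bilinear[OF bounded_bilinear_mult Suc.prems(1) C_k_on_const[of k "- v"]
        C_k_on_bilinear[OF bounded_bilinear_mult Suc.prems(1)], of inverse inverse]
    by (subst C_k_on_cong[OF Suc.prems(1) e]) auto
  moreover have "inverse differentiable (at x)" if "x \<in> U" for x
    using d[OF that] differentiable_def by blast
  ultimately show ?case by simp
qed

text \<open>The induction is on the order: differentiability is a condition at single points, so that only
  continuity of the derivatives of highest order has to be localized.\<close>

lemma C_k_on_local:
  assumes "\<And>x. x \<in> U \<Longrightarrow> \<exists>W. open W \<and> x \<in> W \<and> C_k_on k f (W \<inter> U)"
  shows "C_k_on k f U"
  using assms
proof (induction k arbitrary: f)
  case 0
  have "continuous (at x within U) f" if x: "x \<in> U" for x
  proof -
    obtain W where "open W" "x \<in> W" "continuous_on (W \<inter> U) f" using 0 x by auto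
    then have "continuous (at x within (W \<inter> U)) f" using x by (simp add: continuous_on_eq_continuous_within)
    moreover have "at x within (W \<inter> U) = at x within U" using \<open>open W\<close> \<open>x \<in> W\<close>
      by (intro at_within_nhd[of _ W]) auto
    ultimately show ?thesis by simp
  qed
  then show ?case by (simp add: continuous_on_eq_continuous_within)
next
  case (Suc k)
  have "f differentiable (at x)" if "x \<in> U" for x using Suc.prems[OF that] that by auto
  moreover have "C_k_on k (\<lambda>x. frechet_derivative f (at x) v) U" for v
  proof (rule Suc.IH)
    fix x assume "x \<in> U"
    then obtain W where "open W" "x \<in> W" "C_k_on (Suc k) f (W \<inter> U)" using Suc.prems by blast
    then show "\<exists>W. open W \<and> x \<in> W \<and> C_k_on k (\<lambda>x. frechet_derivative f (at x) v) (W \<inter> U)"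
      by (intro exI[of _ W]) simp
  qed
  ultimately show ?case by simp
qed

lemma smooth_on_open_iff:
  assumes "open U" shows "smooth_on U f \<longleftrightarrow> (\<forall>k. C_k_on k f U)"
proof
  assume L: "smooth_on U f"
  show "\<forall>k. C_k_on k f U"
  proof (intro allI C_k_on_local)
    fix k x assume "x \<in> U"
    with L obtain W h where W: "open W" "x \<in> W" "C_k_on k h W" "\<forall>x\<in>U \<inter> W. f x = h x"
      unfolding smooth_on_def by meson
    have "C_k_on k h (W \<inter> U)" using W(3) C_k_on_subset by blast
    then have "C_k_on k f (W \<inter> U)" using C_k_on_cong[of "W \<inter> U" f h k] W assms by auto
    then show "\<exists>W. open W \<and> x \<in> W \<and> C_k_on k f (W \<inter> U)" using W by blast
  qed
next
  assume "\<forall>k. C_k_on k f U" then show "smooth_on U f" unfolding smooth_on_def using assms by blast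
qed

lemma smooth_on_openD: "open U \<Longrightarrow> smooth_on U f \<Longrightarrow> C_k_on k f U"
  using iffD1[OF smooth_on_open_iff] by (rule spec)

lemma smooth_on_extension:
  assumes "smooth_on S f" "p \<in> S"
  obtains U h where "open U" "p \<in> U" "smooth_on U h" "\<And>x. x \<in> S \<Longrightarrow> x \<in> U \<Longrightarrow> f x = h x"
proof -
  obtain U h where "open U" "p \<in> U" "\<forall>k. C_k_on k h U" "\<forall>x\<in>S \<inter> U. f x = h x"
    using assms unfolding smooth_on_def by blast
  then show thesis using that[of U h] by (auto simp: smooth_on_open_iff)
qed

lemma smooth_onI:
  assumes "\<And>p. p \<in> S \<Longrightarrow> \<exists>U h. open U \<and> p \<in> U \<and> smooth_on U h \<and> (\<forall>x\<in>S \<inter> U. f x = h x)"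
  shows "smooth_on S f"
  unfolding smooth_on_def
proof
  fix p assume "p \<in> S"
  then obtain U h where "open U" "p \<in> U" "smooth_on U h" "\<forall>x\<in>S \<inter> U. f x = h x"
    using assms by blast
  then show "\<exists>U h. open U \<and> p \<in> U \<and> (\<forall>k. C_k_on k h U) \<and> (\<forall>x\<in>S \<inter> U. f x = h x)"
    using smooth_on_open_iff[of U h] by blast
qed

lemma smooth_on_subset:
  assumes "smooth_on S f" "T \<subseteq> S" shows "smooth_on T f"
proof (rule smooth_onI)
  fix p assume "p \<in> T"
  then obtain U h where "open U" "p \<in> U" "smooth_on U h" "\<And>x. x \<in> S \<Longrightarrow> x \<in> U \<Longrightarrow> f x = h x"
    using smooth_on_extension[OF assms(1), of p] assms(2) by blast
  then show "\<exists>U h. open U \<and> p \<in> U \<and> smooth_on U h \<and> (\<forall>x\<in>T \<inter> U. f x = h x)"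
    using assms(2) by (intro exI[of _ U] exI[of _ h]) auto
qed

lemma smooth_on_cong:
  assumes "smooth_on S f" "\<And>x. x \<in> S \<Longrightarrow> f x = g x" shows "smooth_on S g"
proof (rule smooth_onI)
  fix p assume "p \<in> S"
  then obtain U h where "open U" "p \<in> U" "smooth_on U h" "\<And>x. x \<in> S \<Longrightarrow> x \<in> U \<Longrightarrow> f x = h x"
    using smooth_on_extension[OF assms(1), of p] by blast
  then show "\<exists>U h. open U \<and> p \<in> U \<and> smooth_on U h \<and> (\<forall>x\<in>S \<inter> U. g x = h x)"
    using assms(2) by (intro exI[of _ U] exI[of _ h]) auto
qed

lemma smooth_on_const [simp]: "smooth_on S (\<lambda>_. c)"
  by (rule smooth_onI) (auto intro!: exI[of _ UNIV] exI[of _ "\<lambda>_. c"] simp: smooth_on_open_iff)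

lemma smooth_on_linear: "bounded_linear f \<Longrightarrow> smooth_on S f"
  by (rule smooth_onI) (auto intro!: exI[of _ UNIV] exI[of _ f] simp: smooth_on_open_iff C_k_on_bounded_linear)

lemma smooth_on_bilinear:
  assumes "bounded_bilinear B" "smooth_on S f" "smooth_on S g"
  shows "smooth_on S (\<lambda>x. B (f x) (g x))"
proof (rule smooth_onI)
  fix p assume p: "p \<in> S"
  obtain U h where 1: "open U" "p \<in> U" "smooth_on U h" "\<And>x. x \<in> S \<Longrightarrow> x \<in> U \<Longrightarrow> f x = h x"
    using smooth_on_extension[OF assms(2) p] by metis
  obtain W k where 2: "open W" "p \<in> W" "smooth_on W k" "\<And>x. x \<in> S \<Longrightarrow> x \<in> W \<Longrightarrow> g x = k x"
    using smooth_on_extension[OF assms(3) p] by metis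
  have o: "open (U \<inter> W)" using 1 2 by blast
  have "smooth_on (U \<inter> W) (\<lambda>x. B (h x) (k x))"
    unfolding smooth_on_open_iff[OF o]
    using 1(1,3) 2(1,3) by (auto intro!: C_k_on_bilinear[OF assms(1) o] simp: smooth_on_open_iff intro: C_k_on_subset)
  then show "\<exists>U h. open U \<and> p \<in> U \<and> smooth_on U h \<and> (\<forall>x\<in>S \<inter> U. B (f x) (g x) = h x)"
    using 1 2 o by (intro exI[of _ "U \<inter> W"] exI[of _ "\<lambda>x. B (h x) (k x)"]) auto
qed

lemma smooth_on_add:
  assumes "smooth_on S f" "smooth_on S g"
  shows "smooth_on S (\<lambda>x. f x + g x)"
proof (rule smooth_onI)
  fix p assume p: "p \<in> S"
  obtain U h where 1: "open U" "p \<in> U" "smooth_on U h" "\<And>x. x \<in> S \<Longrightarrow> x \<in> U \<Longrightarrow> f x = h x"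
    using smooth_on_extension[OF assms(1) p] by metis
  obtain W k where 2: "open W" "p \<in> W" "smooth_on W k" "\<And>x. x \<in> S \<Longrightarrow> x \<in> W \<Longrightarrow> g x = k x"
    using smooth_on_extension[OF assms(2) p] by metis
  have o: "open (U \<inter> W)" using 1 2 by blast
  have "smooth_on (U \<inter> W) (\<lambda>x. h x + k x)"
    unfolding smooth_on_open_iff[OF o]
    using 1(1,3) 2(1,3) by (auto intro!: C_k_on_add[OF o] simp: smooth_on_open_iff intro: C_k_on_subset)
  then show "\<exists>U h. open U \<and> p \<in> U \<and> smooth_on U h \<and> (\<forall>x\<in>S \<inter> U. f x + g x = h x)"
    using 1 2 o by (intro exI[of _ "U \<inter> W"] exI[of _ "\<lambda>x. h x + k x"]) auto
qed

lemma smooth_on_sum: "(\<And>i. i \<in> I \<Longrightarrow> smooth_on S (f i)) \<Longrightarrow> smooth_on S (\<lambda>x. \<Sum>i\<in>I. f i x)"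
  by (induction I rule: infinite_finite_induct) (auto intro: smooth_on_add)

lemma smooth_on_compose:
  fixes f :: "'a::real_normed_vector \<Rightarrow> 'b::euclidean_space"
  assumes "smooth_on S f" "smooth_on T g" "f ` S \<subseteq> T"
  shows "smooth_on S (\<lambda>x. g (f x))"
proof (rule smooth_onI)
  fix p assume p: "p \<in> S"
  then have fp: "f p \<in> T" using assms(3) by auto
  obtain U h where 1: "open U" "p \<in> U" "smooth_on U h" "\<And>x. x \<in> S \<Longrightarrow> x \<in> U \<Longrightarrow> f x = h x"
    using smooth_on_extension[OF assms(1) p] by metis
  obtain W k where 2: "open W" "f p \<in> W" "smooth_on W k" "\<And>x. x \<in> T \<Longrightarrow> x \<in> W \<Longrightarrow> g x = k x"
    using smooth_on_extension[OF assms(2) fp] by metis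
  have "continuous_on U h" by (rule C_k_on_imp_continuous_on[OF smooth_on_openD[OF 1(1,3)]])
  then have o: "open (U \<inter> h -` W)"
    using continuous_on_open_vimage[OF 1(1), of h] 2(1) by (simp add: Int_commute)
  have "smooth_on (U \<inter> h -` W) (\<lambda>x. k (h x))"
    unfolding smooth_on_open_iff[OF o]
  proof
    fix n
    show "C_k_on n (\<lambda>x. k (h x)) (U \<inter> h -` W)"
    proof (rule C_k_on_compose[OF o])
      show "C_k_on n h (U \<inter> h -` W)"
        by (rule C_k_on_subset[OF smooth_on_openD[OF 1(1,3)]]) simp
      show "C_k_on n k W" by (rule smooth_on_openD[OF 2(1,3)])
      show "h ` (U \<inter> h -` W) \<subseteq> W" by auto
    qed
  qed
  then show "\<exists>U h. open U \<and> p \<in> U \<and> smooth_on U h \<and> (\<forall>x\<in>S \<inter> U. g (f x) = h x)"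
  proof (intro exI[of _ "U \<inter> h -` W"] exI[of _ "\<lambda>x. k (h x)"] conjI ballI o)
    show "p \<in> U \<inter> h -` W" using 1(2,4) p 2(2) by auto
    fix x assume x: "x \<in> S \<inter> (U \<inter> h -` W)"
    then have "f x = h x" "f x \<in> T" using 1(4) assms(3) by auto
    then show "g (f x) = k (h x)" using 2(4)[of "f x"] x by simp
  qed
qed

lemma smooth_on_bounded_linear_compose:
  assumes "bounded_linear L" "smooth_on S f"
  shows "smooth_on S (\<lambda>x. L (f x))"
proof -
  interpret bounded_linear L by fact
  have "bounded_bilinear (\<lambda>(c::real) x. c *\<^sub>R L x)"
    using bounded_bilinear.comp[OF bounded_bilinear_scaleR bounded_linear_ident assms(1)] .
  from smooth_on_bilinear[OF this smooth_on_const[of S 1] assms(2)] show ?thesis by simp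
qed

lemma smooth_on_inverse:
  fixes f :: "'a::real_normed_vector \<Rightarrow> real"
  assumes "smooth_on S f" "\<And>x. x \<in> S \<Longrightarrow> f x \<noteq> 0"
  shows "smooth_on S (\<lambda>x. inverse (f x))"
proof -
  have o: "open (- {0::real})" by (rule open_Compl) simp
  have "smooth_on (- {0::real}) inverse" unfolding smooth_on_open_iff[OF o]
    by (intro allI C_k_on_inverse[OF o]) simp
  then show ?thesis by (rule smooth_on_compose[OF assms(1)]) (use assms(2) in auto)
qed

lemma smooth_on_imp_differentiable:
  assumes "smooth_on S f" "p \<in> S" shows "f differentiable (at p within S)"
proof -
  obtain U h where 1: "open U" "p \<in> U" "smooth_on U h" "\<And>x. x \<in> S \<Longrightarrow> x \<in> U \<Longrightarrow> f x = h x"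
    using smooth_on_extension[OF assms] by metis
  have "C_k_on (Suc 0) h U" by (rule smooth_on_openD[OF 1(1,3)])
  then have "h differentiable (at p)" using 1(2) by auto
  then have "h differentiable (at p within S)" by (rule differentiable_at_withinI)
  then obtain D where "(h has_derivative D) (at p within S)" by (auto simp: differentiable_def)
  moreover have ev: "\<forall>\<^sub>F x in at p within S. h x = f x"
    using 1 assms(2) unfolding eventually_at_topological by (intro exI[of _ U]) auto
  ultimately have "(f has_derivative D) (at p within S)"
    using has_derivative_transform_eventually[OF _ ev] 1(4)[OF assms(2) 1(2)] assms(2) by fastforce
  then show ?thesis by (auto simp: differentiable_def)
qed

lemma smooth_on_imp_continuous_on: "smooth_on S f \<Longrightarrow> continuous_on S f"
  unfolding continuous_on_eq_continuous_within
  by (intro ballI differentiable_imp_continuous_within smooth_on_imp_differentiable)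

lemma smooth_on_has_derivative:
  "smooth_on S f \<Longrightarrow> p \<in> S \<Longrightarrow> (f has_derivative differential S f p) (at p within S)"
  using smooth_on_imp_differentiable[of S f p] frechet_derivative_works[of f "at p within S"] by simp

lemma smooth_on_derivative:
  assumes "open V" "smooth_on V f"
  shows "smooth_on V (\<lambda>x. frechet_derivative f (at x) v)"
proof -
  have "C_k_on (Suc k) f V" for k by (rule smooth_on_openD[OF assms])
  then show ?thesis
    unfolding smooth_on_open_iff[OF assms(1)] by simp
qed

text \<open>The second argument of the derivative depends on the point; expanding it in a basis reduces
  this to derivatives in constant directions.\<close>

lemma smooth_on_derivative_field:
  fixes f :: "'a::euclidean_space \<Rightarrow> 'b::real_normed_vector"
  assumes "open V" "smooth_on V f" "smooth_on V Y"
  shows "smooth_on V (\<lambda>x. frechet_derivative f (at x) (Y x))"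
proof -
  have "smooth_on V (\<lambda>x. \<Sum>i\<in>Basis. (Y x \<bullet> i) *\<^sub>R frechet_derivative f (at x) i)"
    using assms by (intro smooth_on_sum smooth_on_bilinear[OF bounded_bilinear_scaleR]
        smooth_on_bilinear[OF bounded_bilinear_inner] smooth_on_derivative) auto
  then show ?thesis
  proof (rule smooth_on_cong)
    fix x assume x: "x \<in> V"
    then have "f differentiable (at x)"
      using smooth_on_imp_differentiable[OF assms(2) x] at_within_open[OF x assms(1)] by simp
    then show "(\<Sum>i\<in>Basis. (Y x \<bullet> i) *\<^sub>R frechet_derivative f (at x) i) = frechet_derivative f (at x) (Y x)"
      using linear_sum_Basis[OF linear_frechet_derivative, of f "at x" "Y x"] by simp
  qed
qed


section \<open>Two by two matrices and the Lie algebra of trace-free ones\<close>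

lemma mat2_nth [simp]:
  "mat2 a b c d $ 1 $ 1 = a" "mat2 a b c d $ 1 $ 2 = b" "mat2 a b c d $ 2 $ 1 = c" "mat2 a b c d $ 2 $ 2 = d"
  by (simp_all add: mat2_def)

lemma mat2_collapse: "mat2 (A $ 1 $ 1) (A $ 1 $ 2) (A $ 2 $ 1) (A $ 2 $ 2) = A"
  by (simp add: vec_eq_iff forall_2)

lemma mat2_exhaust: obtains a b c d where "A = mat2 a b c d"
  using mat2_collapse by metis

lemma mat2_eq_iff [simp]: "mat2 a b c d = mat2 a' b' c' d' \<longleftrightarrow> a = a' \<and> b = b' \<and> c = c' \<and> d = d'"
  by (metis mat2_nth)

lemma mat2_simps [simp]:
  "mat2 a b c d + mat2 a' b' c' d' = mat2 (a + a') (b + b') (c + c') (d + d')"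
  "mat2 a b c d - mat2 a' b' c' d' = mat2 (a - a') (b - b') (c - c') (d - d')"
  "- mat2 a b c d = mat2 (- a) (- b) (- c) (- d)"
  "r *\<^sub>R mat2 a b c d = mat2 (r * a) (r * b) (r * c) (r * d)"
  "mat2 a b c d ** mat2 a' b' c' d' =
     mat2 (a * a' + b * c') (a * b' + b * d') (c * a' + d * c') (c * b' + d * d')"
  "trace (mat2 a b c d) = a + d"
  "det (mat2 a b c d) = a * d - b * c"
  "adj2 (mat2 a b c d) = mat2 d (- b) (- c) a"
  "mat2_inner (mat2 a b c d) (mat2 a' b' c' d') = (b * c' + c * b' - d * a' - a * d') / 2"
  by (simp_all add: vec_eq_iff forall_2 matrix_matrix_mult_def sum_2 trace_def det_2 adj2_def mat2_inner_def
      algebra_simps)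

lemma zero_mat2: "(0 :: mat2) = mat2 0 0 0 0" and one_mat2: "(mat 1 :: mat2) = mat2 1 0 0 1"
  by (simp_all add: vec_eq_iff forall_2 mat_def)

lemma mat2_eq_0_iff [simp]: "mat2 a b c d = 0 \<longleftrightarrow> a = 0 \<and> b = 0 \<and> c = 0 \<and> d = 0"
  by (simp add: zero_mat2)

lemma mat2_mem_sl2 [simp]: "mat2 a b c d \<in> sl2 \<longleftrightarrow> a + d = 0"
  by (simp add: sl2_def)

lemma sl2_exhaust:
  assumes "A \<in> sl2" obtains x y z where "A = mat2 x y z (- x)"
proof -
  obtain a b c d where A: "A = mat2 a b c d" by (rule mat2_exhaust)
  then have "d = - a" using assms by simp
  then show thesis using A that by blast
qed

lemma subspace_sl2: "subspace sl2"
  unfolding subspace_def sl2_def by (auto simp: trace_add trace_def sum_2 simp flip: distrib_left)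

lemmas sl2_closed [intro, simp] =
  subspace_0[OF subspace_sl2] subspace_add[OF subspace_sl2] subspace_diff[OF subspace_sl2]
  subspace_neg[OF subspace_sl2] subspace_scale[OF subspace_sl2]

lemma bounded_bilinear_matrix_mult: "bounded_bilinear ((**) :: mat2 \<Rightarrow> mat2 \<Rightarrow> mat2)"
  unfolding bilinear_conv_bounded_bilinear[symmetric] bilinear_def
proof (intro conjI allI linearI)
  fix x y z :: mat2 and r :: real
  obtain a b c d a' b' c' d' a'' b'' c'' d''
    where "x = mat2 a b c d" "y = mat2 a' b' c' d'" "z = mat2 a'' b'' c'' d''" by (meson mat2_exhaust)
  then show "x ** (y + z) = x ** y + x ** z" "(x + y) ** z = x ** z + y ** z"
    "x ** (r *\<^sub>R y) = r *\<^sub>R (x ** y)" "(r *\<^sub>R x) ** y = r *\<^sub>R (x ** y)"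
    by (simp_all add: algebra_simps)
qed

interpretation mm: bounded_bilinear "(**) :: mat2 \<Rightarrow> mat2 \<Rightarrow> mat2"
  by (rule bounded_bilinear_matrix_mult)

lemma bounded_bilinear_mat2_inner: "bounded_bilinear mat2_inner"
  unfolding bilinear_conv_bounded_bilinear[symmetric] bilinear_def
proof (intro conjI allI linearI)
  fix x y z :: mat2 and r :: real
  obtain a b c d a' b' c' d' a'' b'' c'' d''
    where "x = mat2 a b c d" "y = mat2 a' b' c' d'" "z = mat2 a'' b'' c'' d''" by (meson mat2_exhaust)
  then show "mat2_inner x (y + z) = mat2_inner x y + mat2_inner x z"
    "mat2_inner (x + y) z = mat2_inner x z + mat2_inner y z"
    "mat2_inner x (r *\<^sub>R y) = r *\<^sub>R mat2_inner x y" "mat2_inner (r *\<^sub>R x) y = r *\<^sub>R mat2_inner x y"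
    by (simp_all add: field_simps)
qed

interpretation ip: bounded_bilinear mat2_inner
  by (rule bounded_bilinear_mat2_inner)

lemma bounded_linear_adj2: "bounded_linear adj2"
  unfolding linear_conv_bounded_linear[symmetric]
proof (intro linearI)
  fix x y :: mat2 and r :: real
  obtain a b c d a' b' c' d' where "x = mat2 a b c d" "y = mat2 a' b' c' d'" by (meson mat2_exhaust)
  then show "adj2 (x + y) = adj2 x + adj2 y" "adj2 (r *\<^sub>R x) = r *\<^sub>R adj2 x" by simp_all
qed

lemmas adj2_linear =
  linear_add[OF bounded_linear.linear[OF bounded_linear_adj2]] linear_diff[OF bounded_linear.linear[OF bounded_linear_adj2]]
  linear_scale[OF bounded_linear.linear[OF bounded_linear_adj2]] linear_neg[OF bounded_linear.linear[OF bounded_linear_adj2]]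
  linear_0[OF bounded_linear.linear[OF bounded_linear_adj2]]

lemma bounded_linear_trace: "bounded_linear (trace :: mat2 \<Rightarrow> real)"
  unfolding linear_conv_bounded_linear[symmetric]
proof (intro linearI)
  fix x y :: mat2 and r :: real
  obtain a b c d a' b' c' d' where "x = mat2 a b c d" "y = mat2 a' b' c' d'" by (meson mat2_exhaust)
  then show "trace (x + y) = trace x + trace y" "trace (r *\<^sub>R x) = r *\<^sub>R trace x"
    by (simp_all add: algebra_simps)
qed

lemma det_eq_mat2_inner: "det (a :: mat2) = - mat2_inner a a"
  by (cases a rule: mat2_exhaust) (simp add: field_simps)

lemma adj2_mult [simp]: "adj2 a ** a = det a *\<^sub>R mat 1" "a ** adj2 a = det a *\<^sub>R mat 1"
  by (cases a rule: mat2_exhaust; simp add: one_mat2 algebra_simps)+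

lemma adj2_adj2 [simp]: "adj2 (adj2 a) = a"
  by (cases a rule: mat2_exhaust) simp

lemma det_adj2 [simp]: "det (adj2 a) = det a"
  by (cases a rule: mat2_exhaust) simp

lemma adj2_matrix_mult: "adj2 (a ** b) = adj2 b ** adj2 a"
  by (cases a rule: mat2_exhaust; cases b rule: mat2_exhaust) (simp add: algebra_simps)

lemma matrix_mult_scaleR_one [simp]: "a ** (r *\<^sub>R mat 1) = r *\<^sub>R a" "(r *\<^sub>R mat 1) ** a = r *\<^sub>R a" for a :: mat2
  by (simp_all add: mm.scaleR_left mm.scaleR_right)

lemma SL2_cancel:
  assumes "a \<in> SL2"
  shows "adj2 a ** (a ** x) = x" "a ** (adj2 a ** x) = x" "x ** a ** adj2 a = x" "x ** adj2 a ** a = x"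
    "adj2 a ** a = mat 1" "a ** adj2 a = mat 1"
  using assms by (simp_all add: matrix_mul_assoc SL2_def) (simp_all flip: matrix_mul_assoc)

lemma matrix_inv_SL2: assumes "a \<in> SL2" shows "matrix_inv a = adj2 a"
proof -
  have "a ** matrix_inv a = mat 1 \<and> matrix_inv a ** a = mat 1"
    unfolding matrix_inv_def by (rule someI[of _ "adj2 a"]) (use assms in \<open>simp add: SL2_def\<close>)
  then have "a ** matrix_inv a = mat 1" by blast
  then show ?thesis using SL2_cancel(1)[OF assms, of "matrix_inv a"] by simp
qed

lemma SL2_closed [intro, simp]:
  "a \<in> SL2 \<Longrightarrow> b \<in> SL2 \<Longrightarrow> a ** b \<in> SL2" "a \<in> SL2 \<Longrightarrow> adj2 a \<in> SL2" "mat 1 \<in> SL2"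
  by (simp_all add: SL2_def det_mul)

definition br :: "mat2 \<Rightarrow> mat2 \<Rightarrow> mat2" where
  "br a b = a ** b - b ** a"

lemma br_mat2 [simp]: "br (mat2 a b c d) (mat2 a' b' c' d') =
   mat2 (b * c' - c * b') (a * b' + b * d' - a' * b - b' * d) (c * a' + d * c' - c' * a - d' * c) (c * b' - b * c')"
  by (simp add: br_def algebra_simps)

lemma br_in_sl2 [intro, simp]: "br a b \<in> sl2"
  by (cases a rule: mat2_exhaust; cases b rule: mat2_exhaust) simp

lemma bounded_bilinear_br: "bounded_bilinear br"
  unfolding bilinear_conv_bounded_bilinear[symmetric] bilinear_def br_def
  by (intro conjI allI linearI) (simp_all add: mm.add_left mm.add_right mm.scaleR_left mm.scaleR_right algebra_simps)

interpretation br: bounded_bilinear br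
  by (rule bounded_bilinear_br)

lemma br_self [simp]: "br a a = 0" and br_anti: "br a b = - br b a"
  by (simp_all add: br_def)

lemma mat2_inner_commute: "mat2_inner a b = mat2_inner b a"
  by (cases a rule: mat2_exhaust; cases b rule: mat2_exhaust) (simp add: algebra_simps)

lemma mat2_inner_br: "mat2_inner (br k a) b = mat2_inner k (br a b)"
  by (cases a rule: mat2_exhaust; cases b rule: mat2_exhaust; cases k rule: mat2_exhaust) (simp add: algebra_simps)

lemma jacobi: "br (br k m) a = br k (br m a) - br m (br k a)"
  by (cases a rule: mat2_exhaust; cases m rule: mat2_exhaust; cases k rule: mat2_exhaust) (simp add: algebra_simps)

lemma mat2_inner_nondeg:
  assumes "n \<in> sl2" "\<And>k. k \<in> sl2 \<Longrightarrow> mat2_inner k n = 0" shows "n = 0"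
proof -
  obtain x y z where n: "n = mat2 x y z (- x)" using sl2_exhaust[OF assms(1)] .
  show ?thesis using assms(2)[of "mat2 1 0 0 (-1)"] assms(2)[of "mat2 0 1 0 0"] assms(2)[of "mat2 0 0 1 0"]
    by (simp add: n)
qed

lemma sl2_anticommutator:
  assumes "a \<in> sl2" "b \<in> sl2" shows "a ** b + b ** a = (2 * mat2_inner a b) *\<^sub>R mat 1"
  by (rule sl2_exhaust[OF assms(1)], rule sl2_exhaust[OF assms(2)]) (simp add: one_mat2 algebra_simps)

text \<open>In terms of the cross product on a three dimensional Lorentzian space, this is the expansion of
  an iterated product.\<close>

lemma br_br:
  assumes "a \<in> sl2" "b \<in> sl2" "c \<in> sl2"
  shows "br a (br b c) = (4 * mat2_inner a b) *\<^sub>R c - (4 * mat2_inner a c) *\<^sub>R b"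
  by (rule sl2_exhaust[OF assms(1)], rule sl2_exhaust[OF assms(2)], rule sl2_exhaust[OF assms(3)])
    (simp add: field_simps)

text \<open>Gram's formula for the coordinates of \<open>z\<close> with respect to \<open>e\<close>, \<open>k\<close> and \<open>br e k\<close>, with denominators
  cleared.\<close>

lemma sl2_expansion:
  assumes "e \<in> sl2" "k \<in> sl2" "z \<in> sl2"
  shows "(mat2_inner e e * mat2_inner k k - (mat2_inner e k)\<^sup>2) *\<^sub>R z =
    (mat2_inner k k * mat2_inner z e - mat2_inner e k * mat2_inner z k) *\<^sub>R e
    + (mat2_inner e e * mat2_inner z k - mat2_inner e k * mat2_inner z e) *\<^sub>R k
    - (mat2_inner z (br e k) / 4) *\<^sub>R br e k"
  by (rule sl2_exhaust[OF assms(1)], rule sl2_exhaust[OF assms(2)], rule sl2_exhaust[OF assms(3)])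
    (simp add: field_simps power2_eq_square)


section \<open>Lagrangian subspaces invariant under the curvature\<close>

text \<open>The forms and maps below live on pairs \<open>(\<alpha>, \<beta>)\<close>, that is, on tangent vectors after left
  translation. Up to the factor \<open>sqrt 3\<close>, \<open>J0\<close> is the almost complex structure and \<open>om\<close> the fundamental two-form of
  the metric \<open>gq\<close>. The matrix \<open>curv_sl2 X Y\<close> represents the curvature of the canonical Hermitian connection, which
  is that of \<open>SL2 \<times> SL2\<close> as a quotient of \<open>SL2 \<times> SL2 \<times> SL2\<close> by the diagonal.\<close>

definition pair_ad :: "mat2 \<Rightarrow> mat2 \<times> mat2 \<Rightarrow> mat2 \<times> mat2" where
  "pair_ad k X = (br k (fst X), br k (snd X))"

definition om :: "mat2 \<times> mat2 \<Rightarrow> mat2 \<times> mat2 \<Rightarrow> real" where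
  "om X Y = mat2_inner (fst X) (snd Y) - mat2_inner (snd X) (fst Y)"

definition gq :: "mat2 \<times> mat2 \<Rightarrow> mat2 \<times> mat2 \<Rightarrow> real" where
  "gq X Y = 2 / 3 * (mat2_inner (fst X) (fst Y) + mat2_inner (snd X) (snd Y))
    - 1 / 3 * (mat2_inner (snd X) (fst Y) + mat2_inner (fst X) (snd Y))"

definition J0 :: "mat2 \<times> mat2 \<Rightarrow> mat2 \<times> mat2" where
  "J0 X = (fst X - 2 *\<^sub>R snd X, 2 *\<^sub>R fst X - snd X)"

definition curv_sl2 :: "mat2 \<times> mat2 \<Rightarrow> mat2 \<times> mat2 \<Rightarrow> mat2" where
  "curv_sl2 X Y = 2 *\<^sub>R br (fst X) (fst Y) + 2 *\<^sub>R br (snd X) (snd Y) - br (fst X) (snd Y) - br (snd X) (fst Y)"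

definition vol :: "mat2 \<Rightarrow> mat2 \<Rightarrow> mat2 \<Rightarrow> real" where
  "vol a b c = mat2_inner (br a b) c"

text \<open>With \<open>vol30\<close> and \<open>vol03\<close> below, these are the coefficients of \<open>s\<^sup>2 t\<close> and \<open>s t\<^sup>2\<close> in
  \<open>vol (s \<alpha> + t \<beta>) (s \<alpha>' + t \<beta>') (s \<alpha>'' + t \<beta>'')\<close>.\<close>

definition vol21 :: "mat2 \<times> mat2 \<Rightarrow> mat2 \<times> mat2 \<Rightarrow> mat2 \<times> mat2 \<Rightarrow> real" where
  "vol21 X Y Z = vol (fst X) (fst Y) (snd Z) + vol (fst X) (snd Y) (fst Z) + vol (snd X) (fst Y) (fst Z)"

definition vol12 :: "mat2 \<times> mat2 \<Rightarrow> mat2 \<times> mat2 \<Rightarrow> mat2 \<times> mat2 \<Rightarrow> real" where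
  "vol12 X Y Z = vol (snd X) (snd Y) (fst Z) + vol (snd X) (fst Y) (snd Z) + vol (fst X) (snd Y) (snd Z)"

text \<open>The left-trivialized differential of the isometry \<open>rho\<close> of order three defined below, up to
  conjugation.\<close>

definition rot1 :: "mat2 \<times> mat2 \<Rightarrow> mat2 \<times> mat2" where
  "rot1 X = (- snd X, fst X - snd X)"

abbreviation sl2sq :: "(mat2 \<times> mat2) set" where "sl2sq \<equiv> sl2 \<times> sl2"

lemmas ip_simps = ip.add_left ip.add_right ip.diff_left ip.diff_right ip.scaleR_left ip.scaleR_right
  ip.minus_left ip.minus_right ip.zero_left ip.zero_right
lemmas br_simps = br.add_left br.add_right br.diff_left br.diff_right br.scaleR_left br.scaleR_right
  br.minus_left br.minus_right br.zero_left br.zero_right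

lemma J0_J0: "J0 (J0 X) = - 3 *\<^sub>R X"
  by (simp add: J0_def prod_eq_iff vec_eq_iff)

lemma gq_J0: "gq (J0 X) Y = om X Y"
  by (simp add: gq_def J0_def om_def ip_simps algebra_simps)

lemma gq_J0J0: "om (J0 X) Y = - 3 * gq X Y"
  by (simp add: gq_def J0_def om_def ip_simps algebra_simps)

lemma J0_pair_ad: "J0 (pair_ad k X) = pair_ad k (J0 X)"
  by (simp add: J0_def pair_ad_def br_simps)

text \<open>The adjoint action and the curvature are dual to each other. This identity drives the whole
  pointwise classification.\<close>

lemma gq_pair_ad: "gq (pair_ad k X) Y = mat2_inner k (curv_sl2 X Y) / 3"
  by (simp add: gq_def pair_ad_def curv_sl2_def mat2_inner_br ip_simps field_simps)

lemma om_pair_ad: "om (pair_ad k X) Y = mat2_inner k (br (fst X) (snd Y) - br (snd X) (fst Y))"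
  by (simp add: om_def pair_ad_def mat2_inner_br ip_simps)

lemma curv_sl2_in [simp]: "curv_sl2 X Y \<in> sl2"
  unfolding curv_sl2_def by (intro sl2_closed br_in_sl2)

lemma pair_ad_in [simp]: "pair_ad k X \<in> sl2sq"
  by (simp add: pair_ad_def)

lemma J0_in: "X \<in> sl2sq \<Longrightarrow> J0 X \<in> sl2sq"
  by (auto simp: J0_def)

text \<open>The conditions \<open>special\<close> and \<open>curvature\<close> are the pointwise traces of being totally geodesic: the
  first says that the \<open>J0\<close>-antilinear part of the Levi-Civita connection preserves \<open>L\<close>, the second that the curvature of the
  remaining part does.\<close>

locale invariant_lagrangian =
  fixes L :: "(mat2 \<times> mat2) set"
  assumes subspace_L: "subspace L"
    and L_sl2: "L \<subseteq> sl2sq"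
    and isotropic: "X \<in> L \<Longrightarrow> Y \<in> L \<Longrightarrow> om X Y = 0"
    and maximal: "Y \<in> sl2sq \<Longrightarrow> (\<And>X. X \<in> L \<Longrightarrow> om Y X = 0) \<Longrightarrow> Y \<in> L"
    and nondegenerate: "X \<in> L \<Longrightarrow> (\<And>Y. Y \<in> L \<Longrightarrow> gq X Y = 0) \<Longrightarrow> X = 0"
    and special: "X \<in> L \<Longrightarrow> Y \<in> L \<Longrightarrow> Z \<in> L \<Longrightarrow> vol21 X Y Z = vol12 X Y Z"
    and curvature: "X \<in> L \<Longrightarrow> Y \<in> L \<Longrightarrow> Z \<in> L \<Longrightarrow> pair_ad (curv_sl2 X Y) Z \<in> L"
begin

lemmas L_closed = subspace_0[OF subspace_L] subspace_add[OF subspace_L] subspace_diff[OF subspace_L]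
  subspace_neg[OF subspace_L] subspace_scale[OF subspace_L]

lemma L_scaleR_iff: "r \<noteq> 0 \<Longrightarrow> r *\<^sub>R X \<in> L \<longleftrightarrow> X \<in> L"
  using L_closed(5)[of X r] L_closed(5)[of "r *\<^sub>R X" "inverse r"] by auto

text \<open>As \<open>J0 (J0 X) = - 3 X\<close>, membership in \<open>P\<close> means that the adjoint action maps \<open>L\<close> into \<open>J0 L\<close>, which is the
  orthogonal complement of \<open>L\<close>. The two sets behave like the even and the odd part of a symmetric pair.\<close>

definition K :: "mat2 set" where "K = {k \<in> sl2. \<forall>X\<in>L. pair_ad k X \<in> L}"

definition P :: "mat2 set" where "P = {k \<in> sl2. \<forall>X\<in>L. J0 (pair_ad k X) \<in> L}"

lemma pair_ad_linear:
  "pair_ad (k + m) X = pair_ad k X + pair_ad m X" "pair_ad (r *\<^sub>R k) X = r *\<^sub>R pair_ad k X"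
  "pair_ad (k - m) X = pair_ad k X - pair_ad m X" "pair_ad 0 X = 0"
  by (simp_all add: pair_ad_def br_simps zero_prod_def)

lemma subspace_K: "subspace K"
  unfolding subspace_def K_def by (auto simp: pair_ad_linear intro: L_closed)

lemmas K_closed = subspace_0[OF subspace_K] subspace_add[OF subspace_K] subspace_diff[OF subspace_K]
  subspace_neg[OF subspace_K] subspace_scale[OF subspace_K]

lemma K_D: "k \<in> K \<Longrightarrow> k \<in> sl2" "k \<in> K \<Longrightarrow> X \<in> L \<Longrightarrow> pair_ad k X \<in> L"
  and P_D: "k \<in> P \<Longrightarrow> k \<in> sl2" "k \<in> P \<Longrightarrow> X \<in> L \<Longrightarrow> J0 (pair_ad k X) \<in> L"
  by (auto simp: K_def P_def)

lemma pair_ad_br: "pair_ad (br k m) X = pair_ad k (pair_ad m X) - pair_ad m (pair_ad k X)"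
  by (simp add: pair_ad_def jacobi)

lemma K_br: "k \<in> K \<Longrightarrow> m \<in> K \<Longrightarrow> br k m \<in> K"
  by (auto simp: K_def pair_ad_br intro: L_closed)

lemma P_br:
  assumes "k \<in> P" "m \<in> P" shows "br k m \<in> K"
proof -
  have "pair_ad (br k m) X \<in> L" if "X \<in> L" for X
  proof -
    have "pair_ad k' (pair_ad m' X) \<in> L" if "k' \<in> P" "m' \<in> P" for k' m'
    proof -
      have "J0 (pair_ad k' (J0 (pair_ad m' X))) \<in> L" using P_D \<open>X \<in> L\<close> that by blast
      then have "- 3 *\<^sub>R pair_ad k' (pair_ad m' X) \<in> L" by (simp add: J0_pair_ad[symmetric] J0_J0)
      then show ?thesis using L_scaleR_iff[of "- 3"] by simp
    qed
    then show ?thesis unfolding pair_ad_br using assms by (intro L_closed)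
  qed
  then show ?thesis by (simp add: K_def)
qed

lemma curv_in_K: "X \<in> L \<Longrightarrow> Y \<in> L \<Longrightarrow> curv_sl2 X Y \<in> K"
  using curvature by (simp add: K_def)

text \<open>Curvatures of pairs in \<open>L\<close> lie in \<open>K\<close>; by duality, an element orthogonal to all of them moves \<open>L\<close>
  into its orthogonal complement.\<close>

lemma K_perp:
  assumes "k \<in> sl2" "\<And>m. m \<in> K \<Longrightarrow> mat2_inner k m = 0" shows "k \<in> P"
proof -
  have "J0 (pair_ad k X) \<in> L" if X: "X \<in> L" for X
  proof (rule maximal)
    show "J0 (pair_ad k X) \<in> sl2sq" by (rule J0_in[OF pair_ad_in])
    fix Z assume "Z \<in> L"
    then show "om (J0 (pair_ad k X)) Z = 0"
      unfolding gq_J0J0 gq_pair_ad using assms(2)[OF curv_in_K[OF X]] by simp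
  qed
  then show ?thesis using assms(1) by (simp add: P_def)
qed

text \<open>Such an element maps \<open>L\<close> into \<open>L\<close> and into the orthogonal complement of \<open>L\<close>, hence annihilates \<open>L\<close>.
  Then everything in the image of \<open>br k\<close>, put into either slot, is \<open>om\<close>-orthogonal to \<open>L\<close> and so belongs to
  \<open>L\<close>. Isotropy makes this image totally null, which is impossible for a plane.\<close>

lemma K_Int_P:
  assumes "k \<in> K" "k \<in> P" shows "k = 0"
proof -
  have ad0: "pair_ad k X = 0" if X: "X \<in> L" for X
  proof (rule nondegenerate)
    show "pair_ad k X \<in> L" using K_D assms X by blast
    fix Z assume "Z \<in> L"
    then have "om (J0 (pair_ad k X)) Z = 0" using isotropic P_D(2)[OF assms(2) X] by blast
    then show "gq (pair_ad k X) Z = 0" unfolding gq_J0J0 by simp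
  qed
  have "(br m k, 0) \<in> L" "(0, br m k) \<in> L" for m
  proof -
    have *: "br k (fst X) = 0" "br k (snd X) = 0" if "X \<in> L" for X
      using ad0[OF that] by (simp_all add: pair_ad_def prod_eq_iff)
    show "(br m k, 0) \<in> L" "(0, br m k) \<in> L"
      by (rule maximal; simp add: om_def mat2_inner_br * ip_simps)+
  qed
  then have "mat2_inner (br m k) (br m' k) = 0" for m m'
    using isotropic[of "(br m k, 0)" "(0, br m' k)"] by (simp add: om_def ip_simps)
  note n = this
  obtain x y z where k: "k = mat2 x y z (- x)" using sl2_exhaust[OF K_D(1)[OF assms(1)]] .
  show ?thesis
    using n[of "mat2 0 1 0 0" "mat2 0 1 0 0"] n[of "mat2 0 0 1 0" "mat2 0 0 1 0"] n[of "mat2 0 1 0 0" "mat2 0 0 1 0"]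
    by (auto simp: k)
qed

text \<open>If all elements of \<open>K\<close> were null, then \<open>K\<close> would lie in its own orthogonal complement and vanish. But then
  \<open>P\<close> would be everything, and brackets of elements of \<open>P\<close> lie in \<open>K\<close>.\<close>

lemma ex_nonnull: "\<exists>e\<in>K. mat2_inner e e \<noteq> 0"
proof (rule ccontr)
  assume "\<not> ?thesis"
  then have null: "mat2_inner e e = 0" if "e \<in> K" for e using that by blast
  have "e = 0" if e: "e \<in> K" for e
  proof (rule K_Int_P[OF e K_perp])
    show "e \<in> sl2" using K_D e by blast
    fix m assume m: "m \<in> K"
    have "mat2_inner (e + m) (e + m) = 0" by (intro null K_closed(2) e m)
    then show "mat2_inner e m = 0" using null[OF e] null[OF m] mat2_inner_commute[of e m] by (simp add: ip_simps)
  qed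
  then have K0: "K = {0}" using K_closed(1) by blast
  then have "k \<in> P" if "k \<in> sl2" for k using that by (intro K_perp) (auto simp: ip_simps)
  then have "br (mat2 0 1 0 0) (mat2 0 0 1 0) \<in> K" by (intro P_br) auto
  then show False using K0 by simp
qed

text \<open>Two orthogonal non-null elements of \<open>K\<close> generate all of \<open>sl2\<close>. If \<open>K\<close> contains any element
  orthogonal to \<open>e\<close> other than \<open>0\<close>, then it contains a non-null one.\<close>

lemma full_or_axis:
  assumes e: "e \<in> K" "mat2_inner e e \<noteq> 0"
  shows "sl2 \<subseteq> K \<or> {p \<in> sl2. mat2_inner p e = 0} \<subseteq> P"
proof (cases "\<exists>k\<in>K. k \<noteq> 0 \<and> mat2_inner k e = 0")
  case False
  have "p \<in> P" if p: "p \<in> sl2" "mat2_inner p e = 0" for p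
  proof (rule K_perp[OF p(1)])
    fix m assume m: "m \<in> K"
    let ?m = "m - (mat2_inner m e / mat2_inner e e) *\<^sub>R e"
    have "?m \<in> K" by (intro K_closed(3,5) m e(1))
    moreover have "mat2_inner ?m e = 0" using e by (simp add: ip_simps)
    ultimately have "?m = 0" using False by blast
    then have "m = (mat2_inner m e / mat2_inner e e) *\<^sub>R e" by simp
    then have "mat2_inner p m = mat2_inner p ((mat2_inner m e / mat2_inner e e) *\<^sub>R e)" by simp
    then show "mat2_inner p m = 0" using p(2) by (simp only: ip.scaleR_right) simp
  qed
  then show ?thesis by blast
next
  case True
  then obtain k0 where k0: "k0 \<in> K" "k0 \<noteq> 0" "mat2_inner k0 e = 0" by blast
  obtain k where k: "k \<in> K" "mat2_inner k k \<noteq> 0" "mat2_inner k e = 0"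
  proof (cases "mat2_inner k0 k0 = 0")
    case False
    then show ?thesis using k0 that by blast
  next
    case null: True
    have "k0 \<notin> P" using K_Int_P k0 by blast
    then obtain y where y: "y \<in> K" "mat2_inner k0 y \<noteq> 0" using K_perp[OF K_D(1)[OF k0(1)]] by blast
    \<comment> \<open>A null \<open>k0\<close> has a partner \<open>?y\<close> in \<open>K\<close>, orthogonal to \<open>e\<close>, that is not orthogonal to \<open>k0\<close>.\<close>
    let ?y = "y - (mat2_inner y e / mat2_inner e e) *\<^sub>R e"
    have yK: "?y \<in> K" by (intro K_closed(3,5) y(1) e(1))
    have y': "mat2_inner ?y e = 0" "mat2_inner k0 ?y \<noteq> 0"
      using y(2) e(2) k0(3) by (simp_all add: ip_simps)
    show ?thesis
    proof (cases "mat2_inner ?y ?y = 0")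
      case False
      then show ?thesis using yK y' that by blast
    next
      case y0: True
      have "mat2_inner (k0 + ?y) (k0 + ?y) = 2 * mat2_inner k0 ?y"
        unfolding ip.add_left ip.add_right using null y0 mat2_inner_commute[of ?y k0] by linarith
      moreover have "mat2_inner (k0 + ?y) e = 0" using k0(3) y'(1) by (simp add: ip.add_left)
      moreover have "k0 + ?y \<in> K" by (intro K_closed(2) k0(1) yK)
      ultimately show ?thesis using y'(2) that[of "k0 + ?y"] by simp
    qed
  qed
  have "z \<in> K" if z: "z \<in> sl2" for z
  proof -
    have ek: "mat2_inner e k = 0" using k(3) mat2_inner_commute[of e k] by simp
    have "(mat2_inner e e * mat2_inner k k) *\<^sub>R z =
      (mat2_inner k k * mat2_inner z e) *\<^sub>R e + (mat2_inner e e * mat2_inner z k) *\<^sub>R k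
      - (mat2_inner z (br e k) / 4) *\<^sub>R br e k"
      using sl2_expansion[OF K_D(1)[OF e(1)] K_D(1)[OF k(1)] z] ek by simp
    also have "\<dots> \<in> K" by (intro K_closed(2,3,5) K_br e(1) k(1))
    finally have "inverse (mat2_inner e e * mat2_inner k k) *\<^sub>R (mat2_inner e e * mat2_inner k k) *\<^sub>R z \<in> K"
      by (rule K_closed(5))
    then show ?thesis using e(2) k(2) by (simp del: inverse_mult_distrib)
  qed
  then show ?thesis by blast
qed

lemma ex_nonzero: "\<exists>X\<in>L. X \<noteq> 0"
proof (rule ccontr)
  assume "\<not> ?thesis"
  then have L0: "X = 0" if "X \<in> L" for X using that by blast
  have "fst X = 0" "snd X = 0" if "X \<in> L" for X by (simp_all add: L0[OF that])
  then have "om (mat2 0 1 0 0, 0) X = 0" if "X \<in> L" for X using that by (simp add: om_def ip_simps)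
  then have "(mat2 0 1 0 0, 0) \<in> L" by (intro maximal) auto
  from L0[OF this] show False by (simp add: zero_prod_def)
qed

end

lemma mat2_inner_br_self: "mat2_inner (br e w) e = 0"
  by (cases e rule: mat2_exhaust; cases w rule: mat2_exhaust) (simp add: algebra_simps)

lemma scaleR_eq_imp_divide:
  fixes u v :: "'a::real_vector"
  assumes "r \<noteq> 0" "r *\<^sub>R u = l *\<^sub>R v" shows "u = (l / r) *\<^sub>R v"
proof -
  have "u = inverse r *\<^sub>R (r *\<^sub>R u)" using assms(1) by simp
  then show ?thesis by (simp add: assms(2) divide_inverse mult.commute)
qed

lemma br_eq_0_imp_parallel:
  assumes "a \<in> sl2" "b \<in> sl2" "br a b = 0" "a \<noteq> 0"
  shows "\<exists>r. b = r *\<^sub>R a"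
proof -
  obtain x y z where a: "a = mat2 x y z (- x)" using sl2_exhaust[OF assms(1)] .
  obtain x' y' z' where b: "b = mat2 x' y' z' (- x')" using sl2_exhaust[OF assms(2)] .
  have "br a b $ 1 $ 1 = y * z' - z * y'" "br a b $ 1 $ 2 = 2 * (x * y') - 2 * (x' * y)"
    "br a b $ 2 $ 1 = 2 * (z * x') - 2 * (z' * x)"
    by (simp_all add: a b)
  then have eq: "y * z' = z * y'" "x * y' = x' * y" "z * x' = z' * x" unfolding assms(3) by simp_all
  consider "x \<noteq> 0" | "y \<noteq> 0" | "z \<noteq> 0" using assms(4) by (auto simp: a)
  then show ?thesis
  proof cases
    case 1 then show ?thesis using eq by (intro exI[of _ "x' / x"]) (simp add: a b field_simps)
  next
    case 2 then show ?thesis using eq by (intro exI[of _ "y' / y"]) (simp add: a b field_simps)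
  next
    case 3 then show ?thesis using eq by (intro exI[of _ "z' / z"]) (simp add: a b field_simps)
  qed
qed

lemma br_br_eq_0:
  assumes "m \<in> sl2" "n \<in> sl2" "m \<noteq> 0" "\<And>k. k \<in> sl2 \<Longrightarrow> br (br k m) n = 0" shows "n = 0"
proof -
  obtain x y z where m: "m = mat2 x y z (- x)" using sl2_exhaust[OF assms(1)] .
  obtain p q r where n: "n = mat2 p q r (- p)" using sl2_exhaust[OF assms(2)] .
  have "x \<noteq> 0 \<or> y \<noteq> 0 \<or> z \<noteq> 0" using assms(3) by (auto simp: m)
  then show ?thesis
    using assms(4)[of "mat2 1 0 0 (-1)"] assms(4)[of "mat2 0 1 0 0"] assms(4)[of "mat2 0 0 1 0"]
    by (auto simp: m n)
qed

context invariant_lagrangian begin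

text \<open>By Schur's lemma an invariant subspace of dimension three has the form \<open>{(x z, y z)}\<close>; here this
  is derived from isotropy. The condition on the volumes reads \<open>x y (x - y) = 0\<close>.\<close>

lemma full_case:
  assumes "sl2 \<subseteq> K"
  shows "(\<forall>X\<in>L. fst X = 0) \<or> (\<forall>X\<in>L. snd X = 0) \<or> (\<forall>X\<in>L. fst X = snd X)"
proof -
  have brs: "br (fst X) (snd Y) = br (snd X) (fst Y)" if "X \<in> L" "Y \<in> L" for X Y
  proof -
    have "mat2_inner k (br (fst X) (snd Y) - br (snd X) (fst Y)) = 0" if "k \<in> sl2" for k
      using isotropic[OF K_D(2)[of k X] \<open>Y \<in> L\<close>] that assms \<open>X \<in> L\<close> by (auto simp: om_pair_ad)
    then have "br (fst X) (snd Y) - br (snd X) (fst Y) = 0" by (intro mat2_inner_nondeg) auto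
    then show ?thesis by simp
  qed
  obtain X where X: "X \<in> L" "X \<noteq> 0" using ex_nonzero by blast
  have Xsl: "fst X \<in> sl2" "snd X \<in> sl2" using L_sl2 X by auto
  have "br (fst X) (snd X) = - br (fst X) (snd X)"
    using brs[OF X(1) X(1)] br_anti[of "snd X" "fst X"] by simp
  then have "2 *\<^sub>R br (fst X) (snd X) = 0" unfolding scaleR_2 by (simp add: eq_neg_iff_add_eq_0)
  then have br0: "br (fst X) (snd X) = 0" by simp
  obtain m x y where m: "m \<in> sl2" "m \<noteq> 0" "fst X = x *\<^sub>R m" "snd X = y *\<^sub>R m"
  proof (cases "fst X = 0")
    case True
    then show ?thesis using X Xsl that[of "snd X" 0 1] by (auto simp: prod_eq_iff)
  next
    case False
    then obtain r where "snd X = r *\<^sub>R fst X" using br_eq_0_imp_parallel[OF Xsl br0] by blast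
    then show ?thesis using that[of "fst X" 1 r] False Xsl by simp
  qed
  have xy: "x \<noteq> 0 \<or> y \<noteq> 0" using X m by (auto simp: prod_eq_iff)
  have par: "x *\<^sub>R snd Y = y *\<^sub>R fst Y" if Y: "Y \<in> L" for Y
  proof -
    have "x *\<^sub>R snd Y - y *\<^sub>R fst Y = 0"
    proof (rule br_br_eq_0[OF m(1) _ m(2)])
      show "x *\<^sub>R snd Y - y *\<^sub>R fst Y \<in> sl2" using L_sl2 Y by auto
      fix k :: mat2 assume "k \<in> sl2"
      then have "pair_ad k X \<in> L" using K_D(2)[OF subsetD[OF assms] X(1)] by blast
      from brs[OF this Y] show "br (br k m) (x *\<^sub>R snd Y - y *\<^sub>R fst Y) = 0"
        by (simp add: pair_ad_def m br_simps)
    qed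
    then show ?thesis by (simp only: right_minus_eq)
  qed
  have all: "(x *\<^sub>R z, y *\<^sub>R z) \<in> L" if "z \<in> sl2" for z
  proof (rule maximal)
    fix Y assume "Y \<in> L"
    have "om (x *\<^sub>R z, y *\<^sub>R z) Y = mat2_inner z (x *\<^sub>R snd Y - y *\<^sub>R fst Y)" by (simp add: om_def ip_simps)
    then show "om (x *\<^sub>R z, y *\<^sub>R z) Y = 0" using par[OF \<open>Y \<in> L\<close>] by (simp add: ip_simps)
  qed (use that in auto)
  have "vol21 (x *\<^sub>R a, y *\<^sub>R a) (x *\<^sub>R b, y *\<^sub>R b) (x *\<^sub>R c, y *\<^sub>R c) =
    vol12 (x *\<^sub>R a, y *\<^sub>R a) (x *\<^sub>R b, y *\<^sub>R b) (x *\<^sub>R c, y *\<^sub>R c)" if "a \<in> sl2" "b \<in> sl2" "c \<in> sl2" for a b c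
    using special all that by blast
  from this[of "mat2 1 0 0 (-1)" "mat2 0 1 0 0" "mat2 0 0 1 0"]
  have "x * (x * y) = x * (y * y)" by (simp add: vol21_def vol12_def vol_def)
  then have "x = 0 \<or> y = 0 \<or> x = y" by auto
  then consider "x = 0" "y \<noteq> 0" | "y = 0" "x \<noteq> 0" | "x = y" "x \<noteq> 0" using xy by auto
  then show ?thesis
  proof cases
    case 1 then have "\<forall>X\<in>L. fst X = 0" using par by fastforce
    then show ?thesis by blast
  next
    case 2 then have "\<forall>X\<in>L. snd X = 0" using par by fastforce
    then show ?thesis by blast
  next
    case 3 then have "\<forall>X\<in>L. fst X = snd X" using par by fastforce
    then show ?thesis by blast
  qed
qed

text \<open>Let \<open>(x e, y e)\<close> be a nonzero element of \<open>L\<close>; one is obtained by projecting to the axis. The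
  elements orthogonal to \<open>e\<close> act on it through \<open>P\<close>, so that \<open>L\<close> also contains the pairs \<open>(p z, q z)\<close> for
  all \<open>z\<close> orthogonal to \<open>e\<close>, where \<open>(p, q)\<close> is the image of \<open>(x, y)\<close> under \<open>J0\<close>. The condition on the volumes
  again reads \<open>x y (x - y) = 0\<close>, and in each of the three cases \<open>L\<close> is, up to a power of \<open>rot1\<close>, the graph of the half turn about \<open>e\<close>.\<close>

lemma axis_case:
  assumes e: "e \<in> K" "mat2_inner e e \<noteq> 0" and P: "{p \<in> sl2. mat2_inner p e = 0} \<subseteq> P"
  shows "(\<forall>X\<in>L. snd X ** e = e ** fst X) \<or> (\<forall>X\<in>L. (fst X - snd X) ** e = - (e ** snd X)) \<or>
    (\<forall>X\<in>L. - (fst X ** e) = e ** (snd X - fst X))"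
proof -
  define a where "a = mat2_inner e e"
  have a: "a \<noteq> 0" and esl: "e \<in> sl2" using e K_D by (auto simp: a_def)
  have "2 *\<^sub>R (e ** e) = 2 *\<^sub>R (a *\<^sub>R mat 1)"
    using sl2_anticommutator[OF esl esl] unfolding scaleR_2[of "e ** e"] by (simp add: a_def)
  then have ee: "e ** e = a *\<^sub>R mat 1" by (rule scaleR_left_imp_eq[rotated]) simp
  have axis: "((mat2_inner (fst X) e / a) *\<^sub>R e, (mat2_inner (snd X) e / a) *\<^sub>R e) \<in> L" if X: "X \<in> L" for X
  proof -
    have sl: "fst X \<in> sl2" "snd X \<in> sl2" using L_sl2 X by auto
    have "pair_ad e (pair_ad e X) \<in> L" using K_D(2) e(1) X by blast
    \<comment> \<open>This is the projection onto the centralizer of \<open>e\<close>, which is the line spanned by \<open>e\<close>.\<close>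
    then have "X - (1 / (4 * a)) *\<^sub>R pair_ad e (pair_ad e X) \<in> L" by (intro L_closed(3,5) X)
    moreover have "b - (1 / (4 * a)) *\<^sub>R br e (br e b) = (mat2_inner b e / a) *\<^sub>R e" if "b \<in> sl2" for b
    proof -
      have "br e (br e b) = (4 * a) *\<^sub>R b - (4 * mat2_inner b e) *\<^sub>R e"
        using br_br[OF esl esl that] unfolding a_def[symmetric] mat2_inner_commute[of e b] .
      then show ?thesis using a by (simp add: scaleR_diff_right)
    qed
    then have "X - (1 / (4 * a)) *\<^sub>R pair_ad e (pair_ad e X) =
      ((mat2_inner (fst X) e / a) *\<^sub>R e, (mat2_inner (snd X) e / a) *\<^sub>R e)"
      using sl by (simp add: pair_ad_def prod_eq_iff)
    ultimately show ?thesis by simp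
  qed
  obtain x y where xy: "x \<noteq> 0 \<or> y \<noteq> 0" "(x *\<^sub>R e, y *\<^sub>R e) \<in> L"
  proof (cases "\<exists>X\<in>L. mat2_inner (fst X) e \<noteq> 0 \<or> mat2_inner (snd X) e \<noteq> 0")
    case True
    then obtain X where "X \<in> L" "mat2_inner (fst X) e \<noteq> 0 \<or> mat2_inner (snd X) e \<noteq> 0" by blast
    then show ?thesis using that[OF _ axis[of X]] a by simp
  next
    case False
    then have "(e, 0) \<in> L" using esl by (intro maximal) (auto simp: om_def ip_simps mat2_inner_commute[of e])
    then show ?thesis using that[of 1 0] by simp
  qed
  define p q where "p = x - 2 * y" and "q = 2 * x - y"
  have perp: "(p *\<^sub>R z, q *\<^sub>R z) \<in> L" if z: "z \<in> sl2" "mat2_inner z e = 0" for z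
  proof -
    \<comment> \<open>Chosen such that \<open>br ?p e = z\<close>.\<close>
    let ?p = "- (1 / (4 * a)) *\<^sub>R br e z"
    have "br e (br e z) = (4 * a) *\<^sub>R z"
      using br_br[OF esl esl z(1)] z(2) unfolding a_def[symmetric] mat2_inner_commute[of e z] by simp
    then have "br (br e z) e = - (4 * a) *\<^sub>R z" using br_anti[of "br e z" e] by simp
    then have "br ?p e = z" using a by (simp only: br.scaleR_left) simp
    moreover have "mat2_inner ?p e = 0"
      using mat2_inner_br_self by (simp only: ip.scaleR_left) simp
    moreover have "?p \<in> sl2" by simp
    ultimately have "J0 (x *\<^sub>R z, y *\<^sub>R z) \<in> L"
      using P_D(2)[OF subsetD[OF P] xy(2), of ?p]
      unfolding pair_ad_def fst_conv snd_conv br.scaleR_right by simp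
    then show ?thesis by (simp add: J0_def p_def q_def scaleR_diff_left mult.commute)
  qed
  have cubic: "x * y * (x - y) = 0"
  proof (rule ccontr)
    assume nz: "x * y * (x - y) \<noteq> 0"
    have "vol e (br e w1) (br e w2) = 0" for w1 w2
    proof -
      have pe: "mat2_inner (br e w) e = 0" for w
        by (rule mat2_inner_br_self)
      have "vol21 (x *\<^sub>R e, y *\<^sub>R e) (p *\<^sub>R br e w1, q *\<^sub>R br e w1) (p *\<^sub>R br e w2, q *\<^sub>R br e w2) =
        vol12 (x *\<^sub>R e, y *\<^sub>R e) (p *\<^sub>R br e w1, q *\<^sub>R br e w1) (p *\<^sub>R br e w2, q *\<^sub>R br e w2)"
        using special[OF xy(2) perp perp] pe by simp
      then have "(2 * x * p * q + y * p * p - (x * q * q + 2 * y * p * q)) * vol e (br e w1) (br e w2) = 0"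
        by (simp add: vol21_def vol12_def vol_def ip_simps br_simps algebra_simps)
      moreover have "2 * x * p * q + y * p * p - (x * q * q + 2 * y * p * q) = - 9 * (x * y * (x - y))"
        by (simp add: p_def q_def algebra_simps)
      ultimately show ?thesis using nz by simp
    qed
    note v = this
    obtain s t u where E: "e = mat2 s t u (- s)" using sl2_exhaust[OF esl] .
    have a2: "a = s\<^sup>2 + t * u" by (simp add: a_def E power2_eq_square)
    \<comment> \<open>Suitable \<open>w1\<close> and \<open>w2\<close> give the coordinates of \<open>e\<close>, up to the factor \<open>a\<close> and constants.\<close>
    have "a * s = 0" "a * t = 0" "a * u = 0"
      using v[of "mat2 0 1 0 0" "mat2 0 0 1 0"] v[of "mat2 1 0 0 (-1)" "mat2 0 0 1 0"] v[of "mat2 1 0 0 (-1)" "mat2 0 1 0 0"]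
      unfolding a2 by (simp_all add: E vol_def power2_eq_square algebra_simps)
    then have "e = 0" using a by (simp add: E)
    then show False using a by (simp add: a_def ip_simps)
  qed
  have rel1: "x * mat2_inner (snd X) e = y * mat2_inner (fst X) e" if "X \<in> L" for X
    using isotropic[OF xy(2) that] by (simp add: om_def ip_simps mat2_inner_commute[of e])
  have rel2: "\<exists>l. p *\<^sub>R snd X - q *\<^sub>R fst X = l *\<^sub>R e" if X: "X \<in> L" for X
  proof -
    let ?n = "p *\<^sub>R snd X - q *\<^sub>R fst X"
    let ?n' = "?n - (mat2_inner ?n e / a) *\<^sub>R e"
    have nsl: "?n' \<in> sl2" using L_sl2 X esl by auto
    have "mat2_inner (n - (mat2_inner n e / a) *\<^sub>R e) e = 0" for n
      using a by (simp add: ip.diff_left ip.scaleR_left a_def)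
    then have ne: "mat2_inner e ?n' = 0" unfolding mat2_inner_commute[of e] .
    have "?n' = 0"
    proof (rule mat2_inner_nondeg[OF nsl])
      fix w assume w: "w \<in> sl2"
      let ?w = "w - (mat2_inner w e / a) *\<^sub>R e"
      have wp: "?w \<in> sl2" "mat2_inner ?w e = 0" using w esl a by (auto simp: ip_simps a_def)
      have "mat2_inner ?w ?n = 0"
        using isotropic[OF perp[OF wp] X] by (simp add: om_def ip.scaleR_left ip.scaleR_right ip.diff_right)
      then have "mat2_inner ?w ?n' = 0" using wp(2) by (simp only: ip.diff_right ip.scaleR_right) simp
      then show "mat2_inner w ?n' = 0" using ne by (simp only: ip.diff_left ip.scaleR_left) simp
    qed
    then show ?thesis by (intro exI[of _ "mat2_inner ?n e / a"]) simp
  qed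
  have anti: "b ** e + e ** b = (2 * mat2_inner b e) *\<^sub>R mat 1" if "b \<in> sl2" for b
    using sl2_anticommutator[OF that esl] .
  have key: "(b - l *\<^sub>R e) ** e = - (e ** b)" if "b \<in> sl2" "2 * mat2_inner b e = l * a" for b l
    using anti[OF that(1)] that(2) by (simp add: mm.diff_left mm.scaleR_left ee algebra_simps eq_neg_iff_add_eq_0)
  have key': "e ** (b - l *\<^sub>R e) = - (b ** e)" if "b \<in> sl2" "2 * mat2_inner b e = l * a" for b l
    using anti[OF that(1)] that(2) by (simp add: mm.diff_right mm.scaleR_right ee algebra_simps eq_neg_iff_add_eq_0)
  consider "x = y" "x \<noteq> 0" | "x = 0" "y \<noteq> 0" | "y = 0" "x \<noteq> 0" using cubic xy by auto
  then show ?thesis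
  proof cases
    case 1
    have "snd X ** e = e ** fst X" if X: "X \<in> L" for X
    proof -
      obtain l where "p *\<^sub>R snd X - q *\<^sub>R fst X = l *\<^sub>R e" using rel2[OF X] by blast
      then have "(- x) *\<^sub>R (snd X + fst X) = l *\<^sub>R e" using 1 by (simp add: p_def q_def algebra_simps)
      moreover have "- x \<noteq> 0" using 1 by simp
      ultimately obtain l' where "snd X + fst X = l' *\<^sub>R e" using scaleR_eq_imp_divide by blast
      then have l': "snd X = - (fst X - l' *\<^sub>R e)" by (simp add: eq_diff_eq)
      have "mat2_inner (snd X) e = mat2_inner (fst X) e" using rel1[OF X] 1 by simp
      then have "2 * mat2_inner (fst X) e = l' * a" unfolding l' by (simp add: ip_simps a_def)
      moreover have "fst X \<in> sl2" using L_sl2 X by auto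
      ultimately show ?thesis using key[of "fst X" l'] by (simp only: l' mm.minus_left) simp
    qed
    then show ?thesis by blast
  next
    case 2
    have "(fst X - snd X) ** e = - (e ** snd X)" if X: "X \<in> L" for X
    proof -
      obtain l where "p *\<^sub>R snd X - q *\<^sub>R fst X = l *\<^sub>R e" using rel2[OF X] by blast
      then have "(y) *\<^sub>R (fst X - 2 *\<^sub>R snd X) = l *\<^sub>R e" using 2 by (simp add: p_def q_def algebra_simps)
      from scaleR_eq_imp_divide[OF _ this] obtain l' where "fst X - 2 *\<^sub>R snd X = l' *\<^sub>R e" using 2 by auto
      then have "fst X = 2 *\<^sub>R snd X - (- l') *\<^sub>R e" by (simp add: diff_eq_eq add.commute)
      then obtain l' where l': "fst X = 2 *\<^sub>R snd X - l' *\<^sub>R e" by blast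
      have "mat2_inner (fst X) e = 0" using rel1[OF X] 2 by simp
      then have "2 * mat2_inner (snd X) e = l' * a" unfolding l' by (simp add: ip_simps a_def)
      moreover have "fst X - snd X = snd X - l' *\<^sub>R e" unfolding l' by (simp add: scaleR_2)
      ultimately show ?thesis using key[of "snd X" l'] L_sl2 X by auto
    qed
    then show ?thesis by blast
  next
    case 3
    have "- (fst X ** e) = e ** (snd X - fst X)" if X: "X \<in> L" for X
    proof -
      obtain l where "p *\<^sub>R snd X - q *\<^sub>R fst X = l *\<^sub>R e" using rel2[OF X] by blast
      then have "(x) *\<^sub>R (snd X - 2 *\<^sub>R fst X) = l *\<^sub>R e" using 3 by (simp add: p_def q_def algebra_simps)
      from scaleR_eq_imp_divide[OF _ this] obtain l' where "snd X - 2 *\<^sub>R fst X = l' *\<^sub>R e" using 3 by auto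
      then have "snd X = 2 *\<^sub>R fst X - (- l') *\<^sub>R e" by (simp add: diff_eq_eq add.commute)
      then obtain l' where l': "snd X = 2 *\<^sub>R fst X - l' *\<^sub>R e" by blast
      have "mat2_inner (snd X) e = 0" using rel1[OF X] 3 by simp
      then have c: "2 * mat2_inner (fst X) e = l' * a" unfolding l' by (simp add: ip_simps a_def)
      have d: "snd X - fst X = fst X - l' *\<^sub>R e" unfolding l' by (simp add: scaleR_2)
      show ?thesis unfolding d using key'[OF _ c] L_sl2 X by auto
    qed
    then show ?thesis by blast
  qed
qed

text \<open>The three alternatives in \<open>full_case\<close> and in \<open>axis_case\<close> are permuted cyclically by \<open>rot1\<close>.\<close>

lemma classification:
  "\<exists>j<3. (\<forall>X\<in>L. fst ((rot1 ^^ j) X) = 0) \<or>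
     (\<exists>e\<in>sl2. mat2_inner e e \<noteq> 0 \<and> (\<forall>X\<in>L. snd ((rot1 ^^ j) X) ** e = e ** fst ((rot1 ^^ j) X)))"
  (is "\<exists>j<3. ?T j")
proof -
  have r: "(rot1 ^^ 0) X = X" "(rot1 ^^ 1) X = (- snd X, fst X - snd X)"
    "(rot1 ^^ 2) X = (snd X - fst X, - fst X)" for X
    by (simp_all add: rot1_def numeral_2_eq_2)
  obtain e where e: "e \<in> K" "mat2_inner e e \<noteq> 0" using ex_nonnull by blast
  have "?T 0 \<or> ?T 1 \<or> ?T 2"
  proof (cases "sl2 \<subseteq> K")
    case True
    from full_case[OF this] show ?thesis
      by (elim disjE) (simp_all only: r fst_conv snd_conv, simp_all)
  next
    case False
    then have axis: "{p \<in> sl2. mat2_inner p e = 0} \<subseteq> P" using full_or_axis[OF e] by blast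
    have esl: "e \<in> sl2" using e K_D by blast
    from axis_case[OF e axis] show ?thesis
      using e(2) esl unfolding r fst_conv snd_conv mm.minus_left mm.minus_right by blast
  qed
  then consider "?T 0" | "?T 1" | "?T 2" by blast
  then show ?thesis
  proof cases
    case 1 show ?thesis by (rule exI[of _ 0], rule conjI[OF _ 1]) simp
  next
    case 2 show ?thesis by (rule exI[of _ 1], rule conjI[OF _ 2]) simp
  next
    case 3 show ?thesis by (rule exI[of _ 2], rule conjI[OF _ 3]) simp
  qed
qed

end


section \<open>A cubic form that distinguishes the types\<close>

lemmas vol_simps =
  vol_def br.add_left br.add_right br.diff_left br.diff_right br.scaleR_left br.scaleR_right
  br.minus_left br.minus_right br.zero_left br.zero_right ip_simps

definition vol30 :: "mat2 \<times> mat2 \<Rightarrow> mat2 \<times> mat2 \<Rightarrow> mat2 \<times> mat2 \<Rightarrow> real" where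
  "vol30 X Y Z = vol (fst X) (fst Y) (fst Z)"

definition vol03 :: "mat2 \<times> mat2 \<Rightarrow> mat2 \<times> mat2 \<Rightarrow> mat2 \<times> mat2 \<Rightarrow> real" where
  "vol03 X Y Z = vol (snd X) (snd Y) (snd Z)"

lemma vol_rot1:
  "vol30 (rot1 X) (rot1 Y) (rot1 Z) = - vol03 X Y Z"
  "vol03 (rot1 X) (rot1 Y) (rot1 Z) = vol30 X Y Z - vol21 X Y Z + vol12 X Y Z - vol03 X Y Z"
  "vol21 (rot1 X) (rot1 Y) (rot1 Z) = vol12 X Y Z - 3 * vol03 X Y Z"
  "vol12 (rot1 X) (rot1 Y) (rot1 Z) = - vol21 X Y Z + 2 * vol12 X Y Z - 3 * vol03 X Y Z"
  by (simp_all add: rot1_def vol30_def vol03_def vol21_def vol12_def vol_simps)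

lemma rot1_3: "(rot1 ^^ 3) X = X"
  by (simp add: rot1_def numeral_3_eq_3)

lemma rot_2: "(rot1 ^^ 2) X = rot1 (rot1 X)"
  by (simp add: numeral_2_eq_2)

lemma rot_in: "X \<in> sl2sq \<Longrightarrow> (rot1 ^^ j) X \<in> sl2sq"
  by (induction j) (auto simp: rot1_def)

lemma om_rot: "om ((rot1 ^^ j) X) ((rot1 ^^ j) Y) = om X Y"
  by (induction j) (simp_all add: om_def rot1_def ip_simps)

text \<open>The condition \<open>b e = e a\<close> says that \<open>b\<close> is obtained from \<open>a\<close> by the half turn about \<open>e\<close>.\<close>

lemma reflection_eq:
  assumes "e \<in> sl2" "a \<in> sl2" "b ** e = e ** a"
  shows "mat2_inner e e *\<^sub>R b = (2 * mat2_inner a e) *\<^sub>R e - mat2_inner e e *\<^sub>R a"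
proof -
  have ee: "e ** e = mat2_inner e e *\<^sub>R mat 1"
    by (rule sl2_exhaust[OF assms(1)]) (simp add: one_mat2 algebra_simps)
  have "(b ** e) ** e = (e ** a) ** e" using assms(3) by simp
  then have "mat2_inner e e *\<^sub>R b = (e ** a) ** e" by (simp add: ee flip: matrix_mul_assoc)
  also have "e ** a = (2 * mat2_inner a e) *\<^sub>R mat 1 - a ** e"
    using sl2_anticommutator[OF assms(2,1)] by (simp add: eq_diff_eq add.commute)
  also have "\<dots> ** e = (2 * mat2_inner a e) *\<^sub>R e - mat2_inner e e *\<^sub>R a"
    by (simp add: mm.diff_left mm.scaleR_left ee flip: matrix_mul_assoc)
  finally show ?thesis .
qed

lemma cramer_sl2:
  assumes "e \<in> sl2" "a \<in> sl2" "b \<in> sl2" "c \<in> sl2"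
  shows "mat2_inner a e * vol e b c + mat2_inner b e * vol a e c + mat2_inner c e * vol a b e
    = mat2_inner e e * vol a b c"
  by (rule sl2_exhaust[OF assms(1)], rule sl2_exhaust[OF assms(2)], rule sl2_exhaust[OF assms(3)],
      rule sl2_exhaust[OF assms(4)]) (simp add: vol_def field_simps)

lemma vol_eq_trace:
  assumes "a \<in> sl2" "b \<in> sl2" "c \<in> sl2"
  shows "vol a b c = trace (a ** b ** c)"
  by (rule sl2_exhaust[OF assms(1)], rule sl2_exhaust[OF assms(2)], rule sl2_exhaust[OF assms(3)])
   (simp add: vol_def field_simps)

lemma trace_scaleR: "trace (r *\<^sub>R A :: mat2) = r * trace A"
  by (cases A rule: mat2_exhaust) (simp add: algebra_simps)

text \<open>A half turn preserves the volume. For the mixed volume the half turn is written as minus the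
  identity plus twice a projection to the axis, and the projections add up by Cramer's rule.\<close>

lemma vol_reflection:
  assumes e: "e \<in> sl2" "mat2_inner e e \<noteq> 0" and sl: "X \<in> sl2sq" "Y \<in> sl2sq" "Z \<in> sl2sq"
    and r: "snd X ** e = e ** fst X" "snd Y ** e = e ** fst Y" "snd Z ** e = e ** fst Z"
  shows "vol03 X Y Z = vol30 X Y Z" "vol21 X Y Z = - vol30 X Y Z"
proof -
  let ?a = "mat2_inner e e"
  have s: "fst X \<in> sl2" "fst Y \<in> sl2" "fst Z \<in> sl2" "snd X \<in> sl2" "snd Y \<in> sl2" "snd Z \<in> sl2"
    using sl by (auto simp: mem_Times_iff)
  have ee: "e ** e = ?a *\<^sub>R mat 1"
    by (rule sl2_exhaust[OF e(1)]) (simp add: one_mat2 algebra_simps)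
  have "?a * trace (snd X ** snd Y ** snd Z) = trace (snd X ** snd Y ** (snd Z ** e) ** e)"
    by (simp add: ee flip: matrix_mul_assoc) (simp add: mm.scaleR_right trace_scaleR)
  also have "\<dots> = trace (snd X ** (snd Y ** e) ** fst Z ** e)" by (simp add: r(3) matrix_mul_assoc)
  also have "\<dots> = trace ((snd X ** e) ** fst Y ** fst Z ** e)" by (simp add: r(2) matrix_mul_assoc)
  also have "\<dots> = trace (e ** (fst X ** fst Y ** fst Z ** e))" by (simp add: r(1) matrix_mul_assoc)
  also have "\<dots> = trace (fst X ** fst Y ** fst Z ** (e ** e))"
    by (subst trace_mul_sym) (simp add: matrix_mul_assoc)
  also have "\<dots> = ?a * trace (fst X ** fst Y ** fst Z)"
    by (simp add: ee trace_scaleR)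
  finally show "vol03 X Y Z = vol30 X Y Z" using e(2) by (simp add: vol03_def vol30_def vol_eq_trace s)
  have "?a * vol21 X Y Z = vol (fst X) (fst Y) (?a *\<^sub>R snd Z) + vol (fst X) (?a *\<^sub>R snd Y) (fst Z)
      + vol (?a *\<^sub>R snd X) (fst Y) (fst Z)"
    by (simp add: vol21_def vol_simps algebra_simps)
  also have "\<dots> = 2 * (mat2_inner (fst X) e * vol e (fst Y) (fst Z) + mat2_inner (fst Y) e * vol (fst X) e (fst Z)
      + mat2_inner (fst Z) e * vol (fst X) (fst Y) e) - 3 * (?a * vol (fst X) (fst Y) (fst Z))"
    by (simp add: reflection_eq[OF e(1) s(1) r(1)] reflection_eq[OF e(1) s(2) r(2)] reflection_eq[OF e(1) s(3) r(3)]
        vol_simps algebra_simps)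
  also have "\<dots> = ?a * (- vol30 X Y Z)" unfolding cramer_sl2[OF e(1) s(1-3)] by (simp add: vol30_def)
  finally show "vol21 X Y Z = - vol30 X Y Z" using e(2) by (metis mult_left_cancel)
qed

definition factor_type :: "nat \<Rightarrow> (mat2 \<times> mat2) set \<Rightarrow> bool" where
  "factor_type j L \<longleftrightarrow> (\<forall>X\<in>L. fst ((rot1 ^^ j) X) = 0)"

definition axis_type :: "nat \<Rightarrow> mat2 \<Rightarrow> (mat2 \<times> mat2) set \<Rightarrow> bool" where
  "axis_type j e L \<longleftrightarrow> e \<in> sl2 \<and> mat2_inner e e \<noteq> 0 \<and>
     (\<forall>X\<in>L. snd ((rot1 ^^ j) X) ** e = e ** fst ((rot1 ^^ j) X))"

text \<open>The arguments \<open>p\<close>, \<open>m\<close>, \<open>q\<close> stand for values of \<open>vol30\<close>, \<open>vol21\<close> and \<open>vol03\<close> on three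
  elements of \<open>L\<close>; on \<open>L\<close>, \<open>vol12\<close> agrees with \<open>vol21\<close>. The argument \<open>t\<close> tells the axis
  type from the factor type. Each of the six conditions defines a line in the space of all triples \<open>(p, m, q)\<close>, and these
  lines are pairwise different, so that one triple other than zero determines the type.\<close>

definition cubic_rel :: "nat \<Rightarrow> bool \<Rightarrow> real \<Rightarrow> real \<Rightarrow> real \<Rightarrow> bool" where
  "cubic_rel j t p m q \<longleftrightarrow>
    (if t then (if j = 0 then p = q \<and> m = - p else if j = 1 then p = 0 \<and> m = 4 * q else q = 0 \<and> m = 4 * p)
     else (if j = 0 then p = 0 \<and> m = 0 else if j = 1 then q = 0 \<and> m = 0 else p = q \<and> m = 3 * p))"

lemma cubic_rel_unique:
  assumes "cubic_rel j t p m q" "cubic_rel j' t' p m q" "j < 3" "j' < 3" "p \<noteq> 0 \<or> m \<noteq> 0 \<or> q \<noteq> 0"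
  shows "j = j' \<and> t = t'"
proof -
  have j: "j = 0 \<or> j = 1 \<or> j = 2" "j' = 0 \<or> j' = 1 \<or> j' = 2" using assms(3,4) by auto
  show ?thesis using j assms(1,2,5) unfolding cubic_rel_def by (smt (verit))
qed

lemma cubic_rel_factor:
  assumes "factor_type j L" "j < 3" "X \<in> L" "Y \<in> L" "Z \<in> L"
  shows "cubic_rel j False (vol30 X Y Z) (vol21 X Y Z) (vol03 X Y Z)"
proof -
  have "j \<in> {0, 1, 2}" using assms(2) by auto
  then show ?thesis
    using assms(1,3-5) unfolding factor_type_def cubic_rel_def
    by (elim insertE emptyE)
      (simp_all add: rot1_def numeral_2_eq_2 vol30_def vol03_def vol21_def vol_simps)
qed

lemma cubic_rel_axis:
  assumes "axis_type j e L" "j < 3" "X \<in> L" "Y \<in> L" "Z \<in> L" "L \<subseteq> sl2sq"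
  shows "cubic_rel j True (vol30 X Y Z) (vol21 X Y Z) (vol03 X Y Z)"
proof -
  define X' Y' Z' where X': "X' = (rot1 ^^ j) X" and Y': "Y' = (rot1 ^^ j) Y" and Z': "Z' = (rot1 ^^ j) Z"
  have e: "e \<in> sl2" "mat2_inner e e \<noteq> 0" using assms(1) by (auto simp: axis_type_def)
  have sl: "X' \<in> sl2sq" "Y' \<in> sl2sq" "Z' \<in> sl2sq" using assms(3-6) by (auto simp: X' Y' Z' intro!: rot_in)
  have r: "snd X' ** e = e ** fst X'" "snd Y' ** e = e ** fst Y'" "snd Z' ** e = e ** fst Z'"
    using assms(1,3-5) by (auto simp: axis_type_def X' Y' Z')
  note v = vol_reflection[OF e sl r]
  \<comment> \<open>The relation is symmetric in the two factors, which gives the value of the mixed volume as well.\<close>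
  have sw: "snd W ** e = e ** fst W \<Longrightarrow> fst W ** e = e ** snd W" if "W \<in> sl2sq" for W
  proof -
    assume a: "snd W ** e = e ** fst W"
    have ee: "e ** e = mat2_inner e e *\<^sub>R mat 1"
      by (rule sl2_exhaust[OF e(1)]) (simp add: one_mat2 algebra_simps)
    have "e ** (snd W ** e) ** e = e ** (e ** fst W) ** e" by (simp add: a)
    moreover have "e ** (snd W ** e) ** e = mat2_inner e e *\<^sub>R (e ** snd W)"
      by (simp add: matrix_mul_assoc[symmetric] ee mm.scaleR_right)
    moreover have "e ** (e ** fst W) ** e = mat2_inner e e *\<^sub>R (fst W ** e)"
      unfolding matrix_mul_assoc by (simp add: ee mm.scaleR_left flip: matrix_mul_assoc)
    ultimately show ?thesis using e(2) by simp
  qed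
  have "vol21 (snd X', fst X') (snd Y', fst Y') (snd Z', fst Z') =
      - vol30 (snd X', fst X') (snd Y', fst Y') (snd Z', fst Z')"
  proof (rule vol_reflection(2)[OF e])
    show "(snd X', fst X') \<in> sl2sq" "(snd Y', fst Y') \<in> sl2sq" "(snd Z', fst Z') \<in> sl2sq"
      using sl by (simp_all only: mem_Times_iff fst_conv snd_conv)
  qed (simp_all only: fst_conv snd_conv sw[OF sl(1) r(1)] sw[OF sl(2) r(2)] sw[OF sl(3) r(3)])
  then have v12: "vol12 X' Y' Z' = - vol03 X' Y' Z'"
    by (simp add: vol21_def vol12_def vol30_def vol03_def)
  have "j \<in> {0, 1, 2}" using assms(2) by auto
  moreover have ?thesis if "j = 0" using v that by (simp add: cubic_rel_def X' Y' Z')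
  moreover have ?thesis if "j = 1"
    using v v12 that vol_rot1[of X Y Z] by (simp add: cubic_rel_def X' Y' Z')
  moreover have ?thesis if "j = 2"
    using v v12 that vol_rot1[of X Y Z] vol_rot1[of "rot1 X" "rot1 Y" "rot1 Z"] unfolding X' Y' Z' rot_2
    by (simp add: cubic_rel_def rot_2)
  ultimately show ?thesis by blast
qed

lemma cubic_vanish_rot:
  assumes "vol30 X Y Z = 0" "vol21 X Y Z = 0" "vol12 X Y Z = 0" "vol03 X Y Z = 0"
  shows "vol30 ((rot1 ^^ j) X) ((rot1 ^^ j) Y) ((rot1 ^^ j) Z) = 0 \<and> vol21 ((rot1 ^^ j) X) ((rot1 ^^ j) Y) ((rot1 ^^ j) Z) = 0
    \<and> vol12 ((rot1 ^^ j) X) ((rot1 ^^ j) Y) ((rot1 ^^ j) Z) = 0 \<and> vol03 ((rot1 ^^ j) X) ((rot1 ^^ j) Y) ((rot1 ^^ j) Z) = 0"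
  using assms by (induction j) (simp_all add: vol_rot1)

context invariant_lagrangian begin

text \<open>Maximality of \<open>L\<close> transported by a power of \<open>rot1\<close>, which preserves \<open>om\<close>. It shows that a
  type determines the whole subspace, not only an upper bound for it.\<close>

lemma ex_rot_eq:
  assumes "Y \<in> sl2sq" "\<And>X. X \<in> L \<Longrightarrow> om Y ((rot1 ^^ j) X) = 0" "j < 3"
  shows "\<exists>X\<in>L. (rot1 ^^ j) X = Y"
proof
  let ?X = "(rot1 ^^ (3 - j)) Y"
  have "(rot1 ^^ j) ?X = (rot1 ^^ (j + (3 - j))) Y" by (simp only: funpow_add o_apply)
  also have "j + (3 - j) = 3" using assms(3) by simp
  finally show Y: "(rot1 ^^ j) ?X = Y" by (simp only: rot1_3)
  show "?X \<in> L"
  proof (rule maximal)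
    show "?X \<in> sl2sq" using assms(1) by (rule rot_in)
    fix X assume "X \<in> L"
    then show "om ?X X = 0" using assms(2) om_rot[of j ?X X] Y by simp
  qed
qed

lemma factor_type_surj:
  assumes "factor_type j L" "j < 3" "z \<in> sl2"
  shows "\<exists>X\<in>L. (rot1 ^^ j) X = (0, z)"
  using assms by (intro ex_rot_eq) (auto simp: factor_type_def om_def ip_simps)

lemma axis_type_surj:
  assumes "axis_type j e L" "j < 3" "a \<in> sl2"
  shows "\<exists>X\<in>L. (rot1 ^^ j) X = (mat2_inner e e *\<^sub>R a, e ** a ** e)"
proof (rule ex_rot_eq[OF _ _ assms(2)])
  have e: "e \<in> sl2" "mat2_inner e e \<noteq> 0" using assms(1) by (auto simp: axis_type_def)
  have "e ** a ** e \<in> sl2"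
    by (rule sl2_exhaust[OF e(1)], rule sl2_exhaust[OF assms(3)]) (simp add: algebra_simps)
  then show "(mat2_inner e e *\<^sub>R a, e ** a ** e) \<in> sl2sq" using assms(3) by simp
  fix X assume X: "X \<in> L"
  define W where "W = (rot1 ^^ j) X"
  have W: "snd W ** e = e ** fst W" using assms(1) X by (auto simp: axis_type_def W_def)
  have "W \<in> sl2sq" using X L_sl2 by (auto simp: W_def intro!: rot_in)
  then have Wsl: "fst W \<in> sl2" by (auto simp: mem_Times_iff)
  have "mat2_inner a (mat2_inner e e *\<^sub>R snd W) = mat2_inner (e ** a ** e) (fst W)"
    unfolding reflection_eq[OF e(1) Wsl W]
    by (rule sl2_exhaust[OF e(1)], rule sl2_exhaust[OF assms(3)], rule sl2_exhaust[OF Wsl])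
      (simp add: field_simps)
  then show "om (mat2_inner e e *\<^sub>R a, e ** a ** e) ((rot1 ^^ j) X) = 0"
    unfolding W_def[symmetric] by (simp add: om_def ip_simps)
qed

lemma ex_cubic_nonzero:
  assumes "j < 3" "factor_type j L \<or> axis_type j e L"
  shows "\<exists>X\<in>L. \<exists>Y\<in>L. \<exists>Z\<in>L. vol30 X Y Z \<noteq> 0 \<or> vol21 X Y Z \<noteq> 0 \<or> vol03 X Y Z \<noteq> 0"
proof (rule ccontr)
  assume neg: "\<not> ?thesis"
  have 0: "vol30 ((rot1 ^^ j) X) ((rot1 ^^ j) Y) ((rot1 ^^ j) Z) = 0"
     "vol03 ((rot1 ^^ j) X) ((rot1 ^^ j) Y) ((rot1 ^^ j) Z) = 0" if "X \<in> L" "Y \<in> L" "Z \<in> L" for X Y Z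
    using cubic_vanish_rot[of X Y Z j] neg special that by auto
  let ?H = "mat2 1 0 0 (-1)" and ?E = "mat2 0 1 0 0" and ?F = "mat2 0 0 1 0"
  from assms(2) show False
  proof
    assume f: "factor_type j L"
    obtain X Y Z where "X \<in> L" "Y \<in> L" "Z \<in> L" "(rot1 ^^ j) X = (0, ?H)" "(rot1 ^^ j) Y = (0, ?E)" "(rot1 ^^ j) Z = (0, ?F)"
      using factor_type_surj[OF f assms(1), of ?H] factor_type_surj[OF f assms(1), of ?E]
        factor_type_surj[OF f assms(1), of ?F] by auto
    then show False using 0(2)[of X Y Z] by (simp add: vol03_def vol_def)
  next
    assume f: "axis_type j e L"
    obtain X Y Z where "X \<in> L" "Y \<in> L" "Z \<in> L" "fst ((rot1 ^^ j) X) = mat2_inner e e *\<^sub>R ?H"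
      "fst ((rot1 ^^ j) Y) = mat2_inner e e *\<^sub>R ?E" "fst ((rot1 ^^ j) Z) = mat2_inner e e *\<^sub>R ?F"
      using axis_type_surj[OF f assms(1), of ?H] axis_type_surj[OF f assms(1), of ?E]
        axis_type_surj[OF f assms(1), of ?F] by (metis fst_conv mat2_mem_sl2 add.right_inverse add_0)
    then show False using 0(1)[of X Y Z] f by (simp add: vol30_def vol_def axis_type_def)
  qed
qed

text \<open>The rotated subspace contains the pair \<open>(e, e)\<close> up to a factor, and for a second axis \<open>e'\<close> the
  relation on this pair says that \<open>e\<close> and \<open>e'\<close> commute.\<close>

lemma axis_unique:
  assumes "axis_type j e L" "axis_type j e' L" "j < 3"
  shows "\<exists>r. e' = r *\<^sub>R e"
proof -
  have e: "e \<in> sl2" "mat2_inner e e \<noteq> 0" "e' \<in> sl2" using assms(1,2) by (auto simp: axis_type_def)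
  obtain X where X: "X \<in> L" "(rot1 ^^ j) X = (mat2_inner e e *\<^sub>R e, e ** e ** e)"
    using axis_type_surj[OF assms(1,3) e(1)] by blast
  have "e ** e = mat2_inner e e *\<^sub>R mat 1"
    by (rule sl2_exhaust[OF e(1)]) (simp add: one_mat2 algebra_simps)
  then have "(rot1 ^^ j) X = (mat2_inner e e *\<^sub>R e, mat2_inner e e *\<^sub>R e)" using X(2) by simp
  then have "mat2_inner e e *\<^sub>R (e ** e') = mat2_inner e e *\<^sub>R (e' ** e)"
    using assms(2) X(1) by (auto simp: axis_type_def mm.scaleR_left mm.scaleR_right)
  then have "br e e' = 0" using e(2) by (simp add: br_def)
  moreover have "e \<noteq> 0" using e(2) by (auto simp: ip_simps)
  ultimately show ?thesis using br_eq_0_imp_parallel e by blast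
qed

lemma factor_or_axis_type: "\<exists>j<3. factor_type j L \<or> (\<exists>e. axis_type j e L)"
  using classification unfolding factor_type_def axis_type_def by blast

end


section \<open>Derivatives along subsets\<close>

text \<open>On an arbitrary subset \<open>S\<close> a derivative within \<open>S\<close> need not be unique. It is unique on velocities
  of curves in \<open>S\<close>, and these are preserved by smooth maps.\<close>

definition tangent_dir :: "'a::real_normed_vector set \<Rightarrow> 'a \<Rightarrow> 'a \<Rightarrow> bool" where
  "tangent_dir S p v \<longleftrightarrow>
     (\<exists>c. c 0 = p \<and> (c has_vector_derivative v) (at (0::real)) \<and> (\<forall>\<^sub>F t in nhds 0. c t \<in> S))"

lemma tangent_dir_curve:
  assumes "tangent_dir S p v"
  obtains c W where "open W" "0 \<in> W" "c 0 = p" "(c has_vector_derivative v) (at (0::real))" "c ` W \<subseteq> S"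
proof -
  obtain c where c: "c 0 = p" "(c has_vector_derivative v) (at (0::real))" "\<forall>\<^sub>F t in nhds 0. c t \<in> S"
    using assms unfolding tangent_dir_def by blast
  then obtain W where "open W" "0 \<in> W" "\<forall>t\<in>W. c t \<in> S" unfolding eventually_nhds by blast
  then show thesis using that c by blast
qed

text \<open>Along a curve in \<open>S\<close> any derivative within \<open>S\<close> obeys the chain rule.\<close>

lemma tangent_dir_compose:
  assumes "tangent_dir S p v" "(f has_derivative D) (at p within S)"
  shows "\<exists>c W. open W \<and> 0 \<in> W \<and> c 0 = p \<and> c ` W \<subseteq> S \<and> (c has_vector_derivative v) (at 0) \<and>
    ((\<lambda>t. f (c t)) has_vector_derivative D v) (at (0::real))"
proof -
  obtain c W where c: "open W" "0 \<in> W" "c 0 = p" "(c has_vector_derivative v) (at (0::real))" "c ` W \<subseteq> S"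
    using tangent_dir_curve[OF assms(1)] by metis
  have at: "at 0 within W = at (0::real)" by (rule at_within_open[OF c(2,1)])
  have "(f has_derivative D) (at (c 0) within c ` W)"
    unfolding c(3) by (rule has_derivative_subset[OF assms(2) c(5)])
  moreover have "(c has_derivative (\<lambda>t. t *\<^sub>R v)) (at 0 within W)"
    using c(4) unfolding at has_vector_derivative_def .
  ultimately have "((\<lambda>t. f (c t)) has_derivative (\<lambda>t. D (t *\<^sub>R v))) (at 0 within W)"
    by (rule has_derivative_in_compose[rotated])
  then have "((\<lambda>t. f (c t)) has_vector_derivative D v) (at 0)"
    unfolding at has_vector_derivative_def linear_scale[OF has_derivative_linear[OF assms(2)]] .
  then show ?thesis using c by blast
qed

lemma tangent_dir_unique:
  assumes "tangent_dir S p v" "(f has_derivative D1) (at p within S)" "(f has_derivative D2) (at p within S)"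
  shows "D1 v = D2 v"
proof -
  have z: "((\<lambda>x. f x - f x) has_derivative (\<lambda>v. D1 v - D2 v)) (at p within S)"
    by (rule has_derivative_diff[OF assms(2,3)])
  obtain c where "((\<lambda>t. f (c t) - f (c t)) has_vector_derivative D1 v - D2 v) (at (0::real))"
    using tangent_dir_compose[OF assms(1) z] by blast
  then have "((\<lambda>t. 0) has_vector_derivative D1 v - D2 v) (at (0::real))" by simp
  then have "D1 v - D2 v = 0" using vector_derivative_unique_at has_vector_derivative_const by blast
  then show ?thesis by simp
qed

lemma differential_eq:
  assumes "tangent_dir S p v" "(f has_derivative D) (at p within S)"
  shows "differential S f p v = D v"
  using tangent_dir_unique[OF assms(1) _ assms(2)] frechet_derivative_works differentiableI assms(2) by blast

lemma differential_cong:
  assumes "tangent_dir S p v" "p \<in> S" "smooth_on S f" "\<And>x. x \<in> S \<Longrightarrow> f x = g x"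
  shows "differential S f p v = differential S g p v"
proof -
  have "(f has_derivative differential S f p) (at p within S)" by (rule smooth_on_has_derivative[OF assms(3,2)])
  then have "(g has_derivative differential S f p) (at p within S)"
    by (rule has_derivative_transform[OF assms(2), rotated]) (simp add: assms(4))
  then show ?thesis using differential_eq[OF assms(1)] by metis
qed

lemma tangent_dir_image:
  assumes "tangent_dir S p v" "(f has_derivative D) (at p within S)" "f ` S \<subseteq> T"
  shows "tangent_dir T (f p) (D v)"
proof -
  obtain c W where c: "open W" "0 \<in> W" "c 0 = p" "c ` W \<subseteq> S"
    "((\<lambda>t. f (c t)) has_vector_derivative D v) (at (0::real))"
    using tangent_dir_compose[OF assms(1,2)] by blast
  then have "\<forall>\<^sub>F t in nhds 0. f (c t) \<in> T" unfolding eventually_nhds using assms(3) by blast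
  then show ?thesis unfolding tangent_dir_def using c by (intro exI[of _ "\<lambda>t. f (c t)"]) auto
qed

lemma tangent_dir_openin:
  assumes "tangent_dir S p v" "openin (top_of_set S) U" "p \<in> U"
  shows "tangent_dir U p v"
proof -
  obtain c where c: "c 0 = p" "(c has_vector_derivative v) (at (0::real))" "\<forall>\<^sub>F t in nhds 0. c t \<in> S"
    using assms(1) unfolding tangent_dir_def by blast
  obtain T where T: "open T" "U = S \<inter> T" using assms(2) openin_open by metis
  have "isCont c 0" using has_vector_derivative_continuous[OF c(2)] .
  then have "(c \<longlongrightarrow> c 0) (nhds 0)" unfolding isCont_def tendsto_at_iff_tendsto_nhds .
  then have "\<forall>\<^sub>F t in nhds 0. c t \<in> T" using T assms(3) c(1) by (intro topological_tendstoD) auto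
  then have "\<forall>\<^sub>F t in nhds 0. c t \<in> U" using c(3) unfolding T(2) by (auto elim: eventually_elim2)
  then show ?thesis unfolding tangent_dir_def using c by blast
qed

lemma tangent_dir_UNIV: "tangent_dir UNIV p v"
  unfolding tangent_dir_def
  by (intro exI[of _ "\<lambda>t. p + t *\<^sub>R v"] conjI) (auto intro!: derivative_eq_intros simp: has_vector_derivative_def)

lemma tangent_dir_open: "open V \<Longrightarrow> x \<in> V \<Longrightarrow> tangent_dir V x v"
  using tangent_dir_openin[OF tangent_dir_UNIV, of V x v] by simp

lemma linear_differential: "smooth_on S f \<Longrightarrow> p \<in> S \<Longrightarrow> linear (differential S f p)"
  by (intro linear_frechet_derivative smooth_on_imp_differentiable)

lemma smooth_on_differential_field:
  fixes s :: "'a::euclidean_space \<Rightarrow> 'b::real_normed_vector"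
  assumes "smooth_on S s" "smooth_on S X" "\<And>p. p \<in> S \<Longrightarrow> tangent_dir S p (X p)"
  shows "smooth_on S (\<lambda>p. differential S s p (X p))"
proof (rule smooth_onI)
  fix p assume p: "p \<in> S"
  obtain U h where 1: "open U" "p \<in> U" "smooth_on U h" "\<And>x. x \<in> S \<Longrightarrow> x \<in> U \<Longrightarrow> s x = h x"
    using smooth_on_extension[OF assms(1) p] by metis
  obtain W k where 2: "open W" "p \<in> W" "smooth_on W k" "\<And>x. x \<in> S \<Longrightarrow> x \<in> W \<Longrightarrow> X x = k x"
    using smooth_on_extension[OF assms(2) p] by metis
  have o: "open (U \<inter> W)" using 1 2 by blast
  have "smooth_on (U \<inter> W) (\<lambda>x. frechet_derivative h (at x) (k x))"
    by (intro smooth_on_derivative_field[OF o] smooth_on_subset[OF 1(3)] smooth_on_subset[OF 2(3)]) auto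
  moreover have "differential S s x (X x) = frechet_derivative h (at x) (k x)" if x: "x \<in> S \<inter> (U \<inter> W)" for x
  proof -
    have "openin (top_of_set S) (S \<inter> U)" using 1(1) by (simp add: openin_open_Int)
    then have t: "tangent_dir (S \<inter> U) x (X x)" using tangent_dir_openin[OF assms(3)] x by blast
    have "(h has_derivative frechet_derivative h (at x)) (at x within S \<inter> U)"
      using smooth_on_has_derivative[OF 1(3), of x] x at_within_open[of x U] 1(1)
      by (metis IntD1 IntD2 has_derivative_at_withinI)
    then have "(s has_derivative frechet_derivative h (at x)) (at x within S \<inter> U)"
      by (rule has_derivative_transform[rotated 2]) (use x 1(4) in auto)
    moreover have "(s has_derivative differential S s x) (at x within S \<inter> U)"
      using smooth_on_has_derivative[OF assms(1)] x has_derivative_subset by blast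
    ultimately show ?thesis using tangent_dir_unique[OF t] 2(4) x by auto
  qed
  ultimately show "\<exists>U h. open U \<and> p \<in> U \<and> smooth_on U h \<and> (\<forall>x\<in>S \<inter> U. differential S s x (X x) = h x)"
    using o 1(2) 2(2) by (intro exI[of _ "U \<inter> W"] exI[of _ "\<lambda>x. frechet_derivative h (at x) (k x)"]) simp
qed

lemma smooth_on_fst: "smooth_on S f \<Longrightarrow> smooth_on S (\<lambda>x. fst (f x))"
  and smooth_on_snd: "smooth_on S f \<Longrightarrow> smooth_on S (\<lambda>x. snd (f x))"
  by (rule smooth_on_bounded_linear_compose[OF bounded_linear_fst] smooth_on_bounded_linear_compose[OF bounded_linear_snd], assumption)+

lemma smooth_on_Pair:
  fixes f :: "'a::real_normed_vector \<Rightarrow> 'c::real_normed_vector" and g :: "'a \<Rightarrow> 'd::real_normed_vector"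
  assumes "smooth_on S f" "smooth_on S g" shows "smooth_on S (\<lambda>x. (f x, g x))"
proof -
  have "bounded_linear (\<lambda>a. (a, 0 :: 'd::real_normed_vector))" "bounded_linear (\<lambda>b. (0 :: 'c::real_normed_vector, b))"
    by (intro bounded_linear_Pair bounded_linear_ident bounded_linear_zero)+
  note smooth_on_add[OF smooth_on_bounded_linear_compose[OF this(1) assms(1)]
      smooth_on_bounded_linear_compose[OF this(2) assms(2)]]
  then show ?thesis by simp
qed

lemma smooth_on_id: "smooth_on S (\<lambda>x. x)"
  by (rule smooth_on_linear[OF bounded_linear_ident])

lemma smooth_on_diff: "smooth_on S f \<Longrightarrow> smooth_on S g \<Longrightarrow> smooth_on S (\<lambda>x. f x - g x)"
  using smooth_on_add[of S f "\<lambda>x. - g x"] smooth_on_bounded_linear_compose[OF bounded_linear_minus[OF bounded_linear_ident], of S g]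
  by simp

lemma smooth_on_scaleR_const: "smooth_on S f \<Longrightarrow> smooth_on S (\<lambda>x. r *\<^sub>R f x)"
  by (rule smooth_on_bilinear[OF bounded_bilinear_scaleR smooth_on_const])

lemmas smooth_on_mm = smooth_on_bilinear[OF bounded_bilinear_matrix_mult]
lemmas smooth_on_br = smooth_on_bilinear[OF bounded_bilinear_br]
lemmas smooth_on_adj2 = smooth_on_bounded_linear_compose[OF bounded_linear_adj2]
lemmas smooth_intros = smooth_on_const smooth_on_id smooth_on_add smooth_on_diff smooth_on_scaleR_const
  smooth_on_fst smooth_on_snd smooth_on_Pair smooth_on_mm smooth_on_br smooth_on_adj2

section \<open>The tangent bundle in the left trivialization\<close>

text \<open>The curve \<open>a (1 + t \<alpha>)\<close> has the right velocity and leaves \<open>SL2\<close> only to second order. Dividing it by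
  the square root of its determinant corrects this.\<close>

lemma tangent_dir_SL2:
  assumes "a \<in> SL2" "\<alpha> \<in> sl2" shows "tangent_dir SL2 a (a ** \<alpha>)"
  unfolding tangent_dir_def
proof (intro exI conjI)
  let ?c = "\<lambda>t::real. inverse (sqrt (1 + t\<^sup>2 * det \<alpha>)) *\<^sub>R (a + t *\<^sub>R (a ** \<alpha>))"
  show "?c 0 = a" by simp
  show "(?c has_vector_derivative a ** \<alpha>) (at 0)"
    by (auto intro!: derivative_eq_intros simp: has_vector_derivative_def)
  have "\<forall>\<^sub>F t in nhds 0. 1 + t\<^sup>2 * det \<alpha> \<in> {0<..}"
  proof -
    have "((\<lambda>t::real. 1 + t\<^sup>2 * det \<alpha>) \<longlongrightarrow> 1 + 0\<^sup>2 * det \<alpha>) (nhds 0)"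
      by (intro tendsto_intros filterlim_ident)
    then show ?thesis by (rule topological_tendstoD) auto
  qed
  then show "\<forall>\<^sub>F t in nhds 0. ?c t \<in> SL2"
  proof (rule eventually_mono)
    fix t :: real assume pos: "1 + t\<^sup>2 * det \<alpha> \<in> {0<..}"
    have "a + t *\<^sub>R (a ** \<alpha>) = a ** (mat 1 + t *\<^sub>R \<alpha>)" by (simp add: mm.add_right mm.scaleR_right)
    moreover have "det (mat 1 + t *\<^sub>R \<alpha>) = 1 + t\<^sup>2 * det \<alpha>"
      by (rule sl2_exhaust[OF assms(2)]) (simp add: one_mat2 power2_eq_square algebra_simps)
    moreover have "det a = 1" using assms(1) by (simp add: SL2_def)
    moreover have "det (r *\<^sub>R A) = r\<^sup>2 * det A" for r and A :: mat2
      by (cases A rule: mat2_exhaust) (simp add: power2_eq_square algebra_simps)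
    ultimately show "?c t \<in> SL2" using pos by (simp add: SL2_def det_mul power_inverse)
  qed
qed

text \<open>Differentiate \<open>\<langle>c, c\<rangle> = - 1\<close> along a curve \<open>c\<close> in \<open>SL2\<close>.\<close>

lemma tangent_dir_SL2_D:
  assumes "tangent_dir SL2 a v" "a \<in> SL2" shows "adj2 a ** v \<in> sl2"
proof -
  obtain c W where c: "open W" "0 \<in> W" "c 0 = a" "(c has_vector_derivative v) (at (0::real))" "c ` W \<subseteq> SL2"
    using tangent_dir_curve[OF assms(1)] by metis
  have cd: "(c has_derivative (\<lambda>t. t *\<^sub>R v)) (at 0)" using c(4) by (simp add: has_vector_derivative_def)
  have "((\<lambda>t. mat2_inner (c t) (c t)) has_derivative (\<lambda>t. mat2_inner (c 0) (t *\<^sub>R v) + mat2_inner (t *\<^sub>R v) (c 0))) (at 0)"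
    by (rule ip.FDERIV[OF cd cd])
  moreover have "((\<lambda>t. mat2_inner (c t) (c t)) has_derivative (\<lambda>t. 0)) (at 0)"
  proof (rule has_derivative_transform_within_open[OF has_derivative_const[of "- 1"] c(1,2)])
    fix t assume "t \<in> W"
    then have "det (c t) = 1" using c(5) by (auto simp: SL2_def)
    then show "- 1 = mat2_inner (c t) (c t)" by (simp add: det_eq_mat2_inner)
  qed
  ultimately have "(\<lambda>t. mat2_inner (c 0) (t *\<^sub>R v) + mat2_inner (t *\<^sub>R v) (c 0)) = (\<lambda>t. 0)"
    by (rule has_derivative_unique)
  from fun_cong[OF this, of 1] have "mat2_inner a v = 0" using c(3) by (simp add: mat2_inner_commute[of v a])
  moreover have "trace (adj2 a ** v) = - 2 * mat2_inner a v" by (simp add: mat2_inner_def)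
  ultimately show ?thesis by (simp add: sl2_def)
qed

text \<open>Left translation of a tangent vector to the identity, and back. On \<open>SL2\<close> the adjugate is the
  inverse, which makes \<open>lt\<close> bilinear.\<close>

definition lt :: "mat2 \<times> mat2 \<Rightarrow> mat2 \<times> mat2 \<Rightarrow> mat2 \<times> mat2" where
  "lt p v = (adj2 (fst p) ** fst v, adj2 (snd p) ** snd v)"

definition lift :: "mat2 \<times> mat2 \<Rightarrow> mat2 \<times> mat2 \<Rightarrow> mat2 \<times> mat2" where
  "lift p X = (fst p ** fst X, snd p ** snd X)"

lemma SL2xSL2_D: "p \<in> SL2xSL2 \<Longrightarrow> fst p \<in> SL2" "p \<in> SL2xSL2 \<Longrightarrow> snd p \<in> SL2"
  by (auto simp: SL2xSL2_def)

lemma lt_lift [simp]: "p \<in> SL2xSL2 \<Longrightarrow> lt p (lift p X) = X"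
  and lift_lt [simp]: "p \<in> SL2xSL2 \<Longrightarrow> lift p (lt p v) = v"
  using SL2xSL2_D[of p] by (simp_all add: lt_def lift_def SL2_cancel)

lemma bounded_bilinear_lift: "bounded_bilinear lift"
  unfolding bilinear_conv_bounded_bilinear[symmetric] bilinear_def lift_def
  by (intro conjI allI linearI) (simp_all add: mm.add_left mm.add_right mm.scaleR_left mm.scaleR_right)

lemma bounded_bilinear_lt: "bounded_bilinear lt"
  unfolding bilinear_conv_bounded_bilinear[symmetric] bilinear_def lt_def
  by (intro conjI allI linearI) (simp_all add: mm.add_left mm.add_right mm.scaleR_left mm.scaleR_right adj2_linear)

interpretation lift: bounded_bilinear lift by (rule bounded_bilinear_lift)
interpretation lt: bounded_bilinear lt by (rule bounded_bilinear_lt)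

lemma T_iff: assumes "p \<in> SL2xSL2" shows "v \<in> T_SL2xSL2 p \<longleftrightarrow> lt p v \<in> sl2sq"
proof
  assume "v \<in> T_SL2xSL2 p"
  then show "lt p v \<in> sl2sq" using SL2xSL2_D[OF assms]
    by (cases p) (auto simp: T_SL2xSL2_def lt_def SL2_cancel)
next
  assume "lt p v \<in> sl2sq"
  moreover have "v = lift p (lt p v)" using assms by simp
  ultimately show "v \<in> T_SL2xSL2 p" unfolding T_SL2xSL2_def lift_def
    by (cases p; cases "lt p v") auto
qed

lemma lift_in_T: "p \<in> SL2xSL2 \<Longrightarrow> X \<in> sl2sq \<Longrightarrow> lift p X \<in> T_SL2xSL2 p"
  by (simp add: T_iff)

lemma g_NK_eq: assumes "p \<in> SL2xSL2" shows "g_NK p v w = gq (lt p v) (lt p w)"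
  using SL2xSL2_D[OF assms]
  by (cases p; cases v; cases w) (simp add: g_NK_def gq_def lt_def matrix_inv_SL2 Let_def)

lemma J_NK_eq: assumes "p \<in> SL2xSL2" shows "J_NK p v = (1 / sqrt 3) *\<^sub>R lift p (J0 (lt p v))"
  using SL2xSL2_D[OF assms]
  by (cases p; cases v) (simp add: J_NK_def J0_def lt_def lift_def matrix_inv_SL2 Let_def)

lemma subspace_sl2sq: "subspace sl2sq"
  by (rule subspace_Times[OF subspace_sl2 subspace_sl2])

lemmas sl2sq_closed = subspace_0[OF subspace_sl2sq] subspace_add[OF subspace_sl2sq] subspace_diff[OF subspace_sl2sq]
  subspace_neg[OF subspace_sl2sq] subspace_scale[OF subspace_sl2sq] subspace_sum[OF subspace_sl2sq]

lemma tangent_dir_SL2xSL2: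
  assumes p: "p \<in> SL2xSL2" and v: "v \<in> T_SL2xSL2 p" shows "tangent_dir SL2xSL2 p v"
proof -
  obtain \<alpha> \<beta> where ab: "v = (fst p ** \<alpha>, snd p ** \<beta>)" "\<alpha> \<in> sl2" "\<beta> \<in> sl2"
    using v by (cases p) (auto simp: T_SL2xSL2_def)
  obtain c W where c: "open W" "0 \<in> W" "c 0 = fst p" "(c has_vector_derivative fst p ** \<alpha>) (at (0::real))" "c ` W \<subseteq> SL2"
    using tangent_dir_curve[OF tangent_dir_SL2[OF SL2xSL2_D(1)[OF p] ab(2)]] by metis
  obtain d U where d: "open U" "0 \<in> U" "d 0 = snd p" "(d has_vector_derivative snd p ** \<beta>) (at (0::real))" "d ` U \<subseteq> SL2"
    using tangent_dir_curve[OF tangent_dir_SL2[OF SL2xSL2_D(2)[OF p] ab(3)]] by metis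
  have "\<forall>\<^sub>F t in nhds 0. (c t, d t) \<in> SL2xSL2" unfolding eventually_nhds
    using c(1,2,5) d(1,2,5) by (intro exI[of _ "W \<inter> U"]) (auto simp: SL2xSL2_def)
  moreover have "((\<lambda>t. (c t, d t)) has_vector_derivative v) (at 0)"
    unfolding ab(1) by (rule has_vector_derivative_Pair[OF c(4) d(4)])
  ultimately show ?thesis unfolding tangent_dir_def using c(3) d(3)
    by (intro exI[of _ "\<lambda>t. (c t, d t)"]) simp
qed

lemma tangent_dir_SL2xSL2_D:
  assumes "p \<in> SL2xSL2" "tangent_dir SL2xSL2 p v" shows "v \<in> T_SL2xSL2 p"
proof -
  have "tangent_dir SL2 (fst p) (fst v)"
    by (rule tangent_dir_image[OF assms(2) bounded_linear_imp_has_derivative[OF bounded_linear_fst]])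
      (auto simp: SL2xSL2_def)
  moreover have "tangent_dir SL2 (snd p) (snd v)"
    by (rule tangent_dir_image[OF assms(2) bounded_linear_imp_has_derivative[OF bounded_linear_snd]])
      (auto simp: SL2xSL2_def)
  ultimately show ?thesis
    using tangent_dir_SL2_D SL2xSL2_D[OF assms(1)] T_iff[OF assms(1)] by (simp add: lt_def)
qed

lemma differential_in_T:
  assumes "smooth_on S f" "f ` S \<subseteq> SL2xSL2" "x \<in> S" "tangent_dir S x v"
  shows "differential S f x v \<in> T_SL2xSL2 (f x)"
  using assms tangent_dir_image[OF assms(4) smooth_on_has_derivative[OF assms(1,3)] assms(2)]
  by (intro tangent_dir_SL2xSL2_D) auto

section \<open>The Levi-Civita connection of the nearly Kaehler metric\<close>

text \<open>\<open>Bt X Y\<close> is the covariant derivative of the left-invariant field \<open>Y\<close> in the direction \<open>X\<close>, left-translated to the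
  identity. A field given by matrix entries is also differentiated through its base point; the
  product \<open>pair_mult\<close> in \<open>Gam\<close> corrects this, whence \<open>Gam\<close> plays the role of Christoffel symbols in the matrix
  space. With them, \<open>cov S f\<close> covers both the connection of the ambient group (for the identity map) and
  covariant derivatives along an immersion \<open>f\<close>.\<close>

definition kap :: "mat2 \<times> mat2 \<Rightarrow> mat2 \<times> mat2 \<Rightarrow> mat2" where
  "kap X Y = br (fst X) (snd Y) + br (fst Y) (snd X)"

definition Bt :: "mat2 \<times> mat2 \<Rightarrow> mat2 \<times> mat2 \<Rightarrow> mat2 \<times> mat2" where
  "Bt X Y = ((1 / 2) *\<^sub>R br (fst X) (fst Y) - (1 / 6) *\<^sub>R kap X Y, (1 / 2) *\<^sub>R br (snd X) (snd Y) + (1 / 6) *\<^sub>R kap X Y)"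

definition pair_mult :: "mat2 \<times> mat2 \<Rightarrow> mat2 \<times> mat2 \<Rightarrow> mat2 \<times> mat2" where
  "pair_mult X Y = (fst X ** fst Y, snd X ** snd Y)"

definition Gam :: "mat2 \<times> mat2 \<Rightarrow> mat2 \<times> mat2 \<Rightarrow> mat2 \<times> mat2 \<Rightarrow> mat2 \<times> mat2" where
  "Gam p v w = lift p (Bt (lt p v) (lt p w) - pair_mult (lt p v) (lt p w))"

definition cov :: "'a::real_normed_vector set \<Rightarrow> ('a \<Rightarrow> mat2 \<times> mat2) \<Rightarrow> 'a \<Rightarrow> 'a \<Rightarrow> ('a \<Rightarrow> mat2 \<times> mat2) \<Rightarrow> mat2 \<times> mat2" where
  "cov S f x v s = differential S s x v + Gam (f x) (differential S f x v) (s x)"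

lemma kap_simps:
  "kap (X + X') Y = kap X Y + kap X' Y" "kap X (Y + Y') = kap X Y + kap X Y'"
  "kap (r *\<^sub>R X) Y = r *\<^sub>R kap X Y" "kap X (r *\<^sub>R Y) = r *\<^sub>R kap X Y" "kap X Y = kap Y X"
  by (simp_all add: kap_def br_simps algebra_simps)

lemma bilinear_Bt: "bounded_bilinear Bt"
  unfolding bilinear_conv_bounded_bilinear[symmetric] bilinear_def Bt_def
  by (intro conjI allI linearI) (simp_all add: br_simps kap_simps(1-4) algebra_simps)

lemma bilinear_pair_mult: "bounded_bilinear pair_mult"
  unfolding bilinear_conv_bounded_bilinear[symmetric] bilinear_def pair_mult_def
  by (intro conjI allI linearI) (simp_all add: mm.add_left mm.add_right mm.scaleR_left mm.scaleR_right)

interpretation Bt: bounded_bilinear Bt by (rule bilinear_Bt)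
interpretation pair_mult: bounded_bilinear pair_mult by (rule bilinear_pair_mult)

lemma Bt_in: "Bt X Y \<in> sl2sq"
  by (simp add: Bt_def kap_def)

lemma bounded_bilinear_gq: "bounded_bilinear gq"
  unfolding bilinear_conv_bounded_bilinear[symmetric] bilinear_def gq_def
  by (intro conjI allI linearI) (simp_all add: ip_simps algebra_simps)

interpretation gq: bounded_bilinear gq by (rule bounded_bilinear_gq)

lemma gq_commute: "gq X Y = gq Y X"
  by (simp add: gq_def mat2_inner_commute algebra_simps)

lemma mat2_inner_br_swap: "mat2_inner x (br y z) = - mat2_inner (br y x) z"
  by (cases x rule: mat2_exhaust; cases y rule: mat2_exhaust; cases z rule: mat2_exhaust) (simp add: field_simps)

lemma mat2_inner_br_cycle: "mat2_inner x (br y z) = mat2_inner (br x y) z"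
  by (cases x rule: mat2_exhaust; cases y rule: mat2_exhaust; cases z rule: mat2_exhaust) (simp add: field_simps)

text \<open>Skew-symmetry of \<open>Bt X\<close> expresses that the connection is metric. That it is torsion-free
  is \<open>Gam_commute\<close>.\<close>

lemma gq_Bt: "gq (Bt X Y) Z + gq Y (Bt X Z) = 0"
proof -
  obtain a b c d e f where XYZ: "X = (a, b)" "Y = (c, d)" "Z = (e, f)" by (metis surj_pair)
  have r: "mat2_inner c (br e b) = - mat2_inner (br c b) e" "mat2_inner d (br e b) = mat2_inner (br b d) e"
    using mat2_inner_br_cycle[of c b e] mat2_inner_br_swap[of d b e] unfolding br_anti[of e b] ip.minus_right by simp_all
  show ?thesis
    unfolding XYZ
    by (simp add: gq_def Bt_def kap_def ip_simps r mat2_inner_br_cycle[of c b f] mat2_inner_br_swap[of c a]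
        mat2_inner_br_swap[of d a] mat2_inner_br_swap[of d b f] field_simps)
qed

lemma gq_nondegenerate:
  assumes "W \<in> sl2sq" "\<And>Z. Z \<in> sl2sq \<Longrightarrow> gq W Z = 0" shows "W = 0"
proof -
  have sl: "fst W \<in> sl2" "snd W \<in> sl2" using assms(1) by (auto simp: mem_Times_iff)
  have 1: "2 *\<^sub>R fst W - snd W = 0"
  proof (rule mat2_inner_nondeg)
    show "2 *\<^sub>R fst W - snd W \<in> sl2" using sl by (intro sl2_closed)
    fix k assume "k \<in> sl2"
    then have "gq W (k, 0) = 0" by (intro assms(2)) auto
    then show "mat2_inner k (2 *\<^sub>R fst W - snd W) = 0"
      by (simp add: gq_def ip_simps mat2_inner_commute[of k])
  qed
  have 2: "2 *\<^sub>R snd W - fst W = 0"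
  proof (rule mat2_inner_nondeg)
    show "2 *\<^sub>R snd W - fst W \<in> sl2" using sl by (intro sl2_closed)
    fix k assume "k \<in> sl2"
    then have "gq W (0, k) = 0" by (intro assms(2)) auto
    then show "mat2_inner k (2 *\<^sub>R snd W - fst W) = 0"
      by (simp add: gq_def ip_simps mat2_inner_commute[of k])
  qed
  have "snd W = 2 *\<^sub>R fst W" "fst W = 2 *\<^sub>R snd W" using 1 2 by simp_all
  then have "fst W = 4 *\<^sub>R fst W" by (metis mult_2_right numeral_Bit0 scaleR_scaleR one_add_one)
  then have "(4 - 1) *\<^sub>R fst W = 0" unfolding scaleR_diff_left by simp
  then have "fst W = 0" by simp
  then show ?thesis using \<open>snd W = 2 *\<^sub>R fst W\<close> by (simp add: prod_eq_iff)
qed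

lemma Gam_commute: "Gam p v w = Gam p w v"
proof -
  have "Bt X Y - pair_mult X Y = Bt Y X - pair_mult Y X" for X Y
    by (simp add: Bt_def pair_mult_def kap_simps(5)[of X Y] br_def prod_eq_iff vec_eq_iff field_simps)
  then show ?thesis by (simp add: Gam_def)
qed

lemma Gam_linear:
  "Gam p (v + v') w = Gam p v w + Gam p v' w" "Gam p (r *\<^sub>R v) w = r *\<^sub>R Gam p v w"
  "Gam p v (w + w') = Gam p v w + Gam p v w'" "Gam p v (r *\<^sub>R w) = r *\<^sub>R Gam p v w"
  by (simp_all add: Gam_def Bt.add_left Bt.add_right Bt.scaleR_left Bt.scaleR_right pair_mult.add_left
      pair_mult.add_right pair_mult.scaleR_left pair_mult.scaleR_right lt.add_right lt.scaleR_right
      lift.add_right lift.diff_right lift.scaleR_right algebra_simps)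

lemma smooth_on_Gam:
  assumes "smooth_on S f" "smooth_on S u" "smooth_on S w"
  shows "smooth_on S (\<lambda>x. Gam (f x) (u x) (w x))"
  unfolding Gam_def
  by (intro smooth_on_bilinear[OF bounded_bilinear_lift] smooth_on_diff smooth_on_bilinear[OF bilinear_Bt]
      smooth_on_bilinear[OF bilinear_pair_mult] smooth_on_bilinear[OF bounded_bilinear_lt] assms)

text \<open>Both for the identity of the ambient group and for an immersion of an open set, the connection
  \<open>cov S f\<close> has to be shown to be a metric connection. \<open>T\<close> gives the tangent spaces of the domain.\<close>

locale smooth_map_into =
  fixes S :: "'a::euclidean_space set" and T :: "'a \<Rightarrow> 'a set" and f :: "'a \<Rightarrow> mat2 \<times> mat2"
  assumes smooth_f: "smooth_on S f" and f_into: "f ` S \<subseteq> SL2xSL2"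
    and T_dir: "x \<in> S \<Longrightarrow> v \<in> T x \<Longrightarrow> tangent_dir S x v"
begin

abbreviation "\<E> \<equiv> sections S (\<lambda>x. T_SL2xSL2 (f x))"

lemma f_in: "x \<in> S \<Longrightarrow> f x \<in> SL2xSL2" using f_into by blast

lemma section_D: "s \<in> \<E> \<Longrightarrow> smooth_on S s" "s \<in> \<E> \<Longrightarrow> x \<in> S \<Longrightarrow> lt (f x) (s x) \<in> sl2sq"
  using T_iff[OF f_in] by (auto simp: sections_def)

lemma df_in: "x \<in> S \<Longrightarrow> v \<in> T x \<Longrightarrow> lt (f x) (differential S f x v) \<in> sl2sq"
  using differential_in_T[OF smooth_f f_into _ T_dir] T_iff[OF f_in] by blast

lemma smooth_lt: "smooth_on S s \<Longrightarrow> smooth_on S (\<lambda>x. lt (f x) (s x))"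
  by (rule smooth_on_bilinear[OF bounded_bilinear_lt smooth_f])

lemma differential_lt_in:
  assumes "s \<in> \<E>" "x \<in> S" "v \<in> T x"
  shows "differential S (\<lambda>x. lt (f x) (s x)) x v \<in> sl2sq"
proof -
  let ?Y = "\<lambda>x. lt (f x) (s x)"
  have d: "(?Y has_derivative differential S ?Y x) (at x within S)"
    by (rule smooth_on_has_derivative[OF smooth_lt[OF section_D(1)[OF assms(1)]] assms(2)])
  have "trace (pr (differential S ?Y x v)) = 0"
    if pr: "bounded_linear pr" and 0: "\<And>y. y \<in> S \<Longrightarrow> trace (pr (?Y y) :: mat2) = 0" for pr
  proof -
    have "((\<lambda>y. trace (pr (?Y y))) has_derivative (\<lambda>v. trace (pr (differential S ?Y x v)))) (at x within S)"
      by (rule bounded_linear.has_derivative[OF bounded_linear_trace bounded_linear.has_derivative[OF pr d]])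
    moreover have "((\<lambda>y. trace (pr (?Y y))) has_derivative (\<lambda>v. 0)) (at x within S)"
      by (rule has_derivative_transform[OF assms(2) _ has_derivative_const[of 0]]) (rule 0)
    ultimately show ?thesis using tangent_dir_unique[OF T_dir[OF assms(2,3)]] by blast
  qed
  from this[OF bounded_linear_fst] this[OF bounded_linear_snd] show ?thesis
    using section_D(2)[OF assms(1)] by (simp add: mem_Times_iff sl2_def)
qed

text \<open>In the left trivialization the correction by \<open>pair_mult\<close> cancels, and only \<open>Bt\<close> remains.\<close>

lemma cov_eq:
  assumes "s \<in> \<E>" "x \<in> S" "v \<in> T x"
  shows "cov S f x v s = lift (f x) (differential S (\<lambda>x. lt (f x) (s x)) x v
     + Bt (lt (f x) (differential S f x v)) (lt (f x) (s x)))"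
proof -
  let ?Y = "\<lambda>x. lt (f x) (s x)"
  have dY: "(?Y has_derivative differential S ?Y x) (at x within S)"
    by (rule smooth_on_has_derivative[OF smooth_lt[OF section_D(1)[OF assms(1)]] assms(2)])
  have df: "(f has_derivative differential S f x) (at x within S)"
    by (rule smooth_on_has_derivative[OF smooth_f assms(2)])
  have "((\<lambda>y. lift (f y) (?Y y)) has_derivative
      (\<lambda>v. lift (f x) (differential S ?Y x v) + lift (differential S f x v) (?Y x))) (at x within S)"
    by (rule lift.FDERIV[OF df dY])
  then have "(s has_derivative
      (\<lambda>v. lift (f x) (differential S ?Y x v) + lift (differential S f x v) (?Y x))) (at x within S)"
    by (rule has_derivative_transform[OF assms(2), rotated]) (simp add: f_in)
  then have ds: "differential S s x v = lift (f x) (differential S ?Y x v) + lift (differential S f x v) (?Y x)"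
    by (rule differential_eq[OF T_dir[OF assms(2,3)]])
  have "lift (differential S f x v) (?Y x) = lift (f x) (pair_mult (lt (f x) (differential S f x v)) (?Y x))"
    using SL2xSL2_D[OF f_in[OF assms(2)]]
    by (simp only: lift_def pair_mult_def lt_def fst_conv snd_conv matrix_mul_assoc[symmetric] SL2_cancel(2))
  then show ?thesis unfolding cov_def ds Gam_def by (simp add: lift.add_right lift.diff_right)
qed

lemma cov_connection:
  shows "is_connection S T (\<lambda>x. T_SL2xSL2 (f x)) (cov S f)"
  unfolding is_connection_def
proof (intro conjI ballI allI impI)
  fix X s assume X: "X \<in> sections S T" and s: "s \<in> \<E>"
  have Xs: "smooth_on S X" "\<And>x. x \<in> S \<Longrightarrow> X x \<in> T x" using X by (auto simp: sections_def)
  have "smooth_on S (\<lambda>p. cov S f p (X p) s)" unfolding cov_def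
    by (intro smooth_on_add smooth_on_Gam smooth_f smooth_on_differential_field Xs(1) T_dir Xs(2) section_D(1)[OF s])
  moreover have "cov S f x (X x) s \<in> T_SL2xSL2 (f x)" if x: "x \<in> S" for x
    unfolding cov_eq[OF s x Xs(2)[OF x]]
    by (intro lift_in_T f_in x sl2sq_closed Bt_in differential_lt_in[OF s x Xs(2)[OF x]])
  ultimately show "(\<lambda>p. cov S f p (X p) s) \<in> \<E>" by (simp add: sections_def)
next
  fix x v s assume x: "x \<in> S" and v: "v \<in> T x" and s: "s \<in> \<E>"
  note ls = linear_differential[OF section_D(1)[OF s] x] and lf = linear_differential[OF smooth_f x]
  note td = T_dir[OF x v] and ds = smooth_on_has_derivative[OF section_D(1)[OF s] x]
  show "cov S f x v s \<in> T_SL2xSL2 (f x)" unfolding cov_eq[OF s x v]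
    by (intro lift_in_T f_in x sl2sq_closed Bt_in differential_lt_in[OF s x v])
  show "cov S f x (c *\<^sub>R v + w) s = c *\<^sub>R cov S f x v s + cov S f x w s" for c w
    by (simp add: cov_def linear_add[OF ls] linear_scale[OF ls] linear_add[OF lf] linear_scale[OF lf]
        Gam_linear algebra_simps)
  show "cov S f x v (\<lambda>q. s q + t q) = cov S f x v s + cov S f x v t" if t: "t \<in> \<E>" for t
    using differential_eq[OF td has_derivative_add[OF ds smooth_on_has_derivative[OF section_D(1)[OF t] x]]]
    by (simp add: cov_def Gam_linear)
  show "cov S f x v (\<lambda>q. c q *\<^sub>R s q) = differential S c x v *\<^sub>R s x + c x *\<^sub>R cov S f x v s"
    if c: "smooth_on S c" for c :: "'a \<Rightarrow> real"
    using differential_eq[OF td has_derivative_scaleR[OF smooth_on_has_derivative[OF c x] ds]]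
    by (simp add: cov_def Gam_linear algebra_simps)
  show "cov S f x v s = cov S f x v t" if "t \<in> \<E>" "\<forall>q\<in>S. s q = t q" for t
    using differential_cong[OF td x section_D(1)[OF s]] that(2) x by (simp add: cov_def)
qed

lemma cov_metric:
  assumes Y: "Y \<in> \<E>" and Z: "Z \<in> \<E>" and x: "x \<in> S" and v: "v \<in> T x"
  shows "differential S (\<lambda>q. g_NK (f q) (Y q) (Z q)) x v =
    g_NK (f x) (cov S f x v Y) (Z x) + g_NK (f x) (Y x) (cov S f x v Z)"
proof -
  let ?Y = "\<lambda>x. lt (f x) (Y x)" and ?Z = "\<lambda>x. lt (f x) (Z x)"
  have dY: "(?Y has_derivative differential S ?Y x) (at x within S)"
    by (rule smooth_on_has_derivative[OF smooth_lt[OF section_D(1)[OF Y]] x])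
  have dZ: "(?Z has_derivative differential S ?Z x) (at x within S)"
    by (rule smooth_on_has_derivative[OF smooth_lt[OF section_D(1)[OF Z]] x])
  have "((\<lambda>q. g_NK (f q) (Y q) (Z q)) has_derivative
      (\<lambda>v. gq (?Y x) (differential S ?Z x v) + gq (differential S ?Y x v) (?Z x))) (at x within S)"
    by (rule has_derivative_transform[OF x _ gq.FDERIV[OF dY dZ]]) (simp add: g_NK_eq f_in)
  from differential_eq[OF T_dir[OF x v] this]
  show ?thesis
    using gq_Bt[of "lt (f x) (differential S f x v)" "?Y x" "?Z x"]
    by (simp add: g_NK_eq f_in x cov_eq[OF Y x v] cov_eq[OF Z x v] gq.add_left gq.add_right)
qed

end

interpretation N: smooth_map_into SL2xSL2 T_SL2xSL2 "\<lambda>p. p"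
  by unfold_locales (auto intro: smooth_on_id tangent_dir_SL2xSL2)

abbreviation covN :: "mat2 \<times> mat2 \<Rightarrow> mat2 \<times> mat2 \<Rightarrow> (mat2 \<times> mat2 \<Rightarrow> mat2 \<times> mat2) \<Rightarrow> mat2 \<times> mat2" where
  "covN \<equiv> cov SL2xSL2 (\<lambda>p. p)"

lemma differential_ident: "tangent_dir S p v \<Longrightarrow> differential S (\<lambda>p. p) p v = v"
  using differential_eq[OF _ has_derivative_ident] .

lemma covN_levi_civita: "is_levi_civita SL2xSL2 T_SL2xSL2 g_NK covN"
  unfolding is_levi_civita_def
proof (intro conjI ballI N.cov_connection N.cov_metric)
  fix X Y p assume "X \<in> sections SL2xSL2 T_SL2xSL2" "Y \<in> sections SL2xSL2 T_SL2xSL2" and p: "p \<in> SL2xSL2"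
  then have "tangent_dir SL2xSL2 p (X p)" "tangent_dir SL2xSL2 p (Y p)"
    by (auto simp: sections_def intro: tangent_dir_SL2xSL2)
  then show "covN p (X p) Y - covN p (Y p) X = lie_bracket SL2xSL2 X Y p"
    using Gam_commute[of p "X p" "Y p"] by (simp add: cov_def lie_bracket_def differential_ident)
qed

lemma cov_pullback:
  fixes V :: "'a::euclidean_space set"
  assumes "open V" "smooth_on V f" "f ` V \<subseteq> SL2xSL2"
  shows "is_pullback_connection V f SL2xSL2 T_SL2xSL2 covN (cov V f)"
proof -
  interpret smooth_map_into V "\<lambda>_. UNIV" f
    by unfold_locales (use assms in \<open>auto intro: tangent_dir_open\<close>)
  show ?thesis unfolding is_pullback_connection_def
  proof (intro conjI ballI allI cov_connection)
    fix Y x v assume Y: "Y \<in> sections SL2xSL2 T_SL2xSL2" and x: "x \<in> V"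
    have td: "tangent_dir V x v" by (rule tangent_dir_open[OF assms(1) x])
    have df: "(f has_derivative differential V f x) (at x within V)" by (rule smooth_on_has_derivative[OF assms(2) x])
    have sY: "smooth_on SL2xSL2 Y" using Y by (simp add: sections_def)
    have "(Y has_derivative differential SL2xSL2 Y (f x)) (at (f x) within f ` V)"
      using has_derivative_subset[OF smooth_on_has_derivative[OF sY] assms(3)] f_in[OF x] by blast
    from differential_eq[OF td has_derivative_in_compose[OF df this]]
    have "differential V (\<lambda>y. Y (f y)) x v = differential SL2xSL2 Y (f x) (differential V f x v)" .
    moreover have "tangent_dir SL2xSL2 (f x) (differential V f x v)"
      by (rule tangent_dir_image[OF td df assms(3)])
    ultimately show "cov V f x v (\<lambda>y. Y (f y)) = covN (f x) (differential V f x v) Y"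
      by (simp add: cov_def differential_ident)
  qed
qed

section \<open>Uniqueness of the connections\<close>

text \<open>Vector fields along \<open>f\<close> need not extend to the ambient space, so that a pullback connection is
  only known on restrictions of ambient fields. The left-invariant fields generate all fields along \<open>f\<close>,
  and on these every Levi-Civita connection agrees with \<open>covN\<close>.\<close>

definition left_inv :: "mat2 \<times> mat2 \<Rightarrow> mat2 \<times> mat2 \<Rightarrow> mat2 \<times> mat2" where
  "left_inv X p = lift p X"

lemma left_inv_section: "X \<in> sl2sq \<Longrightarrow> left_inv X \<in> sections SL2xSL2 T_SL2xSL2"
  unfolding sections_def left_inv_def
  by (auto intro!: smooth_on_bilinear[OF bounded_bilinear_lift] smooth_intros lift_in_T)

lemma diff_eq_diff_swap: "p - q = r - s \<Longrightarrow> p - r = q - s" for p q r s :: "'a::ab_group_add"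
  by (simp add: algebra_simps)

text \<open>The difference of two Levi-Civita connections is symmetric in its two arguments and skew with respect to
  the metric in the last two. Such a trilinear form vanishes by the usual cyclic argument.\<close>

lemma levi_civita_left_inv:
  assumes D: "is_levi_civita SL2xSL2 T_SL2xSL2 g_NK D" and p: "p \<in> SL2xSL2" and v: "v \<in> T_SL2xSL2 p" and Y: "Y \<in> sl2sq"
  shows "D p v (left_inv Y) = covN p v (left_inv Y)"
proof -
  define C where "C X Y = lt p (D p (lift p X) (left_inv Y)) - lt p (covN p (lift p X) (left_inv Y))" for X Y
  have conn: "E p (lift p X) (left_inv Y) \<in> T_SL2xSL2 p"
    if "is_levi_civita SL2xSL2 T_SL2xSL2 g_NK E" "X \<in> sl2sq" "Y \<in> sl2sq" for E X Y
    using that p left_inv_section[OF that(3)] lift_in_T[OF p that(2)] unfolding is_levi_civita_def is_connection_def by blast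
  have tors: "E p (lift p X) (left_inv Y) - E p (lift p Y) (left_inv X) = lie_bracket SL2xSL2 (left_inv X) (left_inv Y) p"
    if "is_levi_civita SL2xSL2 T_SL2xSL2 g_NK E" "X \<in> sl2sq" "Y \<in> sl2sq" for E X Y
  proof -
    have "E p (left_inv X p) (left_inv Y) - E p (left_inv Y p) (left_inv X) = lie_bracket SL2xSL2 (left_inv X) (left_inv Y) p"
      using that p left_inv_section unfolding is_levi_civita_def by blast
    then show ?thesis by (simp add: left_inv_def)
  qed
  have met: "gq (lt p (E p (lift p X) (left_inv Y))) Z + gq Y (lt p (E p (lift p X) (left_inv Z)))
      = differential SL2xSL2 (\<lambda>q. g_NK q (left_inv Y q) (left_inv Z q)) p (lift p X)"
    if "is_levi_civita SL2xSL2 T_SL2xSL2 g_NK E" "X \<in> sl2sq" "Y \<in> sl2sq" "Z \<in> sl2sq" for E X Y Z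
  proof -
    have "differential SL2xSL2 (\<lambda>q. g_NK q (left_inv Y q) (left_inv Z q)) p (lift p X) =
      g_NK p (E p (lift p X) (left_inv Y)) (left_inv Z p) + g_NK p (left_inv Y p) (E p (lift p X) (left_inv Z))"
      using that p left_inv_section lift_in_T[OF p that(2)] unfolding is_levi_civita_def by blast
    then show ?thesis using p by (simp add: g_NK_eq left_inv_def)
  qed
  have Cin: "C X Y \<in> sl2sq" if "X \<in> sl2sq" "Y \<in> sl2sq" for X Y
    unfolding C_def using conn[OF D that] conn[OF covN_levi_civita that]
    by (intro sl2sq_closed) (simp_all only: T_iff[OF p])
  have Csym: "C X Y = C Y X" if "X \<in> sl2sq" "Y \<in> sl2sq" for X Y
  proof -
    have "lt p (D p (lift p X) (left_inv Y) - D p (lift p Y) (left_inv X)) =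
      lt p (covN p (lift p X) (left_inv Y) - covN p (lift p Y) (left_inv X))"
      using tors[OF D that] tors[OF covN_levi_civita that] by simp
    then show ?thesis unfolding C_def lt.diff_right by (rule diff_eq_diff_swap)
  qed
  have Cskew: "gq (C X Y) Z = - gq (C X Z) Y" if "X \<in> sl2sq" "Y \<in> sl2sq" "Z \<in> sl2sq" for X Y Z
    using met[OF D that] met[OF covN_levi_civita that] gq_commute[of Y "C X Z"]
    unfolding C_def by (simp add: gq.diff_left gq.diff_right)
  have C0: "C X Y = 0" if X: "X \<in> sl2sq" and Y: "Y \<in> sl2sq" for X Y
  proof (rule gq_nondegenerate[OF Cin[OF X Y]])
    fix Z assume Z: "Z \<in> sl2sq"
    show "gq (C X Y) Z = 0"
      using Csym[OF X Y] Cskew[OF Y X Z] Csym[OF Y Z] Cskew[OF Z Y X] Csym[OF Z X] Cskew[OF X Z Y] by simp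
  qed
  have X: "lt p v \<in> sl2sq" using T_iff[OF p] v by blast
  have "lt p (D p v (left_inv Y)) = lt p (covN p v (left_inv Y))"
    using C0[OF X Y] p by (simp add: C_def)
  then show ?thesis using lift_lt[OF p] by metis
qed

lemma connection_add:
  assumes "is_connection V T E D" "x \<in> V" "v \<in> T x" "s \<in> sections V E" "t \<in> sections V E"
  shows "D x v (\<lambda>q. s q + t q) = D x v s + D x v t"
  using assms unfolding is_connection_def by blast

lemma connection_cong:
  assumes "is_connection V T E D" "x \<in> V" "v \<in> T x" "s \<in> sections V E" "t \<in> sections V E"
    "\<And>q. q \<in> V \<Longrightarrow> s q = t q"
  shows "D x v s = D x v t"
  using assms unfolding is_connection_def by blast

lemma connection_zero:
  assumes "is_connection V T E D" "\<And>x. x \<in> V \<Longrightarrow> 0 \<in> E x" "x \<in> V" "v \<in> T x"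
  shows "D x v (\<lambda>_. 0) = 0"
proof -
  have "(\<lambda>_. 0) \<in> sections V E" using assms(2) by (auto simp: sections_def)
  from connection_add[OF assms(1,3,4) this this]
  show ?thesis by simp
qed

lemma connection_sum:
  assumes D: "is_connection V T E D" and E: "\<And>x. x \<in> V \<Longrightarrow> subspace (E x)" and x: "x \<in> V" and v: "v \<in> T x"
    and c: "\<And>i. i \<in> I \<Longrightarrow> smooth_on V (c i :: _ \<Rightarrow> real)" and e: "\<And>i. i \<in> I \<Longrightarrow> e i \<in> sections V E" and "finite I"
  shows "(\<lambda>q. \<Sum>i\<in>I. c i q *\<^sub>R e i q) \<in> sections V E \<and>
    D x v (\<lambda>q. \<Sum>i\<in>I. c i q *\<^sub>R e i q) = (\<Sum>i\<in>I. differential V (c i) x v *\<^sub>R e i x + c i x *\<^sub>R D x v (e i))"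
  using \<open>finite I\<close> c e
proof (induction I rule: finite_induct)
  case empty
  then show ?case using connection_zero[OF D subspace_0[OF E] x v] subspace_0[OF E] by (auto simp: sections_def)
next
  case (insert j J)
  have IH: "(\<lambda>q. \<Sum>i\<in>J. c i q *\<^sub>R e i q) \<in> sections V E"
    "D x v (\<lambda>q. \<Sum>i\<in>J. c i q *\<^sub>R e i q) = (\<Sum>i\<in>J. differential V (c i) x v *\<^sub>R e i x + c i x *\<^sub>R D x v (e i))"
    using insert by auto
  have ej: "e j \<in> sections V E" "smooth_on V (c j)" using insert.prems by auto
  have s: "(\<lambda>q. c j q *\<^sub>R e j q) \<in> sections V E"
    using ej E by (auto simp: sections_def intro!: smooth_on_bilinear[OF bounded_bilinear_scaleR] subspace_scale)
  have "D x v (\<lambda>q. c j q *\<^sub>R e j q) = differential V (c j) x v *\<^sub>R e j x + c j x *\<^sub>R D x v (e j)"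
    using D x v ej unfolding is_connection_def by blast
  moreover have "D x v (\<lambda>q. c j q *\<^sub>R e j q + (\<Sum>i\<in>J. c i q *\<^sub>R e i q)) =
      D x v (\<lambda>q. c j q *\<^sub>R e j q) + D x v (\<lambda>q. \<Sum>i\<in>J. c i q *\<^sub>R e i q)"
    by (rule connection_add[OF D x v s IH(1)])
  moreover have "(\<lambda>q. c j q *\<^sub>R e j q + (\<Sum>i\<in>J. c i q *\<^sub>R e i q)) \<in> sections V E"
    using s IH(1) E by (auto simp: sections_def intro!: smooth_on_add subspace_add)
  ultimately show ?case using insert.hyps IH(2) by simp
qed

text \<open>Basis matrices need not be trace-free; this projection turns the standard basis into a
  generating set of \<open>sl2 \<times> sl2\<close>.\<close>

definition sl2_proj :: "mat2 \<times> mat2 \<Rightarrow> mat2 \<times> mat2" where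
  "sl2_proj X = (fst X - (trace (fst X) / 2) *\<^sub>R mat 1, snd X - (trace (snd X) / 2) *\<^sub>R mat 1)"

lemma sl2_proj:
  shows "linear sl2_proj" "sl2_proj X \<in> sl2sq" "X \<in> sl2sq \<Longrightarrow> sl2_proj X = X"
proof -
  have tr: "trace (a + b) = trace a + trace b" "trace (r *\<^sub>R a) = r * trace a" "trace (a - r *\<^sub>R mat 1) = trace a - 2 * r"
    for a b :: mat2 and r
    by (cases a rule: mat2_exhaust; cases b rule: mat2_exhaust; simp add: one_mat2 algebra_simps)+
  show "linear sl2_proj"
    by (rule linearI) (simp_all add: sl2_proj_def tr algebra_simps add_divide_distrib scaleR_add_left)
  show "sl2_proj X \<in> sl2sq" by (simp add: sl2_proj_def sl2_def tr)
  show "X \<in> sl2sq \<Longrightarrow> sl2_proj X = X" by (auto simp: sl2_proj_def sl2_def)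
qed

text \<open>Expand \<open>s\<close> with smooth coefficients in the left-invariant fields \<open>e i\<close> along \<open>f\<close>, and apply the Leibniz
  rule for both connections.\<close>

lemma pullback_unique:
  fixes V :: "'a::euclidean_space set"
  assumes V: "open V" "smooth_on V f" "f ` V \<subseteq> SL2xSL2"
    and DN: "is_levi_civita SL2xSL2 T_SL2xSL2 g_NK DN"
    and Dt: "is_pullback_connection V f SL2xSL2 T_SL2xSL2 DN Dt"
    and x: "x \<in> V" and s: "s \<in> sections V (\<lambda>x. T_SL2xSL2 (f x))"
  shows "Dt x v s = cov V f x v s"
proof -
  interpret smooth_map_into V "\<lambda>_. UNIV" f
    by unfold_locales (use V in \<open>auto intro: tangent_dir_open\<close>)
  let ?E = "\<lambda>x. T_SL2xSL2 (f x)"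
  define c where "c i q = lt (f q) (s q) \<bullet> i" for i q
  define e where "e i q = left_inv (sl2_proj i) (f q)" for i q
  have sub: "subspace (?E q)" if "q \<in> V" for q
    unfolding subspace_def using T_iff[OF f_in[OF that]]
    by (auto simp: lt.add_right lt.scaleR_right lt.zero_right intro!: sl2sq_closed(2)[simplified mem_Times_iff] simp: mem_Times_iff)
  have cs: "smooth_on V (c i)" for i unfolding c_def
    by (intro smooth_on_bilinear[OF bounded_bilinear_inner] smooth_on_const smooth_lt section_D(1)[OF s])
  have es: "e i \<in> sections V ?E" for i
    unfolding e_def left_inv_def sections_def
    using V(2) by (auto intro!: smooth_on_bilinear[OF bounded_bilinear_lift] smooth_on_const lift_in_T f_in sl2_proj(2))
  have dec: "s q = (\<Sum>i\<in>Basis. c i q *\<^sub>R e i q)" if q: "q \<in> V" for q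
  proof -
    have "lt (f q) (s q) = (\<Sum>i\<in>Basis. (lt (f q) (s q) \<bullet> i) *\<^sub>R sl2_proj i)"
      using linear_sum_Basis[OF sl2_proj(1), of "lt (f q) (s q)"] sl2_proj(3)[OF section_D(2)[OF s q]] by simp
    then have "lift (f q) (lt (f q) (s q)) = (\<Sum>i\<in>Basis. (lt (f q) (s q) \<bullet> i) *\<^sub>R lift (f q) (sl2_proj i))"
      by (metis (no_types, lifting) lift.scaleR_right lift.sum_right sum.cong)
    then show ?thesis using f_in[OF q] by (simp add: c_def e_def left_inv_def)
  qed
  have eq: "Dt x v (e i) = cov V f x v (e i)" for i
  proof -
    have Y: "left_inv (sl2_proj i) \<in> sections SL2xSL2 T_SL2xSL2" by (rule left_inv_section[OF sl2_proj(2)])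
    have "Dt x v (e i) = DN (f x) (differential V f x v) (left_inv (sl2_proj i))"
      using Dt Y x unfolding is_pullback_connection_def e_def by blast
    also have "\<dots> = covN (f x) (differential V f x v) (left_inv (sl2_proj i))"
      using differential_in_T[OF V(2,3) x tangent_dir_open[OF V(1) x]]
      by (intro levi_civita_left_inv DN f_in x sl2_proj(2))
    also have "\<dots> = cov V f x v (e i)"
      using cov_pullback[OF V] Y x unfolding is_pullback_connection_def e_def by metis
    finally show ?thesis .
  qed
  have con: "is_connection V (\<lambda>_. UNIV) ?E Dt" using Dt by (simp add: is_pullback_connection_def)
  have *: "D x v s = (\<Sum>i\<in>Basis. differential V (c i) x v *\<^sub>R e i x + c i x *\<^sub>R D x v (e i))"
    if D: "is_connection V (\<lambda>_. UNIV) ?E D" for D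
  proof -
    note sm = connection_sum[where v = v and c = c and e = e and I = Basis, OF D sub x UNIV_I cs es finite_Basis]
    have "D x v s = D x v (\<lambda>q. \<Sum>i\<in>Basis. c i q *\<^sub>R e i q)"
      by (rule connection_cong[OF D x UNIV_I s conjunct1[OF sm] dec])
    then show ?thesis using sm by simp
  qed
  show ?thesis unfolding *[OF con] *[OF cov_connection] eq ..
qed

lemma totally_geodesic_cov:
  assumes tg: "totally_geodesic SL2xSL2 T_SL2xSL2 g_NK A F" and c: "c \<in> A"
    and V: "V = chart_range c" "open V" and f: "f = in_chart F c" "smooth_on V f" "f ` V \<subseteq> SL2xSL2" and x: "x \<in> V"
  shows "cov V f x v (\<lambda>y. differential V f y w) \<in> tangent_image V f x"
proof -
  obtain DN where DN: "is_levi_civita SL2xSL2 T_SL2xSL2 g_NK DN"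
    and ch: "\<forall>c\<in>A. let V = chart_range c; f = in_chart F c in
          \<exists>Dt D. is_pullback_connection V f SL2xSL2 T_SL2xSL2 DN Dt \<and>
            is_levi_civita V (\<lambda>_. UNIV) (induced_metric g_NK V f) D \<and>
            (\<forall>x\<in>V. \<forall>v. \<forall>Y\<in>sections V (\<lambda>_. UNIV). second_fundamental_form Dt D V f x v Y = 0)"
    using tg unfolding totally_geodesic_def by blast
  obtain Dt D where Dt: "is_pullback_connection V f SL2xSL2 T_SL2xSL2 DN Dt"
    and h: "\<forall>x\<in>V. \<forall>v. \<forall>Y\<in>sections V (\<lambda>_. UNIV). second_fundamental_form Dt D V f x v Y = 0"
    using ch[rule_format, OF c] unfolding Let_def V(1)[symmetric] f(1)[symmetric] by blast
  have "(\<lambda>_. w) \<in> sections V (\<lambda>_. UNIV)" by (simp add: sections_def)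
  from bspec[OF spec[OF bspec[OF h x]] this, of v]
  have "Dt x v (\<lambda>y. differential V f y w) = differential V f x (D x v (\<lambda>_. w))"
    unfolding second_fundamental_form_def by simp
  moreover have sec: "(\<lambda>y. differential V f y w) \<in> sections V (\<lambda>x. T_SL2xSL2 (f x))"
    unfolding sections_def
    by (auto intro!: smooth_on_differential_field f(2) smooth_on_const tangent_dir_open[OF V(2)] differential_in_T f(3))
  ultimately show ?thesis
    using pullback_unique[OF V(2) f(2,3) DN Dt x sec, of v] by (simp add: tangent_image_def)
qed


section \<open>Symmetry of second derivatives\<close>

text \<open>The mean value theorem applied in the two directions one after the other. Since the second
  difference is symmetric in \<open>u\<close> and \<open>v\<close>, letting \<open>h\<close> tend to \<open>0\<close> proves the symmetry of the second derivative.\<close>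

lemma second_difference:
  fixes g :: "'a::euclidean_space \<Rightarrow> real"
  assumes V: "open V" "smooth_on V g" and h: "h > 0" and r: "ball x r \<subseteq> V" "h * (norm u + norm v) < r"
  shows "\<exists>s t. 0 < s \<and> s < h \<and> 0 < t \<and> t < h \<and>
    g (x + h *\<^sub>R u + h *\<^sub>R v) - g (x + h *\<^sub>R u) - g (x + h *\<^sub>R v) + g x =
    h * h * frechet_derivative (\<lambda>y. frechet_derivative g (at y) u) (at (x + s *\<^sub>R u + t *\<^sub>R v)) v"
proof -
  have inV: "x + s *\<^sub>R u + t *\<^sub>R v \<in> V" if "0 \<le> s" "s \<le> h" "0 \<le> t" "t \<le> h" for s t
  proof -
    have "norm (s *\<^sub>R u + t *\<^sub>R v) \<le> s * norm u + t * norm v"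
      using norm_triangle_ineq[of "s *\<^sub>R u" "t *\<^sub>R v"] that by simp
    also have "\<dots> \<le> h * norm u + h * norm v" using that by (intro add_mono mult_right_mono) auto
    finally have "dist x (x + s *\<^sub>R u + t *\<^sub>R v) < r"
      using r(2) by (simp add: dist_norm algebra_simps norm_minus_commute)
    then show ?thesis using r(1) by auto
  qed
  have line: "((\<lambda>s. k (c + s *\<^sub>R w)) has_real_derivative frechet_derivative k (at (c + s *\<^sub>R w)) w) (at s)"
    if "smooth_on V k" "c + s *\<^sub>R w \<in> V" for k :: "'a \<Rightarrow> real" and c w s
  proof -
    have "(k has_derivative frechet_derivative k (at (c + s *\<^sub>R w))) (at (c + s *\<^sub>R w))"
      using smooth_on_has_derivative[OF that] at_within_open[OF that(2) V(1)] by simp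
    moreover have "((\<lambda>s. c + s *\<^sub>R w) has_derivative (\<lambda>t. t *\<^sub>R w)) (at s)"
      by (auto intro!: derivative_eq_intros)
    ultimately have "((\<lambda>s. k (c + s *\<^sub>R w)) has_derivative (\<lambda>t. frechet_derivative k (at (c + s *\<^sub>R w)) (t *\<^sub>R w))) (at s)"
      by (rule has_derivative_compose[rotated])
    moreover have "frechet_derivative k (at (c + s *\<^sub>R w)) (t *\<^sub>R w) = t *\<^sub>R frechet_derivative k (at (c + s *\<^sub>R w)) w" for t
      by (rule linear_scale[OF has_derivative_linear]) fact
    ultimately show ?thesis
      unfolding has_real_derivative_iff_has_vector_derivative has_vector_derivative_def by simp
  qed
  let ?gu = "\<lambda>y. frechet_derivative g (at y) u"
  have sgu: "smooth_on V ?gu" by (rule smooth_on_derivative[OF V])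
  let ?\<phi> = "\<lambda>s. g (x + h *\<^sub>R v + s *\<^sub>R u) - g (x + s *\<^sub>R u)"
  have "((\<lambda>s. ?\<phi> s) has_real_derivative (?gu (x + h *\<^sub>R v + s *\<^sub>R u) - ?gu (x + s *\<^sub>R u))) (at s)"
    if "0 \<le> s" "s \<le> h" for s
    using inV[of s h] inV[of s 0] that h by (intro DERIV_diff line V(2)) (simp_all add: ac_simps)
  from MVT2[OF h this] obtain s where s: "0 < s" "s < h"
    "?\<phi> h - ?\<phi> 0 = (h - 0) * (?gu (x + h *\<^sub>R v + s *\<^sub>R u) - ?gu (x + s *\<^sub>R u))" by blast
  have "((\<lambda>t. ?gu (x + s *\<^sub>R u + t *\<^sub>R v)) has_real_derivative
      frechet_derivative ?gu (at (x + s *\<^sub>R u + t *\<^sub>R v)) v) (at t)" if "0 \<le> t" "t \<le> h" for t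
    using inV[of s t] that s by (intro line sgu) simp_all
  from MVT2[OF h this] obtain t where t: "0 < t" "t < h"
    "?gu (x + s *\<^sub>R u + h *\<^sub>R v) - ?gu (x + s *\<^sub>R u + 0 *\<^sub>R v) =
      (h - 0) * frechet_derivative ?gu (at (x + s *\<^sub>R u + t *\<^sub>R v)) v" by blast
  have "x + h *\<^sub>R v + s *\<^sub>R u = x + s *\<^sub>R u + h *\<^sub>R v" "x + h *\<^sub>R v + h *\<^sub>R u = x + h *\<^sub>R u + h *\<^sub>R v"
    by (simp_all add: ac_simps)
  then show ?thesis using s t by (intro exI[of _ s] exI[of _ t]) (simp add: algebra_simps)
qed

lemma second_derivative_symmetric_real:
  fixes g :: "'a::euclidean_space \<Rightarrow> real"
  assumes V: "open V" "smooth_on V g" and x: "x \<in> V"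
  shows "frechet_derivative (\<lambda>y. frechet_derivative g (at y) u) (at x) v =
    frechet_derivative (\<lambda>y. frechet_derivative g (at y) v) (at x) u" (is "?A x = ?B x")
proof (rule ccontr)
  assume ne: "?A x \<noteq> ?B x"
  \<comment> \<open>Near \<open>x\<close> both mixed derivatives vary by less than half of the supposed gap.\<close>
  define e where "e = \<bar>?A x - ?B x\<bar> / 2"
  have e: "e > 0" using ne by (simp add: e_def)
  have "smooth_on V ?A" "smooth_on V ?B" by (intro smooth_on_derivative V)+
  then have "continuous_on V ?A" "continuous_on V ?B" by (auto intro: smooth_on_imp_continuous_on)
  then have "isCont ?A x" "isCont ?B x" using V(1) x by (simp_all add: continuous_on_eq_continuous_at)
  then obtain d1 d2 where d: "d1 > 0" "d2 > 0" "\<And>y. dist y x < d1 \<Longrightarrow> dist (?A y) (?A x) < e"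
      "\<And>y. dist y x < d2 \<Longrightarrow> dist (?B y) (?B x) < e"
    unfolding continuous_at_eps_delta using e by metis
  obtain r where r: "r > 0" "ball x r \<subseteq> V" using V(1) x open_contains_ball by metis
  define \<rho> where "\<rho> = min r (min d1 d2)"
  have \<rho>: "\<rho> > 0" "\<rho> \<le> r" "\<rho> \<le> d1" "\<rho> \<le> d2" using r d by (auto simp: \<rho>_def)
  have nn: "0 \<le> norm u" "0 \<le> norm v" by auto
  define N where "N = norm u + norm v + 1"
  have N: "N > 0" using nn unfolding N_def by linarith
  define h where "h = \<rho> / (2 * N)"
  have h: "h > 0" using \<rho>(1) N unfolding h_def by simp
  have "h * (norm u + norm v) \<le> h * N" using h by (simp add: N_def)
  also have "\<dots> = \<rho> / 2" using N unfolding h_def by simp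
  finally have hr: "h * (norm u + norm v) < \<rho>" using \<rho>(1) by linarith
  have near: "dist (x + s *\<^sub>R u + t *\<^sub>R v) x < \<rho>" if "0 < s" "s < h" "0 < t" "t < h" for s t
  proof -
    have "dist (x + s *\<^sub>R u + t *\<^sub>R v) x = norm (s *\<^sub>R u + t *\<^sub>R v)" by (simp add: dist_norm)
    also have "\<dots> \<le> s * norm u + t * norm v"
      using norm_triangle_ineq[of "s *\<^sub>R u" "t *\<^sub>R v"] that by simp
    also have "\<dots> \<le> h * norm u + h * norm v" using that by (intro add_mono mult_right_mono) auto
    finally show ?thesis using hr by (simp add: distrib_left)
  qed
  obtain s t where 1: "0 < s" "s < h" "0 < t" "t < h"
    "g (x + h *\<^sub>R u + h *\<^sub>R v) - g (x + h *\<^sub>R u) - g (x + h *\<^sub>R v) + g x = h * h * ?A (x + s *\<^sub>R u + t *\<^sub>R v)"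
    using second_difference[OF V h r(2), of u v] hr \<rho>(2) by auto
  have "h * (norm v + norm u) < r" using hr \<rho>(2) by (simp add: add.commute)
  from second_difference[OF V h r(2) this] obtain t' s' where 2: "0 < t'" "t' < h" "0 < s'" "s' < h"
    "g (x + h *\<^sub>R v + h *\<^sub>R u) - g (x + h *\<^sub>R v) - g (x + h *\<^sub>R u) + g x = h * h * ?B (x + t' *\<^sub>R v + s' *\<^sub>R u)"
    by blast
  have e: "x + h *\<^sub>R v + h *\<^sub>R u = x + h *\<^sub>R u + h *\<^sub>R v" "x + t' *\<^sub>R v + s' *\<^sub>R u = x + s' *\<^sub>R u + t' *\<^sub>R v"
    by (simp_all add: ac_simps)
  have "h * h * ?A (x + s *\<^sub>R u + t *\<^sub>R v) = h * h * ?B (x + s' *\<^sub>R u + t' *\<^sub>R v)"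
    using 1(5) 2(5)[unfolded e] by linarith
  then have "?A (x + s *\<^sub>R u + t *\<^sub>R v) = ?B (x + s' *\<^sub>R u + t' *\<^sub>R v)" using h by simp
  moreover have "dist (?A (x + s *\<^sub>R u + t *\<^sub>R v)) (?A x) < e" using near[OF 1(1-4)] \<rho> by (intro d(3)) linarith
  moreover have "dist (?B (x + s' *\<^sub>R u + t' *\<^sub>R v)) (?B x) < e" using near[OF 2(3,4,1,2)] \<rho> by (intro d(4)) linarith
  ultimately have "\<bar>?A x - ?B x\<bar> < 2 * e" unfolding dist_real_def by linarith
  then show False by (simp add: e_def)
qed

lemma second_derivative_symmetric:
  fixes f :: "'a::euclidean_space \<Rightarrow> 'b::euclidean_space"
  assumes V: "open V" "smooth_on V f" and x: "x \<in> V"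
  shows "frechet_derivative (\<lambda>y. frechet_derivative f (at y) u) (at x) v =
    frechet_derivative (\<lambda>y. frechet_derivative f (at y) v) (at x) u"
proof (rule euclidean_eqI)
  fix i :: 'b assume "i \<in> Basis"
  have inner: "frechet_derivative (\<lambda>y. k y \<bullet> i) (at y) w = frechet_derivative k (at y) w \<bullet> i"
    if "smooth_on V k" "y \<in> V" for k :: "'a \<Rightarrow> 'b" and y w
  proof -
    have "(k has_derivative frechet_derivative k (at y)) (at y)"
      using smooth_on_has_derivative[OF that] at_within_open[OF that(2) V(1)] by simp
    from frechet_derivative_at[OF has_derivative_inner_left[OF this, of i]] show ?thesis by metis
  qed
  have sm: "smooth_on V (\<lambda>y. f y \<bullet> i)" by (rule smooth_on_bilinear[OF bounded_bilinear_inner V(2) smooth_on_const])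
  have two: "frechet_derivative (\<lambda>y. frechet_derivative (\<lambda>y. f y \<bullet> i) (at y) u) (at x) v =
      frechet_derivative (\<lambda>y. frechet_derivative f (at y) u) (at x) v \<bullet> i" for u v
  proof -
    have s1: "smooth_on V (\<lambda>y. frechet_derivative (\<lambda>y. f y \<bullet> i) (at y) u)" by (rule smooth_on_derivative[OF V(1) sm])
    have "frechet_derivative (\<lambda>y. frechet_derivative (\<lambda>y. f y \<bullet> i) (at y) u) (at x) =
      frechet_derivative (\<lambda>y. frechet_derivative f (at y) u \<bullet> i) (at x)"
      using smooth_on_imp_differentiable[OF s1 x] at_within_open[OF x V(1)] inner[OF V(2)]
      by (intro frechet_derivative_transform_within_open[OF _ V(1) x]) simp_all
    then show ?thesis using inner[OF smooth_on_derivative[OF V] x] by simp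
  qed
  show "frechet_derivative (\<lambda>y. frechet_derivative f (at y) u) (at x) v \<bullet> i =
    frechet_derivative (\<lambda>y. frechet_derivative f (at y) v) (at x) u \<bullet> i"
    using second_derivative_symmetric_real[OF V(1) sm x, of u v] unfolding two .
qed


section \<open>Totally geodesic Lagrangian immersions in a chart\<close>

lemma differential_bilinear:
  assumes "bounded_bilinear B" "tangent_dir S x v" "x \<in> S" "smooth_on S g" "smooth_on S h"
  shows "differential S (\<lambda>y. B (g y) (h y)) x v = B (g x) (differential S h x v) + B (differential S g x v) (h x)"
  using differential_eq[OF assms(2) bounded_bilinear.FDERIV[OF assms(1) smooth_on_has_derivative[OF assms(4,3)]
      smooth_on_has_derivative[OF assms(5,3)]]] .

lemma differential_add:
  assumes "tangent_dir S x v" "x \<in> S" "smooth_on S g" "smooth_on S h"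
  shows "differential S (\<lambda>y. g y + h y) x v = differential S g x v + differential S h x v"
  using differential_eq[OF assms(1) has_derivative_add[OF smooth_on_has_derivative[OF assms(3,2)]
      smooth_on_has_derivative[OF assms(4,2)]]] .

lemma differential_linear:
  assumes "bounded_linear B" "tangent_dir S x v" "x \<in> S" "smooth_on S g"
  shows "differential S (\<lambda>y. B (g y)) x v = B (differential S g x v)"
  using differential_eq[OF assms(2) bounded_linear.has_derivative[OF assms(1) smooth_on_has_derivative[OF assms(4,3)]]] .

lemma differential_constant:
  assumes "tangent_dir S x v" "x \<in> S" "\<And>y. y \<in> S \<Longrightarrow> g y = c" shows "differential S g x v = 0"
proof -
  have "differential S (\<lambda>_. c) x v = differential S g x v"
    by (rule differential_cong[OF assms(1,2) smooth_on_const]) (simp add: assms(3))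
  then show ?thesis using differential_eq[OF assms(1) has_derivative_const[of c]] by simp
qed

lemma differential_symmetric:
  fixes g :: "'a::euclidean_space \<Rightarrow> 'b::euclidean_space"
  assumes V: "open V" "smooth_on V g" and x: "x \<in> V"
  shows "differential V (\<lambda>y. differential V g y u) x v = differential V (\<lambda>y. differential V g y v) x u"
proof -
  have eq: "differential V (\<lambda>y. differential V g y u) x = frechet_derivative (\<lambda>y. frechet_derivative g (at y) u) (at x)" for u
  proof -
    have "smooth_on V (\<lambda>y. frechet_derivative g (at y) u)" by (rule smooth_on_derivative[OF V])
    then have "(\<lambda>y. frechet_derivative g (at y) u) differentiable (at x)"
      using smooth_on_imp_differentiable[OF _ x] at_within_open[OF x V(1)] by metis
    then have "frechet_derivative (\<lambda>y. frechet_derivative g (at y) u) (at x) =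
      frechet_derivative (\<lambda>y. differential V g y u) (at x)"
      by (rule frechet_derivative_transform_within_open[OF _ V(1) x]) (simp add: at_within_open[OF _ V(1)])
    then show ?thesis by (simp add: at_within_open[OF x V(1)])
  qed
  show ?thesis unfolding eq by (rule second_derivative_symmetric[OF V x])
qed

lemma bounded_bilinear_om: "bounded_bilinear om"
  unfolding bilinear_conv_bounded_bilinear[symmetric] bilinear_def om_def
  by (intro conjI allI linearI) (simp_all add: ip_simps algebra_simps)

interpretation om: bounded_bilinear om by (rule bounded_bilinear_om)

lemma om_commute: "om X Y = - om Y X"
  by (simp add: om_def mat2_inner_commute)

lemma bounded_bilinear_pair_ad: "bounded_bilinear pair_ad"
  unfolding bilinear_conv_bounded_bilinear[symmetric] bilinear_def pair_ad_def
  by (intro conjI allI linearI) (simp_all add: br_simps algebra_simps)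

interpretation pair_ad: bounded_bilinear pair_ad by (rule bounded_bilinear_pair_ad)

text \<open>The images of a constant vector field \<open>w\<close> of the chart, in the left trivialization.\<close>

definition frame :: "'a::real_normed_vector set \<Rightarrow> ('a \<Rightarrow> mat2 \<times> mat2) \<Rightarrow> 'a \<Rightarrow> 'a \<Rightarrow> mat2 \<times> mat2" where
  "frame V f w = (\<lambda>x. lt (f x) (differential V f x w))"

abbreviation dframe :: "'a::real_normed_vector set \<Rightarrow> ('a \<Rightarrow> mat2 \<times> mat2) \<Rightarrow> 'a \<Rightarrow> 'a \<Rightarrow> 'a \<Rightarrow> mat2 \<times> mat2" where
  "dframe V f w v x \<equiv> differential V (frame V f w) x v"

text \<open>In the decomposition \<open>Bt_canonical\<close> below, the adjoint action of \<open>sum_part X\<close> commutes with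
  \<open>J0\<close>, while \<open>conj_br X\<close> anticommutes with it. The first summand gives the canonical Hermitian connection of the
  nearly Kaehler structure, the second its difference from the Levi-Civita connection.\<close>

definition sum_part :: "mat2 \<times> mat2 \<Rightarrow> mat2" where "sum_part X = fst X + snd X"

definition conj_br :: "mat2 \<times> mat2 \<Rightarrow> mat2 \<times> mat2 \<Rightarrow> mat2 \<times> mat2" where
  "conj_br X Y = (br (fst X) (fst Y) - br (fst X) (snd Y) - br (snd X) (fst Y),
     br (snd X) (snd Y) - br (fst X) (snd Y) - br (snd X) (fst Y))"

lemma Bt_canonical: "Bt X Y = (1 / 3) *\<^sub>R pair_ad (sum_part X) Y + (1 / 6) *\<^sub>R conj_br X Y"
proof -
  have "br (fst Y) (snd X) = - br (snd X) (fst Y)" by (rule br_anti)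
  then show ?thesis
    by (simp add: Bt_def kap_def pair_ad_def sum_part_def conj_br_def br_simps prod_eq_iff vec_eq_iff field_simps)
qed

lemma om_conj_br: "om (conj_br X Y) Z = vol21 X Y Z - vol12 X Y Z"
  by (simp add: om_def conj_br_def vol21_def vol12_def vol_def ip_simps mat2_inner_commute)

lemma vol_swap: "vol a b c = - vol a c b"
  by (cases a rule: mat2_exhaust; cases b rule: mat2_exhaust; cases c rule: mat2_exhaust) (simp add: vol_def field_simps)

lemma vol21_swap: "vol21 X Y Z = - vol21 X Z Y" and vol12_swap: "vol12 X Y Z = - vol12 X Z Y"
  using vol_swap[of "fst X" "fst Y" "snd Z"] vol_swap[of "fst X" "snd Y" "fst Z"] vol_swap[of "snd X" "fst Y" "fst Z"]
    vol_swap[of "snd X" "snd Y" "fst Z"] vol_swap[of "snd X" "fst Y" "snd Z"] vol_swap[of "fst X" "snd Y" "snd Z"]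
  by (simp_all add: vol21_def vol12_def)

lemma om_pair_ad_skew: "om (pair_ad k X) Y = - om X (pair_ad k Y)"
  using mat2_inner_br_swap[of "fst X" k "snd Y"] mat2_inner_br_swap[of "snd X" k "fst Y"]
  by (simp add: om_def pair_ad_def)

text \<open>A totally geodesic Lagrangian immersion of an open set, with all conditions expressed in the left
  trivialization. In \<open>geodesic\<close>, being tangent to the immersion is expressed as \<open>om\<close>-orthogonality to its tangent
  space.\<close>

locale frame_chart =
  fixes V :: "(real^3) set" and f :: "real^3 \<Rightarrow> mat2 \<times> mat2"
  assumes open_V: "open V" and smooth: "smooth_on V f" and into: "f ` V \<subseteq> SL2xSL2"
    and isotropic: "x \<in> V \<Longrightarrow> om (frame V f v x) (frame V f w x) = 0"
    and maximal: "x \<in> V \<Longrightarrow> Y \<in> sl2sq \<Longrightarrow> (\<And>w. om Y (frame V f w x) = 0) \<Longrightarrow> \<exists>w. Y = frame V f w x"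
    and nondegenerate: "x \<in> V \<Longrightarrow> (\<And>w. gq (frame V f v x) (frame V f w x) = 0) \<Longrightarrow> v = 0"
    and geodesic: "x \<in> V \<Longrightarrow>
      om (dframe V f w v x + Bt (frame V f v x) (frame V f w x)) (frame V f u x) = 0"
begin

sublocale smooth_map_into V "\<lambda>_. UNIV" f
  by unfold_locales (use open_V smooth into in \<open>auto intro: tangent_dir_open\<close>)

abbreviation X :: "real^3 \<Rightarrow> real^3 \<Rightarrow> mat2 \<times> mat2" where "X \<equiv> frame V f"
abbreviation dX :: "real^3 \<Rightarrow> real^3 \<Rightarrow> real^3 \<Rightarrow> mat2 \<times> mat2" where "dX \<equiv> dframe V f"

definition L :: "real^3 \<Rightarrow> (mat2 \<times> mat2) set" where "L x = range (\<lambda>w. X w x)"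

lemma td: "x \<in> V \<Longrightarrow> tangent_dir V x v" by (rule tangent_dir_open[OF open_V])

lemma smooth_df: "smooth_on V (\<lambda>y. differential V f y w)"
  by (rule smooth_on_differential_field[OF smooth smooth_on_const td])

lemma smooth_X: "smooth_on V (X w)" unfolding frame_def by (rule smooth_lt[OF smooth_df])

lemma smooth_dX: "smooth_on V (\<lambda>y. dX w v y)"
  by (rule smooth_on_differential_field[OF smooth_X smooth_on_const td])

lemma df_section: "(\<lambda>y. differential V f y w) \<in> \<E>"
  unfolding sections_def using smooth_df differential_in_T[OF smooth into _ td] by auto

lemma X_sl2: "x \<in> V \<Longrightarrow> X w x \<in> sl2sq"
  unfolding frame_def by (rule df_in) auto

lemma dX_sl2: "x \<in> V \<Longrightarrow> dX w v x \<in> sl2sq"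
  unfolding frame_def by (rule differential_lt_in[OF df_section]) auto

lemma linear_X: assumes "x \<in> V" shows "linear (\<lambda>w. X w x)"
proof -
  note l = linear_differential[OF smooth assms]
  show ?thesis unfolding frame_def
    by (rule linearI) (simp_all add: linear_add[OF l] linear_scale[OF l] lt.add_right lt.scaleR_right)
qed

lemma subspace_L: "x \<in> V \<Longrightarrow> subspace (L x)"
  unfolding L_def using linear_subspace_image[OF linear_X subspace_UNIV] by simp

lemma mem_L_iff: assumes "x \<in> V" shows "Y \<in> L x \<longleftrightarrow> Y \<in> sl2sq \<and> (\<forall>w. om Y (X w x) = 0)"
  using isotropic[OF assms] maximal[OF assms, of Y] X_sl2[OF assms] unfolding L_def by blast

lemma X_in_L [simp]: "X w x \<in> L x" by (simp add: L_def)

lemma om_L: "x \<in> V \<Longrightarrow> Y \<in> L x \<Longrightarrow> Z \<in> L x \<Longrightarrow> om Y Z = 0"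
  using mem_L_iff unfolding L_def by blast

text \<open>The Maurer-Cartan equation: symmetry of second derivatives, seen in a left-invariant frame.\<close>

lemma maurer_cartan:
  assumes x: "x \<in> V"
  shows "dX w v x - dX v w x = - (br (fst (X v x)) (fst (X w x)), br (snd (X v x)) (snd (X w x)))"
proof -
  have d: "dX w v x = lt (f x) (differential V (\<lambda>y. differential V f y w) x v)
      + lt (differential V f x v) (differential V f x w)" for w v
    unfolding frame_def by (rule differential_bilinear[OF bounded_bilinear_lt td[OF x] x smooth smooth_df])
  have l: "lt (differential V f x v) (differential V f x w) =
      - (fst (X v x) ** fst (X w x), snd (X v x) ** snd (X w x))" for v w
  proof -
    have "differential V f x u = lift (f x) (X u x)" for u
      unfolding frame_def using f_in[OF x] by simp
    moreover have "adj2 \<alpha> = - \<alpha>" if "\<alpha> \<in> sl2" for \<alpha>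
      by (rule sl2_exhaust[OF that]) simp
    ultimately show ?thesis
      using X_sl2[OF x, of v] SL2xSL2_D[OF f_in[OF x]]
      by (simp add: lt_def lift_def adj2_matrix_mult mem_Times_iff mm.minus_left)
        (simp add: SL2_cancel(1) flip: matrix_mul_assoc)
  qed
  show ?thesis
    unfolding d l by (simp add: differential_symmetric[OF open_V smooth x, of w v] br_def)
qed

text \<open>Let \<open>T\<close> be the trilinear form \<open>om (Bt X Y) Z\<close>. Being totally geodesic identifies \<open>T\<close> with
  \<open>- om (dX) Z\<close>, and differentiating \<open>om Y Z = 0\<close> then shows that \<open>T\<close> is symmetric in \<open>Y\<close> and \<open>Z\<close>. The canonical part of
  \<open>Bt\<close> is symmetric in this sense as well, whereas the form \<open>om (conj_br X Y) Z\<close> is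
  skew-symmetric; so the latter vanishes.\<close>

lemma special_volume:
  assumes x: "x \<in> V" shows "vol21 (X v x) (X w x) (X u x) = vol12 (X v x) (X w x) (X u x)"
proof -
  have g: "om (dX w v x) (X u x) = - om (Bt (X v x) (X w x)) (X u x)" for v w u
    using geodesic[OF x, of w v u] by (simp add: om.add_left)
  have "differential V (\<lambda>y. om (X w y) (X u y)) x v = 0"
    by (rule differential_constant[OF td[OF x] x]) (rule isotropic)
  then have "om (X w x) (dX u v x) + om (dX w v x) (X u x) = 0"
    by (simp add: differential_bilinear[OF bounded_bilinear_om td[OF x] x smooth_X smooth_X])
  then have "om (Bt (X v x) (X u x)) (X w x) = om (Bt (X v x) (X w x)) (X u x)"
    using g[of w v u] g[of u v w] om_commute[of "X w x" "dX u v x"] by simp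
  moreover have "om (pair_ad (sum_part (X v x)) (X u x)) (X w x) = om (pair_ad (sum_part (X v x)) (X w x)) (X u x)"
    using om_pair_ad_skew[of _ "X u x" "X w x"] om_commute[of "X u x"] by simp
  ultimately have "om (conj_br (X v x) (X u x)) (X w x) = om (conj_br (X v x) (X w x)) (X u x)"
    by (simp add: Bt_canonical om.add_left om.scaleR_left)
  then show ?thesis
    unfolding om_conj_br using vol21_swap[of "X v x" "X u x" "X w x"] vol12_swap[of "X v x" "X u x" "X w x"] by simp
qed

text \<open>The derivative of the frame with respect to the canonical Hermitian connection.\<close>

definition canon :: "real^3 \<Rightarrow> real^3 \<Rightarrow> real^3 \<Rightarrow> mat2 \<times> mat2" where
  "canon v w x = dX w v x + (1 / 3) *\<^sub>R pair_ad (sum_part (X v x)) (X w x)"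

lemma canon_in_L: assumes x: "x \<in> V" shows "canon v w x \<in> L x"
proof -
  have o: "om (canon v w x) (X u x) = 0" for u
  proof -
    have "om (conj_br (X v x) (X w x)) (X u x) = 0" unfolding om_conj_br using special_volume[OF x] by simp
    then show ?thesis using geodesic[OF x, of w v u]
      by (simp add: canon_def Bt_canonical om.add_left om.scaleR_left)
  qed
  have "canon v w x \<in> sl2sq"
    unfolding canon_def by (intro sl2sq_closed dX_sl2[OF x] pair_ad_in)
  with o show ?thesis by (simp only: mem_L_iff[OF x] simp_thms)
qed

lemma bounded_linear_sum_part: "bounded_linear sum_part"
  unfolding sum_part_def by (intro bounded_linear_add bounded_linear_fst bounded_linear_snd)

text \<open>Because the frame spans the field of subspaces \<open>L\<close>, \<open>canon_in_L\<close> says that \<open>L\<close> is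
  parallel. A second canonical derivative therefore stays in \<open>L\<close>, and the commutator of two canonical derivatives is the
  curvature, up to the factor \<open>- 1 / 9\<close>.\<close>

lemma curvature_invariant:
  assumes x: "x \<in> V" shows "pair_ad (curv_sl2 (X z x) (X v x)) (X w x) \<in> L x"
proof -
  let ?s = "\<lambda>v. sum_part (X v x)" and ?ds = "\<lambda>v z. sum_part (dX v z x)"
  have sm_s: "smooth_on V (\<lambda>y. sum_part (X v y))" for v
    by (rule smooth_on_bounded_linear_compose[OF bounded_linear_sum_part smooth_X])
  have sm_ad: "smooth_on V (\<lambda>y. pair_ad (sum_part (X v y)) (X w y))" for v w
    by (rule smooth_on_bilinear[OF bounded_bilinear_pair_ad sm_s smooth_X])
  have sm_c: "smooth_on V (\<lambda>y. canon v w y)" for v w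
    unfolding canon_def by (intro smooth_on_add smooth_dX smooth_on_scaleR_const sm_ad)
  have dc: "differential V (\<lambda>y. canon v w y) x z = differential V (\<lambda>y. dX w v y) x z
      + (1 / 3) *\<^sub>R (pair_ad (?s v) (dX w z x) + pair_ad (?ds v z) (X w x))" for v w z
    unfolding canon_def
      differential_add[OF td[OF x] x smooth_dX smooth_on_scaleR_const[OF sm_ad]]
      differential_linear[OF bounded_linear_scaleR_right td[OF x] x sm_ad]
      differential_bilinear[OF bounded_bilinear_pair_ad td[OF x] x sm_s smooth_X]
      differential_linear[OF bounded_linear_sum_part td[OF x] x smooth_X] ..
  have key: "om (differential V (\<lambda>y. canon v w y) x z + (1 / 3) *\<^sub>R pair_ad (?s z) (canon v w x)) (X u x) = 0" for v w z u
  proof -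
    have "differential V (\<lambda>y. om (canon v w y) (X u y)) x z = 0"
    proof (rule differential_constant[OF td[OF x] x])
      fix y assume y: "y \<in> V"
      show "om (canon v w y) (X u y) = 0" by (rule om_L[OF y canon_in_L[OF y] X_in_L])
    qed
    then have "om (canon v w x) (dX u z x) + om (differential V (\<lambda>y. canon v w y) x z) (X u x) = 0"
      by (simp add: differential_bilinear[OF bounded_bilinear_om td[OF x] x sm_c smooth_X])
    moreover have "om (canon v w x) (canon z u x) = 0" by (rule om_L[OF x canon_in_L[OF x] canon_in_L[OF x]])
    ultimately show ?thesis
      using om_pair_ad_skew[of "?s z" "canon v w x" "X u x"]
      by (simp add: canon_def[of z u] om.add_left om.add_right om.scaleR_left om.scaleR_right)
  qed
  have mc: "?ds v z - ?ds z v = - br (fst (X z x)) (fst (X v x)) - br (snd (X z x)) (snd (X v x))"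
    using arg_cong[OF maurer_cartan[OF x, of v z], of sum_part] by (simp add: sum_part_def algebra_simps)
  have "differential V (\<lambda>y. canon v w y) x z + (1 / 3) *\<^sub>R pair_ad (?s z) (canon v w x)
      - (differential V (\<lambda>y. canon z w y) x v + (1 / 3) *\<^sub>R pair_ad (?s v) (canon z w x))
    = (1 / 3) *\<^sub>R pair_ad (?ds v z - ?ds z v) (X w x) + (1 / 9) *\<^sub>R pair_ad (br (?s z) (?s v)) (X w x)"
    unfolding dc unfolding canon_def differential_symmetric[OF open_V smooth_X x, of w v z]
    by (simp add: pair_ad_def jacobi br_simps prod_eq_iff vec_eq_iff field_simps)
  also have "\<dots> = - (1 / 9) *\<^sub>R pair_ad (curv_sl2 (X z x) (X v x)) (X w x)"
    unfolding mc by (simp add: sum_part_def curv_sl2_def pair_ad_def br_simps prod_eq_iff vec_eq_iff field_simps)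
  finally have eq: "differential V (\<lambda>y. canon v w y) x z + (1 / 3) *\<^sub>R pair_ad (?s z) (canon v w x)
      - (differential V (\<lambda>y. canon z w y) x v + (1 / 3) *\<^sub>R pair_ad (?s v) (canon z w x))
    = - (1 / 9) *\<^sub>R pair_ad (curv_sl2 (X z x) (X v x)) (X w x)" .
  have "om (- (1 / 9) *\<^sub>R pair_ad (curv_sl2 (X z x) (X v x)) (X w x)) (X u x) = 0" for u
    unfolding eq[symmetric] om.diff_left key by simp
  then have "om (pair_ad (curv_sl2 (X z x) (X v x)) (X w x)) (X u x) = 0" for u
    unfolding om.scaleR_left by simp
  then show ?thesis using mem_L_iff[OF x] pair_ad_in by blast
qed

lemma invariant_lagrangian_L: assumes x: "x \<in> V" shows "invariant_lagrangian (L x)"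
proof
  show "subspace (L x)" by (rule subspace_L[OF x])
  show "L x \<subseteq> sl2sq" using mem_L_iff[OF x] by blast
  show "om Y Z = 0" if "Y \<in> L x" "Z \<in> L x" for Y Z using om_L[OF x that] .
  show "Y \<in> L x" if "Y \<in> sl2sq" "\<And>Z. Z \<in> L x \<Longrightarrow> om Y Z = 0" for Y
    using that mem_L_iff[OF x] X_in_L by blast
  show "Y = 0" if Y: "Y \<in> L x" "\<And>Z. Z \<in> L x \<Longrightarrow> gq Y Z = 0" for Y
  proof -
    obtain v where v: "Y = X v x" using Y(1) unfolding L_def by blast
    then have "v = 0" using Y(2) X_in_L by (intro nondegenerate[OF x]) blast
    then show ?thesis using v linear_0[OF linear_X[OF x]] by simp
  qed
  show "vol21 Y Z W = vol12 Y Z W" if "Y \<in> L x" "Z \<in> L x" "W \<in> L x" for Y Z W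
    using that special_volume[OF x] unfolding L_def by blast
  show "pair_ad (curv_sl2 Y Z) W \<in> L x" if "Y \<in> L x" "Z \<in> L x" "W \<in> L x" for Y Z W
    using that curvature_invariant[OF x] unfolding L_def by blast
qed

end

text \<open>The interface to the definitions: the Lagrangian condition is a pair of inclusions, of which the
  first gives isotropy and the second maximality.\<close>

lemma chart_frame_chart:
  assumes tgl: "totally_geodesic_lagrangian M A F" and c: "c \<in> A"
  shows "frame_chart (chart_range c) (in_chart F c)"
proof -
  define V f where "V = chart_range c" and "f = in_chart F c"
  have lag: "lagrangian_immersion M A F" and tg: "totally_geodesic SL2xSL2 T_SL2xSL2 g_NK A F"
    using tgl by (auto simp: totally_geodesic_lagrangian_def)
  have im: "immersion_into SL2xSL2 M A F" and nd: "nondegenerate_immersion g_NK A F"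
    and J: "\<And>x. x \<in> V \<Longrightarrow> J_NK (f x) ` tangent_image V f x \<subseteq> normal_space T_SL2xSL2 g_NK V f x"
      "\<And>x. x \<in> V \<Longrightarrow> J_NK (f x) ` normal_space T_SL2xSL2 g_NK V f x \<subseteq> tangent_image V f x"
    using lag c by (auto simp: lagrangian_immersion_def Let_def V_def f_def)
  obtain U \<phi> where cU: "c = (U, \<phi>)" by (cases c)
  have "is_chart M c" using im c by (auto simp: immersion_into_def smooth_manifold_def)
  then have UM: "openin M U" and V1: "open V" by (auto simp: is_chart_def cU V_def chart_range_def)
  have V2: "smooth_on V f" using im c by (auto simp: immersion_into_def V_def f_def)
  have "in_chart F c y \<in> F ` topspace M" if "y \<in> V" for y
    using that openin_subset[OF UM] inv_into_into[of y \<phi> U] by (auto simp: in_chart_def cU V_def chart_range_def)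
  then have V3: "f ` V \<subseteq> SL2xSL2" using im by (auto simp: immersion_into_def f_def)
  interpret smooth_map_into V "\<lambda>_. UNIV" f
    by unfold_locales (use V1 V2 V3 in \<open>auto intro: tangent_dir_open\<close>)
  have ti: "tangent_image V f x = lift (f x) ` range (\<lambda>w. frame V f w x)" if "x \<in> V" for x
    using f_in[OF that] by (auto simp: tangent_image_def frame_def image_image)
  have sl: "frame V f w x \<in> sl2sq" if "x \<in> V" for w x
    unfolding frame_def using that by (rule df_in) auto
  have lin: "linear (\<lambda>w. frame V f w x)" if "x \<in> V" for x
  proof -
    note l = linear_differential[OF V2 that]
    show ?thesis unfolding frame_def
      by (rule linearI) (simp_all add: linear_add[OF l] linear_scale[OF l] lt.add_right lt.scaleR_right)
  qed
  have iso: "om (frame V f v x) (frame V f w x) = 0" if x: "x \<in> V" for v w x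
  proof -
    have "J_NK (f x) (lift (f x) (frame V f v x)) \<in> normal_space T_SL2xSL2 g_NK V f x"
      using J(1)[OF x] ti[OF x] by blast
    then have "g_NK (f x) (lift (f x) (frame V f w x)) (J_NK (f x) (lift (f x) (frame V f v x))) = 0"
      unfolding normal_space_def ti[OF x] by blast
    then have "gq (frame V f w x) (J0 (frame V f v x)) = 0"
      using f_in[OF x] by (simp add: g_NK_eq J_NK_eq lt.scaleR_right gq.scaleR_right)
    then show ?thesis by (simp add: gq_commute[of "frame V f w x"] gq_J0)
  qed
  have mx: "\<exists>w. Y = frame V f w x" if x: "x \<in> V" and Y: "Y \<in> sl2sq" "\<And>w. om Y (frame V f w x) = 0" for x Y
  proof -
    have "lift (f x) (J0 Y) \<in> normal_space T_SL2xSL2 g_NK V f x"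
      unfolding normal_space_def ti[OF x]
      using f_in[OF x] Y by (auto simp: g_NK_eq gq_commute[of "frame V f w x" for w] gq_J0 intro!: lift_in_T J0_in)
    then have "J_NK (f x) (lift (f x) (J0 Y)) \<in> tangent_image V f x" using J(2)[OF x] by blast
    then obtain w where "(1 / sqrt 3) *\<^sub>R lift (f x) (J0 (J0 Y)) = lift (f x) (frame V f w x)"
      unfolding ti[OF x] using f_in[OF x] by (auto simp: J_NK_eq)
    then have "lt (f x) ((1 / sqrt 3) *\<^sub>R lift (f x) (J0 (J0 Y))) = frame V f w x" using f_in[OF x] by simp
    then have eq: "(- 3 / sqrt 3) *\<^sub>R Y = frame V f w x" using f_in[OF x] by (simp add: J0_J0 lt.scaleR_right)
    have "Y = (- sqrt 3 / 3) *\<^sub>R ((- 3 / sqrt 3) *\<^sub>R Y)" by simp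
    also have "\<dots> = frame V f ((- sqrt 3 / 3) *\<^sub>R w) x"
      unfolding eq by (rule linear_scale[OF lin[OF x], symmetric])
    finally show ?thesis by blast
  qed
  have ndg: "v = 0" if x: "x \<in> V" and v: "\<And>w. gq (frame V f v x) (frame V f w x) = 0" for x v
  proof -
    have "induced_metric g_NK V f x v w = 0" for w
      using v f_in[OF x] by (simp add: induced_metric_def g_NK_eq frame_def)
    then show ?thesis using nd c x unfolding nondegenerate_immersion_def V_def f_def by blast
  qed
  have geo: "om (dframe V f w v x + Bt (frame V f v x) (frame V f w x)) (frame V f u x) = 0" if x: "x \<in> V" for x u v w
  proof -
    have sec: "(\<lambda>y. differential V f y w) \<in> \<E>"
      unfolding sections_def
      by (auto intro!: smooth_on_differential_field V2 smooth_on_const tangent_dir_open[OF V1] differential_in_T V3)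
    have "cov V f x v (\<lambda>y. differential V f y w) \<in> tangent_image V f x"
      by (rule totally_geodesic_cov[OF tg c V_def V1 f_def V2 V3 x])
    then have "lift (f x) (dframe V f w v x + Bt (frame V f v x) (frame V f w x)) \<in> lift (f x) ` range (\<lambda>w. frame V f w x)"
      unfolding cov_eq[OF sec x UNIV_I] ti[OF x] frame_def .
    then obtain u' where "lift (f x) (dframe V f w v x + Bt (frame V f v x) (frame V f w x)) = lift (f x) (frame V f u' x)"
      by auto
    then have "dframe V f w v x + Bt (frame V f v x) (frame V f w x) = frame V f u' x"
      using lt_lift[OF f_in[OF x]] by metis
    then show ?thesis using iso[OF x] by simp
  qed
  show ?thesis unfolding V_def[symmetric] f_def[symmetric]
    by unfold_locales (fact V1 V2 V3 iso mx ndg geo)+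
qed

section \<open>The isometry of order three\<close>

text \<open>Seen on triples \<open>(a, b, 1)\<close> modulo simultaneous right translation, \<open>rho\<close> is a cyclic permutation: the triple
  \<open>(1, a, b)\<close> is equivalent to \<open>(inverse b, a (inverse b), 1)\<close>.\<close>

definition rho :: "mat2 \<times> mat2 \<Rightarrow> mat2 \<times> mat2" where
  "rho p = (adj2 (snd p), fst p ** adj2 (snd p))"

definition Ad :: "mat2 \<Rightarrow> mat2 \<times> mat2 \<Rightarrow> mat2 \<times> mat2" where
  "Ad b X = (b ** fst X ** adj2 b, b ** snd X ** adj2 b)"

lemma conj_mat2:
  assumes "b \<in> SL2"
  shows "mat2_inner (b ** x ** adj2 b) (b ** y ** adj2 b) = mat2_inner x y"
    "br (b ** x ** adj2 b) (b ** y ** adj2 b) = b ** br x y ** adj2 b"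
    "x \<in> sl2 \<Longrightarrow> b ** x ** adj2 b \<in> sl2"
proof -
  have c: "b ** x ** adj2 b ** (b ** y ** adj2 b) = b ** (x ** y) ** adj2 b" for x y
    by (simp only: matrix_mul_assoc[symmetric] SL2_cancel(1)[OF assms])
  have t: "trace (b ** x ** adj2 b) = trace x" for x
    by (simp only: trace_mul_sym[of "b ** x"] matrix_mul_assoc SL2_cancel(5)[OF assms] matrix_mul_lid)
  have "adj2 (b ** x ** adj2 b) = b ** adj2 x ** adj2 b"
    by (simp add: adj2_matrix_mult matrix_mul_assoc)
  then show "mat2_inner (b ** x ** adj2 b) (b ** y ** adj2 b) = mat2_inner x y"
    by (simp add: mat2_inner_def c t)
  show "br (b ** x ** adj2 b) (b ** y ** adj2 b) = b ** br x y ** adj2 b"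
    by (simp add: br_def c mm.diff_left mm.diff_right)
  show "x \<in> sl2 \<Longrightarrow> b ** x ** adj2 b \<in> sl2" by (simp add: sl2_def t)
qed

lemma Ad_simps:
  assumes "b \<in> SL2"
  shows "om (Ad b X) (Ad b Y) = om X Y" "gq (Ad b X) (Ad b Y) = gq X Y" "X \<in> sl2sq \<Longrightarrow> Ad b X \<in> sl2sq"
    "Bt (Ad b X) (Ad b Y) = Ad b (Bt X Y)" "Ad b (Ad (adj2 b) X) = X" "Ad (adj2 b) (Ad b X) = X"
    "Ad b (X + Y) = Ad b X + Ad b Y" "Ad b (rot1 X) = rot1 (Ad b X)"
proof -
  show "om (Ad b X) (Ad b Y) = om X Y" "gq (Ad b X) (Ad b Y) = gq X Y"
    by (simp_all add: om_def gq_def Ad_def conj_mat2[OF assms])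
  show "X \<in> sl2sq \<Longrightarrow> Ad b X \<in> sl2sq" by (auto simp: Ad_def conj_mat2[OF assms])
  show "Bt (Ad b X) (Ad b Y) = Ad b (Bt X Y)"
    by (simp add: Bt_def kap_def Ad_def conj_mat2[OF assms] mm.add_left mm.add_right mm.diff_left mm.diff_right
        mm.scaleR_left mm.scaleR_right)
  show "Ad b (Ad (adj2 b) X) = X" "Ad (adj2 b) (Ad b X) = X"
    by (simp_all only: Ad_def fst_conv snd_conv adj2_adj2 matrix_mul_assoc[symmetric] SL2_cancel[OF assms]
        matrix_mul_rid prod.collapse)
  show "Ad b (X + Y) = Ad b X + Ad b Y" "Ad b (rot1 X) = rot1 (Ad b X)"
    by (simp_all add: Ad_def rot1_def mm.add_left mm.add_right mm.minus_left mm.minus_right mm.diff_left mm.diff_right)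
qed

lemma om_rot1: "om (rot1 X) (rot1 Y) = om X Y" and gq_rot1: "gq (rot1 X) (rot1 Y) = gq X Y"
  by (simp_all add: om_def gq_def rot1_def ip_simps field_simps)

lemma rot1_in: "X \<in> sl2sq \<Longrightarrow> rot1 X \<in> sl2sq"
  by (auto simp: rot1_def)

lemma rot1_cubed: "rot1 (rot1 (rot1 X)) = X"
  by (simp add: rot1_def)

lemma bounded_linear_rot1: "bounded_linear rot1"
  unfolding rot1_def
  by (intro bounded_linear_Pair bounded_linear_minus bounded_linear_sub bounded_linear_fst bounded_linear_snd)

text \<open>The term with \<open>pair_ad\<close> comes from differentiating the conjugation by the second component that \<open>rho\<close>
  introduces.\<close>

lemma Bt_rot1: "pair_ad (snd X) (rot1 Y) + Bt (rot1 X) (rot1 Y) = rot1 (Bt X Y)"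
proof -
  have "br (fst Y) (snd X) = - br (snd X) (fst Y)" "br (snd Y) (fst X) = - br (fst X) (snd Y)"
     "br (snd Y) (snd X) = - br (snd X) (snd Y)" "br (fst Y) (fst X) = - br (fst X) (fst Y)" by (rule br_anti)+
  then show ?thesis
    by (simp add: Bt_def kap_def pair_ad_def rot1_def br_simps prod_eq_iff vec_eq_iff field_simps)
qed

lemma rho_in: "p \<in> SL2xSL2 \<Longrightarrow> rho p \<in> SL2xSL2"
  by (auto simp: rho_def SL2xSL2_def)

lemma smooth_on_rho: "smooth_on S f \<Longrightarrow> smooth_on S (\<lambda>x. rho (f x))"
  unfolding rho_def by (intro smooth_intros)

lemma sl2_adj2: "\<alpha> \<in> sl2 \<Longrightarrow> adj2 \<alpha> = - \<alpha>"
  by (erule sl2_exhaust) simp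

text \<open>\<open>rho\<close> acts on left-trivialized tangent vectors by \<open>rot1\<close>, up to a conjugation that depends on
  the base point.\<close>

lemma (in smooth_map_into) frame_rho:
  assumes x: "x \<in> S" and w: "w \<in> T x"
  shows "frame S (\<lambda>y. rho (f y)) w x = Ad (snd (f x)) (rot1 (frame S f w x))"
proof -
  obtain a b where ab: "f x = (a, b)" by (cases "f x")
  have SL: "a \<in> SL2" "b \<in> SL2" using SL2xSL2_D[OF f_in[OF x]] by (simp_all add: ab)
  define \<alpha> \<beta> where "\<alpha> = fst (frame S f w x)" and "\<beta> = snd (frame S f w x)"
  have "frame S f w x \<in> sl2sq" unfolding frame_def by (rule df_in[OF x w])
  then have sl: "\<alpha> \<in> sl2" "\<beta> \<in> sl2" by (auto simp: \<alpha>_def \<beta>_def mem_Times_iff)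
  have "differential S f x w = lift (f x) (frame S f w x)"
    unfolding frame_def using f_in[OF x] by simp
  then have df: "differential S f x w = (a ** \<alpha>, b ** \<beta>)" by (simp add: lift_def ab \<alpha>_def \<beta>_def)
  note td = T_dir[OF x w]
  have d1: "differential S (\<lambda>y. fst (f y)) x w = a ** \<alpha>"
    using differential_linear[OF bounded_linear_fst td x smooth_f] df by simp
  have d2: "differential S (\<lambda>y. snd (f y)) x w = b ** \<beta>"
    using differential_linear[OF bounded_linear_snd td x smooth_f] df by simp
  have s: "smooth_on S (\<lambda>y. fst (f y))" "smooth_on S (\<lambda>y. snd (f y))" "smooth_on S (\<lambda>y. adj2 (snd (f y)))"
    by (intro smooth_intros smooth_f)+
  have d3: "differential S (\<lambda>y. adj2 (snd (f y))) x w = - (\<beta> ** adj2 b)"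
    using differential_linear[OF bounded_linear_adj2 td x s(2)] d2
    by (simp add: adj2_matrix_mult sl2_adj2[OF sl(2)] mm.minus_left)
  have d4: "differential S (\<lambda>y. fst (f y) ** adj2 (snd (f y))) x w = a ** (\<alpha> - \<beta>) ** adj2 b"
    using differential_bilinear[OF bounded_bilinear_matrix_mult td x s(1,3)] d1 d3
    by (simp add: ab mm.minus_right mm.diff_left mm.diff_right matrix_mul_assoc)
  have sr: "smooth_on S (\<lambda>y. rho (f y))" by (rule smooth_on_rho[OF smooth_f])
  have "fst (differential S (\<lambda>y. rho (f y)) x w) = - (\<beta> ** adj2 b)"
    using differential_linear[OF bounded_linear_fst td x sr] d3 by (simp add: rho_def)
  moreover have "snd (differential S (\<lambda>y. rho (f y)) x w) = a ** (\<alpha> - \<beta>) ** adj2 b"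
    using differential_linear[OF bounded_linear_snd td x sr] d4 by (simp add: rho_def)
  ultimately have "frame S (\<lambda>y. rho (f y)) w x =
      (b ** (- (\<beta> ** adj2 b)), (b ** adj2 a) ** (a ** (\<alpha> - \<beta>) ** adj2 b))"
    unfolding frame_def by (simp add: lt_def rho_def ab adj2_matrix_mult)
  also have "\<dots> = (b ** (- \<beta>) ** adj2 b, b ** (\<alpha> - \<beta>) ** adj2 b)"
    by (simp only: matrix_mul_assoc[symmetric] SL2_cancel(1)[OF SL(1)] mm.minus_left mm.minus_right)
  also have "\<dots> = Ad (snd (f x)) (rot1 (frame S f w x))"
    by (simp add: Ad_def rot1_def ab \<alpha>_def \<beta>_def)
  finally show ?thesis .
qed

text \<open>An isometry that is compatible with the complex structure preserves the whole situation. It is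
  verified in terms of frames, where it amounts to \<open>Bt_rot1\<close> and the invariance of all forms under \<open>rot1\<close> and
  conjugation.\<close>

lemma (in frame_chart) frame_chart_rho: "frame_chart V (\<lambda>y. rho (f y))"
proof -
  let ?f = "\<lambda>y. rho (f y)"
  have fr: "frame V ?f w x = Ad (snd (f x)) (rot1 (X w x))" if "x \<in> V" for w x
    by (rule frame_rho[OF that UNIV_I])
  have b: "snd (f x) \<in> SL2" if "x \<in> V" for x using SL2xSL2_D[OF f_in[OF that]] by blast
  have dfr: "dframe V ?f w v x = Ad (snd (f x)) (rot1 (dX w v x) + pair_ad (snd (X v x)) (rot1 (X w x)))"
    if x: "x \<in> V" for w v x
  proof -
    have s: "smooth_on V (\<lambda>y. rot1 (X w y))"
      by (rule smooth_on_bounded_linear_compose[OF bounded_linear_rot1 smooth_X])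
    have "smooth_on V (\<lambda>y. Ad (snd (f y)) (rot1 (X w y)))"
      unfolding Ad_def by (intro smooth_intros smooth s)
    then have "dframe V ?f w v x = differential V (\<lambda>y. Ad (snd (f y)) (rot1 (X w y))) x v"
      by (intro differential_cong[OF td[OF x] x, symmetric]) (simp_all add: fr)
    moreover have "differential V (\<lambda>y. snd (f y) ** Z y ** adj2 (snd (f y))) x v =
      snd (f x) ** (differential V Z x v + br (snd (X v x)) (Z x)) ** adj2 (snd (f x))" if Z: "smooth_on V Z" for Z
    proof -
      let ?b = "snd (f x)" and ?\<beta> = "snd (X v x)"
      have sl: "?\<beta> \<in> sl2" using X_sl2[OF x] by (auto simp: mem_Times_iff)
      have "differential V f x v = lift (f x) (X v x)" unfolding frame_def using f_in[OF x] by simp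
      then have db: "differential V (\<lambda>y. snd (f y)) x v = ?b ** ?\<beta>"
        using differential_linear[OF bounded_linear_snd td[OF x] x smooth] by (simp add: lift_def)
      have sb: "smooth_on V (\<lambda>y. snd (f y))" "smooth_on V (\<lambda>y. adj2 (snd (f y)))" by (intro smooth_intros smooth)+
      have dab: "differential V (\<lambda>y. adj2 (snd (f y))) x v = - (?\<beta> ** adj2 ?b)"
        using differential_linear[OF bounded_linear_adj2 td[OF x] x sb(1)] db
        by (simp add: adj2_matrix_mult sl2_adj2[OF sl] mm.minus_left)
      show ?thesis
        unfolding differential_bilinear[OF bounded_bilinear_matrix_mult td[OF x] x smooth_on_mm[OF sb(1) Z] sb(2)]
          differential_bilinear[OF bounded_bilinear_matrix_mult td[OF x] x sb(1) Z] db dab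
        by (simp add: br_def mm.add_left mm.add_right mm.diff_left mm.diff_right mm.minus_right matrix_mul_assoc)
    qed
    note conj = this
    have "differential V (\<lambda>y. Ad (snd (f y)) (rot1 (X w y))) x v =
      Ad (snd (f x)) (rot1 (dX w v x) + pair_ad (snd (X v x)) (rot1 (X w x)))"
    proof (rule prod_eqI)
      have sA: "smooth_on V (\<lambda>y. Ad (snd (f y)) (rot1 (X w y)))"
        unfolding Ad_def by (intro smooth_intros smooth s)
      have dr: "differential V (\<lambda>y. rot1 (X w y)) x v = rot1 (dX w v x)"
        by (rule differential_linear[OF bounded_linear_rot1 td[OF x] x smooth_X])
      show "fst (differential V (\<lambda>y. Ad (snd (f y)) (rot1 (X w y))) x v) =
        fst (Ad (snd (f x)) (rot1 (dX w v x) + pair_ad (snd (X v x)) (rot1 (X w x))))"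
        using differential_linear[OF bounded_linear_fst td[OF x] x sA] conj[OF smooth_on_fst[OF s]]
          differential_linear[OF bounded_linear_fst td[OF x] x s] dr
        by (simp add: Ad_def pair_ad_def)
      show "snd (differential V (\<lambda>y. Ad (snd (f y)) (rot1 (X w y))) x v) =
        snd (Ad (snd (f x)) (rot1 (dX w v x) + pair_ad (snd (X v x)) (rot1 (X w x))))"
        using differential_linear[OF bounded_linear_snd td[OF x] x sA] conj[OF smooth_on_snd[OF s]]
          differential_linear[OF bounded_linear_snd td[OF x] x s] dr
        by (simp add: Ad_def pair_ad_def)
    qed
    ultimately show ?thesis by simp
  qed
  show ?thesis
  proof
    show "open V" by (rule open_V)
    show "smooth_on V ?f" by (rule smooth_on_rho[OF smooth])
    show "?f ` V \<subseteq> SL2xSL2" using into by (auto intro!: rho_in)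
    show "om (frame V ?f v x) (frame V ?f w x) = 0" if x: "x \<in> V" for x v w
      using isotropic[OF x] by (simp add: fr[OF x] Ad_simps(1)[OF b[OF x]] om_rot1)
    show "\<exists>w. Y = frame V ?f w x" if x: "x \<in> V" and Y: "Y \<in> sl2sq" "\<And>w. om Y (frame V ?f w x) = 0" for x Y
    proof -
      let ?Y = "rot1 (rot1 (Ad (adj2 (snd (f x))) Y))"
      have Ysl: "?Y \<in> sl2sq" using Ad_simps(3)[of "adj2 (snd (f x))"] b[OF x] Y(1) by (intro rot1_in) auto
      have Yom: "om ?Y (X w x) = 0" for w
      proof -
        have "om ?Y (X w x) = om (rot1 ?Y) (rot1 (X w x))" by (simp only: om_rot1)
        also have "\<dots> = om (Ad (adj2 (snd (f x))) Y) (rot1 (X w x))" by (simp only: rot1_cubed)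
        also have "\<dots> = om Y (Ad (snd (f x)) (rot1 (X w x)))"
          using Ad_simps(1)[OF b[OF x], of "Ad (adj2 (snd (f x))) Y"] by (simp only: Ad_simps(5)[OF b[OF x]])
        finally show ?thesis using Y(2)[of w] by (simp only: fr[OF x])
      qed
      obtain w where w: "?Y = X w x" using maximal[OF x Ysl Yom] by (rule exE)
      have "Ad (snd (f x)) (rot1 ?Y) = Y" by (simp only: rot1_cubed Ad_simps(5)[OF b[OF x]])
      then have "Y = frame V ?f w x" unfolding w fr[OF x] by (rule sym)
      then show ?thesis by (rule exI)
    qed
    show "v = 0" if x: "x \<in> V" and v: "\<And>w. gq (frame V ?f v x) (frame V ?f w x) = 0" for x v
      using v by (intro nondegenerate[OF x]) (simp add: fr[OF x] Ad_simps(2)[OF b[OF x]] gq_rot1)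
    show "om (dframe V ?f w v x + Bt (frame V ?f v x) (frame V ?f w x)) (frame V ?f u x) = 0" if x: "x \<in> V" for x u v w
    proof -
      have "dframe V ?f w v x + Bt (frame V ?f v x) (frame V ?f w x) =
        Ad (snd (f x)) (rot1 (dX w v x) + (pair_ad (snd (X v x)) (rot1 (X w x)) + Bt (rot1 (X v x)) (rot1 (X w x))))"
        by (simp only: dfr[OF x] fr[OF x] Ad_simps(4)[OF b[OF x]] Ad_simps(7)[OF b[OF x]] add.assoc)
      also have "\<dots> = Ad (snd (f x)) (rot1 (dX w v x + Bt (X v x) (X w x)))"
        unfolding Bt_rot1 by (simp add: linear_add[OF bounded_linear.linear[OF bounded_linear_rot1]])
      finally show ?thesis
        using geodesic[OF x] by (simp add: fr[OF x] Ad_simps(1)[OF b[OF x]] om_rot1)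
    qed
  qed
qed


section \<open>Local structure of totally geodesic Lagrangian immersions\<close>

lemma closed_cubic_rel: "closed {z. cubic_rel j t (fst z) (fst (snd z)) (snd (snd z))}"
  unfolding cubic_rel_def
  by (cases t; cases "j = 0"; cases "j = 1"; simp; intro closed_Collect_conj closed_Collect_eq continuous_intros)

lemma eventually_not_cubic_rel:
  assumes "(p \<longlongrightarrow> p0) F" "(m \<longlongrightarrow> m0) F" "(q \<longlongrightarrow> q0) F" "\<not> cubic_rel j t p0 m0 q0"
  shows "\<forall>\<^sub>F x in F. \<not> cubic_rel j t (p x) (m x) (q x)"
proof -
  have "((\<lambda>x. (p x, m x, q x)) \<longlongrightarrow> (p0, m0, q0)) F" by (intro tendsto_Pair assms(1-3))
  from topological_tendstoD[OF this open_Compl[OF closed_cubic_rel[of j t]]] assms(4) show ?thesis by simp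
qed

text \<open>The flag \<open>t\<close> is the one of \<open>cubic_rel\<close>: true for the axis type.\<close>

definition has_type :: "nat \<Rightarrow> bool \<Rightarrow> (mat2 \<times> mat2) set \<Rightarrow> bool" where
  "has_type j t L \<longleftrightarrow> (if t then \<exists>e. axis_type j e L else factor_type j L)"

lemma cubic_rel_has_type:
  assumes "has_type j t L" "j < 3" "X \<in> L" "Y \<in> L" "Z \<in> L" "L \<subseteq> sl2sq"
  shows "cubic_rel j t (vol30 X Y Z) (vol21 X Y Z) (vol03 X Y Z)"
  using assms cubic_rel_factor[of j L X Y Z] cubic_rel_axis[of j _ L X Y Z] by (cases t) (auto simp: has_type_def)

lemma differential_constant_near:
  assumes "open V" "open W" "x \<in> W" "W \<subseteq> V" "\<And>y. y \<in> W \<Longrightarrow> g y = c"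
  shows "differential V g x v = 0"
proof -
  have "at x within V = at x within W"
    using at_within_open[OF subsetD[OF assms(4,3)] assms(1)] at_within_open[OF assms(3,2)] by simp
  then show ?thesis using differential_constant[OF tangent_dir_open[OF assms(2,3)] assms(3,5)] by simp
qed

lemma constant_on_ball:
  fixes g :: "'a::real_normed_vector \<Rightarrow> 'b::real_normed_vector"
  assumes "\<And>x. x \<in> ball x0 r \<Longrightarrow> (g has_derivative D x) (at x)" "\<And>x v. x \<in> ball x0 r \<Longrightarrow> D x v = 0"
  shows "\<exists>c. \<forall>x\<in>ball x0 r. g x = c"
proof (rule has_derivative_zero_constant)
  fix x assume x: "x \<in> ball x0 r"
  have "D x = (\<lambda>v. 0)" using assms(2)[OF x] by blast
  then show "(g has_derivative (\<lambda>v. 0)) (at x within ball x0 r)"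
    using has_derivative_at_withinI[OF assms(1)[OF x]] by simp
qed simp

context frame_chart begin

lemma type_at: assumes "x \<in> V" shows "\<exists>j<3. \<exists>t. has_type j t (L x)"
proof -
  interpret I: invariant_lagrangian "L x" by (rule invariant_lagrangian_L[OF assms])
  obtain j where "j < 3" "factor_type j (L x) \<or> (\<exists>e. axis_type j e (L x))" using I.factor_or_axis_type by blast
  then have "has_type j False (L x) \<or> has_type j True (L x)" by (simp add: has_type_def)
  then show ?thesis using \<open>j < 3\<close> by blast
qed

lemma L_sl2: "x \<in> V \<Longrightarrow> L x \<subseteq> sl2sq"
  using X_sl2 unfolding L_def by blast

lemma type_unique:
  assumes "x \<in> V" "has_type j t (L x)" "has_type j' t' (L x)" "j < 3" "j' < 3"
  shows "j = j' \<and> t = t'"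
proof -
  interpret I: invariant_lagrangian "L x" by (rule invariant_lagrangian_L[OF assms(1)])
  have "factor_type j (L x) \<or> (\<exists>e. axis_type j e (L x))" using assms(2) by (auto simp: has_type_def split: if_splits)
  then obtain Y1 Y2 Y3 where Y: "Y1 \<in> L x" "Y2 \<in> L x" "Y3 \<in> L x"
    "vol30 Y1 Y2 Y3 \<noteq> 0 \<or> vol21 Y1 Y2 Y3 \<noteq> 0 \<or> vol03 Y1 Y2 Y3 \<noteq> 0"
    using I.ex_cubic_nonzero[OF assms(4)] by metis
  show ?thesis
    by (rule cubic_rel_unique[OF cubic_rel_has_type[OF assms(2,4) Y(1-3) L_sl2[OF assms(1)]]
        cubic_rel_has_type[OF assms(3,5) Y(1-3) L_sl2[OF assms(1)]] assms(4,5) Y(4)])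
qed

text \<open>The cubic form is nonzero at \<open>x0\<close> on three elements of the frame, so that there it violates the
  conditions of all other types, and by continuity it does so at nearby points.\<close>

lemma type_near:
  assumes x0: "x0 \<in> V" and j: "j < 3" and t: "has_type j t (L x0)"
  shows "\<exists>r>0. ball x0 r \<subseteq> V \<and> (\<forall>x\<in>ball x0 r. has_type j t (L x))"
proof -
  interpret I: invariant_lagrangian "L x0" by (rule invariant_lagrangian_L[OF x0])
  have "factor_type j (L x0) \<or> (\<exists>e. axis_type j e (L x0))" using t by (auto simp: has_type_def split: if_splits)
  then obtain Y1 Y2 Y3 where Y: "Y1 \<in> L x0" "Y2 \<in> L x0" "Y3 \<in> L x0"
    "vol30 Y1 Y2 Y3 \<noteq> 0 \<or> vol21 Y1 Y2 Y3 \<noteq> 0 \<or> vol03 Y1 Y2 Y3 \<noteq> 0"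
    using I.ex_cubic_nonzero[OF j] by metis
  then obtain u1 u2 u3 where u: "Y1 = X u1 x0" "Y2 = X u2 x0" "Y3 = X u3 x0" unfolding L_def by blast
  define p m q where "p x = vol30 (X u1 x) (X u2 x) (X u3 x)" and "m x = vol21 (X u1 x) (X u2 x) (X u3 x)"
    and "q x = vol03 (X u1 x) (X u2 x) (X u3 x)" for x
  have rel: "cubic_rel j' t' (p x) (m x) (q x)" if "x \<in> V" "j' < 3" "has_type j' t' (L x)" for x j' t'
    unfolding p_def m_def q_def by (rule cubic_rel_has_type[OF that(3,2) X_in_L X_in_L X_in_L L_sl2[OF that(1)]])
  have cX: "(X u \<longlongrightarrow> X u x0) (nhds x0)" for u
  proof -
    have "isCont (X u) x0" using smooth_on_imp_continuous_on[OF smooth_X] open_V x0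
      by (simp add: continuous_on_eq_continuous_at)
    then show ?thesis unfolding isCont_def tendsto_at_iff_tendsto_nhds .
  qed
  note tl = bounded_bilinear.tendsto[OF bounded_bilinear_mat2_inner] bounded_bilinear.tendsto[OF bounded_bilinear_br]
    tendsto_fst tendsto_snd tendsto_add cX
  have lim: "(p \<longlongrightarrow> p x0) (nhds x0)" "(m \<longlongrightarrow> m x0) (nhds x0)" "(q \<longlongrightarrow> q x0) (nhds x0)"
    unfolding p_def m_def q_def vol30_def vol21_def vol03_def vol_def by (intro tl)+
  have "\<forall>\<^sub>F x in nhds x0. \<not> cubic_rel (fst k) (snd k) (p x) (m x) (q x)"
    if k: "k \<in> {..<3} \<times> UNIV - {(j, t)}" for k
  proof (rule eventually_not_cubic_rel[OF lim])
    show "\<not> cubic_rel (fst k) (snd k) (p x0) (m x0) (q x0)"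
      using cubic_rel_unique[OF rel[OF x0 j t], of "fst k" "snd k"] k j Y(4) u by (auto simp: p_def m_def q_def)
  qed
  then have "\<forall>\<^sub>F x in nhds x0. \<forall>k\<in>{..<3} \<times> UNIV - {(j, t)}. \<not> cubic_rel (fst k) (snd k) (p x) (m x) (q x)"
    by (intro eventually_ball_finite) auto
  moreover have "\<forall>\<^sub>F x in nhds x0. x \<in> V" by (rule eventually_nhds_in_open[OF open_V x0])
  ultimately have "\<forall>\<^sub>F x in nhds x0. x \<in> V \<and> has_type j t (L x)"
  proof (eventually_elim)
    case (elim x)
    obtain j' t' where jt: "j' < 3" "has_type j' t' (L x)" using type_at[OF elim(2)] by blast
    have "(j', t') = (j, t)"
    proof (rule ccontr)
      assume "(j', t') \<noteq> (j, t)"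
      then have "(j', t') \<in> {..<3} \<times> UNIV - {(j, t)}" using jt(1) by simp
      from bspec[OF elim(1) this] show False using rel[OF elim(2) jt] by simp
    qed
    then show ?case using jt(2) elim(2) by simp
  qed
  then obtain r where "r > 0" "\<And>x. dist x x0 < r \<Longrightarrow> x \<in> V \<and> has_type j t (L x)"
    unfolding eventually_nhds_metric by blast
  then show ?thesis by (intro exI[of _ r]) (auto simp: dist_commute)
qed

lemma df_eq: "x \<in> V \<Longrightarrow> differential V f x v = lift (f x) (X v x)"
  unfolding frame_def using f_in by simp

lemma d_fst: "x \<in> V \<Longrightarrow> differential V (\<lambda>y. fst (f y)) x v = fst (f x) ** fst (X v x)"
  and d_snd: "x \<in> V \<Longrightarrow> differential V (\<lambda>y. snd (f y)) x v = snd (f x) ** snd (X v x)"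
  using differential_linear[OF bounded_linear_fst td _ smooth] differential_linear[OF bounded_linear_snd td _ smooth]
  by (simp_all add: df_eq lift_def)

lemma has_derivative_at_V: "smooth_on V g \<Longrightarrow> x \<in> V \<Longrightarrow> (g has_derivative differential V g x) (at x)"
  using smooth_on_has_derivative[of V g x] at_within_open[OF _ open_V, of x] by simp

lemma factor_ball:
  assumes "ball x0 r \<subseteq> V" "\<And>x. x \<in> ball x0 r \<Longrightarrow> factor_type 0 (L x)"
  shows "\<exists>c. \<forall>x\<in>ball x0 r. fst (f x) = c"
proof (rule constant_on_ball)
  fix x v assume x: "x \<in> ball x0 r"
  then have xV: "x \<in> V" using assms(1) by blast
  show "((\<lambda>y. fst (f y)) has_derivative differential V (\<lambda>y. fst (f y)) x) (at x)"
    by (rule has_derivative_at_V[OF smooth_on_fst[OF smooth] xV])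
  have "fst (X v x) = 0" using assms(2)[OF x] X_in_L[of v x] by (simp add: factor_type_def)
  then show "differential V (\<lambda>y. fst (f y)) x v = 0" by (simp add: d_fst[OF xV] mm.zero_right)
qed

text \<open>For a half turn about \<open>e\<close>, the vector \<open>\<alpha> + \<beta>\<close> is proportional to \<open>e\<close>. This turns the unknown axis
  into the smooth vector field \<open>S = sum_part (X v0)\<close>. As \<open>L\<close> is parallel and vectors on one axis
  commute, the derivative of \<open>S\<close> is proportional to \<open>S\<close>, so that its direction is constant. With a fixed axis, \<open>b e (inverse a)\<close>
  has derivative \<open>b (\<beta> e - e \<alpha>) (inverse a) = 0\<close>.\<close>

lemma axis_ball:
  assumes x0: "ball x0 r \<subseteq> V" "r > 0" and ax: "\<And>x. x \<in> ball x0 r \<Longrightarrow> \<exists>e. axis_type 0 e (L x)"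
  shows "\<exists>r'>0. r' \<le> r \<and> (\<exists>c e. e \<in> sl2 \<and> mat2_inner e e \<noteq> 0 \<and> (\<forall>x\<in>ball x0 r'. snd (f x) ** e = c ** fst (f x)))"
proof -
  have x0V: "x0 \<in> V" using x0 by auto
  obtain e0 where e0: "axis_type 0 e0 (L x0)" using ax[of x0] x0(2) by auto
  have e0': "e0 \<in> sl2" "mat2_inner e0 e0 \<noteq> 0" using e0 by (auto simp: axis_type_def)
  interpret I: invariant_lagrangian "L x0" by (rule invariant_lagrangian_L[OF x0V])
  have "\<exists>Y\<in>L x0. (rot1 ^^ 0) Y = (mat2_inner e0 e0 *\<^sub>R e0, e0 ** e0 ** e0)"
    by (rule I.axis_type_surj[OF e0 _ e0'(1)]) simp
  moreover have "e0 ** e0 = mat2_inner e0 e0 *\<^sub>R mat 1"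
    by (rule sl2_exhaust[OF e0'(1)]) (simp add: one_mat2 algebra_simps)
  ultimately obtain v0 where v0: "X v0 x0 = (mat2_inner e0 e0 *\<^sub>R e0, mat2_inner e0 e0 *\<^sub>R e0)"
    unfolding L_def by auto
  define S where "S y = sum_part (X v0 y)" for y
  have Sx0: "S x0 = (2 * mat2_inner e0 e0) *\<^sub>R e0" by (simp add: S_def sum_part_def v0 flip: scaleR_add_left)
  have "e0 \<noteq> 0" using e0'(2) by (auto simp: ip_simps)
  then have "S x0 \<noteq> 0" unfolding Sx0 using e0'(2) by simp
  then obtain i k where ik: "S x0 $ i $ k \<noteq> 0" by (metis vec_eq_iff zero_index)
  \<comment> \<open>Dividing \<open>S\<close> by a nonvanishing matrix entry normalizes its length without a choice of sign.\<close>
  define l where "l y = S y $ i $ k" for y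
  have sS: "smooth_on V S" unfolding S_def by (rule smooth_on_bounded_linear_compose[OF bounded_linear_sum_part smooth_X])
  have bl: "bounded_linear (\<lambda>A::mat2. A $ i $ k)"
    using bounded_linear_compose[OF bounded_linear_vec_nth bounded_linear_vec_nth] .
  have sl: "smooth_on V l" unfolding l_def by (rule smooth_on_bounded_linear_compose[OF bl sS])
  have "open (V \<inter> l -` (- {0}))"
    by (rule continuous_open_preimage[OF smooth_on_imp_continuous_on[OF sl] open_V]) (simp add: open_Compl)
  moreover have "x0 \<in> V \<inter> l -` (- {0})" using x0V ik by (simp add: l_def)
  ultimately obtain r1 where r1: "r1 > 0" "ball x0 r1 \<subseteq> V \<inter> l -` (- {0})" using open_contains_ball by blast
  define r' where "r' = min r r1"
  have r': "r' > 0" "r' \<le> r" using x0(2) r1(1) by (auto simp: r'_def)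
  have B: "x \<in> V" "l x \<noteq> 0" "x \<in> ball x0 r" if "x \<in> ball x0 r'" for x
    using that r1(2) by (auto simp: r'_def)
  have par: "\<exists>c. sum_part Y = c *\<^sub>R e" if e: "axis_type 0 e (L x)" and x: "x \<in> V" and Y: "Y \<in> L x" for e x Y
  proof -
    have a: "e \<in> sl2" "mat2_inner e e \<noteq> 0" "snd Y ** e = e ** fst Y" using e Y by (auto simp: axis_type_def)
    have "fst Y \<in> sl2" using L_sl2[OF x] Y by (auto simp: mem_Times_iff)
    from reflection_eq[OF a(1) this a(3)]
    have "mat2_inner e e *\<^sub>R sum_part Y = (2 * mat2_inner (fst Y) e) *\<^sub>R e" by (simp add: sum_part_def scaleR_add_right)
    from scaleR_eq_imp_divide[OF a(2) this] show ?thesis by blast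
  qed
  have dS: "\<exists>c. differential V S x v = c *\<^sub>R S x" if x: "x \<in> ball x0 r'" for x v
  proof -
    obtain e where e: "axis_type 0 e (L x)" using ax[OF B(3)[OF x]] by blast
    obtain c where c: "S x = c *\<^sub>R e" unfolding S_def using par[OF e B(1)[OF x] X_in_L] by blast
    obtain c1 where c1: "sum_part (X v x) = c1 *\<^sub>R e" using par[OF e B(1)[OF x] X_in_L] by blast
    obtain c2 where c2: "sum_part (canon v v0 x) = c2 *\<^sub>R e" using par[OF e B(1)[OF x] canon_in_L[OF B(1)[OF x]]] by blast
    have "sum_part (canon v v0 x) = sum_part (dX v0 v x) + (1 / 3) *\<^sub>R br (sum_part (X v x)) (S x)"
      by (simp add: canon_def sum_part_def S_def pair_ad_def br_simps algebra_simps)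
    also have "br (sum_part (X v x)) (S x) = 0" by (simp add: c c1 br_simps)
    finally have "sum_part (dX v0 v x) = c2 *\<^sub>R e" using c2 by simp
    moreover have "differential V S x v = sum_part (dX v0 v x)"
      unfolding S_def by (rule differential_linear[OF bounded_linear_sum_part td[OF B(1)[OF x]] B(1)[OF x] smooth_X])
    moreover have "c \<noteq> 0" using B(2)[OF x] c by (auto simp: l_def)
    ultimately have "differential V S x v = (c2 / c) *\<^sub>R S x" by (simp add: c)
    then show ?thesis by blast
  qed
  have "\<exists>e. \<forall>x\<in>ball x0 r'. inverse (l x) *\<^sub>R S x = e"
  proof (rule constant_on_ball)
    fix x assume x: "x \<in> ball x0 r'"
    have hS: "(S has_derivative differential V S x) (at x)" by (rule has_derivative_at_V[OF sS B(1)[OF x]])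
    have hl: "(l has_derivative (\<lambda>v. differential V S x v $ i $ k)) (at x)"
      unfolding l_def by (rule bounded_linear.has_derivative[OF bl hS])
    show "((\<lambda>x. inverse (l x) *\<^sub>R S x) has_derivative
      (\<lambda>v. inverse (l x) *\<^sub>R differential V S x v + (- (inverse (l x) * (differential V S x v $ i $ k) * inverse (l x))) *\<^sub>R S x)) (at x)"
      by (rule has_derivative_scaleR[OF Deriv.has_derivative_inverse[OF B(2)[OF x] hl] hS])
    fix v
    obtain c where c: "differential V S x v = c *\<^sub>R S x" using dS[OF x] by blast
    have "inverse (l x) * (c * l x) * inverse (l x) = inverse (l x) * c" using B(2)[OF x] by simp
    then show "inverse (l x) *\<^sub>R differential V S x v + (- (inverse (l x) * (differential V S x v $ i $ k) * inverse (l x))) *\<^sub>R S x = 0"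
      unfolding c by (simp add: l_def)
  qed
  then obtain e where e: "\<And>x. x \<in> ball x0 r' \<Longrightarrow> inverse (l x) *\<^sub>R S x = e" by blast
  have ex0: "e = (inverse (l x0) * (2 * mat2_inner e0 e0)) *\<^sub>R e0" using e[of x0] r'(1) by (simp add: Sx0)
  have l0: "l x0 \<noteq> 0" using ik by (simp add: l_def)
  have enn: "e \<in> sl2" "mat2_inner e e \<noteq> 0"
    unfolding ex0 using e0' l0 by (auto simp: ip_simps)
  have rel: "snd (X v x) ** e = e ** fst (X v x)" if x: "x \<in> ball x0 r'" for x v
  proof -
    obtain e' where e': "axis_type 0 e' (L x)" using ax[OF B(3)[OF x]] by blast
    obtain c where "S x = c *\<^sub>R e'" unfolding S_def using par[OF e' B(1)[OF x] X_in_L] by blast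
    then have "e = (inverse (l x) * c) *\<^sub>R e'" using e[OF x] by simp
    moreover have "snd (X v x) ** e' = e' ** fst (X v x)" using e' X_in_L[of v x] by (auto simp: axis_type_def)
    ultimately show ?thesis by (simp add: mm.scaleR_left mm.scaleR_right)
  qed
  have "\<exists>c. \<forall>x\<in>ball x0 r'. snd (f x) ** e ** adj2 (fst (f x)) = c"
  proof (rule constant_on_ball)
    fix x v assume x: "x \<in> ball x0 r'"
    note xV = B(1)[OF x]
    have s: "smooth_on V (\<lambda>y. fst (f y))" "smooth_on V (\<lambda>y. snd (f y))" "smooth_on V (\<lambda>y. adj2 (fst (f y)))"
      "smooth_on V (\<lambda>y. snd (f y) ** e)" by (intro smooth_intros smooth)+
    show "((\<lambda>x. snd (f x) ** e ** adj2 (fst (f x))) has_derivative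
        differential V (\<lambda>x. snd (f x) ** e ** adj2 (fst (f x))) x) (at x)"
      by (intro has_derivative_at_V xV smooth_intros smooth)
    have slx: "fst (X v x) \<in> sl2" using X_sl2[OF xV] by (auto simp: mem_Times_iff)
    have "differential V (\<lambda>x. snd (f x) ** e ** adj2 (fst (f x))) x v =
      snd (f x) ** e ** differential V (\<lambda>y. adj2 (fst (f y))) x v
      + differential V (\<lambda>y. snd (f y) ** e) x v ** adj2 (fst (f x))"
      by (rule differential_bilinear[OF bounded_bilinear_matrix_mult td[OF xV] xV s(4,3)])
    also have "differential V (\<lambda>y. adj2 (fst (f y))) x v = - (fst (X v x) ** adj2 (fst (f x)))"
      using differential_linear[OF bounded_linear_adj2 td[OF xV] xV s(1)]
      by (simp add: d_fst[OF xV] adj2_matrix_mult sl2_adj2[OF slx] mm.minus_left)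
    also have "differential V (\<lambda>y. snd (f y) ** e) x v = snd (f x) ** (snd (X v x) ** e)"
      using differential_linear[OF mm.bounded_linear_left td[OF xV] xV s(2), of e]
      by (simp add: d_snd[OF xV] matrix_mul_assoc)
    finally show "differential V (\<lambda>x. snd (f x) ** e ** adj2 (fst (f x))) x v = 0"
      by (simp add: rel[OF x] mm.minus_right matrix_mul_assoc)
  qed
  then obtain c where c: "\<And>x. x \<in> ball x0 r' \<Longrightarrow> snd (f x) ** e ** adj2 (fst (f x)) = c" by blast
  have "snd (f x) ** e = c ** fst (f x)" if x: "x \<in> ball x0 r'" for x
    using c[OF x] SL2_cancel(4)[OF SL2xSL2_D(1)[OF f_in[OF B(1)[OF x]]], of "snd (f x) ** e"] by simp
  then show ?thesis using r' enn by blast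
qed

end

text \<open>The conjugations that accumulate when \<open>frame_rho\<close> is applied repeatedly.\<close>

primrec hol :: "nat \<Rightarrow> mat2 \<times> mat2 \<Rightarrow> mat2" where
  "hol 0 p = mat 1" | "hol (Suc j) p = snd ((rho ^^ j) p) ** hol j p"

lemma rho_iter_in: "p \<in> SL2xSL2 \<Longrightarrow> (rho ^^ j) p \<in> SL2xSL2"
  by (induction j) (auto intro: rho_in)

lemma hol_SL2: "p \<in> SL2xSL2 \<Longrightarrow> hol j p \<in> SL2"
  by (induction j) (auto intro!: SL2_closed SL2xSL2_D rho_iter_in)

lemma Ad_Ad: "Ad b (Ad c X) = Ad (b ** c) X"
  by (simp add: Ad_def adj2_matrix_mult matrix_mul_assoc)

lemma adj2_one: "adj2 (mat 1) = mat 1" by (simp add: one_mat2)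

lemma Ad_one: "Ad (mat 1) X = X" by (simp add: Ad_def adj2_one)

context frame_chart begin

lemma frame_chart_iter: "frame_chart V (\<lambda>y. (rho ^^ j) (f y))"
proof (induction j)
  case 0
  then show ?case by (simp add: frame_chart_axioms)
next
  case (Suc j)
  then show ?case using frame_chart.frame_chart_rho[OF Suc] by simp
qed

lemma frame_iter: "x \<in> V \<Longrightarrow> frame V (\<lambda>y. (rho ^^ j) (f y)) w x = Ad (hol j (f x)) ((rot1 ^^ j) (X w x))"
proof (induction j)
  case 0
  then show ?case by (simp add: Ad_one)
next
  case (Suc j)
  interpret J: frame_chart V "\<lambda>y. (rho ^^ j) (f y)" by (rule frame_chart_iter)
  have "frame V (\<lambda>y. rho ((rho ^^ j) (f y))) w x = Ad (snd ((rho ^^ j) (f x))) (rot1 (J.X w x))"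
    by (rule J.frame_rho[OF Suc.prems UNIV_I])
  also have "rot1 (J.X w x) = Ad (hol j (f x)) (rot1 ((rot1 ^^ j) (X w x)))"
    using Suc Ad_simps(8)[OF hol_SL2[OF f_in[OF Suc.prems]]] by simp
  finally show ?case by (simp add: Ad_Ad)
qed

lemma factor_type_iter:
  assumes x: "x \<in> V"
  shows "factor_type 0 (frame_chart.L V (\<lambda>y. (rho ^^ j) (f y)) x) \<longleftrightarrow> factor_type j (L x)"
proof -
  interpret J: frame_chart V "\<lambda>y. (rho ^^ j) (f y)" by (rule frame_chart_iter)
  let ?h = "hol j (f x)"
  have h: "?h \<in> SL2" by (rule hol_SL2[OF f_in[OF x]])
  have "?h ** a ** adj2 ?h = 0 \<longleftrightarrow> a = 0" for a
  proof
    assume "?h ** a ** adj2 ?h = 0"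
    then have "adj2 ?h ** (?h ** a ** adj2 ?h) ** ?h = 0" by (simp add: mm.zero_left mm.zero_right)
    then show "a = 0" by (simp only: matrix_mul_assoc SL2_cancel[OF h] matrix_mul_lid)
  qed (simp add: mm.zero_left mm.zero_right)
  then show ?thesis
    by (simp add: factor_type_def J.L_def L_def frame_iter[OF x] Ad_def)
qed

lemma axis_type_iter:
  assumes x: "x \<in> V"
  shows "axis_type 0 e (frame_chart.L V (\<lambda>y. (rho ^^ j) (f y)) x) \<longleftrightarrow>
    axis_type j (adj2 (hol j (f x)) ** e ** hol j (f x)) (L x)"
proof -
  interpret J: frame_chart V "\<lambda>y. (rho ^^ j) (f y)" by (rule frame_chart_iter)
  let ?h = "hol j (f x)"
  have h: "?h \<in> SL2" "adj2 ?h \<in> SL2" using hol_SL2[OF f_in[OF x]] by auto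
  let ?e = "adj2 ?h ** e ** ?h"
  have e: "?h ** ?e ** adj2 ?h = e"
    by (simp only: matrix_mul_assoc SL2_cancel[OF h(1)] matrix_mul_lid)
  have 1: "e \<in> sl2 \<longleftrightarrow> ?e \<in> sl2" using conj_mat2(3)[OF h(2), of e] conj_mat2(3)[OF h(1), of ?e] e by auto
  have 2: "mat2_inner e e = mat2_inner ?e ?e" using conj_mat2(1)[OF h(1), of ?e ?e] e by simp
  have 3: "(?h ** b ** adj2 ?h) ** e = e ** (?h ** a ** adj2 ?h) \<longleftrightarrow> b ** ?e = ?e ** a" for a b
  proof -
    have "(?h ** b ** adj2 ?h) ** e = ?h ** (b ** ?e) ** adj2 ?h"
      by (simp only: matrix_mul_assoc) (simp only: matrix_mul_assoc[symmetric] SL2_cancel[OF h(1)] matrix_mul_rid)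
    moreover have "e ** (?h ** a ** adj2 ?h) = ?h ** (?e ** a) ** adj2 ?h"
      by (simp only: matrix_mul_assoc SL2_cancel[OF h(1)] matrix_mul_lid)
    moreover have "?h ** u ** adj2 ?h = ?h ** v ** adj2 ?h \<longleftrightarrow> u = v" for u v
    proof
      assume "?h ** u ** adj2 ?h = ?h ** v ** adj2 ?h"
      then have "adj2 ?h ** (?h ** u ** adj2 ?h) ** ?h = adj2 ?h ** (?h ** v ** adj2 ?h) ** ?h" by simp
      then show "u = v" by (simp only: matrix_mul_assoc SL2_cancel[OF h(1)] matrix_mul_lid)
    qed simp
    ultimately show ?thesis by simp
  qed
  show ?thesis
    unfolding axis_type_def 1[symmetric] 2[symmetric]
    by (simp add: J.L_def L_def frame_iter[OF x] Ad_def 3)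
qed

end

section \<open>The model submanifolds\<close>

text \<open>These integrate the two types: for \<open>j = 0\<close> they are the subsets \<open>a = c\<close> and \<open>b e = c a\<close>.\<close>

definition model_factor :: "nat \<Rightarrow> mat2 \<Rightarrow> (mat2 \<times> mat2) set" where
  "model_factor j c = {p \<in> SL2xSL2. fst ((rho ^^ j) p) = c}"

definition model_axis :: "nat \<Rightarrow> mat2 \<Rightarrow> mat2 \<Rightarrow> (mat2 \<times> mat2) set" where
  "model_axis j c e = {p \<in> SL2xSL2. snd ((rho ^^ j) p) ** e = c ** fst ((rho ^^ j) p)}"

definition model_submanifold :: "(mat2 \<times> mat2) set \<Rightarrow> bool" where
  "model_submanifold Q \<longleftrightarrow> (\<exists>j<3. (\<exists>c. Q = model_factor j c) \<or>
     (\<exists>c e. e \<in> sl2 \<and> mat2_inner e e \<noteq> 0 \<and> Q = model_axis j c e))"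

context frame_chart begin

lemma local_model:
  assumes x0: "x0 \<in> V"
  shows "\<exists>r>0. ball x0 r \<subseteq> V \<and> (\<exists>Q. model_submanifold Q \<and> f ` ball x0 r \<subseteq> Q)"
proof -
  obtain j t where jt: "j < 3" "has_type j t (L x0)" using type_at[OF x0] by blast
  obtain r where r: "r > 0" "ball x0 r \<subseteq> V" "\<And>x. x \<in> ball x0 r \<Longrightarrow> has_type j t (L x)"
    using type_near[OF x0 jt] by blast
  interpret J: frame_chart V "\<lambda>y. (rho ^^ j) (f y)" by (rule frame_chart_iter)
  show ?thesis
  proof (cases t)
    case False
    then have "factor_type 0 (J.L x)" if "x \<in> ball x0 r" for x
      using r(3)[OF that] factor_type_iter[of x j] r(2) that by (auto simp: has_type_def)
    then obtain c where "\<And>x. x \<in> ball x0 r \<Longrightarrow> fst ((rho ^^ j) (f x)) = c" using J.factor_ball[OF r(2)] by blast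
    then have "f ` ball x0 r \<subseteq> model_factor j c" using r(2) f_in by (auto simp: model_factor_def)
    then show ?thesis using r jt(1) unfolding model_submanifold_def by blast
  next
    case True
    have "\<exists>e. axis_type 0 e (J.L x)" if x: "x \<in> ball x0 r" for x
    proof -
      have xV: "x \<in> V" using r(2) x by blast
      let ?h = "hol j (f x)"
      have h: "?h \<in> SL2" by (rule hol_SL2[OF f_in[OF xV]])
      obtain e where e: "axis_type j e (L x)" using r(3)[OF x] True by (auto simp: has_type_def)
      have "adj2 ?h ** (?h ** e ** adj2 ?h) ** ?h = e"
        by (simp only: matrix_mul_assoc SL2_cancel[OF h] matrix_mul_lid)
      then have "axis_type 0 (?h ** e ** adj2 ?h) (J.L x)" using e axis_type_iter[OF xV, of "?h ** e ** adj2 ?h" j] by simp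
      then show ?thesis by blast
    qed
    from J.axis_ball[OF r(2,1) this] obtain r' c e where r': "r' > 0" "r' \<le> r" "e \<in> sl2" "mat2_inner e e \<noteq> 0"
      "\<And>x. x \<in> ball x0 r' \<Longrightarrow> snd ((rho ^^ j) (f x)) ** e = c ** fst ((rho ^^ j) (f x))" by blast
    have b: "ball x0 r' \<subseteq> V" using r(2) r'(2) by (meson order_trans subset_ball)
    then have "f ` ball x0 r' \<subseteq> model_axis j c e" using r'(5) f_in by (auto simp: model_axis_def)
    then show ?thesis using r' jt(1) b unfolding model_submanifold_def by blast
  qed
qed

text \<open>Together with \<open>axis_type_of_model\<close> this recovers the type of the tangent spaces from the model, by
  differentiating its equation.\<close>

lemma factor_type_of_model:
  assumes W: "open W" "W \<subseteq> V" "x \<in> W" and f: "f ` W \<subseteq> model_factor j c"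
  shows "factor_type j (L x)"
proof -
  interpret J: frame_chart V "\<lambda>y. (rho ^^ j) (f y)" by (rule frame_chart_iter)
  have xV: "x \<in> V" using W by blast
  have a: "fst ((rho ^^ j) (f x)) \<in> SL2" using SL2xSL2_D J.f_in[OF xV] by blast
  have "fst (J.X v x) = 0" for v
  proof -
    have "differential V (\<lambda>y. fst ((rho ^^ j) (f y))) x v = 0"
      using f by (intro differential_constant_near[OF open_V W(1,3,2), of _ c]) (auto simp: model_factor_def)
    then have "adj2 (fst ((rho ^^ j) (f x))) ** (fst ((rho ^^ j) (f x)) ** fst (J.X v x)) = 0"
      by (simp add: J.d_fst[OF xV] mm.zero_right)
    then show ?thesis by (simp only: SL2_cancel(1)[OF a])
  qed
  then have "factor_type 0 (J.L x)" by (auto simp: factor_type_def J.L_def)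
  then show ?thesis using factor_type_iter[OF xV] by blast
qed

lemma axis_type_of_model:
  assumes W: "open W" "W \<subseteq> V" "x \<in> W" and e: "e \<in> sl2" "mat2_inner e e \<noteq> 0" and f: "f ` W \<subseteq> model_axis j c e"
  shows "axis_type j (adj2 (hol j (f x)) ** e ** hol j (f x)) (L x)"
proof -
  interpret J: frame_chart V "\<lambda>y. (rho ^^ j) (f y)" by (rule frame_chart_iter)
  let ?g = "\<lambda>y. (rho ^^ j) (f y)"
  have xV: "x \<in> V" using W by blast
  have b: "snd (?g x) \<in> SL2" using SL2xSL2_D J.f_in[OF xV] by blast
  have "snd (J.X v x) ** e = e ** fst (J.X v x)" for v
  proof -
    have "differential V (\<lambda>y. snd (?g y) ** e - c ** fst (?g y)) x v = 0"
      using f by (intro differential_constant_near[OF open_V W(1,3,2), of _ 0]) (auto simp: model_axis_def)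
    moreover have "differential V (\<lambda>y. snd (?g y) ** e - c ** fst (?g y)) x v =
      differential V (\<lambda>y. snd (?g y)) x v ** e - c ** differential V (\<lambda>y. fst (?g y)) x v"
    proof (rule differential_eq[OF td[OF xV]])
      have h: "((\<lambda>y. snd (?g y)) has_derivative differential V (\<lambda>y. snd (?g y)) x) (at x within V)"
        "((\<lambda>y. fst (?g y)) has_derivative differential V (\<lambda>y. fst (?g y)) x) (at x within V)"
        by (intro smooth_on_has_derivative xV smooth_intros J.smooth)+
      show "((\<lambda>y. snd (?g y) ** e - c ** fst (?g y)) has_derivative
        (\<lambda>v. differential V (\<lambda>y. snd (?g y)) x v ** e - c ** differential V (\<lambda>y. fst (?g y)) x v)) (at x within V)"
        by (intro has_derivative_diff bounded_linear.has_derivative[OF mm.bounded_linear_left h(1)]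
            bounded_linear.has_derivative[OF mm.bounded_linear_right h(2)])
    qed
    ultimately have "snd (?g x) ** (snd (J.X v x) ** e) = (c ** fst (?g x)) ** fst (J.X v x)"
      by (simp add: J.d_fst[OF xV] J.d_snd[OF xV] matrix_mul_assoc)
    also have "c ** fst (?g x) = snd (?g x) ** e" using f W(3) by (auto simp: model_axis_def)
    finally have "adj2 (snd (?g x)) ** (snd (?g x) ** (snd (J.X v x) ** e)) =
      adj2 (snd (?g x)) ** (snd (?g x) ** (e ** fst (J.X v x)))" by (simp add: matrix_mul_assoc)
    then show ?thesis by (simp only: SL2_cancel(1)[OF b])
  qed
  then have "axis_type 0 e (J.L x)" using e by (auto simp: axis_type_def J.L_def)
  then show ?thesis using axis_type_iter[OF xV] by blast
qed

text \<open>One tangent space determines the type and, in the axis case, \<open>e\<close> up to a factor; one point of the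
  image then determines \<open>c\<close>.\<close>

lemma model_unique:
  assumes W: "open W" "W \<subseteq> V" "x \<in> W" and Q: "model_submanifold Q" "f ` W \<subseteq> Q"
    and Q': "model_submanifold Q'" "f ` W \<subseteq> Q'"
  shows "Q = Q'"
proof -
  have xV: "x \<in> V" using W by blast
  have data: "\<exists>j<3. (has_type j False (L x) \<and> Q = model_factor j (fst ((rho ^^ j) (f x)))) \<or>
     (\<exists>e c. has_type j True (L x) \<and> e \<in> sl2 \<and> mat2_inner e e \<noteq> 0 \<and> Q = model_axis j c e \<and>
        axis_type j (adj2 (hol j (f x)) ** e ** hol j (f x)) (L x) \<and> snd ((rho ^^ j) (f x)) ** e = c ** fst ((rho ^^ j) (f x)))"
    if "model_submanifold Q" "f ` W \<subseteq> Q" for Q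
  proof -
    obtain j where j: "j < 3" and c: "(\<exists>c. Q = model_factor j c) \<or>
     (\<exists>c e. e \<in> sl2 \<and> mat2_inner e e \<noteq> 0 \<and> Q = model_axis j c e)" using \<open>model_submanifold Q\<close>
      unfolding model_submanifold_def by blast
    from c show ?thesis
    proof (elim disjE exE conjE)
      fix c assume c: "Q = model_factor j c"
      have "factor_type j (L x)" using that(2) unfolding c by (rule factor_type_of_model[OF W])
      moreover have "c = fst ((rho ^^ j) (f x))" using that(2) W(3) unfolding c by (auto simp: model_factor_def)
      ultimately show ?thesis using j c by (auto simp: has_type_def)
    next
      fix c e assume e: "e \<in> sl2" "mat2_inner e e \<noteq> 0" and c: "Q = model_axis j c e"
      have a: "axis_type j (adj2 (hol j (f x)) ** e ** hol j (f x)) (L x)"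
        using that(2) unfolding c by (rule axis_type_of_model[OF W e])
      moreover have "snd ((rho ^^ j) (f x)) ** e = c ** fst ((rho ^^ j) (f x))"
        using that(2) W(3) unfolding c by (auto simp: model_axis_def)
      moreover have "has_type j True (L x)" using a by (auto simp: has_type_def)
      ultimately show ?thesis using j c e by blast
    qed
  qed
  obtain j where j: "j < 3" and d: "(has_type j False (L x) \<and> Q = model_factor j (fst ((rho ^^ j) (f x)))) \<or>
     (\<exists>e c. has_type j True (L x) \<and> e \<in> sl2 \<and> mat2_inner e e \<noteq> 0 \<and> Q = model_axis j c e \<and>
        axis_type j (adj2 (hol j (f x)) ** e ** hol j (f x)) (L x) \<and> snd ((rho ^^ j) (f x)) ** e = c ** fst ((rho ^^ j) (f x)))"
    using data[OF Q] by blast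
  obtain j' where j': "j' < 3" and d': "(has_type j' False (L x) \<and> Q' = model_factor j' (fst ((rho ^^ j') (f x)))) \<or>
     (\<exists>e c. has_type j' True (L x) \<and> e \<in> sl2 \<and> mat2_inner e e \<noteq> 0 \<and> Q' = model_axis j' c e \<and>
        axis_type j' (adj2 (hol j' (f x)) ** e ** hol j' (f x)) (L x) \<and> snd ((rho ^^ j') (f x)) ** e = c ** fst ((rho ^^ j') (f x)))"
    using data[OF Q'] by blast
  note tu = type_unique[OF xV _ _ j j']
  from d show ?thesis
  proof (elim disjE exE conjE)
    assume t: "has_type j False (L x)" and q: "Q = model_factor j (fst ((rho ^^ j) (f x)))"
    from d' show ?thesis using tu[OF t] q by auto
  next
    fix e c assume t: "has_type j True (L x)" and e: "e \<in> sl2" "mat2_inner e e \<noteq> 0" and q: "Q = model_axis j c e"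
      and a: "axis_type j (adj2 (hol j (f x)) ** e ** hol j (f x)) (L x)"
      and r: "snd ((rho ^^ j) (f x)) ** e = c ** fst ((rho ^^ j) (f x))"
    have "\<not> has_type j' False (L x)" using tu[OF t] by blast
    then obtain e' c' where t': "has_type j' True (L x)" "e' \<in> sl2" "mat2_inner e' e' \<noteq> 0" "Q' = model_axis j' c' e'"
        "axis_type j' (adj2 (hol j' (f x)) ** e' ** hol j' (f x)) (L x)"
        "snd ((rho ^^ j') (f x)) ** e' = c' ** fst ((rho ^^ j') (f x))"
      using d' by blast
    have jj: "j' = j" using tu[OF t t'(1)] by simp
    let ?h = "hol j (f x)"
    have h: "?h \<in> SL2" by (rule hol_SL2[OF f_in[OF xV]])
    interpret I: invariant_lagrangian "L x" by (rule invariant_lagrangian_L[OF xV])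
    obtain s where s: "adj2 ?h ** e' ** ?h = s *\<^sub>R (adj2 ?h ** e ** ?h)"
      using I.axis_unique[OF a t'(5)[unfolded jj] j] by blast
    have cc: "?h ** (adj2 ?h ** u ** ?h) ** adj2 ?h = u" for u
      by (simp only: matrix_mul_assoc SL2_cancel[OF h] matrix_mul_lid)
    have "?h ** (adj2 ?h ** e' ** ?h) ** adj2 ?h = s *\<^sub>R (?h ** (adj2 ?h ** e ** ?h) ** adj2 ?h)"
      unfolding s by (simp only: mm.scaleR_left mm.scaleR_right)
    then have e': "e' = s *\<^sub>R e" unfolding cc .
    have s0: "s \<noteq> 0" using t'(3) by (auto simp: e' ip_simps)
    have q1: "fst ((rho ^^ j) (f x)) \<in> SL2" using SL2xSL2_D rho_iter_in f_in[OF xV] by blast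
    have "c' ** fst ((rho ^^ j) (f x)) = (s *\<^sub>R c) ** fst ((rho ^^ j) (f x))"
      using t'(6) r unfolding jj e' by (simp add: mm.scaleR_left mm.scaleR_right)
    then have "c' ** fst ((rho ^^ j) (f x)) ** adj2 (fst ((rho ^^ j) (f x))) =
      (s *\<^sub>R c) ** fst ((rho ^^ j) (f x)) ** adj2 (fst ((rho ^^ j) (f x)))" by simp
    then have c': "c' = s *\<^sub>R c" by (simp only: SL2_cancel(3)[OF q1])
    show ?thesis unfolding q t'(4) jj e' c' model_axis_def
      using s0 by (simp add: mm.scaleR_left mm.scaleR_right)
  qed
qed

end


section \<open>Isometries\<close>

lemma differential_chain:
  assumes "tangent_dir S x v" "x \<in> S" "smooth_on S f" "smooth_on T g" "f ` S \<subseteq> T"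
  shows "differential S (\<lambda>y. g (f y)) x v = differential T g (f x) (differential S f x v)"
proof (rule differential_eq[OF assms(1)])
  have "f x \<in> T" using assms(2,5) by blast
  then have "(g has_derivative differential T g (f x)) (at (f x) within f ` S)"
    using has_derivative_subset[OF smooth_on_has_derivative[OF assms(4)] assms(5)] by blast
  then show "((\<lambda>y. g (f y)) has_derivative (\<lambda>v. differential T g (f x) (differential S f x v))) (at x within S)"
    by (rule has_derivative_in_compose[OF smooth_on_has_derivative[OF assms(3,2)]])
qed

abbreviation isometry :: "(mat2 \<times> mat2 \<Rightarrow> mat2 \<times> mat2) \<Rightarrow> bool" where
  "isometry \<Phi> \<equiv> isometry_of SL2xSL2 T_SL2xSL2 g_NK \<Phi>"

lemma isometry_D:
  assumes "isometry \<Phi>"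
  shows "smooth_on SL2xSL2 \<Phi>" "\<Phi> ` SL2xSL2 = SL2xSL2" "inj_on \<Phi> SL2xSL2"
    "p \<in> SL2xSL2 \<Longrightarrow> \<Phi> p \<in> SL2xSL2"
    "p \<in> SL2xSL2 \<Longrightarrow> v \<in> T_SL2xSL2 p \<Longrightarrow> w \<in> T_SL2xSL2 p \<Longrightarrow>
      g_NK (\<Phi> p) (differential SL2xSL2 \<Phi> p v) (differential SL2xSL2 \<Phi> p w) = g_NK p v w"
  using assms unfolding isometry_of_def bij_betw_def by auto

lemma isometryI:
  assumes "\<And>p. p \<in> SL2xSL2 \<Longrightarrow> \<Phi> p \<in> SL2xSL2" "\<And>p. p \<in> SL2xSL2 \<Longrightarrow> \<Psi> p \<in> SL2xSL2"
    and "\<And>p. p \<in> SL2xSL2 \<Longrightarrow> \<Psi> (\<Phi> p) = p" "\<And>p. p \<in> SL2xSL2 \<Longrightarrow> \<Phi> (\<Psi> p) = p"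
    and "smooth_on SL2xSL2 \<Phi>" "smooth_on SL2xSL2 \<Psi>"
    and gq: "\<And>p v w. p \<in> SL2xSL2 \<Longrightarrow> v \<in> T_SL2xSL2 p \<Longrightarrow> w \<in> T_SL2xSL2 p \<Longrightarrow>
      gq (frame SL2xSL2 \<Phi> v p) (frame SL2xSL2 \<Phi> w p) = gq (lt p v) (lt p w)"
  shows "isometry \<Phi>"
  unfolding isometry_of_def
proof (intro conjI ballI)
  show b: "bij_betw \<Phi> SL2xSL2 SL2xSL2"
    by (rule bij_betw_byWitness[of _ \<Psi>]) (use assms(1-4) in auto)
  have "\<Psi> p = inv_into SL2xSL2 \<Phi> p" if "p \<in> SL2xSL2" for p
    using inv_into_f_f[OF bij_betw_imp_inj_on[OF b] assms(2)[OF that]] assms(4)[OF that] by simp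
  then show "smooth_on SL2xSL2 (inv_into SL2xSL2 \<Phi>)" by (rule smooth_on_cong[OF assms(6)])
  show "smooth_on SL2xSL2 \<Phi>" by fact
  fix p v w assume p: "p \<in> SL2xSL2" "v \<in> T_SL2xSL2 p" "w \<in> T_SL2xSL2 p"
  then show "g_NK (\<Phi> p) (differential SL2xSL2 \<Phi> p v) (differential SL2xSL2 \<Phi> p w) = g_NK p v w"
    using gq[OF p] assms(1) by (simp add: g_NK_eq frame_def)
qed

lemma isometry_compose:
  assumes "isometry \<Phi>" "isometry \<Psi>" shows "isometry (\<lambda>p. \<Psi> (\<Phi> p))"
  unfolding isometry_of_def
proof (intro conjI ballI)
  have b: "bij_betw \<Phi> SL2xSL2 SL2xSL2" "bij_betw \<Psi> SL2xSL2 SL2xSL2"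
    and s: "smooth_on SL2xSL2 (inv_into SL2xSL2 \<Phi>)" "smooth_on SL2xSL2 (inv_into SL2xSL2 \<Psi>)"
    using assms by (auto simp: isometry_of_def)
  show b': "bij_betw (\<lambda>p. \<Psi> (\<Phi> p)) SL2xSL2 SL2xSL2" using bij_betw_trans[OF b] by (simp add: o_def)
  have im: "inv_into SL2xSL2 \<Psi> ` SL2xSL2 \<subseteq> SL2xSL2" "inv_into SL2xSL2 \<Phi> ` SL2xSL2 \<subseteq> SL2xSL2"
    using bij_betw_inv_into[OF b(1)] bij_betw_inv_into[OF b(2)] by (auto simp: bij_betw_def)
  have "smooth_on SL2xSL2 (\<lambda>p. inv_into SL2xSL2 \<Phi> (inv_into SL2xSL2 \<Psi> p))"
    by (rule smooth_on_compose[OF s(2,1) im(1)])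
  then show "smooth_on SL2xSL2 (inv_into SL2xSL2 (\<lambda>p. \<Psi> (\<Phi> p)))"
  proof (rule smooth_on_cong)
    fix p assume p: "p \<in> SL2xSL2"
    let ?q = "inv_into SL2xSL2 \<Phi> (inv_into SL2xSL2 \<Psi> p)"
    have q: "inv_into SL2xSL2 \<Psi> p \<in> SL2xSL2" "?q \<in> SL2xSL2" using im p by blast+
    have "\<Psi> (\<Phi> ?q) = p" using bij_betw_inv_into_right[OF b(1) q(1)] bij_betw_inv_into_right[OF b(2) p] by simp
    then show "?q = inv_into SL2xSL2 (\<lambda>p. \<Psi> (\<Phi> p)) p"
      using inv_into_f_f[OF bij_betw_imp_inj_on[OF b'] q(2)] by simp
  qed
  note P = isometry_D[OF assms(1)] and Q = isometry_D[OF assms(2)]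
  show "smooth_on SL2xSL2 (\<lambda>p. \<Psi> (\<Phi> p))" by (rule smooth_on_compose[OF P(1) Q(1)]) (use P(2) in simp)
  fix p v w assume p: "p \<in> SL2xSL2" and v: "v \<in> T_SL2xSL2 p" and w: "w \<in> T_SL2xSL2 p"
  have c: "differential SL2xSL2 (\<lambda>p. \<Psi> (\<Phi> p)) p v = differential SL2xSL2 \<Psi> (\<Phi> p) (differential SL2xSL2 \<Phi> p v)"
    if "v \<in> T_SL2xSL2 p" for v
    by (rule differential_chain[OF tangent_dir_SL2xSL2[OF p that] p P(1) Q(1)]) (use P(2) in simp)
  have T: "differential SL2xSL2 \<Phi> p v \<in> T_SL2xSL2 (\<Phi> p)" if "v \<in> T_SL2xSL2 p" for v
    by (rule differential_in_T[OF P(1) _ p tangent_dir_SL2xSL2[OF p that]]) (use P(2) in simp)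
  show "g_NK (\<Psi> (\<Phi> p)) (differential SL2xSL2 (\<lambda>p. \<Psi> (\<Phi> p)) p v) (differential SL2xSL2 (\<lambda>p. \<Psi> (\<Phi> p)) p w) = g_NK p v w"
    unfolding c[OF v] c[OF w] using Q(5)[OF P(4)[OF p] T[OF v] T[OF w]] P(5)[OF p v w] by simp
qed

lemma frame_ident: "p \<in> SL2xSL2 \<Longrightarrow> v \<in> T_SL2xSL2 p \<Longrightarrow> frame SL2xSL2 (\<lambda>p. p) v p = lt p v"
  by (simp add: frame_def differential_ident tangent_dir_SL2xSL2)

lemma isometry_ident: "isometry (\<lambda>p. p)"
  by (rule isometryI[where \<Psi> = "\<lambda>p. p"]) (auto simp: smooth_on_id frame_ident)

lemma rho_cubed: assumes "p \<in> SL2xSL2" shows "rho (rho (rho p)) = p"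
  using SL2xSL2_D[OF assms]
  by (simp add: rho_def adj2_matrix_mult prod_eq_iff) (simp only: matrix_mul_assoc SL2_cancel matrix_mul_lid simp_thms)

lemma isometry_rho: "isometry rho"
proof (rule isometryI[where \<Psi> = "\<lambda>p. rho (rho p)"])
  show "smooth_on SL2xSL2 rho" using smooth_on_rho[OF smooth_on_id] .
  show "smooth_on SL2xSL2 (\<lambda>p. rho (rho p))" by (intro smooth_on_rho smooth_on_id)
  fix p v w assume p: "p \<in> SL2xSL2" and v: "v \<in> T_SL2xSL2 p" and w: "w \<in> T_SL2xSL2 p"
  show "gq (frame SL2xSL2 rho v p) (frame SL2xSL2 rho w p) = gq (lt p v) (lt p w)"
    using N.frame_rho[OF p v] N.frame_rho[OF p w] Ad_simps(2)[OF SL2xSL2_D(2)[OF p]]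
    by (simp add: frame_ident[OF p v] frame_ident[OF p w] gq_rot1)
qed (auto intro: rho_in simp: rho_cubed)

lemma isometry_rho_iter: "isometry (\<lambda>p. (rho ^^ j) p)"
proof (induction j)
  case 0
  then show ?case using isometry_ident by simp
next
  case (Suc j)
  then show ?case using isometry_compose[OF Suc isometry_rho] by simp
qed

text \<open>Right translations have to be simultaneous in both components since the metric is only
  left-invariant; it is invariant under the diagonal adjoint action.\<close>

lemma isometry_translation:
  assumes "p \<in> SL2" "q \<in> SL2" "r \<in> SL2"
  shows "isometry (\<lambda>x. (p ** fst x ** r, q ** snd x ** r))" (is "isometry ?\<Phi>")
proof (rule isometryI[where \<Psi> = "\<lambda>x. (adj2 p ** fst x ** adj2 r, adj2 q ** snd x ** adj2 r)"])
  show "smooth_on SL2xSL2 ?\<Phi>" "smooth_on SL2xSL2 (\<lambda>x. (adj2 p ** fst x ** adj2 r, adj2 q ** snd x ** adj2 r))"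
    by (intro smooth_intros)+
  fix x v w assume x: "x \<in> SL2xSL2" and v: "v \<in> T_SL2xSL2 x" and w: "w \<in> T_SL2xSL2 x"
  have bl: "bounded_linear ?\<Phi>"
    by (intro bounded_linear_Pair bounded_linear_compose[OF mm.bounded_linear_left]
        bounded_linear_compose[OF mm.bounded_linear_right] bounded_linear_fst bounded_linear_snd)
  have fr: "frame SL2xSL2 ?\<Phi> v x = Ad (adj2 r) (lt x v)" if v: "v \<in> T_SL2xSL2 x" for v
  proof -
    have d: "differential SL2xSL2 ?\<Phi> x v = ?\<Phi> v"
      by (rule differential_eq[OF tangent_dir_SL2xSL2[OF x v] bounded_linear_imp_has_derivative[OF bl]])
    have "adj2 (u ** a ** r) ** (u ** b ** r) = adj2 r ** (adj2 a ** b) ** r" if "u \<in> SL2" for u a b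
      by (simp only: adj2_matrix_mult matrix_mul_assoc[symmetric] SL2_cancel(1)[OF that])
    then show ?thesis unfolding frame_def d by (simp add: lt_def Ad_def assms(1,2))
  qed
  show "gq (frame SL2xSL2 ?\<Phi> v x) (frame SL2xSL2 ?\<Phi> w x) = gq (lt x v) (lt x w)"
    unfolding fr[OF v] fr[OF w] by (rule Ad_simps(2)[OF SL2_closed(2)[OF assms(3)]])
next
  fix x assume x: "x \<in> SL2xSL2"
  have c: "adj2 u ** (u ** x ** r) ** adj2 r = x" "u ** (adj2 u ** x ** adj2 r) ** r = x" if "u \<in> SL2" for u x
    by (simp_all only: matrix_mul_assoc SL2_cancel(5,6)[OF that] matrix_mul_lid SL2_cancel(3,4)[OF assms(3)])
  show "(adj2 p ** fst (?\<Phi> x) ** adj2 r, adj2 q ** snd (?\<Phi> x) ** adj2 r) = x"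
    "?\<Phi> (adj2 p ** fst x ** adj2 r, adj2 q ** snd x ** adj2 r) = x"
    by (simp_all only: fst_conv snd_conv c[OF assms(1)] c[OF assms(2)] prod.collapse)
qed (use assms in \<open>auto simp: SL2xSL2_def\<close>)

section \<open>Every model submanifold is congruent to one of the three standard ones\<close>

text \<open>Let \<open>D\<close> be the norm of \<open>e\<close>, and \<open>s\<close> a square root of its absolute value. Then \<open>e / s\<close> is a complex or a
  product structure on the plane, conjugate to \<open>mat_i\<close> or to \<open>mat_k\<close>. The sign of \<open>s\<close> is chosen such
  that the conjugating matrix has positive determinant.\<close>

lemma sl2_conjugate_normal_form:
  assumes "e \<in> sl2" "mat2_inner e e \<noteq> 0"
  shows "\<exists>g\<in>SL2. \<exists>s. \<exists>m\<in>{mat_i, mat_k}. s \<noteq> 0 \<and> e ** g = s *\<^sub>R (g ** m)"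
proof -
  obtain x y z where e: "e = mat2 x y z (- x)" using sl2_exhaust[OF assms(1)] .
  define D where "D = x\<^sup>2 + y * z"
  have D: "D \<noteq> 0" using assms(2) by (simp add: e D_def power2_eq_square)
  show ?thesis
  proof (cases "D < 0")
    case True
    have z: "z \<noteq> 0" using True by (auto simp: D_def)
    define s where "s = (if z > 0 then - sqrt (- D) else sqrt (- D))"
    have s: "s \<noteq> 0" "s\<^sup>2 = - D" using True by (auto simp: s_def)
    define x' y' z' where "x' = x / s" and "y' = y / s" and "z' = z / s"
    have z': "z' < 0" using z True by (auto simp: z'_def s_def divide_neg_pos)
    have eq: "x = s * x'" "y = s * y'" "z = s * z'" using s(1) by (simp_all add: x'_def y'_def z'_def)
    have "s\<^sup>2 * (x'\<^sup>2 + y' * z') = D" unfolding D_def eq by (simp add: power2_eq_square algebra_simps)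
    then have "s\<^sup>2 * (x'\<^sup>2 + y' * z' + 1) = 0" using s(2) by (simp add: distrib_left)
    then have d: "x'\<^sup>2 + y' * z' = - 1" using s(1) by simp
    define t where "t = 1 / sqrt (- z')"
    have t: "t * t * (- z') = 1" using z' by (simp add: t_def field_simps flip: real_sqrt_mult)
    \<comment> \<open>The second column is the image of the first one under \<open>- e / s\<close>.\<close>
    let ?g = "mat2 t (- (t * x')) 0 (- (t * z'))"
    have "?g \<in> SL2" using t by (simp add: SL2_def algebra_simps)
    moreover have "e ** ?g = s *\<^sub>R (?g ** mat_i)"
    proof -
      have "x' * (t * x') + y' * (t * z') = t * (x'\<^sup>2 + y' * z')" by (simp add: power2_eq_square algebra_simps)
      then have "x' * (t * x') + y' * (t * z') = - t" using d by simp
      then have "s * (x' * (t * x')) + s * (y' * (t * z')) = - (s * t)" by (metis distrib_left mult_minus_right)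
      then show ?thesis unfolding e eq mat_i_def by (simp add: algebra_simps)
    qed
    ultimately show ?thesis using s(1) by blast
  next
    case False
    then have D: "D > 0" using D by simp
    define s where "s = (if x < 0 then - sqrt D else sqrt D)"
    have s: "s \<noteq> 0" "s\<^sup>2 = D" using D by (auto simp: s_def)
    define x' y' z' where "x' = x / s" and "y' = y / s" and "z' = z / s"
    have x': "x' \<ge> 0" using D by (auto simp: x'_def s_def divide_le_0_iff)
    have eq: "x = s * x'" "y = s * y'" "z = s * z'" using s(1) by (simp_all add: x'_def y'_def z'_def)
    have "s\<^sup>2 * (x'\<^sup>2 + y' * z') = D" unfolding D_def eq by (simp add: power2_eq_square algebra_simps)
    then have d: "x'\<^sup>2 + y' * z' = 1" unfolding s(2) using D by simp
    define t where "t = 1 / sqrt (2 + 2 * x')"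
    have t: "t * t * (2 + 2 * x') = 1" using x' by (simp add: t_def field_simps flip: real_sqrt_mult)
    \<comment> \<open>A multiple of \<open>1 + (e / s) mat_k\<close>, which intertwines the two involutions \<open>e / s\<close> and \<open>mat_k\<close>.\<close>
    let ?g = "mat2 (t * (1 + x')) (- (t * y')) (t * z') (t * (1 + x'))"
    have "det ?g = t * t * (1 + 2 * x' + (x'\<^sup>2 + y' * z'))" by (simp add: power2_eq_square algebra_simps)
    then have "?g \<in> SL2" using t unfolding d by (simp add: SL2_def algebra_simps)
    moreover have "e ** ?g = s *\<^sub>R (?g ** mat_k)"
    proof -
      have 1: "x' * (t * (1 + x')) + y' * (t * z') = t * (1 + x')"
      proof -
        have "x' * (t * (1 + x')) + y' * (t * z') = t * (x' + (x'\<^sup>2 + y' * z'))" by (simp add: power2_eq_square algebra_simps)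
        then show ?thesis unfolding d by simp
      qed
      have 2: "z' * (- (t * y')) + (- x') * (t * (1 + x')) = - (t * (1 + x'))"
      proof -
        have "z' * (- (t * y')) + (- x') * (t * (1 + x')) = - (t * (x' + (x'\<^sup>2 + y' * z')))" by (simp add: power2_eq_square algebra_simps)
        then show ?thesis unfolding d by simp
      qed
      have "mat2 x' y' z' (- x') ** ?g = ?g ** mat_k"
        using 1 2 unfolding mat_k_def by (simp add: algebra_simps)
      moreover have "e = s *\<^sub>R mat2 x' y' z' (- x')" unfolding e eq by simp
      ultimately show ?thesis by (simp only: mm.scaleR_left)
    qed
    ultimately show ?thesis using s(1) by blast
  qed
qed

text \<open>A linear left inverse of the standard map \<open>f\<close>.\<close>

definition std_proj :: "(mat2 \<Rightarrow> mat2 \<times> mat2) \<Rightarrow> mat2 \<times> mat2 \<Rightarrow> mat2" where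
  "std_proj f = (if f = f1 then snd else fst)"

text \<open>After \<open>j\<close> applications of \<open>rho\<close> a translation suffices. For the axis type, right translation by \<open>g\<close>
  replaces \<open>e\<close> by its normal form \<open>m\<close>, and left translation of the second component removes \<open>c\<close>; as \<open>m\<close> is
  its own inverse up to sign, what remains is \<open>b = m a m\<close>.\<close>

lemma model_congruent:
  assumes Q: "model_submanifold Q" "Q \<noteq> {}"
  shows "\<exists>\<Phi>. isometry \<Phi> \<and> (\<exists>f\<in>{f1, f2, f3}. \<Phi> ` Q \<subseteq> f ` SL2)"
proof -
  obtain j where j: "(\<exists>c. Q = model_factor j c) \<or> (\<exists>c e. e \<in> sl2 \<and> mat2_inner e e \<noteq> 0 \<and> Q = model_axis j c e)"
    using Q(1) unfolding model_submanifold_def by blast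
  obtain p0 where p0: "p0 \<in> Q" using Q(2) by blast
  from j show ?thesis
  proof (elim disjE exE conjE)
    fix c assume c: "Q = model_factor j c"
    then have "c \<in> SL2" using p0 rho_iter_in[of p0 j] by (auto simp: model_factor_def SL2xSL2_def)
    define \<Phi> where "\<Phi> p = (adj2 c ** fst ((rho ^^ j) p) ** mat 1, mat 1 ** snd ((rho ^^ j) p) ** mat 1)" for p
    have "isometry \<Phi>" unfolding \<Phi>_def
      using \<open>c \<in> SL2\<close> by (intro isometry_compose[OF isometry_rho_iter isometry_translation]) auto
    moreover have "\<Phi> p \<in> f1 ` SL2" if "p \<in> Q" for p
    proof -
      have "fst ((rho ^^ j) p) = c" "(rho ^^ j) p \<in> SL2xSL2" using that rho_iter_in by (auto simp: c model_factor_def)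
      then have "\<Phi> p = f1 (snd ((rho ^^ j) p))" "snd ((rho ^^ j) p) \<in> SL2"
        using SL2_cancel(5)[OF \<open>c \<in> SL2\<close>] SL2xSL2_D by (simp_all add: \<Phi>_def f1_def del: adj2_mult)
      then show ?thesis by blast
    qed
    ultimately show ?thesis by blast
  next
    fix c e assume e: "e \<in> sl2" "mat2_inner e e \<noteq> 0" and c: "Q = model_axis j c e"
    obtain g s m where g: "g \<in> SL2" "m \<in> {mat_i, mat_k}" "s \<noteq> 0" "e ** g = s *\<^sub>R (g ** m)"
      using sl2_conjugate_normal_form[OF e] by blast
    define d where "d = det m"
    have d: "d * d = 1" "m ** m = (- d) *\<^sub>R mat 1" using g(2) by (auto simp: d_def mat_i_def mat_k_def one_mat2)
    define c1 where "c1 = (1 / s) *\<^sub>R c"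
    have dets: "det (r *\<^sub>R A) = r\<^sup>2 * det A" for r and A :: mat2
      by (cases A rule: mat2_exhaust) (simp add: power2_eq_square algebra_simps)
    have key: "snd q ** g = - d *\<^sub>R (c1 ** (fst q ** g) ** m)" if "q \<in> SL2xSL2" "snd q ** e = c ** fst q" for q
    proof -
      have "s *\<^sub>R (snd q ** g ** m) = (snd q ** e) ** g" using g(4) by (simp add: mm.scaleR_right flip: matrix_mul_assoc)
      also have "\<dots> = s *\<^sub>R (c1 ** (fst q ** g))" unfolding that(2) c1_def using g(3) by (simp add: mm.scaleR_left matrix_mul_assoc)
      finally have "snd q ** g ** m = c1 ** (fst q ** g)" using g(3) by simp
      then have "c1 ** (fst q ** g) ** m = snd q ** g ** (m ** m)" by (simp add: matrix_mul_assoc)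
      then have "- d *\<^sub>R (c1 ** (fst q ** g) ** m) = (- d * - d) *\<^sub>R (snd q ** g)"
        by (simp only: d(2) matrix_mult_scaleR_one scaleR_scaleR)
      then show ?thesis using d(1) by simp
    qed
    \<comment> \<open>Comparing determinants at a point of \<open>Q\<close>; this is where \<open>Q\<close> must not be empty.\<close>
    have dc: "det c1 = d"
    proof -
      have q: "(rho ^^ j) p0 \<in> SL2xSL2" "snd ((rho ^^ j) p0) ** e = c ** fst ((rho ^^ j) p0)"
        using p0 rho_iter_in by (auto simp: c model_axis_def)
      have "det (snd ((rho ^^ j) p0) ** e ** g) = det (c ** fst ((rho ^^ j) p0) ** g)" by (simp add: q(2))
      then have "det (e ** g) = det c" using q(1) g(1) by (simp add: det_mul SL2xSL2_def SL2_def mem_Times_iff)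
      then have "det c = s\<^sup>2 * d" using g(1) by (simp add: g(4) dets det_mul SL2_def d_def)
      then show ?thesis using g(3) by (simp add: c1_def dets power_divide)
    qed
    define q where "q = - (m ** adj2 c1)"
    have neg: "det (- A) = det A" for A :: mat2 by (cases A rule: mat2_exhaust) simp
    have q: "q \<in> SL2" using d(1) dc by (simp add: q_def SL2_def neg det_mul d_def[symmetric])
    define \<Phi> where "\<Phi> p = (mat 1 ** fst ((rho ^^ j) p) ** g, q ** snd ((rho ^^ j) p) ** g)" for p
    have iso: "isometry \<Phi>" unfolding \<Phi>_def
      using q g(1) by (intro isometry_compose[OF isometry_rho_iter isometry_translation]) auto
    have im: "\<exists>v\<in>SL2. \<Phi> p = (v, m ** v ** m)" if p: "p \<in> Q" for p
    proof
      let ?p = "(rho ^^ j) p"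
      let ?v = "fst ?p ** g"
      have P: "?p \<in> SL2xSL2" "snd ?p ** e = c ** fst ?p" using p rho_iter_in by (auto simp: c model_axis_def)
      show "?v \<in> SL2" using P(1) g(1) SL2xSL2_D by blast
      have "q ** snd ?p ** g = q ** (snd ?p ** g)" by (simp add: matrix_mul_assoc)
      also have "\<dots> = d *\<^sub>R (m ** (adj2 c1 ** c1) ** ?v ** m)"
        unfolding key[OF P] q_def by (simp add: mm.minus_left mm.minus_right mm.scaleR_right matrix_mul_assoc del: adj2_mult)
      also have "\<dots> = (d * d) *\<^sub>R (m ** ?v ** m)" by (simp add: dc mm.scaleR_left)
      finally show "\<Phi> p = (?v, m ** ?v ** m)" using d(1) by (simp add: \<Phi>_def)
    qed
    from g(2) consider "m = mat_i" | "m = mat_k" by blast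
    then show ?thesis
    proof cases
      case 1
      then have "\<Phi> ` Q \<subseteq> f2 ` SL2" using im by (fastforce simp: f2_def)
      then show ?thesis using iso by blast
    next
      case 2
      then have "\<Phi> ` Q \<subseteq> f3 ` SL2" using im by (fastforce simp: f3_def)
      then show ?thesis using iso by blast
    qed
  qed
qed

section \<open>Charts of \<open>SL(2,\<real>)\<close>\<close>

text \<open>Three matrix entries are coordinates of \<open>SL2\<close> near \<open>a\<close>: where the last entry of \<open>inverse a u\<close>
  does not vanish, the determinant gives the first one.\<close>

definition chi :: "mat2 \<Rightarrow> mat2 \<Rightarrow> real^3" where
  "chi a u = vector [(adj2 a ** u) $ 1 $ 2, (adj2 a ** u) $ 2 $ 1, (adj2 a ** u) $ 2 $ 2]"

definition chi_dom :: "mat2 \<Rightarrow> mat2 set" where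
  "chi_dom a = {u \<in> SL2. (adj2 a ** u) $ 2 $ 2 > 0}"

definition chi_inv :: "mat2 \<Rightarrow> real^3 \<Rightarrow> mat2" where
  "chi_inv a x = a ** mat2 ((1 + x $ 1 * x $ 2) * inverse (x $ 3)) (x $ 1) (x $ 2) (x $ 3)"

lemma bounded_linear_chi: "bounded_linear (chi a)"
  unfolding linear_conv_bounded_linear[symmetric] chi_def
  by (rule linearI) (simp_all add: mm.add_right mm.scaleR_right vec_eq_iff forall_3)

lemma chi_inv_chi:
  assumes "a \<in> SL2" "u \<in> chi_dom a" shows "chi_inv a (chi a u) = u"
proof -
  obtain p q r s where w: "adj2 a ** u = mat2 p q r s" by (rule mat2_exhaust)
  have "adj2 a ** u \<in> SL2" using assms by (auto simp: chi_dom_def)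
  then have "p * s - q * r = 1" unfolding w by (simp add: SL2_def)
  moreover have "s > 0" using assms(2) w by (simp add: chi_dom_def)
  ultimately have "(1 + q * r) * inverse s = p" by (simp add: field_simps)
  then have "chi_inv a (chi a u) = a ** (adj2 a ** u)" by (simp add: chi_inv_def chi_def w)
  then show ?thesis using SL2_cancel(2)[OF assms(1)] by simp
qed

lemma chi_chi_inv:
  assumes "a \<in> SL2" "x $ 3 > 0" shows "chi a (chi_inv a x) = x" "chi_inv a x \<in> chi_dom a"
proof -
  have e: "adj2 a ** chi_inv a x = mat2 ((1 + x $ 1 * x $ 2) * inverse (x $ 3)) (x $ 1) (x $ 2) (x $ 3)"
    unfolding chi_inv_def by (rule SL2_cancel(1)[OF assms(1)])
  show "chi a (chi_inv a x) = x" unfolding chi_def e by (simp add: vec_eq_iff forall_3)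
  have "chi_inv a x \<in> SL2" unfolding chi_inv_def using assms
    by (intro SL2_closed) (simp_all add: SL2_def field_simps)
  then show "chi_inv a x \<in> chi_dom a" unfolding chi_dom_def e using assms by (simp add: e)
qed

lemma continuous_on_chi_entry: "continuous_on UNIV (\<lambda>u :: mat2. (adj2 a ** u) $ 2 $ 2)"
  by (intro linear_continuous_on bounded_linear_compose[OF bounded_linear_vec_nth]
      bounded_linear_compose[OF bounded_linear_vec_nth mm.bounded_linear_right])

lemma openin_chi_dom: "openin (top_of_set SL2) (chi_dom a)"
proof -
  have "open {u :: mat2. 0 < (adj2 a ** u) $ 2 $ 2}" using open_Collect_less[OF continuous_on_const continuous_on_chi_entry] .
  moreover have "chi_dom a = SL2 \<inter> {u :: mat2. 0 < (adj2 a ** u) $ 2 $ 2}" by (auto simp: chi_dom_def)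
  ultimately show ?thesis by (simp add: openin_open_Int)
qed

lemma chi_inj_tangent:
  assumes "a \<in> SL2" "adj2 a ** v \<in> sl2" "chi a v = 0" shows "v = 0"
proof -
  obtain x y z where w: "adj2 a ** v = mat2 x y z (- x)" using sl2_exhaust[OF assms(2)] .
  have "y = 0 \<and> z = 0 \<and> x = 0" using assms(3) unfolding chi_def w by (simp add: vec_eq_iff forall_3)
  then have "adj2 a ** v = 0" by (simp add: w)
  then have "a ** (adj2 a ** v) = 0" by (simp add: mm.zero_right)
  then show ?thesis using SL2_cancel(2)[OF assms(1)] by simp
qed

section \<open>The global classification\<close>

text \<open>The last two conclusions make a chart usable without reference to subspace topologies.\<close>

lemma manifold_chart:
  assumes "smooth_manifold M A" "m \<in> topspace M"
  obtains U \<phi> where "(U, \<phi>) \<in> A" "m \<in> U" "openin M U" "open (\<phi> ` U)" "inj_on \<phi> U"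
    "\<And>B. open B \<Longrightarrow> openin M {y \<in> U. \<phi> y \<in> B}" "\<And>W. openin M W \<Longrightarrow> W \<subseteq> U \<Longrightarrow> open (\<phi> ` W)"
proof -
  have "m \<in> (\<Union>(U, \<phi>)\<in>A. U)" using assms unfolding smooth_manifold_def by blast
  then obtain U \<phi> where c: "(U, \<phi>) \<in> A" "m \<in> U" by auto
  then have ch: "is_chart M (U, \<phi>)" using assms by (auto simp: smooth_manifold_def)
  have U: "openin M U" "open (\<phi> ` U)" and h: "homeomorphic_map (subtopology M U) (top_of_set (\<phi> ` U)) \<phi>"
    using ch by (auto simp: is_chart_def)
  have ts: "topspace (subtopology M U) = U" using openin_subset[OF U(1)] by (simp add: Int_absorb1)
  have inj: "inj_on \<phi> U" using homeomorphic_imp_injective_map[OF h] unfolding ts .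
  have o1: "openin M {y \<in> U. \<phi> y \<in> B}" if "open B" for B
  proof -
    have "openin (top_of_set (\<phi> ` U)) (\<phi> ` U \<inter> B)" using that by (simp add: openin_open_Int)
    from openin_continuous_map_preimage[OF homeomorphic_imp_continuous_map[OF h] this]
    have "openin (subtopology M U) {y \<in> U. \<phi> y \<in> \<phi> ` U \<inter> B}" by (simp only: ts)
    moreover have "{y \<in> U. \<phi> y \<in> \<phi> ` U \<inter> B} = {y \<in> U. \<phi> y \<in> B}" by auto
    ultimately show ?thesis using openin_trans_full[OF _ U(1)] by simp
  qed
  have o2: "open (\<phi> ` W)" if "openin M W" "W \<subseteq> U" for W
  proof -
    have "openin (subtopology M U) W" using that by (simp add: openin_open_subtopology[OF U(1)])
    then have "openin (top_of_set (\<phi> ` U)) (\<phi> ` W)" using homeomorphic_imp_open_map[OF h] by (simp add: open_map_def)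
    then show ?thesis using U(2) openin_open_eq by blast
  qed
  show thesis using that[OF c U inj o1 o2] .
qed

text \<open>Each point has a neighbourhood whose image lies in a model, and this model is unique. Sending a
  point to its model is therefore locally constant.\<close>

lemma image_in_model:
  assumes conn: "connected_space M" and tgl: "totally_geodesic_lagrangian M A F" and ne: "topspace M \<noteq> {}"
  shows "\<exists>Q. model_submanifold Q \<and> F ` topspace M \<subseteq> Q"
proof -
  have man: "smooth_manifold M A"
    using tgl by (auto simp: totally_geodesic_lagrangian_def lagrangian_immersion_def immersion_into_def)
  define P where "P Q m \<longleftrightarrow> model_submanifold Q \<and> (\<exists>W. openin M W \<and> m \<in> W \<and> F ` W \<subseteq> Q)" for Q m
  have ex: "\<exists>Q. P Q m" if m: "m \<in> topspace M" for m
  proof -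
    obtain U \<phi> where c: "(U, \<phi>) \<in> A" "m \<in> U" "openin M U" "open (\<phi> ` U)" "inj_on \<phi> U"
      "\<And>B. open B \<Longrightarrow> openin M {y \<in> U. \<phi> y \<in> B}" "\<And>W. openin M W \<Longrightarrow> W \<subseteq> U \<Longrightarrow> open (\<phi> ` W)"
      by (rule manifold_chart[OF man m]) (rule that; assumption)
    interpret frame_chart "\<phi> ` U" "\<lambda>x. F (inv_into U \<phi> x)"
      using chart_frame_chart[OF tgl c(1)] by (simp add: chart_range_def in_chart_def)
    obtain r Q where r: "r > 0" "ball (\<phi> m) r \<subseteq> \<phi> ` U" "model_submanifold Q"
      "(\<lambda>x. F (inv_into U \<phi> x)) ` ball (\<phi> m) r \<subseteq> Q" using local_model[of "\<phi> m"] c(2) by blast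
    let ?W = "{y \<in> U. \<phi> y \<in> ball (\<phi> m) r}"
    have "F y \<in> Q" if "y \<in> ?W" for y
    proof -
      have "F (inv_into U \<phi> (\<phi> y)) \<in> Q" using r(4) that by blast
      then show ?thesis using inv_into_f_f[OF c(5)] that by simp
    qed
    then have "P Q m" unfolding P_def using r(1,3) c(2) c(6)[OF open_ball] by (intro conjI exI[of _ ?W]) auto
    then show ?thesis by blast
  qed
  have uniq: "Q = Q'" if P: "P Q m" "P Q' m" for Q Q' m
  proof -
    obtain W W' where W: "openin M W" "m \<in> W" "F ` W \<subseteq> Q" "openin M W'" "m \<in> W'" "F ` W' \<subseteq> Q'"
      using P by (auto simp: P_def)
    have m: "m \<in> topspace M" using W(1,2) openin_subset by blast
    obtain U \<phi> where c: "(U, \<phi>) \<in> A" "m \<in> U" "openin M U" "open (\<phi> ` U)" "inj_on \<phi> U"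
      "\<And>B. open B \<Longrightarrow> openin M {y \<in> U. \<phi> y \<in> B}" "\<And>W. openin M W \<Longrightarrow> W \<subseteq> U \<Longrightarrow> open (\<phi> ` W)"
      by (rule manifold_chart[OF man m]) (rule that; assumption)
    interpret frame_chart "\<phi> ` U" "\<lambda>x. F (inv_into U \<phi> x)"
      using chart_frame_chart[OF tgl c(1)] by (simp add: chart_range_def in_chart_def)
    let ?W = "U \<inter> W \<inter> W'"
    have "open (\<phi> ` ?W)" using c(3) W(1,4) by (intro c(7)) auto
    moreover have "(\<lambda>x. F (inv_into U \<phi> x)) ` \<phi> ` ?W \<subseteq> Q" "(\<lambda>x. F (inv_into U \<phi> x)) ` \<phi> ` ?W \<subseteq> Q'"
      using W(3,6) inv_into_f_f[OF c(5)] by auto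
    ultimately show ?thesis
      using model_unique[of "\<phi> ` ?W" "\<phi> m" Q Q'] c(2) W(2,5) P by (auto simp: P_def)
  qed
  obtain m0 where m0: "m0 \<in> topspace M" using ne by blast
  obtain Q where Q: "P Q m0" using ex[OF m0] by blast
  define E1 where "E1 = {m \<in> topspace M. P Q m}"
  define E2 where "E2 = {m \<in> topspace M. \<exists>Q'. Q' \<noteq> Q \<and> P Q' m}"
  have op: "openin M {m \<in> topspace M. \<exists>Q'\<in>S. P Q' m}" for S
  proof (subst openin_subopen, intro ballI)
    fix m assume "m \<in> {m \<in> topspace M. \<exists>Q'\<in>S. P Q' m}"
    then obtain Q' W where W: "Q' \<in> S" "model_submanifold Q'" "openin M W" "m \<in> W" "F ` W \<subseteq> Q'" by (auto simp: P_def)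
    then show "\<exists>T. openin M T \<and> m \<in> T \<and> T \<subseteq> {m \<in> topspace M. \<exists>Q'\<in>S. P Q' m}"
      using openin_subset[OF W(3)] by (intro exI[of _ W]) (auto simp: P_def)
  qed
  have o1: "openin M E1" using op[of "{Q}"] by (simp add: E1_def)
  have o2: "openin M E2" using op[of "- {Q}"] by (simp add: E2_def Bex_def)
  have cov: "topspace M \<subseteq> E1 \<union> E2"
  proof
    fix m assume m: "m \<in> topspace M"
    obtain Q' where Q': "P Q' m" using ex[OF m] by (rule exE)
    show "m \<in> E1 \<union> E2"
    proof (cases "Q' = Q")
      case True
      then show ?thesis using Q' m by (simp add: E1_def)
    next
      case False
      then have "m \<in> E2" using Q' m unfolding E2_def by (intro CollectI conjI exI[of _ Q'])
      then show ?thesis by (rule UnI2)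
    qed
  qed
  have dis: "E1 \<inter> E2 = {}" using uniq by (auto simp: E1_def E2_def)
  have ne1: "E1 \<noteq> {}" using m0 Q by (auto simp: E1_def)
  have "E2 = {}" using conn o1 o2 cov dis ne1 unfolding connected_space_def by blast
  then have "P Q m" if "m \<in> topspace M" for m using cov that by (auto simp: E1_def)
  then have "F m \<in> Q" if "m \<in> topspace M" for m using that by (auto simp: P_def)
  then show ?thesis using Q by (auto simp: P_def)
qed

lemma standard_map_props:
  assumes "f \<in> {f1, f2, f3}"
  shows "u \<in> SL2 \<Longrightarrow> f u \<in> SL2xSL2" "std_proj f (f u) = u" "bounded_linear (std_proj f)" "smooth_on S f"
proof -
  have "f1 \<noteq> f2" "f1 \<noteq> f3"
    by (auto simp: f1_def f2_def f3_def fun_eq_iff one_mat2 intro!: exI[of _ 0] simp: zero_mat2)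
  then show "std_proj f (f u) = u" using assms by (auto simp: std_proj_def f1_def f2_def f3_def)
  show "bounded_linear (std_proj f)" by (simp add: std_proj_def bounded_linear_fst bounded_linear_snd)
  have "det mat_i = 1" "det mat_k = - 1" by (simp_all add: mat_i_def mat_k_def)
  then show "u \<in> SL2 \<Longrightarrow> f u \<in> SL2xSL2"
    using assms by (auto simp: SL2xSL2_def f1_def f2_def f3_def SL2_def det_mul)
  have "smooth_on S f1" "smooth_on S f2" "smooth_on S f3"
    unfolding f1_def f2_def f3_def by (intro smooth_intros)+
  then show "smooth_on S f" using assms by blast
qed

text \<open>The composition of \<open>\<Phi> \<circ> F\<close> with the inverse of the standard map is, in charts, a map
  between open subsets of \<open>real^3\<close> with injective, hence surjective, differential. Such a map is open.\<close>

lemma open_image_in_standard: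
  assumes tgl: "totally_geodesic_lagrangian M A F" and \<Phi>: "isometry \<Phi>" and f: "f \<in> {f1, f2, f3}"
    and sub: "\<Phi> ` F ` topspace M \<subseteq> f ` SL2"
  shows "openin (top_of_set SL2) {u \<in> SL2. f u \<in> \<Phi> ` F ` topspace M}" (is "openin _ ?\<Omega>")
proof (subst openin_subopen, intro ballI)
  fix u0 assume "u0 \<in> ?\<Omega>"
  then obtain m where u0: "u0 \<in> SL2" and m: "m \<in> topspace M" "f u0 = \<Phi> (F m)" by auto
  note std = standard_map_props[OF f] and iso = isometry_D[OF \<Phi>]
  have man: "smooth_manifold M A"
    using tgl by (auto simp: totally_geodesic_lagrangian_def lagrangian_immersion_def immersion_into_def)
  obtain U \<phi> where c: "(U, \<phi>) \<in> A" "m \<in> U" "openin M U" "open (\<phi> ` U)" "inj_on \<phi> U"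
    "\<And>B. open B \<Longrightarrow> openin M {y \<in> U. \<phi> y \<in> B}" "\<And>W. openin M W \<Longrightarrow> W \<subseteq> U \<Longrightarrow> open (\<phi> ` W)"
    by (rule manifold_chart[OF man m(1)]) (rule that; assumption)
  define V h where "V = \<phi> ` U" and "h x = F (inv_into U \<phi> x)" for x
  interpret frame_chart V h
    using chart_frame_chart[OF tgl c(1)] by (simp add: chart_range_def in_chart_def V_def h_def[abs_def])
  define x0 where "x0 = \<phi> m"
  have x0: "x0 \<in> V" "h x0 = F m" using c(2) inv_into_f_f[OF c(5)] by (auto simp: x0_def V_def h_def)
  have hF: "h x \<in> F ` topspace M" if "x \<in> V" for x
    using that inv_into_into[of x \<phi> U] openin_subset[OF c(3)] by (auto simp: V_def h_def)
  define G where "G x = std_proj f (\<Phi> (h x))" for x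
  have G: "G x \<in> SL2" "f (G x) = \<Phi> (h x)" if x: "x \<in> V" for x
  proof -
    obtain u where "u \<in> SL2" "\<Phi> (h x) = f u" using sub hF[OF x] by blast
    then show "G x \<in> SL2" "f (G x) = \<Phi> (h x)" by (simp_all add: G_def std(2))
  qed
  have sPh: "smooth_on V (\<lambda>x. \<Phi> (h x))" by (rule smooth_on_compose[OF smooth iso(1) into])
  have sG: "smooth_on V G" unfolding G_def by (rule smooth_on_bounded_linear_compose[OF std(3) sPh])
  have Gx0: "G x0 = u0" unfolding G_def x0(2) m(2)[symmetric] by (rule std(2))
  \<comment> \<open>The differential of \<open>G\<close> is injective because \<open>\<Phi> \<circ> h\<close> is an immersion that factors through \<open>G\<close>.\<close>
  have injG: "v = 0" if dG: "differential V G x0 v = 0" for v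
  proof -
    have "differential V (\<lambda>x. f (G x)) x0 v = differential UNIV f (G x0) (differential V G x0 v)"
      by (rule differential_chain[OF td[OF x0(1)] x0(1) sG std(4)]) simp
    also have "\<dots> = 0" unfolding dG by (rule linear_0[OF linear_differential[OF std(4)]]) simp
    finally have "differential V (\<lambda>x. f (G x)) x0 v = 0" .
    moreover have "differential V (\<lambda>x. \<Phi> (h x)) x0 v = differential V (\<lambda>x. f (G x)) x0 v"
      by (rule differential_cong[OF td[OF x0(1)] x0(1) sPh]) (simp add: G(2))
    ultimately have "differential SL2xSL2 \<Phi> (h x0) (differential V h x0 v) = 0"
      using differential_chain[OF td[OF x0(1)] x0(1) smooth iso(1) into] by simp
    moreover have T: "differential V h x0 w \<in> T_SL2xSL2 (h x0)" for w
      by (rule differential_in_T[OF smooth into x0(1) td[OF x0(1)]])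
    ultimately have "g_NK (h x0) (differential V h x0 v) (differential V h x0 w) = 0" for w
      using iso(5)[OF f_in[OF x0(1)] T T, of v w] iso(4)[OF f_in[OF x0(1)]]
      by (simp add: g_NK_eq lt.zero_right gq.zero_left)
    then show ?thesis
      by (intro nondegenerate[OF x0(1)]) (simp add: g_NK_eq f_in[OF x0(1)] frame_def)
  qed
  define D where "D v = chi u0 (differential V G x0 v)" for v
  have lin: "linear D"
  proof -
    note l = linear_differential[OF sG x0(1)] and l' = bounded_linear.linear[OF bounded_linear_chi[of u0]]
    show ?thesis unfolding D_def
      by (rule linearI) (simp_all add: linear_add[OF l] linear_scale[OF l] linear_add[OF l'] linear_scale[OF l'])
  qed
  have "v = 0" if "D v = 0" for v
  proof -
    have "tangent_dir SL2 (G x0) (differential V G x0 v)"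
      by (rule tangent_dir_image[OF td[OF x0(1)] smooth_on_has_derivative[OF sG x0(1)]]) (use G in auto)
    then have "adj2 u0 ** differential V G x0 v \<in> sl2" using tangent_dir_SL2_D u0 by (simp add: Gx0)
    then have "differential V G x0 v = 0" using chi_inj_tangent[OF u0] that by (simp add: D_def)
    then show ?thesis by (rule injG)
  qed
  then have "inj D" using linear_injective_0[OF lin] by blast
  then have "surj D" using linear_injective_imp_surjective[OF lin] by blast
  then obtain D' where D': "linear D'" "D \<circ> D' = id" using linear_surjective_right_inverse[OF lin] by blast
  let ?e = "\<lambda>x. (adj2 u0 ** G x) $ 2 $ 2"
  define V' where "V' = V \<inter> ?e -` {0<..}"
  have cG: "continuous_on V G" by (rule smooth_on_imp_continuous_on[OF sG])
  have oV': "open V'" unfolding V'_def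
  proof (rule continuous_open_preimage[OF _ open_V])
    show "continuous_on V ?e"
      using continuous_on_compose2[OF continuous_on_chi_entry cG] by simp
  qed simp
  have x0V': "x0 \<in> V'" using x0(1) by (simp add: V'_def Gx0 SL2_cancel(5)[OF u0] one_mat2 del: adj2_mult)
  have "(G has_derivative differential V G x0) (at x0)"
    using has_derivative_at_V[OF sG x0(1)] .
  then have dH: "((\<lambda>x. chi u0 (G x)) has_derivative D) (at x0)"
    unfolding D_def[abs_def] by (rule bounded_linear.has_derivative[OF bounded_linear_chi])
  have cH: "continuous_on V (\<lambda>x. chi u0 (G x))"
    using continuous_on_compose2[OF linear_continuous_on[OF bounded_linear_chi, of UNIV u0] cG] by simp
  have "V' \<subseteq> V" by (auto simp: V'_def)
  moreover have "x0 \<in> interior V'" unfolding interior_open[OF oV'] by (rule x0V')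
  ultimately have "chi u0 (G x0) \<in> interior ((\<lambda>x. chi u0 (G x)) ` V')"
    by (rule sussmann_open_mapping[OF open_V cH x0(1) dH linear_conv_bounded_linear[THEN iffD1, OF D'(1)] D'(2)])
  then have int: "chi u0 u0 \<in> interior ((\<lambda>x. chi u0 (G x)) ` V')" by (simp add: Gx0)
  let ?O = "chi_dom u0 \<inter> chi u0 -` interior ((\<lambda>x. chi u0 (G x)) ` V')"
  have "open (chi u0 -` interior ((\<lambda>x. chi u0 (G x)) ` V'))"
    using continuous_open_preimage[OF linear_continuous_on[OF bounded_linear_chi, of UNIV u0] open_UNIV open_interior] by simp
  then have "openin (top_of_set SL2) ?O"
    using openin_chi_dom[of u0] openin_open_Int openin_Int_open by blast
  moreover have "u0 \<in> ?O" using int u0 by (simp add: chi_dom_def SL2_cancel(5)[OF u0] one_mat2 del: adj2_mult)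
  moreover have "u \<in> ?\<Omega>" if u: "u \<in> ?O" for u
  proof -
    obtain x where x: "x \<in> V'" "chi u0 u = chi u0 (G x)" using u interior_subset by blast
    have xV: "x \<in> V" using x(1) by (simp add: V'_def)
    have "G x \<in> chi_dom u0" using x(1) G(1)[OF xV] by (simp add: chi_dom_def V'_def)
    then have "u = G x" using chi_inv_chi[OF u0, of u] chi_inv_chi[OF u0, of "G x"] u x(2) by simp
    then show ?thesis using G[OF xV] hF[OF xV] by simp
  qed
  ultimately show "\<exists>T. openin (top_of_set SL2) T \<and> u0 \<in> T \<and> T \<subseteq> ?\<Omega>" by blast
qed

text \<open>For empty \<open>M\<close> there is no model to choose, but then the image is empty.\<close>

lemma classification_global:
  assumes "connected_space M" "totally_geodesic_lagrangian M A F"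
  shows "\<exists>f\<in>{f1, f2, f3}. \<exists>\<Omega>. openin (top_of_set SL2) \<Omega> \<and>
    congruent_in SL2xSL2 T_SL2xSL2 g_NK (F ` topspace M) (f ` \<Omega>)"
proof (cases "topspace M = {}")
  case True
  then show ?thesis
    unfolding congruent_in_def using isometry_ident by (intro bexI[of _ f1] exI[of _ "{}"]) auto
next
  case False
  obtain Q where Q: "model_submanifold Q" "F ` topspace M \<subseteq> Q" using image_in_model[OF assms False] by blast
  then have "Q \<noteq> {}" using False by blast
  then obtain \<Phi> where iso: "isometry \<Phi>" and ex: "\<exists>f\<in>{f1, f2, f3}. \<Phi> ` Q \<subseteq> f ` SL2"
    using model_congruent[OF Q(1)] by auto
  from ex obtain f where "f \<in> {f1, f2, f3}" "\<Phi> ` Q \<subseteq> f ` SL2" by (rule bexE)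
  note \<Phi> = iso this
  have sub: "\<Phi> ` F ` topspace M \<subseteq> f ` SL2" using Q(2) \<Phi>(3) by blast
  let ?\<Omega> = "{u \<in> SL2. f u \<in> \<Phi> ` F ` topspace M}"
  have "\<Phi> ` F ` topspace M = f ` ?\<Omega>"
  proof
    show "\<Phi> ` F ` topspace M \<subseteq> f ` ?\<Omega>"
    proof
      fix y assume y: "y \<in> \<Phi> ` F ` topspace M"
      then obtain u where "u \<in> SL2" "y = f u" using subsetD[OF sub y] by (elim imageE) simp
      then show "y \<in> f ` ?\<Omega>" using y by (intro image_eqI[of _ _ u]) simp_all
    qed
    show "f ` ?\<Omega> \<subseteq> \<Phi> ` F ` topspace M" by (rule image_subsetI) simp
  qed
  then have "congruent_in SL2xSL2 T_SL2xSL2 g_NK (F ` topspace M) (f ` ?\<Omega>)"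
    unfolding congruent_in_def using \<Phi>(1) by (intro exI[of _ \<Phi>] conjI)
  with open_image_in_standard[OF assms(2) \<Phi>(1,2) sub] show ?thesis
    by (intro bexI[OF _ \<Phi>(2)] exI[of _ ?\<Omega>] conjI)
qed


section \<open>The standard immersions are totally geodesic and Lagrangian\<close>

lemma differential_left_inverse:
  fixes V :: "'a::euclidean_space set" and f :: "'a \<Rightarrow> 'b::euclidean_space"
  assumes V: "open V" "smooth_on V f" and G: "smooth_on (f ` V) G" "\<And>x. x \<in> V \<Longrightarrow> G (f x) = x" and x: "x \<in> V"
  shows "differential (f ` V) G (f x) (differential V f x w) = w"
proof -
  have td: "tangent_dir V x w" by (rule tangent_dir_open[OF V(1) x])
  have "differential V (\<lambda>y. G (f y)) x w = differential (f ` V) G (f x) (differential V f x w)"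
    by (rule differential_chain[OF td x V(2) G(1)]) simp
  moreover have "differential V (\<lambda>y. G (f y)) x w = differential V (\<lambda>y. y) x w"
    by (rule differential_cong[OF td x smooth_on_compose[OF V(2) G(1)]]) (simp_all add: G(2))
  ultimately show ?thesis by (simp add: differential_ident[OF td])
qed

text \<open>An immersion \<open>f\<close> with smooth left inverse \<open>G\<close> such that covariant derivatives of tangent fields are
  tangent. The induced connection \<open>D\<close> is then the covariant derivative along \<open>f\<close>, pulled back by the differential of \<open>G\<close>.
  The left inverse serves to define \<open>D\<close> and to prove that it maps smooth fields to smooth fields.\<close>

locale totally_geodesic_chart =
  fixes V :: "(real^3) set" and f :: "real^3 \<Rightarrow> mat2 \<times> mat2" and G :: "mat2 \<times> mat2 \<Rightarrow> real^3"
  assumes open_V: "open V" and smooth: "smooth_on V f" and into: "f ` V \<subseteq> SL2xSL2"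
    and smooth_G: "smooth_on (f ` V) G" and G_f: "x \<in> V \<Longrightarrow> G (f x) = x"
    and geodesic: "x \<in> V \<Longrightarrow> smooth_on V Y \<Longrightarrow>
      cov V f x v (\<lambda>y. differential V f y (Y y)) \<in> range (differential V f x)"
begin

sublocale smooth_map_into V "\<lambda>_. UNIV" f
  by unfold_locales (use open_V smooth into in \<open>auto intro: tangent_dir_open\<close>)

lemma td: "x \<in> V \<Longrightarrow> tangent_dir V x v" by (rule tangent_dir_open[OF open_V])

definition push :: "(real^3 \<Rightarrow> real^3) \<Rightarrow> real^3 \<Rightarrow> mat2 \<times> mat2" where
  "push Y y = differential V f y (Y y)"

definition D :: "real^3 \<Rightarrow> real^3 \<Rightarrow> (real^3 \<Rightarrow> real^3) \<Rightarrow> real^3" where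
  "D x v Y = differential (f ` V) G (f x) (cov V f x v (push Y))"

lemma G_df: "x \<in> V \<Longrightarrow> differential (f ` V) G (f x) (differential V f x w) = w"
  by (rule differential_left_inverse[OF open_V smooth smooth_G G_f])

lemma df_inj: "x \<in> V \<Longrightarrow> differential V f x v = differential V f x w \<Longrightarrow> v = w"
  using G_df by metis

lemma df_D:
  assumes x: "x \<in> V" and Y: "smooth_on V Y"
  shows "differential V f x (D x v Y) = cov V f x v (push Y)"
proof -
  obtain w where w: "cov V f x v (push Y) = differential V f x w"
    using geodesic[OF x Y, of v] unfolding push_def[abs_def] by (rule rangeE)
  show ?thesis unfolding D_def w G_df[OF x] ..
qed

lemma push_section: "smooth_on V Y \<Longrightarrow> push Y \<in> \<E>"
  unfolding sections_def push_def[abs_def]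
  by (intro CollectI conjI ballI smooth_on_differential_field[OF smooth _ td]
      differential_in_T[OF smooth into _ td])

lemma linear_df: "x \<in> V \<Longrightarrow> linear (differential V f x)"
  by (rule linear_differential[OF smooth])

lemma smooth_D:
  assumes X: "smooth_on V X" and Y: "smooth_on V Y" shows "smooth_on V (\<lambda>x. D x (X x) Y)"
proof -
  let ?Z = "\<lambda>x. cov V f x (X x) (push Y)"
  have "(\<lambda>x. ?Z x) \<in> \<E>"
    by (rule bspec[OF bspec[OF cov_connection[unfolded is_connection_def, THEN conjunct1]] push_section[OF Y]])
      (simp add: sections_def X)
  then have sZ: "smooth_on V ?Z" by (simp add: sections_def)
  have "smooth_on (f ` V) (\<lambda>p. ?Z (G p))"
    by (rule smooth_on_compose[OF smooth_G sZ]) (use G_f in auto)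
  moreover have "tangent_dir (f ` V) p (?Z (G p))" if p: "p \<in> f ` V" for p
  proof -
    obtain x where x: "x \<in> V" "p = f x" using p by blast
    obtain w where "?Z x = differential V f x w" using geodesic[OF x(1) Y] unfolding push_def[abs_def] by blast
    then show ?thesis
      using tangent_dir_image[OF td[OF x(1)] smooth_on_has_derivative[OF smooth x(1)] order_refl] x G_f by simp
  qed
  ultimately have "smooth_on (f ` V) (\<lambda>p. differential (f ` V) G p (?Z (G p)))"
    by (rule smooth_on_differential_field[OF smooth_G])
  from smooth_on_compose[OF smooth this order_refl]
  show ?thesis by (rule smooth_on_cong) (simp add: D_def G_f)
qed

lemma D_connection: "is_connection V (\<lambda>_. UNIV) (\<lambda>_. UNIV) D"
proof -
  have sec: "s \<in> sections V (\<lambda>_. UNIV) \<longleftrightarrow> smooth_on V s" for s :: "real^3 \<Rightarrow> real^3"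
    by (simp add: sections_def)
  note con = cov_connection[unfolded is_connection_def, THEN conjunct2, rule_format, OF _ UNIV_I]
  show ?thesis unfolding is_connection_def
  proof (intro conjI ballI allI impI)
    show "(\<lambda>p. D p (X p) s) \<in> sections V (\<lambda>_. UNIV)"
      if "X \<in> sections V (\<lambda>_. UNIV)" "s \<in> sections V (\<lambda>_. UNIV)" for X s
      using smooth_D that by (simp add: sec)
    fix x v and s :: "real^3 \<Rightarrow> real^3" assume x: "x \<in> V" and "s \<in> sections V (\<lambda>_. UNIV)"
    then have s: "smooth_on V s" by (simp add: sec)
    note ps = push_section[OF s] and l = linear_df[OF x]
    note c = con[OF x ps]
    show "D x v s \<in> UNIV" by simp
    show "D x (r *\<^sub>R v + w) s = r *\<^sub>R D x v s + D x w s" for r w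
      by (rule df_inj[OF x]) (simp add: linear_add[OF l] linear_scale[OF l] df_D[OF x s] c)
    show "D x v (\<lambda>q. s q + t q) = D x v s + D x v t" if "t \<in> sections V (\<lambda>_. UNIV)" for t
    proof (rule df_inj[OF x])
      have t: "smooth_on V t" using that by (simp add: sec)
      have st: "smooth_on V (\<lambda>q. s q + t q)" by (rule smooth_on_add[OF s t])
      have "cov V f x v (push (\<lambda>q. s q + t q)) = cov V f x v (\<lambda>q. push s q + push t q)"
      proof (rule connection_cong[OF cov_connection x UNIV_I push_section[OF st]])
        show e: "push (\<lambda>q. s q + t q) q = push s q + push t q" if "q \<in> V" for q
          by (simp add: push_def linear_add[OF linear_df[OF that]])
        have "smooth_on V (\<lambda>q. push s q + push t q)"
          using push_section[OF s] push_section[OF t] by (intro smooth_on_add) (auto simp: sections_def)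
        then show "(\<lambda>q. push s q + push t q) \<in> \<E>"
          using push_section[OF st] e by (auto simp: sections_def)
      qed
      also have "\<dots> = cov V f x v (push s) + cov V f x v (push t)"
        by (rule connection_add[OF cov_connection x UNIV_I ps push_section[OF t]])
      finally show "differential V f x (D x v (\<lambda>q. s q + t q)) = differential V f x (D x v s + D x v t)"
        by (simp add: linear_add[OF l] df_D[OF x] s t st)
    qed
    show "D x v (\<lambda>q. k q *\<^sub>R s q) = differential V k x v *\<^sub>R s x + k x *\<^sub>R D x v s"
      if k: "smooth_on V k" for k :: "real^3 \<Rightarrow> real"
    proof (rule df_inj[OF x])
      have ks: "smooth_on V (\<lambda>q. k q *\<^sub>R s q)" by (rule smooth_on_bilinear[OF bounded_bilinear_scaleR k s])
      have "cov V f x v (push (\<lambda>q. k q *\<^sub>R s q)) = cov V f x v (\<lambda>q. k q *\<^sub>R push s q)"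
      proof (rule connection_cong[OF cov_connection x UNIV_I push_section[OF ks]])
        show e: "push (\<lambda>q. k q *\<^sub>R s q) q = k q *\<^sub>R push s q" if "q \<in> V" for q
          by (simp add: push_def linear_scale[OF linear_df[OF that]])
        have "smooth_on V (\<lambda>q. k q *\<^sub>R push s q)"
          using push_section[OF s] by (intro smooth_on_bilinear[OF bounded_bilinear_scaleR k]) (auto simp: sections_def)
        then show "(\<lambda>q. k q *\<^sub>R push s q) \<in> \<E>"
          using push_section[OF ks] e by (auto simp: sections_def)
      qed
      also have "\<dots> = differential V k x v *\<^sub>R push s x + k x *\<^sub>R cov V f x v (push s)"
        using c k by blast
      finally show "differential V f x (D x v (\<lambda>q. k q *\<^sub>R s q)) =
        differential V f x (differential V k x v *\<^sub>R s x + k x *\<^sub>R D x v s)"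
        by (simp add: linear_add[OF l] linear_scale[OF l] df_D[OF x] s ks push_def)
    qed
    show "D x v s = D x v t" if "t \<in> sections V (\<lambda>_. UNIV)" "\<forall>q\<in>V. s q = t q" for t
    proof (rule df_inj[OF x])
      have t: "smooth_on V t" using that by (simp add: sec)
      have "cov V f x v (push s) = cov V f x v (push t)"
        by (rule connection_cong[OF cov_connection x UNIV_I ps push_section[OF t]]) (simp add: push_def that(2))
      then show "differential V f x (D x v s) = differential V f x (D x v t)" by (simp add: df_D[OF x] s t)
    qed
  qed
qed

text \<open>By symmetry of second derivatives the second summand is symmetric in \<open>v\<close> and \<open>Y x\<close>, so that \<open>D\<close> is
  torsion-free.\<close>

lemma differential_push:
  assumes Y: "smooth_on V Y" and x: "x \<in> V"
  shows "differential V (push Y) x v =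
    differential V f x (differential V Y x v) + differential V (\<lambda>y. differential V f y v) x (Y x)"
proof -
  let ?s = "\<lambda>i y. (Y y \<bullet> i) *\<^sub>R differential V f y i"
  have sc: "smooth_on V (\<lambda>y. Y y \<bullet> i)" for i by (rule smooth_on_bilinear[OF bounded_bilinear_inner Y smooth_on_const])
  have sd: "smooth_on V (\<lambda>y. differential V f y i)" for i
    by (rule smooth_on_differential_field[OF smooth smooth_on_const td])
  have "differential V (push Y) x v = differential V (\<lambda>y. \<Sum>i\<in>Basis. ?s i y) x v"
    by (rule differential_cong[OF td[OF x] x])
      (use push_section[OF Y] linear_sum_Basis[OF linear_df] in \<open>auto simp: sections_def push_def\<close>)
  also have "\<dots> = (\<Sum>i\<in>Basis. (Y x \<bullet> i) *\<^sub>R differential V (\<lambda>y. differential V f y i) x v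
      + (differential V Y x v \<bullet> i) *\<^sub>R differential V f x i)"
  proof (rule differential_eq[OF td[OF x]], rule has_derivative_sum)
    fix i :: "real^3"
    have h: "((\<lambda>y. Y y \<bullet> i) has_derivative (\<lambda>v. differential V Y x v \<bullet> i)) (at x within V)"
      by (rule has_derivative_inner_left[OF smooth_on_has_derivative[OF Y x]])
    show "(?s i has_derivative (\<lambda>v. (Y x \<bullet> i) *\<^sub>R differential V (\<lambda>y. differential V f y i) x v
      + (differential V Y x v \<bullet> i) *\<^sub>R differential V f x i)) (at x within V)"
      by (rule has_derivative_scaleR[OF h smooth_on_has_derivative[OF sd x]])
  qed
  also have "\<dots> = (\<Sum>i\<in>Basis. (Y x \<bullet> i) *\<^sub>R differential V (\<lambda>y. differential V f y v) x i)
      + (\<Sum>i\<in>Basis. (differential V Y x v \<bullet> i) *\<^sub>R differential V f x i)"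
    unfolding sum.distrib using differential_symmetric[OF open_V smooth x] by simp
  also have "(\<Sum>i\<in>Basis. (Y x \<bullet> i) *\<^sub>R differential V (\<lambda>y. differential V f y v) x i)
      = differential V (\<lambda>y. differential V f y v) x (Y x)"
    by (rule linear_sum_Basis[OF linear_differential[OF sd x], symmetric])
  also have "(\<Sum>i\<in>Basis. (differential V Y x v \<bullet> i) *\<^sub>R differential V f x i) = differential V f x (differential V Y x v)"
    by (rule linear_sum_Basis[OF linear_df[OF x], symmetric])
  finally show ?thesis by simp
qed

lemma D_levi_civita: "is_levi_civita V (\<lambda>_. UNIV) (induced_metric g_NK V f) D"
  unfolding is_levi_civita_def
proof (intro conjI ballI D_connection)
  fix X Y :: "real^3 \<Rightarrow> real^3" and x assume "X \<in> sections V (\<lambda>_. UNIV)" "Y \<in> sections V (\<lambda>_. UNIV)" and x: "x \<in> V"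
  then have X: "smooth_on V X" and Y: "smooth_on V Y" by (auto simp: sections_def)
  note l = linear_df[OF x]
  show "D x (X x) Y - D x (Y x) X = lie_bracket V X Y x"
  proof (rule df_inj[OF x])
    have "differential V f x (D x (X x) Y - D x (Y x) X) =
      differential V (push Y) x (X x) - differential V (push X) x (Y x)"
      using Gam_commute[of "f x" "push X x" "push Y x"]
      by (simp add: linear_diff[OF l] df_D[OF x] X Y cov_def push_def)
    also have "\<dots> = differential V f x (differential V Y x (X x)) - differential V f x (differential V X x (Y x))"
      using differential_symmetric[OF open_V smooth x, of "X x" "Y x"]
      by (simp add: differential_push[OF X x] differential_push[OF Y x])
    finally show "differential V f x (D x (X x) Y - D x (Y x) X) = differential V f x (lie_bracket V X Y x)"
      by (simp add: lie_bracket_def linear_diff[OF l])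
  qed
next
  fix Y Z :: "real^3 \<Rightarrow> real^3" and x v assume "Y \<in> sections V (\<lambda>_. UNIV)" "Z \<in> sections V (\<lambda>_. UNIV)" and x: "x \<in> V"
  then have Y: "smooth_on V Y" and Z: "smooth_on V Z" by (auto simp: sections_def)
  show "differential V (\<lambda>q. induced_metric g_NK V f q (Y q) (Z q)) x v =
    induced_metric g_NK V f x (D x v Y) (Z x) + induced_metric g_NK V f x (Y x) (D x v Z)"
    using cov_metric[OF push_section[OF Y] push_section[OF Z] x UNIV_I, of v]
    by (simp add: induced_metric_def df_D[OF x] Y Z) (simp add: push_def)
qed

lemma second_fundamental_form_zero:
  assumes "x \<in> V" "Y \<in> sections V (\<lambda>_. UNIV)"
  shows "second_fundamental_form (cov V f) D V f x v Y = 0"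
  using assms df_D[of x Y v] unfolding second_fundamental_form_def push_def[abs_def] sections_def by simp

end

text \<open>A map whose left-trivialized differential is a constant linear map \<open>\<Lambda>\<close>. The conditions
  on \<open>\<Lambda>\<close> are those on a Lagrangian subspace, and closure under \<open>Bt\<close> makes the image totally geodesic.
  The left inverse \<open>pr\<close> provides the left inverses required in charts.\<close>

locale left_invariant_map =
  fixes f :: "mat2 \<Rightarrow> mat2 \<times> mat2" and \<Lambda> :: "mat2 \<Rightarrow> mat2 \<times> mat2" and pr :: "mat2 \<times> mat2 \<Rightarrow> mat2"
  assumes f_SL2: "u \<in> SL2 \<Longrightarrow> f u \<in> SL2xSL2" and smooth_f: "smooth_on S f"
    and pr_f: "pr (f u) = u" and pr: "bounded_linear pr"
    and df: "u \<in> SL2 \<Longrightarrow> \<alpha> \<in> sl2 \<Longrightarrow> differential SL2 f u (u ** \<alpha>) = lift (f u) (\<Lambda> \<alpha>)"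
    and bl: "bounded_linear \<Lambda>"
    and Bt_L: "\<alpha> \<in> sl2 \<Longrightarrow> \<beta> \<in> sl2 \<Longrightarrow> \<exists>\<gamma>\<in>sl2. Bt (\<Lambda> \<alpha>) (\<Lambda> \<beta>) = \<Lambda> \<gamma>"
    and om_L: "\<alpha> \<in> sl2 \<Longrightarrow> \<beta> \<in> sl2 \<Longrightarrow> om (\<Lambda> \<alpha>) (\<Lambda> \<beta>) = 0"
    and max_L: "Y \<in> sl2sq \<Longrightarrow> (\<And>\<alpha>. \<alpha> \<in> sl2 \<Longrightarrow> om Y (\<Lambda> \<alpha>) = 0) \<Longrightarrow> \<exists>\<alpha>\<in>sl2. Y = \<Lambda> \<alpha>"
    and nondeg_L: "\<alpha> \<in> sl2 \<Longrightarrow> (\<And>\<beta>. \<beta> \<in> sl2 \<Longrightarrow> gq (\<Lambda> \<alpha>) (\<Lambda> \<beta>) = 0) \<Longrightarrow> \<alpha> = 0"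

locale left_invariant_chart = left_invariant_map +
  fixes U :: "mat2 set" and \<phi> :: "mat2 \<Rightarrow> real^3"
  assumes atlas: "(U, \<phi>) \<in> submanifold_atlas SL2"
begin

definition "V = \<phi> ` U"
definition "u = inv_into U \<phi>"
definition "F x = f (u x)"

lemma chart: "openin (top_of_set SL2) U" "inj_on \<phi> U" "open V" "smooth_on U \<phi>" "smooth_on V u"
  using atlas by (auto simp: submanifold_atlas_def V_def u_def)

lemma U_SL2: "U \<subseteq> SL2" using openin_imp_subset[OF chart(1)] .

lemma u_U: "x \<in> V \<Longrightarrow> u x \<in> U" unfolding V_def u_def by (rule inv_into_into)
lemma u_SL2: "x \<in> V \<Longrightarrow> u x \<in> SL2" using u_U U_SL2 by blast
lemma phi_u: "x \<in> V \<Longrightarrow> \<phi> (u x) = x" unfolding V_def u_def by (rule f_inv_into_f)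
lemma u_phi: "a \<in> U \<Longrightarrow> u (\<phi> a) = a" unfolding u_def by (rule inv_into_f_f[OF chart(2)])

lemma smooth_F: "smooth_on V F" unfolding F_def
  by (rule smooth_on_compose[OF chart(5) smooth_f[of SL2]]) (use u_SL2 in auto)

lemma F_into: "F ` V \<subseteq> SL2xSL2" unfolding F_def using f_SL2 u_SL2 by blast

lemma td: "x \<in> V \<Longrightarrow> tangent_dir V x v" by (rule tangent_dir_open[OF chart(3)])

definition \<theta> :: "real^3 \<Rightarrow> real^3 \<Rightarrow> mat2" where "\<theta> w x = adj2 (u x) ** differential V u x w"

lemma theta_sl2: assumes "x \<in> V" shows "\<theta> w x \<in> sl2"
  unfolding \<theta>_def
proof (rule tangent_dir_SL2_D[OF _ u_SL2[OF assms]])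
  show "tangent_dir SL2 (u x) (differential V u x w)"
    by (rule tangent_dir_image[OF td[OF assms] smooth_on_has_derivative[OF chart(5) assms]]) (use u_SL2 in auto)
qed

lemma du: "x \<in> V \<Longrightarrow> differential V u x w = u x ** \<theta> w x"
  unfolding \<theta>_def using SL2_cancel(2)[OF u_SL2] by simp

lemma dF: assumes x: "x \<in> V" shows "differential V F x w = lift (F x) (\<Lambda> (\<theta> w x))"
proof -
  have "differential V F x w = differential SL2 f (u x) (differential V u x w)"
    unfolding F_def[abs_def] by (rule differential_chain[OF td[OF x] x chart(5) smooth_f]) (use u_SL2 in auto)
  then show ?thesis unfolding du[OF x] using df[OF u_SL2[OF x] theta_sl2[OF x]] by (simp add: F_def)
qed

text \<open>A chart of \<open>SL2\<close> is only known to be smooth in both directions; differentiating the composition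
  shows that its differential reaches every tangent vector.\<close>

lemma theta_surj: assumes x: "x \<in> V" and \<alpha>: "\<alpha> \<in> sl2" shows "\<exists>w. \<theta> w x = \<alpha>"
proof
  let ?a = "u x"
  have td': "tangent_dir U ?a (?a ** \<alpha>)"
    by (rule tangent_dir_openin[OF tangent_dir_SL2[OF u_SL2[OF x] \<alpha>] chart(1) u_U[OF x]])
  have "differential U (\<lambda>a. u (\<phi> a)) ?a (?a ** \<alpha>) = differential V u (\<phi> ?a) (differential U \<phi> ?a (?a ** \<alpha>))"
    by (rule differential_chain[OF td' u_U[OF x] chart(4,5)]) (simp add: V_def)
  moreover have "differential U (\<lambda>a. a) ?a (?a ** \<alpha>) = differential U (\<lambda>a. u (\<phi> a)) ?a (?a ** \<alpha>)"
    by (rule differential_cong[OF td' u_U[OF x] smooth_on_id]) (simp add: u_phi)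
  ultimately have "differential V u x (differential U \<phi> ?a (?a ** \<alpha>)) = ?a ** \<alpha>"
    by (simp add: differential_ident[OF td'] phi_u[OF x])
  then show "\<theta> (differential U \<phi> ?a (?a ** \<alpha>)) x = \<alpha>"
    unfolding \<theta>_def using SL2_cancel(1)[OF u_SL2[OF x]] by simp
qed

lemma range_dF: "x \<in> V \<Longrightarrow> range (differential V F x) = lift (F x) ` \<Lambda> ` sl2"
  using theta_surj[of x] theta_sl2[of x] dF[of x] by (force simp: image_iff)

definition "G p = \<phi> (pr p)"

lemma pr_F: "pr (F x) = u x" by (simp add: F_def pr_f)

lemma smooth_G: "smooth_on (F ` V) G" unfolding G_def
  by (rule smooth_on_compose[OF smooth_on_linear[OF pr] chart(4)]) (use pr_F u_U in auto)

lemma G_F: "x \<in> V \<Longrightarrow> G (F x) = x" by (simp add: G_def pr_F phi_u)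

lemma Lambda_linear: "\<Lambda> (a + b) = \<Lambda> a + \<Lambda> b" "\<Lambda> (r *\<^sub>R a) = r *\<^sub>R \<Lambda> a" "\<Lambda> 0 = 0"
  using linear_add[OF bounded_linear.linear[OF bl]] linear_scale[OF bounded_linear.linear[OF bl]]
    linear_0[OF bounded_linear.linear[OF bl]] by auto

lemma F_in: "x \<in> V \<Longrightarrow> F x \<in> SL2xSL2" using F_into by blast

text \<open>The coefficients of a tangent field \<open>differential V F y (Y y)\<close> in the left trivialization are \<open>\<Lambda>\<close> of a
  field of matrices. Its derivative lies again in the image of \<open>\<Lambda>\<close> because \<open>\<Lambda>\<close> is constant, and so does the
  \<open>Bt\<close> term.\<close>

lemma geodesic_F:
  assumes x: "x \<in> V" and Y: "smooth_on V Y"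
  shows "cov V F x v (\<lambda>y. differential V F y (Y y)) \<in> range (differential V F x)"
proof -
  interpret smooth_map_into V "\<lambda>_. UNIV" F
    by unfold_locales (use smooth_F F_into td in auto)
  let ?s = "\<lambda>y. differential V F y (Y y)"
  let ?\<theta> = "\<lambda>y. adj2 (u y) ** differential V u y (Y y)"
  have s: "?s \<in> \<E>" unfolding sections_def
    by (auto intro!: smooth_on_differential_field smooth_F Y td differential_in_T F_into)
  have lt_s: "lt (F y) (?s y) = \<Lambda> (?\<theta> y)" if "y \<in> V" for y
    using F_in[OF that] dF[OF that, of "Y y"] by (simp add: \<theta>_def)
  have s\<theta>: "smooth_on V ?\<theta>"
    by (intro smooth_on_mm smooth_on_adj2 smooth_on_differential_field chart(5) Y td)
  have d\<theta>: "differential V ?\<theta> x v \<in> sl2"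
  proof -
    have "differential V (\<lambda>y. trace (?\<theta> y)) x v = 0"
      by (rule differential_constant[OF td[OF x] x]) (use theta_sl2 in \<open>simp add: \<theta>_def sl2_def\<close>)
    then show ?thesis by (simp add: differential_linear[OF bounded_linear_trace td[OF x] x s\<theta>] sl2_def)
  qed
  have "differential V (\<lambda>y. \<Lambda> (?\<theta> y)) x v = differential V (\<lambda>y. lt (F y) (?s y)) x v"
    by (rule differential_cong[OF td[OF x] x smooth_on_bounded_linear_compose[OF bl s\<theta>]]) (simp add: lt_s)
  then have d: "differential V (\<lambda>y. lt (F y) (?s y)) x v = \<Lambda> (differential V ?\<theta> x v)"
    by (simp add: differential_linear[OF bl td[OF x] x s\<theta>])
  have "lt (F x) (differential V F x v) = \<Lambda> (\<theta> v x)" using F_in[OF x] dF[OF x] by simp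
  moreover obtain \<gamma> where \<gamma>: "\<gamma> \<in> sl2" "Bt (\<Lambda> (\<theta> v x)) (\<Lambda> (?\<theta> x)) = \<Lambda> \<gamma>"
    using Bt_L[OF theta_sl2[OF x] theta_sl2[OF x, of "Y x"]] unfolding \<theta>_def by blast
  ultimately have "cov V F x v ?s = lift (F x) (\<Lambda> (differential V ?\<theta> x v + \<gamma>))"
    unfolding cov_eq[OF s x UNIV_I] d lt_s[OF x] by (simp add: Lambda_linear)
  then show ?thesis unfolding range_dF[OF x] using d\<theta> \<gamma>(1) by blast
qed

sublocale TG: totally_geodesic_chart V F G
  by unfold_locales (use chart(3) smooth_F F_into smooth_G G_F geodesic_F in auto)

lemma inj_dF: "x \<in> V \<Longrightarrow> inj (differential V F x)"
  using TG.df_inj by (auto intro: injI)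

lemma theta_eq_0: assumes "x \<in> V" "\<theta> v x = 0" shows "v = 0"
proof (rule TG.df_inj[OF assms(1)])
  show "differential V F x v = differential V F x 0"
    using assms linear_0[OF TG.linear_df[OF assms(1)]] by (simp add: dF Lambda_linear lift.zero_right)
qed

lemma nondegenerate_F:
  assumes x: "x \<in> V" and v: "\<And>w. induced_metric g_NK V F x v w = 0" shows "v = 0"
proof (rule theta_eq_0[OF x], rule nondeg_L[OF theta_sl2[OF x]])
  fix \<beta> assume "\<beta> \<in> sl2"
  then obtain w where "\<theta> w x = \<beta>" using theta_surj[OF x] by blast
  then show "gq (\<Lambda> (\<theta> v x)) (\<Lambda> \<beta>) = 0"
    using v[of w] F_in[OF x] by (auto simp: induced_metric_def g_NK_eq dF[OF x])
qed

lemma J_F: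
  assumes x: "x \<in> V"
  shows "J_NK (F x) ` tangent_image V F x \<subseteq> normal_space T_SL2xSL2 g_NK V F x"
    "J_NK (F x) ` normal_space T_SL2xSL2 g_NK V F x \<subseteq> tangent_image V F x"
proof -
  note ti = tangent_image_def[of V F x, unfolded range_dF[OF x]]
  note g = g_NK_eq[OF F_in[OF x]] and J = J_NK_eq[OF F_in[OF x]] and ll = lt_lift[OF F_in[OF x]]
  have L_in: "\<Lambda> \<alpha> \<in> sl2sq" if a: "\<alpha> \<in> sl2" for \<alpha>
  proof -
    obtain w where "\<theta> w x = \<alpha>" using theta_surj[OF x a] by blast
    then have "lift (F x) (\<Lambda> \<alpha>) \<in> T_SL2xSL2 (F x)"
      using differential_in_T[OF smooth_F F_into x td[OF x], of w] dF[OF x] by simp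
    then show ?thesis using T_iff[OF F_in[OF x]] ll by simp
  qed
  have Jin: "J_NK (F x) w \<in> T_SL2xSL2 (F x)" if "lt (F x) w \<in> sl2sq" for w
    unfolding J T_iff[OF F_in[OF x]] lt.scaleR_right ll by (intro sl2sq_closed J0_in that)
  show "J_NK (F x) ` tangent_image V F x \<subseteq> normal_space T_SL2xSL2 g_NK V F x"
  proof
    fix y assume "y \<in> J_NK (F x) ` tangent_image V F x"
    then obtain \<alpha> where a: "\<alpha> \<in> sl2" "y = J_NK (F x) (lift (F x) (\<Lambda> \<alpha>))" unfolding ti by blast
    have "g_NK (F x) (lift (F x) (\<Lambda> \<beta>)) y = 0" if "\<beta> \<in> sl2" for \<beta>
      using om_L[OF a(1) that] unfolding g a(2) J
      by (simp add: lt.scaleR_right ll gq.scaleR_right gq_commute[of "\<Lambda> \<beta>"] gq_J0)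
    moreover have "y \<in> T_SL2xSL2 (F x)" unfolding a(2) by (rule Jin) (simp only: ll L_in[OF a(1)])
    ultimately show "y \<in> normal_space T_SL2xSL2 g_NK V F x" unfolding normal_space_def ti by blast
  qed
  show "J_NK (F x) ` normal_space T_SL2xSL2 g_NK V F x \<subseteq> tangent_image V F x"
  proof
    fix y assume "y \<in> J_NK (F x) ` normal_space T_SL2xSL2 g_NK V F x"
    then obtain n where n: "n \<in> T_SL2xSL2 (F x)" "y = J_NK (F x) n"
      "\<And>\<beta>. \<beta> \<in> sl2 \<Longrightarrow> g_NK (F x) (lift (F x) (\<Lambda> \<beta>)) n = 0"
      unfolding normal_space_def ti by blast
    define Y where "Y = lt (F x) n"
    have Y: "Y \<in> sl2sq" using n(1) T_iff[OF F_in[OF x]] by (simp add: Y_def)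
    have "\<exists>\<alpha>\<in>sl2. J0 Y = \<Lambda> \<alpha>"
    proof (rule max_L[OF J0_in[OF Y]])
      fix \<alpha> assume "\<alpha> \<in> sl2"
      then have "gq (\<Lambda> \<alpha>) Y = 0" using n(3) unfolding g Y_def by (simp add: ll)
      then show "om (J0 Y) (\<Lambda> \<alpha>) = 0" by (simp add: gq_J0J0 gq_commute[of Y])
    qed
    then obtain \<alpha> where a: "\<alpha> \<in> sl2" "J0 Y = \<Lambda> \<alpha>" by blast
    have "y = lift (F x) (\<Lambda> ((1 / sqrt 3) *\<^sub>R \<alpha>))"
      unfolding n(2) J Y_def[symmetric] a(2) by (simp add: Lambda_linear lift.scaleR_right)
    then show "y \<in> tangent_image V F x" unfolding ti using a(1) by blast
  qed
qed

end

lemma second_countable_euclidean_mat2: "second_countable (euclidean :: mat2 topology)"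
proof -
  obtain B :: "mat2 set set" where B: "countable B" "topological_basis B" using ex_countable_basis by blast
  have "\<exists>W\<in>B. x \<in> W \<and> W \<subseteq> U" if "open U" "x \<in> U" for U x
    using topological_basisE[OF B(2) that] by metis
  then show ?thesis unfolding second_countable_def
    using B(1) topological_basis_open[OF B(2)] by (intro exI[of _ B]) auto
qed

lemma smooth_manifold_SL2: "smooth_manifold (top_of_set SL2) (submanifold_atlas SL2 :: (mat2 set \<times> (mat2 \<Rightarrow> real^3)) set)"
  unfolding smooth_manifold_def
proof (intro conjI ballI)
  show "Hausdorff_space (top_of_set SL2)" by (intro Hausdorff_space_subtopology Hausdorff_space_euclidean)
  show "second_countable (top_of_set SL2)" by (intro second_countable_subtopology) (rule second_countable_euclidean_mat2)
  show "(\<Union>(U, \<phi>)\<in>(submanifold_atlas SL2 :: (mat2 set \<times> (mat2 \<Rightarrow> real^3)) set). U) = topspace (top_of_set SL2)"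
  proof
    show "(\<Union>(U, \<phi>)\<in>(submanifold_atlas SL2 :: (mat2 set \<times> (mat2 \<Rightarrow> real^3)) set). U) \<subseteq> topspace (top_of_set SL2)"
      using openin_imp_subset by (fastforce simp: submanifold_atlas_def)
    show "topspace (top_of_set SL2) \<subseteq> (\<Union>(U, \<phi>)\<in>(submanifold_atlas SL2 :: (mat2 set \<times> (mat2 \<Rightarrow> real^3)) set). U)"
    proof
      fix a assume "a \<in> topspace (top_of_set SL2)"
      then have a: "a \<in> SL2" by simp
      have inj: "inj_on (chi a) (chi_dom a)" by (rule inj_on_inverseI[of _ "chi_inv a"]) (rule chi_inv_chi[OF a])
      have im: "chi a ` chi_dom a = {x. x $ 3 > 0}"
      proof
        show "chi a ` chi_dom a \<subseteq> {x. x $ 3 > 0}" by (auto simp: chi_def chi_dom_def)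
        show "{x. x $ 3 > 0} \<subseteq> chi a ` chi_dom a"
        proof
          fix x :: "real^3" assume "x \<in> {x. x $ 3 > 0}"
          then show "x \<in> chi a ` chi_dom a" using chi_chi_inv[OF a] by (intro image_eqI[of _ _ "chi_inv a x"]) simp_all
        qed
      qed
      have op: "open {x :: real^3. x $ 3 > 0}"
        by (intro open_Collect_less continuous_on_const linear_continuous_on bounded_linear_vec_nth)
      have "smooth_on {x :: real^3. x $ 3 > 0} (chi_inv a)"
      proof -
        have vn: "smooth_on S (\<lambda>x :: real^3. x $ i)" for S i by (rule smooth_on_linear[OF bounded_linear_vec_nth])
        have eq: "mat2 p q r s = p *\<^sub>R mat2 1 0 0 0 + q *\<^sub>R mat2 0 1 0 0 + r *\<^sub>R mat2 0 0 1 0 + s *\<^sub>R mat2 0 0 0 1" for p q r s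
          by simp
        show ?thesis unfolding chi_inv_def
          by (subst eq) (intro smooth_on_mm smooth_on_const smooth_on_add smooth_on_bilinear[OF bounded_bilinear_scaleR]
              smooth_on_bilinear[OF bounded_bilinear_mult] smooth_on_inverse vn, auto)
      qed
      then have "smooth_on {x :: real^3. x $ 3 > 0} (inv_into (chi_dom a) (chi a))"
      proof (rule smooth_on_cong)
        fix x :: "real^3" assume "x \<in> {x. x $ 3 > 0}"
        then have "x $ 3 > 0" by simp
        from inv_into_f_f[OF inj chi_chi_inv(2)[OF a this]] chi_chi_inv(1)[OF a this]
        show "chi_inv a x = inv_into (chi_dom a) (chi a) x" by simp
      qed
      then have "(chi_dom a, chi a) \<in> submanifold_atlas SL2"
        using openin_chi_dom inj op smooth_on_linear[OF bounded_linear_chi] by (simp add: submanifold_atlas_def im)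
      moreover have "a \<in> chi_dom a" using a by (simp add: chi_dom_def SL2_cancel(5)[OF a] one_mat2 del: adj2_mult)
      ultimately show "a \<in> (\<Union>(U, \<phi>)\<in>(submanifold_atlas SL2 :: (mat2 set \<times> (mat2 \<Rightarrow> real^3)) set). U)" by blast
    qed
  qed
next
  fix c assume c: "c \<in> (submanifold_atlas SL2 :: (mat2 set \<times> (mat2 \<Rightarrow> real^3)) set)"
  obtain U \<phi> where cU: "c = (U, \<phi>)" by (cases c)
  have U: "openin (top_of_set SL2) U" "inj_on \<phi> U" "open (\<phi> ` U)" "smooth_on U \<phi>" "smooth_on (\<phi> ` U) (inv_into U \<phi>)"
    using c by (auto simp: submanifold_atlas_def cU)
  have "homeomorphic_maps (top_of_set U) (top_of_set (\<phi> ` U)) \<phi> (inv_into U \<phi>)"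
    unfolding homeomorphic_maps_def
    using smooth_on_imp_continuous_on[OF U(4)] smooth_on_imp_continuous_on[OF U(5)] U(2)
    by (auto simp: inv_into_into f_inv_into_f)
  then have "homeomorphic_map (top_of_set U) (top_of_set (\<phi> ` U)) \<phi>" using homeomorphic_map_maps by blast
  moreover have "subtopology (top_of_set SL2) U = top_of_set U"
    using openin_imp_subset[OF U(1)] by (simp add: subtopology_subtopology Int_absorb1)
  ultimately show "is_chart (top_of_set SL2) c" using U(1,3) by (simp add: is_chart_def cU)
next
  fix c assume c: "c \<in> (submanifold_atlas SL2 :: (mat2 set \<times> (mat2 \<Rightarrow> real^3)) set)"
  obtain U \<phi> where cU: "c = (U, \<phi>)" by (cases c)
  have "smooth_on (\<phi> ` (U \<inter> W)) (\<lambda>x. \<psi> (inv_into U \<phi> x))" if d: "(W, \<psi>) \<in> submanifold_atlas SL2" for W and \<psi> :: "mat2 \<Rightarrow> real^3"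
  proof (rule smooth_on_compose[where f = "inv_into U \<phi>" and g = \<psi>])
    have U: "inj_on \<phi> U" "smooth_on (\<phi> ` U) (inv_into U \<phi>)" and W: "smooth_on W \<psi>"
      using c d by (auto simp: submanifold_atlas_def cU)
    show "smooth_on (\<phi> ` (U \<inter> W)) (inv_into U \<phi>)" by (rule smooth_on_subset[OF U(2)]) auto
    show "smooth_on W \<psi>" by fact
    show "inv_into U \<phi> ` \<phi> ` (U \<inter> W) \<subseteq> W" using inv_into_f_f[OF U(1)] by auto
  qed
  then show "case c of (U, \<phi>) \<Rightarrow> \<forall>(W, \<psi>)\<in>submanifold_atlas SL2. smooth_on (\<phi> ` (U \<inter> W)) (\<lambda>x. (\<psi> :: mat2 \<Rightarrow> real^3) (inv_into U \<phi> x))"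
    by (auto simp: cU)
qed

context left_invariant_map begin

lemma chart_in: "c \<in> submanifold_atlas SL2 \<Longrightarrow> left_invariant_chart f \<Lambda> pr (fst c) (snd c)"
  using left_invariant_map_axioms by (cases c) (simp add: left_invariant_chart_def left_invariant_chart_axioms_def)

lemma totally_geodesic_lagrangian_f:
  "totally_geodesic_lagrangian (top_of_set SL2) (submanifold_atlas SL2) f"
proof -
  let ?A = "submanifold_atlas SL2 :: (mat2 set \<times> (mat2 \<Rightarrow> real^3)) set"
  have VF: "chart_range c = left_invariant_chart.V (fst c) (snd c)"
    "in_chart f c = left_invariant_chart.F f (fst c) (snd c)" if "c \<in> ?A" for c
  proof -
    interpret left_invariant_chart f \<Lambda> pr "fst c" "snd c" by (rule chart_in[OF that])
    show "chart_range c = V" "in_chart f c = F"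
      by (simp_all add: chart_range_def in_chart_def V_def F_def[abs_def] u_def split_beta)
  qed
  have imm: "immersion_into SL2xSL2 (top_of_set SL2) ?A f"
    unfolding immersion_into_def
  proof (intro conjI ballI smooth_manifold_SL2)
    show "f ` topspace (top_of_set SL2) \<subseteq> SL2xSL2" by (simp add: image_subset_iff f_SL2)
    fix c assume c: "c \<in> ?A"
    interpret left_invariant_chart f \<Lambda> pr "fst c" "snd c" by (rule chart_in[OF c])
    show "smooth_on (chart_range c) (in_chart f c)" unfolding VF[OF c] by (rule smooth_F)
    show "inj (differential (chart_range c) (in_chart f c) x)" if "x \<in> chart_range c" for x
      using that unfolding VF[OF c] by (rule inj_dF)
  qed
  have nd: "nondegenerate_immersion g_NK ?A f"
    unfolding nondegenerate_immersion_def
  proof (intro ballI allI impI)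
    fix c x v assume c: "c \<in> ?A" and x: "x \<in> chart_range c"
      and v: "\<forall>w. induced_metric g_NK (chart_range c) (in_chart f c) x v w = 0"
    interpret left_invariant_chart f \<Lambda> pr "fst c" "snd c" by (rule chart_in[OF c])
    show "v = 0" using x v unfolding VF[OF c] by (intro nondegenerate_F) auto
  qed
  have lag: "lagrangian_immersion (top_of_set SL2) ?A f"
    unfolding lagrangian_immersion_def Let_def
  proof (intro conjI ballI imm nd)
    fix c x assume c: "c \<in> ?A" and x: "x \<in> chart_range c"
    interpret left_invariant_chart f \<Lambda> pr "fst c" "snd c" by (rule chart_in[OF c])
    show "J_NK (in_chart f c x) ` tangent_image (chart_range c) (in_chart f c) x
      \<subseteq> normal_space T_SL2xSL2 g_NK (chart_range c) (in_chart f c) x"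
      "J_NK (in_chart f c x) ` normal_space T_SL2xSL2 g_NK (chart_range c) (in_chart f c) x
      \<subseteq> tangent_image (chart_range c) (in_chart f c) x"
      using x unfolding VF[OF c] by (intro J_F; assumption)+
  qed
  have "totally_geodesic SL2xSL2 T_SL2xSL2 g_NK ?A f"
    unfolding totally_geodesic_def Let_def
  proof (intro exI[of _ covN] conjI ballI covN_levi_civita)
    fix c assume c: "c \<in> ?A"
    interpret left_invariant_chart f \<Lambda> pr "fst c" "snd c" by (rule chart_in[OF c])
    show "\<exists>Dt D. is_pullback_connection (chart_range c) (in_chart f c) SL2xSL2 T_SL2xSL2 covN Dt \<and>
        is_levi_civita (chart_range c) (\<lambda>_. UNIV) (induced_metric g_NK (chart_range c) (in_chart f c)) D \<and>
        (\<forall>x\<in>chart_range c. \<forall>v. \<forall>Y\<in>sections (chart_range c) (\<lambda>_. UNIV).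
          second_fundamental_form Dt D (chart_range c) (in_chart f c) x v Y = 0)"
      unfolding VF[OF c]
      by (intro exI[of _ "cov V F"] exI[of _ TG.D] conjI ballI allI cov_pullback chart(3) smooth_F F_into
          TG.D_levi_civita TG.second_fundamental_form_zero)
  qed
  then show ?thesis using lag by (simp add: totally_geodesic_lagrangian_def)
qed

end

lemma left_invariant_map_f1: "left_invariant_map f1 (\<lambda>\<alpha>. (0, \<alpha>)) snd"
proof (rule left_invariant_map.intro)
  show "u \<in> SL2 \<Longrightarrow> f1 u \<in> SL2xSL2" for u using standard_map_props(1)[of f1] by simp
  show "smooth_on S f1" for S using standard_map_props(4)[of f1] by simp
  show "snd (f1 u) = u" for u by (simp add: f1_def)
  show "bounded_linear (snd :: mat2 \<times> mat2 \<Rightarrow> mat2)" by (rule bounded_linear_snd)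
  show "differential SL2 f1 u (u ** \<alpha>) = lift (f1 u) (0, \<alpha>)" if "u \<in> SL2" "\<alpha> \<in> sl2" for u \<alpha>
  proof -
    have "(f1 has_derivative (\<lambda>v. (0, v))) (at u within SL2)"
      unfolding f1_def by (auto intro!: derivative_eq_intros)
    from differential_eq[OF tangent_dir_SL2[OF that] this]
    show ?thesis by (simp add: lift_def f1_def mm.zero_right)
  qed
  show "bounded_linear (\<lambda>\<alpha>::mat2. (0 :: mat2, \<alpha>))" by (intro bounded_linear_Pair bounded_linear_zero bounded_linear_ident)
  show "\<exists>\<gamma>\<in>sl2. Bt (0, \<alpha>) (0, \<beta>) = (0, \<gamma>)" for \<alpha> \<beta>
    by (intro bexI[of _ "(1 / 2) *\<^sub>R br \<alpha> \<beta>"]) (auto simp: Bt_def kap_def br_simps)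
  show "om (0, \<alpha>) (0, \<beta>) = 0" for \<alpha> \<beta> by (simp add: om_def ip_simps)
  show "\<exists>\<alpha>\<in>sl2. Y = (0, \<alpha>)" if "Y \<in> sl2sq" "\<And>\<alpha>. \<alpha> \<in> sl2 \<Longrightarrow> om Y (0, \<alpha>) = 0" for Y
  proof -
    have "fst Y = 0" using that
      by (intro mat2_inner_nondeg) (auto simp: om_def ip_simps mat2_inner_commute mem_Times_iff)
    then show ?thesis using that(1) by (intro bexI[of _ "snd Y"]) (auto simp: prod_eq_iff)
  qed
  show "\<alpha> = 0" if "\<alpha> \<in> sl2" "\<And>\<beta>. \<beta> \<in> sl2 \<Longrightarrow> gq (0, \<alpha>) (0, \<beta>) = 0" for \<alpha>
    using that by (intro mat2_inner_nondeg) (auto simp: gq_def ip_simps mat2_inner_commute)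
qed

text \<open>As \<open>m\<^sup>2 = k\<close> with \<open>k = 1\<close> or \<open>k = - 1\<close>, the map \<open>\<sigma> \<alpha> = k m \<alpha> m\<close> is the conjugation by \<open>m\<close>: an
  involutive automorphism of the Lie algebra that preserves the norm. The tangent spaces are its graph. On
  two elements of the graph the mixed bracket \<open>kap\<close> is reversed by \<open>\<sigma>\<close>, and this is why \<open>Bt\<close> preserves the graph.\<close>

lemma left_invariant_map_conj:
  assumes m: "m \<in> sl2" "mat2_inner m m = k" "k * k = 1" and f: "f = (\<lambda>u. (u, m ** u ** m))"
  shows "left_invariant_map f (\<lambda>\<alpha>. (\<alpha>, k *\<^sub>R (m ** \<alpha> ** m))) fst"
proof -
  define \<sigma> where "\<sigma> \<alpha> = k *\<^sub>R (m ** \<alpha> ** m)" for \<alpha>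
  have mm: "m ** m = k *\<^sub>R mat 1"
    by (rule sl2_exhaust[OF m(1)]) (use m(2) in \<open>auto simp: one_mat2 algebra_simps\<close>)
  have det: "det m = - k" using m(2) by (simp add: det_eq_mat2_inner)
  have cancel: "m ** (m ** x) = k *\<^sub>R x" for x :: mat2 by (simp add: matrix_mul_assoc mm)
  have ss: "\<sigma> (\<sigma> \<alpha>) = \<alpha>" for \<alpha>
    unfolding \<sigma>_def using m(3) by (simp add: mm.scaleR_left mm.scaleR_right cancel mm flip: matrix_mul_assoc)
  have mult: "\<sigma> \<alpha> ** \<sigma> \<beta> = \<sigma> (\<alpha> ** \<beta>)" for \<alpha> \<beta>
    unfolding \<sigma>_def using m(3) by (simp add: mm.scaleR_left mm.scaleR_right cancel flip: matrix_mul_assoc)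
  have bls: "bounded_linear \<sigma>" unfolding \<sigma>_def
    by (intro bounded_linear_compose[OF bounded_linear_scaleR_right] bounded_linear_compose[OF mm.bounded_linear_left]
        mm.bounded_linear_right)
  note sl = linear_add[OF bounded_linear.linear[OF bls]] linear_diff[OF bounded_linear.linear[OF bls]]
    linear_scale[OF bounded_linear.linear[OF bls]]
  have sbr: "br (\<sigma> \<alpha>) (\<sigma> \<beta>) = \<sigma> (br \<alpha> \<beta>)" for \<alpha> \<beta> by (simp add: br_def mult sl)
  have str: "trace (\<sigma> \<alpha>) = trace \<alpha>" for \<alpha>
  proof -
    have "trace (m ** \<alpha> ** m) = trace (m ** (m ** \<alpha>))" by (rule trace_mul_sym)
    then show ?thesis using m(3) by (simp add: \<sigma>_def trace_scaleR cancel)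
  qed
  have ssl: "\<sigma> \<alpha> \<in> sl2 \<longleftrightarrow> \<alpha> \<in> sl2" for \<alpha> by (simp add: sl2_def str)
  have sip: "mat2_inner (\<sigma> \<alpha>) (\<sigma> \<beta>) = mat2_inner \<alpha> \<beta>" if "\<alpha> \<in> sl2" "\<beta> \<in> sl2" for \<alpha> \<beta>
    using that ssl by (simp add: mat2_inner_def sl2_adj2 mm.minus_left mult) (simp add: str linear_neg[OF bounded_linear.linear[OF bounded_linear_trace]])
  have sip': "mat2_inner (\<sigma> \<alpha>) \<beta> = mat2_inner \<alpha> (\<sigma> \<beta>)" if "\<alpha> \<in> sl2" "\<beta> \<in> sl2" for \<alpha> \<beta>
    using sip[of \<alpha> "\<sigma> \<beta>"] that ssl ss by simp
  show ?thesis unfolding \<sigma>_def[symmetric] f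
  proof (rule left_invariant_map.intro)
    show "(u, m ** u ** m) \<in> SL2xSL2" if "u \<in> SL2" for u
      using that det m(3) by (simp add: SL2xSL2_def SL2_def det_mul)
    show "smooth_on S (\<lambda>u. (u, m ** u ** m))" for S by (intro smooth_intros)
    show "fst (u, m ** u ** m) = u" for u by simp
    show "bounded_linear (fst :: mat2 \<times> mat2 \<Rightarrow> mat2)" by (rule bounded_linear_fst)
    show "differential SL2 (\<lambda>u. (u, m ** u ** m)) u (u ** \<alpha>) = lift (u, m ** u ** m) (\<alpha>, \<sigma> \<alpha>)"
      if "u \<in> SL2" "\<alpha> \<in> sl2" for u \<alpha>
    proof -
      have "bounded_linear (\<lambda>u. (u, m ** u ** m))"
        by (intro bounded_linear_Pair bounded_linear_ident bounded_linear_compose[OF mm.bounded_linear_left]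
            mm.bounded_linear_right)
      from differential_eq[OF tangent_dir_SL2[OF that] bounded_linear_imp_has_derivative[OF this]]
      show ?thesis using m(3)
        by (simp add: lift_def \<sigma>_def mm.scaleR_left mm.scaleR_right cancel flip: matrix_mul_assoc)
    qed
    show "bounded_linear (\<lambda>\<alpha>. (\<alpha>, \<sigma> \<alpha>))" by (intro bounded_linear_Pair bounded_linear_ident bls)
    show "\<exists>\<gamma>\<in>sl2. Bt (\<alpha>, \<sigma> \<alpha>) (\<beta>, \<sigma> \<beta>) = (\<gamma>, \<sigma> \<gamma>)" for \<alpha> \<beta>
    proof -
      let ?k = "br \<alpha> (\<sigma> \<beta>) + br \<beta> (\<sigma> \<alpha>)"
      have "\<sigma> ?k = br (\<sigma> \<alpha>) \<beta> + br (\<sigma> \<beta>) \<alpha>" by (simp add: sl sbr[symmetric] ss)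
      then have k: "\<sigma> ?k = - ?k" using br_anti[of "\<sigma> \<alpha>" \<beta>] br_anti[of "\<sigma> \<beta>" \<alpha>] by simp
      show ?thesis
        by (intro bexI[of _ "(1 / 2) *\<^sub>R br \<alpha> \<beta> - (1 / 6) *\<^sub>R ?k"])
          (simp_all only: Bt_def kap_def fst_conv snd_conv sl(2,3) k sbr, simp_all add: algebra_simps)
    qed
    show "om (\<alpha>, \<sigma> \<alpha>) (\<beta>, \<sigma> \<beta>) = 0" if "\<alpha> \<in> sl2" "\<beta> \<in> sl2" for \<alpha> \<beta>
      by (simp add: om_def sip'[OF that])
    show "\<exists>\<alpha>\<in>sl2. Y = (\<alpha>, \<sigma> \<alpha>)" if "Y \<in> sl2sq" "\<And>\<alpha>. \<alpha> \<in> sl2 \<Longrightarrow> om Y (\<alpha>, \<sigma> \<alpha>) = 0" for Y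
    proof -
      have Y: "fst Y \<in> sl2" "snd Y \<in> sl2" using that(1) by (auto simp: mem_Times_iff)
      have "\<sigma> (fst Y) - snd Y = 0"
      proof (rule mat2_inner_nondeg)
        show "\<sigma> (fst Y) - snd Y \<in> sl2" using Y ssl by (intro sl2_closed) auto
        fix a assume a: "a \<in> sl2"
        show "mat2_inner a (\<sigma> (fst Y) - snd Y) = 0"
          using that(2)[OF a] sip'[OF a Y(1)] by (simp add: om_def ip_simps mat2_inner_commute)
      qed
      then show ?thesis using Y by (intro bexI[of _ "fst Y"]) (auto simp: prod_eq_iff)
    qed
    show "\<alpha> = 0" if a: "\<alpha> \<in> sl2" "\<And>\<beta>. \<beta> \<in> sl2 \<Longrightarrow> gq (\<alpha>, \<sigma> \<alpha>) (\<beta>, \<sigma> \<beta>) = 0" for \<alpha>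
    proof -
      have 1: "2 *\<^sub>R \<alpha> - \<sigma> \<alpha> = 0"
      proof (rule mat2_inner_nondeg)
        show "2 *\<^sub>R \<alpha> - \<sigma> \<alpha> \<in> sl2" using a(1) ssl by (intro sl2_closed) auto
        fix b assume b: "b \<in> sl2"
        have "gq (\<alpha>, \<sigma> \<alpha>) (b, \<sigma> b) = 2 / 3 * mat2_inner b (2 *\<^sub>R \<alpha> - \<sigma> \<alpha>)"
          using sip[OF a(1) b] sip'[OF a(1) b]
          by (simp add: gq_def ip_simps mat2_inner_commute[of b])
        then show "mat2_inner b (2 *\<^sub>R \<alpha> - \<sigma> \<alpha>) = 0" using a(2)[OF b] by simp
      qed
      then have "\<sigma> \<alpha> = 2 *\<^sub>R \<alpha>" by simp
      then have "\<alpha> = 4 *\<^sub>R \<alpha>" using ss[of \<alpha>] by (simp add: sl(3))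
      then have "(4 - 1) *\<^sub>R \<alpha> = 0" unfolding scaleR_diff_left by simp
      then show ?thesis by simp
    qed
  qed
qed

theorem theorem1:
  fixes M :: "'m topology"
  shows "(\<forall>A F. connected_space M \<and> totally_geodesic_lagrangian M A F \<longrightarrow>
            (\<exists>f\<in>{f1, f2, f3}. \<exists>\<Omega>. openin (top_of_set SL2) \<Omega> \<and>
               congruent_in SL2xSL2 T_SL2xSL2 g_NK (F ` topspace M) (f ` \<Omega>)))
         \<and> (\<forall>f\<in>{f1, f2, f3}.
               totally_geodesic_lagrangian (top_of_set SL2) (submanifold_atlas SL2) f)"
proof (intro conjI allI impI ballI)
  show "\<exists>f\<in>{f1, f2, f3}. \<exists>\<Omega>. openin (top_of_set SL2) \<Omega> \<and>
               congruent_in SL2xSL2 T_SL2xSL2 g_NK (F ` topspace M) (f ` \<Omega>)"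
    if "connected_space M \<and> totally_geodesic_lagrangian M A F" for A F
    using that by (intro classification_global) auto
next
  fix f :: "mat2 \<Rightarrow> mat2 \<times> mat2" assume "f \<in> {f1, f2, f3}"
  moreover have "left_invariant_map f2 (\<lambda>\<alpha>. (\<alpha>, (-1) *\<^sub>R (mat_i ** \<alpha> ** mat_i))) fst"
    by (rule left_invariant_map_conj) (auto simp: mat_i_def f2_def[abs_def])
  moreover have "left_invariant_map f3 (\<lambda>\<alpha>. (\<alpha>, 1 *\<^sub>R (mat_k ** \<alpha> ** mat_k))) fst"
    by (rule left_invariant_map_conj) (auto simp: mat_k_def f3_def[abs_def])
  ultimately show "totally_geodesic_lagrangian (top_of_set SL2) (submanifold_atlas SL2) f"
    using left_invariant_map.totally_geodesic_lagrangian_f left_invariant_map_f1 by blast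
qed

end
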